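(* Let $n\in\mathbb N$, $n\geq 2$, and let $p>1$ be real. There exist positive constants $C_{p,n}$ (if $p\le n$) and $C'_{p,n}$ (if $p>n$), depending only on $p$ and $n$, such that for every bounded domain $\Omega\subset\mathbb R^n$ with Lipschitz boundary and every integer $k\geq 1$ the variational Steklov eigenvalues $\sigma_{p,k}$ of the $p$-Laplacian on $\Omega$ satisfy the following. If $p\leq n$, then $$|\partial\Omega|^{\frac{p-1}{n-1}}\sigma_{p,k}\leq \frac{C_{p,n}}{I(\Omega)^{\frac{n-p}{n-1}}}\,k^{\frac{p}{n}},\qquad\text{where } I(\Omega):=\frac{|\partial\Omega|}{|\Omega|^{\frac{n-1}{n}}}$$ is the isoperimetric ratio of $\Omega$. If $p>n$, then $$|\partial\Omega|^{\frac{p-1}{n-1}}\sigma_{p,k}\leq C_{p,n}'\,D(\Omega)^{\frac{p-n}{n-1}}\,k^{\frac{p-1}{n-1}},\qquad\text{where } D(\Omega):=\sup_{x\in\mathbb R^n,\, r>0}\frac{|\partial\Omega\cap B(x,r)|}{\omega_{n-1}r^{n-1}}$$ is the $(n-1)$-distortion of $\Omega$.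
   Context: A domain is an open connected set. $|\Omega|$ denotes the Lebesgue measure of $\Omega$; $|\partial\Omega|$ and $|\partial\Omega\cap B(x,r)|$ denote $(n-1)$-dimensional Hausdorff measures. $B(x,r)$ is the Euclidean ball in $\mathbb R^n$ of center $x$ and radius $r$, and $\omega_{m}$ is the volume of the unit ball in $\mathbb R^{m}$. The Steklov problem for the $p$-Laplacian on $\Omega$ is $\Delta_p u={\rm div}(|\nabla u|^{p-2}\nabla u)=0$ in $\Omega$, $|\nabla u|^{p-2}\frac{\partial u}{\partial\nu}=\sigma|u|^{p-2}u$ on $\partial\Omega$, where $\frac{\partial u}{\partial \nu}$ is the outer normal derivative, understood in the weak sense: $\int_\Omega|\nabla u|^{p-2}\nabla u\cdot\nabla\phi\,dx=\sigma\int_{\partial\Omega}|u|^{p-2}u\phi\,d\sigma(x)$ for all $\phi\in W^{1,p}(\Omega)$, with $d\sigma(x)$ the $(n-1)$-dimensional measure element on $\partial\Omega$ and boundary values taken in the sense of traces. Its variational eigenvalues are defined, for integers $k\ge 1$, by $$\sigma_{p,k}:=\inf_{F\in\Gamma_k}\sup_{u\in F}\mathcal R_p(u),\qquad \mathcal R_p(u):=\frac{\int_{\Omega}|\nabla u|^p\,dx}{\int_{\partial\Omega}|u|^p\,d\sigma(x)},$$ where $\mathcal R_p(u)=+\infty$ if the denominator vanishes. Here $\Gamma_k$ is the family of all sets $F\subset W^{1,p}(\Omega)\setminus\{0\}$ such that $F$ is symmetric ($F=-F$), $F\cap\{u:\|u\|_{L^p(\partial\Omega)}=1\}$ is compact,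 and $\gamma(F)\geq k$, where $\gamma(F)$ is the Krasnoselskii genus $$\gamma(F):=\min\{\ell\in\mathbb N:\text{ there exists } f:F\to\mathbb R^\ell\setminus\{0\}\text{ continuous and odd}\}$$ (with $\gamma(F)=+\infty$ if no such $\ell$ exists), and $\mathbb N$ is the set of positive integers. *)

theory Defs
  imports "HOL-Analysis.Analysis"
begin

section \<open>Hausdorff measure\<close>

text \<open>
  The factor \<open>\<omega>\<^sub>s 2\<^sup>-\<^sup>s\<close> makes the \<open>s\<close>-dimensional measure agree with Lebesgue measure on
  \<open>s\<close>-dimensional planes.  Only \<open>s > 0\<close> is meaningful: since \<open>0 powr 0 = 0\<close>, the case \<open>s = 0\<close> is
  not counting measure.
\<close>

definition hausdorff_content :: "real \<Rightarrow> real \<Rightarrow> 'a::metric_space set \<Rightarrow> ennreal" where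
  "hausdorff_content s \<delta> A =
     (INF U \<in> {U :: nat \<Rightarrow> 'a set. A \<subseteq> (\<Union>i. U i) \<and> (\<forall>i. bounded (U i) \<and> diameter (U i) \<le> \<delta>)}.
        \<Sum>i. ennreal (unit_ball_vol s * (diameter (U i) / 2) powr s))"

definition hausdorff_outer :: "real \<Rightarrow> 'a::metric_space set \<Rightarrow> ennreal" where
  "hausdorff_outer s A = (SUP \<delta> \<in> {0<..}. hausdorff_content s \<delta> A)"

definition hausdorff_measure :: "real \<Rightarrow> 'a::metric_space measure" where
  "hausdorff_measure s = measure_of UNIV (sets borel) (hausdorff_outer s)"

text \<open>
  \<open>measure_of\<close> is the zero measure unless the given set function is countably additive on the
  given sets, so we verify Caratheodory's criterion for the metric outer measure
  \<open>hausdorff_outer s\<close>.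
\<close>

lemma hausdorff_content_antimono:
  "\<delta> \<le> \<delta>' \<Longrightarrow> hausdorff_content s \<delta>' A \<le> hausdorff_content s \<delta> A"
  unfolding hausdorff_content_def by (rule INF_superset_mono) (auto intro: order_trans)

lemma hausdorff_content_mono:
  "A \<subseteq> B \<Longrightarrow> hausdorff_content s \<delta> A \<le> hausdorff_content s \<delta> B"
  unfolding hausdorff_content_def by (rule INF_superset_mono) auto

lemma hausdorff_outer_mono: "A \<subseteq> B \<Longrightarrow> hausdorff_outer s A \<le> hausdorff_outer s B"
  unfolding hausdorff_outer_def by (rule SUP_mono) (auto intro: hausdorff_content_mono)

lemma hausdorff_outer_empty: "hausdorff_outer s {} = 0"
proof -
  have "hausdorff_content s \<delta> {} \<le> 0" if "\<delta> > 0" for \<delta>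
    unfolding hausdorff_content_def
    by (rule INF_lower2[of "\<lambda>_. {}"]) (use that in auto)
  then show ?thesis unfolding hausdorff_outer_def by (auto simp: SUP_eq_iff)
qed

lemma hausdorff_content_UN:
  fixes A :: "nat \<Rightarrow> 'a::metric_space set"
  shows "hausdorff_content s \<delta> (\<Union>i. A i) \<le> (\<Sum>i. hausdorff_content s \<delta> (A i))"
proof (rule ennreal_le_epsilon)
  let ?c = "\<lambda>U::'a set. ennreal (unit_ball_vol s * (diameter U / 2) powr s)"
  fix e :: real
  assume fin: "(\<Sum>i. hausdorff_content s \<delta> (A i)) < top" and e: "0 < e"
  have "\<exists>U::nat \<Rightarrow> 'a set. A i \<subseteq> (\<Union>j. U j) \<and> (\<forall>j. bounded (U j) \<and> diameter (U j) \<le> \<delta>) \<and>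
      (\<Sum>j. ?c (U j)) \<le> hausdorff_content s \<delta> (A i) + ennreal (e * (1/2)^Suc i)" for i
  proof -
    have "hausdorff_content s \<delta> (A i) < top"
      using fin by (rule ennreal_suminf_lessD)
    then have "hausdorff_content s \<delta> (A i) < hausdorff_content s \<delta> (A i) + ennreal (e * (1/2)^Suc i)"
      using e by (simp add: ennreal_less_zero_iff)
    from this[THEN ord_eq_less_trans[OF hausdorff_content_def[symmetric]]]
    show ?thesis unfolding INF_less_iff by (auto intro: less_imp_le)
  qed
  then obtain U :: "nat \<Rightarrow> nat \<Rightarrow> 'a set" where U: "\<And>i. A i \<subseteq> (\<Union>j. U i j)"
      "\<And>i j. bounded (U i j) \<and> diameter (U i j) \<le> \<delta>"
      "\<And>i. (\<Sum>j. ?c (U i j)) \<le> hausdorff_content s \<delta> (A i) + ennreal (e * (1/2)^Suc i)"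
    by metis
  let ?V = "\<lambda>k. case prod_decode k of (i, j) \<Rightarrow> U i j"
  have "(\<Union>i. A i) \<subseteq> (\<Union>k. ?V k)"
  proof
    fix x assume "x \<in> (\<Union>i. A i)"
    then obtain i j where "x \<in> U i j" using U(1) by blast
    then show "x \<in> (\<Union>k. ?V k)" by (intro UN_I[of "prod_encode (i, j)"]) auto
  qed
  then have "hausdorff_content s \<delta> (\<Union>i. A i) \<le> (\<Sum>k. ?c (?V k))"
    unfolding hausdorff_content_def using U(2) by (intro INF_lower) (auto split: prod.split)
  also have "\<dots> = (\<Sum>i. \<Sum>j. ?c (U i j))"
    using suminf_ennreal_2dimen[of "\<lambda>i. \<Sum>j. ?c (U i j)" "\<lambda>(i, j). ?c (U i j)"]
    by (simp add: o_def case_prod_beta)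
  also have "\<dots> \<le> (\<Sum>i. hausdorff_content s \<delta> (A i) + ennreal (e * (1/2)^Suc i))"
    by (intro suminf_le U(3)) auto
  also have "\<dots> = (\<Sum>i. hausdorff_content s \<delta> (A i)) + (\<Sum>i. ennreal (e * (1/2)^Suc i))"
    by (intro suminf_add[symmetric]) auto
  also have "(\<Sum>i. ennreal (e * (1/2)^Suc i)) = ennreal e"
    using e sums_mult[OF power_half_series, of e]
    by (subst suminf_ennreal_eq[of _ e]) auto
  finally show "hausdorff_content s \<delta> (\<Union>i. A i) \<le> (\<Sum>i. hausdorff_content s \<delta> (A i)) + ennreal e" .
qed

lemma hausdorff_outer_UN:
  "hausdorff_outer s (\<Union>i::nat. A i) \<le> (\<Sum>i. hausdorff_outer s (A i))"
  unfolding hausdorff_outer_def[of s "\<Union>i. A i"]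
proof (rule SUP_least)
  fix \<delta> :: real assume d: "\<delta> \<in> {0<..}"
  have "hausdorff_content s \<delta> (\<Union>i. A i) \<le> (\<Sum>i. hausdorff_content s \<delta> (A i))"
    by (rule hausdorff_content_UN)
  also have "\<dots> \<le> (\<Sum>i. hausdorff_outer s (A i))"
    using d unfolding hausdorff_outer_def by (intro suminf_le SUP_upper) auto
  finally show "hausdorff_content s \<delta> (\<Union>i. A i) \<le> (\<Sum>i. hausdorff_outer s (A i))" .
qed

lemma hausdorff_outer_Un: "hausdorff_outer s (A \<union> B) \<le> hausdorff_outer s A + hausdorff_outer s B"
proof -
  let ?F = "\<lambda>i::nat. if i = 0 then A else if i = 1 then B else {}"
  have "A \<union> B = (\<Union>i. ?F i)" by (auto split: if_splits)
  then have "hausdorff_outer s (A \<union> B) \<le> (\<Sum>i. hausdorff_outer s (?F i))"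
    using hausdorff_outer_UN[of s ?F] by simp
  also have "\<dots> = (\<Sum>i\<in>{0,1}. hausdorff_outer s (?F i))"
    by (rule suminf_finite) (auto simp: hausdorff_outer_empty)
  finally show ?thesis by simp
qed

lemma hausdorff_outer_separated:
  assumes s: "s > 0" and d: "d > 0" and sep: "\<And>x y. x \<in> A \<Longrightarrow> y \<in> B \<Longrightarrow> dist x y \<ge> d"
  shows "hausdorff_outer s A + hausdorff_outer s B \<le> hausdorff_outer s (A \<union> B)"
proof -
  let ?c = "\<lambda>U::'a set. ennreal (unit_ball_vol s * (diameter U / 2) powr s)"
  have c_mono: "?c U \<le> ?c V" if "U \<subseteq> V" "bounded V" for U V
    using that s diameter_subset[OF that] diameter_ge_0[of U] bounded_subset[OF that(2,1)]
    by (intro ennreal_leI mult_left_mono powr_mono2) auto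
  have c_split: "?c (U \<inter> A) + ?c (U \<inter> B) \<le> ?c U" if "bounded U" "diameter U < d" for U
  proof -
    have "U \<inter> A = {} \<or> U \<inter> B = {}"
      using diameter_bounded_bound[OF that(1)] sep that(2) by fastforce
    then show ?thesis
      using c_mono[of "U \<inter> A" U] c_mono[of "U \<inter> B" U] that by auto
  qed
  have main: "hausdorff_content s a A + hausdorff_content s b B \<le> hausdorff_outer s (A \<union> B)"
    if ab: "a > 0" "b > 0" for a b
  proof -
    define m where "m = min (d / 2) (min a b)"
    have m: "m > 0" "m < d" "m \<le> a" "m \<le> b" using d ab by (auto simp: m_def)
    have "hausdorff_content s a A + hausdorff_content s b B
        \<le> hausdorff_content s m A + hausdorff_content s m B"
      using m by (intro add_mono hausdorff_content_antimono) auto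
    also have "\<dots> \<le> hausdorff_content s m (A \<union> B)"
      unfolding hausdorff_content_def[of s m "A \<union> B"]
    proof (rule INF_greatest)
      fix U :: "nat \<Rightarrow> 'a set"
      assume "U \<in> {U. A \<union> B \<subseteq> (\<Union>i. U i) \<and> (\<forall>i. bounded (U i) \<and> diameter (U i) \<le> m)}"
      then have U: "A \<union> B \<subseteq> (\<Union>i. U i)" "\<And>i. bounded (U i)" "\<And>i. diameter (U i) \<le> m" by auto
      have sub: "bounded (U i \<inter> S)" "diameter (U i \<inter> S) \<le> m" for i S
        using U(2,3)[of i] diameter_subset[of "U i \<inter> S" "U i"] bounded_subset[of "U i" "U i \<inter> S"]
        by (auto intro: order_trans)
      have "hausdorff_content s m A \<le> (\<Sum>i. ?c (U i \<inter> A))"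
        unfolding hausdorff_content_def using U(1) sub by (intro INF_lower) auto
      moreover have "hausdorff_content s m B \<le> (\<Sum>i. ?c (U i \<inter> B))"
        unfolding hausdorff_content_def using U(1) sub by (intro INF_lower) auto
      ultimately have "hausdorff_content s m A + hausdorff_content s m B
          \<le> (\<Sum>i. ?c (U i \<inter> A)) + (\<Sum>i. ?c (U i \<inter> B))" by (rule add_mono)
      also have "\<dots> = (\<Sum>i. ?c (U i \<inter> A) + ?c (U i \<inter> B))" by (intro suminf_add) auto
      also have "\<dots> \<le> (\<Sum>i. ?c (U i))"
      proof (intro suminf_le c_split)
        show "diameter (U n) < d" for n using U(3)[of n] m(2) by linarith
      qed (use U in auto)
      finally show "hausdorff_content s m A + hausdorff_content s m B \<le> (\<Sum>i. ?c (U i))" .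
    qed
    also have "\<dots> \<le> hausdorff_outer s (A \<union> B)"
      unfolding hausdorff_outer_def using m by (intro SUP_upper) auto
    finally show ?thesis .
  qed
  have ne: "{0::real<..} \<noteq> {}" by (auto intro: exI[of _ 1])
  have "hausdorff_content s a A + hausdorff_outer s B \<le> hausdorff_outer s (A \<union> B)" if "a > 0" for a
  proof -
    have "hausdorff_content s a A + hausdorff_outer s B
        = (SUP b\<in>{0<..}. hausdorff_content s a A + hausdorff_content s b B)"
      unfolding hausdorff_outer_def using ne by (simp add: ennreal_SUP_add_right)
    also have "\<dots> \<le> hausdorff_outer s (A \<union> B)" using main that by (intro SUP_least) auto
    finally show ?thesis .
  qed
  then have "(SUP a\<in>{0<..}. hausdorff_content s a A + hausdorff_outer s B)
      \<le> hausdorff_outer s (A \<union> B)"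
    by (intro SUP_least) auto
  moreover have "(SUP a\<in>{0<..}. hausdorff_content s a A + hausdorff_outer s B)
      = hausdorff_outer s A + hausdorff_outer s B"
    unfolding hausdorff_outer_def[of s A] using ne by (simp add: ennreal_SUP_add_left)
  ultimately show ?thesis by simp
qed

lemma hausdorff_outer_closed:
  fixes C A :: "'a::metric_space set"
  assumes s: "s > 0" and C: "closed C"
  shows "hausdorff_outer s (A \<inter> C) + hausdorff_outer s (A - C) \<le> hausdorff_outer s A"
proof (cases "C = {} \<or> hausdorff_outer s A = top")
  case True
  then show ?thesis by (auto simp: hausdorff_outer_empty)
next
  case False
  then have ne: "C \<noteq> {}" and fin: "hausdorff_outer s A \<noteq> top" by auto
  let ?\<mu> = "hausdorff_outer s"
  define T where "T n = {a \<in> A. infdist a C \<ge> 1 / (real n + 1)}" for n :: nat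
  define R where "R n = T (Suc n) - T n" for n
  have T_mono: "T m \<subseteq> T n" if "m \<le> n" for m n
  proof -
    have "1 / (real n + 1) \<le> 1 / (real m + 1)" using that by (intro divide_left_mono) auto
    then show ?thesis by (auto simp: T_def)
  qed
  have TA: "T n \<subseteq> A" for n by (auto simp: T_def)
  have sepT: "?\<mu> (A \<inter> C) + ?\<mu> (T n) \<le> ?\<mu> A" for n
  proof -
    have "?\<mu> (A \<inter> C) + ?\<mu> (T n) \<le> ?\<mu> (A \<inter> C \<union> T n)"
    proof (rule hausdorff_outer_separated[OF s])
      show "1 / (real n + 1) \<le> dist x y" if "x \<in> A \<inter> C" "y \<in> T n" for x y
        using that infdist_le[of x C y] by (auto simp: T_def dist_commute)
    qed simp
    also have "\<dots> \<le> ?\<mu> A" by (rule hausdorff_outer_mono) (auto simp: T_def)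
    finally show ?thesis .
  qed
  have sepR: "?\<mu> (R (Suc n)) + ?\<mu> (T n) \<le> ?\<mu> (T (Suc (Suc n)))" for n
  proof -
    have "?\<mu> (R (Suc n)) + ?\<mu> (T n) \<le> ?\<mu> (R (Suc n) \<union> T n)"
    proof (rule hausdorff_outer_separated[OF s])
      show "0 < 1 / (real n + 1) - 1 / (real (Suc n) + 1)"
        using frac_less2[of 1 1 "real n + 1" "real (Suc n) + 1"] by simp
      show "1 / (real n + 1) - 1 / (real (Suc n) + 1) \<le> dist x y"
        if "x \<in> R (Suc n)" "y \<in> T n" for x y
        using that infdist_triangle[of y C x] by (auto simp: T_def R_def dist_commute)
    qed
    also have "\<dots> \<le> ?\<mu> (T (Suc (Suc n)))"
      using T_mono[of n "Suc (Suc n)"] by (intro hausdorff_outer_mono) (auto simp: R_def)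
    finally show ?thesis .
  qed
  have bound: "(\<Sum>m<Suc n. ?\<mu> (R m)) \<le> ?\<mu> (T (Suc n)) + ?\<mu> (T n)" for n
  proof (induction n)
    case 0
    have "?\<mu> (R 0) \<le> ?\<mu> (T (Suc 0))" by (rule hausdorff_outer_mono) (auto simp: R_def)
    then show ?case by (simp add: add_increasing2)
  next
    case (Suc n)
    have "(\<Sum>m<Suc (Suc n). ?\<mu> (R m)) \<le> (?\<mu> (T (Suc n)) + ?\<mu> (T n)) + ?\<mu> (R (Suc n))"
      using add_right_mono[OF Suc.IH, of "?\<mu> (R (Suc n))"] by simp
    also have "\<dots> = ?\<mu> (T (Suc n)) + (?\<mu> (R (Suc n)) + ?\<mu> (T n))" by (simp add: ac_simps)
    also have "\<dots> \<le> ?\<mu> (T (Suc n)) + ?\<mu> (T (Suc (Suc n)))" by (rule add_left_mono[OF sepR])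
    finally show ?case by (simp add: ac_simps)
  qed
  have "(\<Sum>m<n. ?\<mu> (R m)) \<le> ?\<mu> A + ?\<mu> A" for n
  proof -
    have "(\<Sum>m<n. ?\<mu> (R m)) \<le> (\<Sum>m<Suc n. ?\<mu> (R m))" by (simp add: add_increasing2)
    also note bound
    also have "?\<mu> (T (Suc n)) + ?\<mu> (T n) \<le> ?\<mu> A + ?\<mu> A"
      by (intro add_mono hausdorff_outer_mono TA)
    finally show ?thesis .
  qed
  then have "(\<Sum>m. ?\<mu> (R m)) \<le> ?\<mu> A + ?\<mu> A" by (intro suminf_le_const) auto
  then have sumfin: "(\<Sum>m. ?\<mu> (R m)) \<noteq> top"
    using fin by (auto simp: top_unique)
  have cover: "A - C \<subseteq> T n \<union> (\<Union>m. R (m + n))" for n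
  proof
    fix a assume a: "a \<in> A - C"
    then have "infdist a C > 0" using infdist_pos_not_in_closed[OF C ne] by auto
    then obtain N where "1 / (real N + 1) < infdist a C"
      using reals_Archimedean[of "infdist a C"] by (auto simp: inverse_eq_divide add.commute)
    then have N: "a \<in> T N" using a by (auto simp: T_def)
    show "a \<in> T n \<union> (\<Union>m. R (m + n))"
    proof (cases "a \<in> T n")
      case False
      define k where "k = (LEAST k. a \<in> T k)"
      have k: "a \<in> T k" unfolding k_def using N by (rule LeastI)
      have "n < k" using False k T_mono[of k n] by (meson not_le subsetD)
      then obtain j where j: "k = Suc (j + n)" using less_imp_Suc_add[of n k] by (auto simp: add.commute)
      have "a \<notin> T (j + n)" using not_less_Least[of "j + n" "\<lambda>k. a \<in> T k"] j k_def by auto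
      then show ?thesis using k j by (auto simp: R_def)
    qed auto
  qed
  have tail: "?\<mu> (A \<inter> C) + ?\<mu> (A - C) \<le> ?\<mu> A + (\<Sum>m. ?\<mu> (R (m + n)))" for n
  proof -
    have "?\<mu> (A - C) \<le> ?\<mu> (T n \<union> (\<Union>m. R (m + n)))" by (rule hausdorff_outer_mono[OF cover])
    also have "\<dots> \<le> ?\<mu> (T n) + ?\<mu> (\<Union>m. R (m + n))" by (rule hausdorff_outer_Un)
    also have "\<dots> \<le> ?\<mu> (T n) + (\<Sum>m. ?\<mu> (R (m + n)))" by (intro add_left_mono hausdorff_outer_UN)
    finally have "?\<mu> (A \<inter> C) + ?\<mu> (A - C) \<le> ?\<mu> (A \<inter> C) + (?\<mu> (T n) + (\<Sum>m. ?\<mu> (R (m + n))))"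
      by (rule add_left_mono)
    also have "\<dots> \<le> ?\<mu> A + (\<Sum>m. ?\<mu> (R (m + n)))"
      using add_right_mono[OF sepT] by (simp add: add.assoc)
    finally show ?thesis .
  qed
  have "(\<lambda>n. (\<Sum>m. ?\<mu> (R m)) - (\<Sum>m<n. ?\<mu> (R m))) \<longlonglongrightarrow> (\<Sum>m. ?\<mu> (R m)) - (\<Sum>m. ?\<mu> (R m))"
    using sumfin by (intro tendsto_diff_ennreal tendsto_const summable_LIMSEQ) auto
  moreover have "(\<Sum>m. ?\<mu> (R m)) - (\<Sum>m<n. ?\<mu> (R m)) = (\<Sum>m. ?\<mu> (R (m + n)))" for n
  proof -
    have eq: "(\<Sum>m. ?\<mu> (R m)) = (\<Sum>m. ?\<mu> (R (m + n))) + (\<Sum>m<n. ?\<mu> (R m))"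
      by (rule suminf_offset) simp
    then show ?thesis using sumfin by (metis ennreal_add_diff_cancel_right ennreal_add_eq_top)
  qed
  ultimately have "(\<lambda>n. \<Sum>m. ?\<mu> (R (m + n))) \<longlonglongrightarrow> 0" using sumfin by (simp add: less_top)
  then have "(\<lambda>n. ?\<mu> A + (\<Sum>m. ?\<mu> (R (m + n)))) \<longlonglongrightarrow> ?\<mu> A + 0"
    by (intro tendsto_add tendsto_const)
  then have "(\<lambda>n. ?\<mu> A + (\<Sum>m. ?\<mu> (R (m + n)))) \<longlonglongrightarrow> ?\<mu> A" by simp
  then show ?thesis by (rule LIMSEQ_le_const) (use tail in auto)
qed

lemma space_hausdorff_measure [simp]: "space (hausdorff_measure s) = UNIV"
  and sets_hausdorff_measure [simp, measurable_cong]: "sets (hausdorff_measure s) = sets borel"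
  unfolding hausdorff_measure_def
  using sets.sigma_sets_eq[of borel]
  by (simp_all add: space_measure_of_conv sets_measure_of_conv)

lemma emeasure_hausdorff_measure:
  fixes A :: "'a::metric_space set"
  assumes s: "s > 0" and A: "A \<in> sets borel"
  shows "emeasure (hausdorff_measure s) A = hausdorff_outer s A"
proof -
  let ?\<mu> = "hausdorff_outer s :: 'a set \<Rightarrow> ennreal"
  let ?L = "lambda_system UNIV (Pow UNIV) ?\<mu>"
  have "outer_measure_space (Pow UNIV) ?\<mu>"
    unfolding outer_measure_space_def positive_def increasing_def countably_subadditive_def
    by (auto intro: hausdorff_outer_mono hausdorff_outer_UN simp: hausdorff_outer_empty)
  then have L: "measure_space UNIV ?L ?\<mu>"
    by (rule sigma_algebra.caratheodory_lemma[OF sigma_algebra_Pow])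
  then have sig: "sigma_algebra UNIV ?L" by (simp add: measure_space_def)
  have "C \<in> ?L" if "closed C" for C
  proof -
    have "?\<mu> (C \<inter> X) + ?\<mu> ((UNIV - C) \<inter> X) = ?\<mu> X" for X
    proof (rule antisym)
      have X: "X = (C \<inter> X) \<union> ((UNIV - C) \<inter> X)" by auto
      show "?\<mu> X \<le> ?\<mu> (C \<inter> X) + ?\<mu> ((UNIV - C) \<inter> X)"
        using hausdorff_outer_Un[of s "C \<inter> X" "(UNIV - C) \<inter> X"] X by simp
      have "X - C = (UNIV - C) \<inter> X" by auto
      then show "?\<mu> (C \<inter> X) + ?\<mu> ((UNIV - C) \<inter> X) \<le> ?\<mu> X"
        using hausdorff_outer_closed[OF s that, of X] by (simp add: Int_commute)
    qed
    then show ?thesis by (simp add: lambda_system_def)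
  qed
  then have "sigma_sets UNIV (Collect closed) \<subseteq> ?L"
    by (intro sigma_algebra.sigma_sets_subset[OF sig]) auto
  then have borel: "sets borel \<subseteq> ?L"
    by (simp add: borel_eq_closed)
  have "positive (sets borel) ?\<mu>" "countably_additive (sets borel) ?\<mu>"
    using L borel by (auto simp: measure_space_def positive_def countably_additive_def)
  then show ?thesis
    using A sets.sigma_algebra_axioms[of "borel :: 'a measure"]
    unfolding hausdorff_measure_def by (intro emeasure_measure_of_sigma) auto
qed

definition surface_measure :: "(real^'n) set \<Rightarrow> (real^'n) measure" where
  "surface_measure \<Omega> = restrict_space (hausdorff_measure (real CARD('n) - 1)) (frontier \<Omega>)"

definition boundary_area :: "(real^'n) set \<Rightarrow> real" where
  "boundary_area \<Omega> = measure (surface_measure \<Omega>) (frontier \<Omega>)"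


section \<open>Lipschitz domains and their geometric quantities\<close>

text \<open>
  Near each boundary point the domain is the strict epigraph, in some direction \<open>\<nu>\<close>, of a
  Lipschitz function of the component \<open>y - (y \<bullet> \<nu>) \<nu>\<close> orthogonal to \<open>\<nu>\<close>.
\<close>

definition lipschitz_boundary :: "(real^'n) set \<Rightarrow> bool" where
  "lipschitz_boundary \<Omega> \<longleftrightarrow>
     (\<forall>z \<in> frontier \<Omega>. \<exists>\<nu> g L r. norm \<nu> = 1 \<and> r > 0 \<and> L-lipschitz_on {y. y \<bullet> \<nu> = 0} g \<and>
        \<Omega> \<inter> ball z r = {y \<in> ball z r. y \<bullet> \<nu> > (g (y - (y \<bullet> \<nu>) *\<^sub>R \<nu>) :: real)})"

definition bounded_lipschitz_domain :: "(real^'n) set \<Rightarrow> bool" where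
  "bounded_lipschitz_domain \<Omega> \<longleftrightarrow>
     open \<Omega> \<and> connected \<Omega> \<and> \<Omega> \<noteq> {} \<and> bounded \<Omega> \<and> lipschitz_boundary \<Omega>"

definition isoperimetric_ratio :: "(real^'n) set \<Rightarrow> real" where
  "isoperimetric_ratio \<Omega> =
     boundary_area \<Omega> / measure lebesgue \<Omega> powr ((real CARD('n) - 1) / real CARD('n))"

definition distortion :: "(real^'n) set \<Rightarrow> real" where
  "distortion \<Omega> =
     (SUP (x, r) \<in> UNIV \<times> {0<..}. measure (surface_measure \<Omega>) (frontier \<Omega> \<inter> ball x r) /
        (unit_ball_vol (real CARD('n) - 1) * r powr (real CARD('n) - 1)))"


section \<open>Sobolev functions\<close>

text \<open>Functions all of whose iterated directional derivatives exist and are differentiable.\<close>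

coinductive smooth :: "('a::real_normed_vector \<Rightarrow> real) \<Rightarrow> bool" where
  "(\<And>x. f differentiable (at x)) \<Longrightarrow> (\<And>v. smooth (\<lambda>x. frechet_derivative f (at x) v)) \<Longrightarrow> smooth f"

definition test_function :: "(real^'n) set \<Rightarrow> (real^'n \<Rightarrow> real) \<Rightarrow> bool" where
  "test_function \<Omega> \<phi> \<longleftrightarrow>
     smooth \<phi> \<and> compact (closure {x. \<phi> x \<noteq> 0}) \<and> closure {x. \<phi> x \<noteq> 0} \<subseteq> \<Omega>"

definition Lp :: "'a measure \<Rightarrow> real \<Rightarrow> ('a \<Rightarrow> 'b::real_normed_vector) set" where
  "Lp M p = {f \<in> borel_measurable M. integrable M (\<lambda>x. norm (f x) powr p)}"

definition Lp_norm :: "'a measure \<Rightarrow> real \<Rightarrow> ('a \<Rightarrow> 'b::real_normed_vector) \<Rightarrow> real" where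
  "Lp_norm M p f = (\<integral>x. norm (f x) powr p \<partial>M) powr (1 / p)"

definition is_weak_gradient ::
    "(real^'n) set \<Rightarrow> (real^'n \<Rightarrow> real) \<Rightarrow> (real^'n \<Rightarrow> real^'n) \<Rightarrow> bool" where
  "is_weak_gradient \<Omega> u G \<longleftrightarrow>
     (\<forall>\<phi> i. test_function \<Omega> \<phi> \<longrightarrow>
        (\<integral>x. u x * frechet_derivative \<phi> (at x) (axis i 1) \<partial>lebesgue_on \<Omega>) =
        - (\<integral>x. G x $ i * \<phi> x \<partial>lebesgue_on \<Omega>))"

text \<open>
  Elements of \<open>W\<^sup>1\<^sup>,\<^sup>p(\<Omega>)\<close> are represented by functions on the whole space, two of which stand for
  the same element iff they agree almost everywhere on \<open>\<Omega>\<close>; then their distance in the norm below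
  is zero, so no open set of \<open>sobolev_topology\<close> separates them.  Compactness of sets and
  existence of continuous odd maps into a Hausdorff space are hence the same for a set of
  representatives and for the set of the elements represented.
\<close>

definition sobolev :: "(real^'n) set \<Rightarrow> real \<Rightarrow> (real^'n \<Rightarrow> real) set" where
  "sobolev \<Omega> p =
     {u \<in> Lp (lebesgue_on \<Omega>) p. \<exists>G \<in> Lp (lebesgue_on \<Omega>) p. is_weak_gradient \<Omega> u G}"

definition weak_gradient :: "(real^'n) set \<Rightarrow> real \<Rightarrow> (real^'n \<Rightarrow> real) \<Rightarrow> real^'n \<Rightarrow> real^'n" where
  "weak_gradient \<Omega> p u = (SOME G. G \<in> Lp (lebesgue_on \<Omega>) p \<and> is_weak_gradient \<Omega> u G)"

definition sobolev_norm :: "(real^'n) set \<Rightarrow> real \<Rightarrow> (real^'n \<Rightarrow> real) \<Rightarrow> real" where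
  "sobolev_norm \<Omega> p u =
     ((\<integral>x. \<bar>u x\<bar> powr p \<partial>lebesgue_on \<Omega>) +
      (\<integral>x. norm (weak_gradient \<Omega> p u x) powr p \<partial>lebesgue_on \<Omega>)) powr (1 / p)"

definition sobolev_topology :: "(real^'n) set \<Rightarrow> real \<Rightarrow> (real^'n \<Rightarrow> real) topology" where
  "sobolev_topology \<Omega> p =
     topology (\<lambda>U. U \<subseteq> sobolev \<Omega> p \<and>
       (\<forall>u\<in>U. \<exists>e>0. \<forall>v \<in> sobolev \<Omega> p. sobolev_norm \<Omega> p (\<lambda>x. v x - u x) < e \<longrightarrow> v \<in> U))"

lemma openin_sobolev_topology:
  "openin (sobolev_topology \<Omega> p) U \<longleftrightarrow>
     U \<subseteq> sobolev \<Omega> p \<and>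
     (\<forall>u\<in>U. \<exists>e>0. \<forall>v \<in> sobolev \<Omega> p. sobolev_norm \<Omega> p (\<lambda>x. v x - u x) < e \<longrightarrow> v \<in> U)"
proof -
  let ?P = "\<lambda>U. U \<subseteq> sobolev \<Omega> p \<and>
     (\<forall>u\<in>U. \<exists>e>0. \<forall>v \<in> sobolev \<Omega> p. sobolev_norm \<Omega> p (\<lambda>x. v x - u x) < e \<longrightarrow> v \<in> U)"
  have "istopology ?P"
    unfolding istopology_def
  proof (rule conjI; intro allI impI)
    fix S T assume S: "?P S" and T: "?P T"
    show "?P (S \<inter> T)"
    proof (intro conjI ballI)
      show "S \<inter> T \<subseteq> sobolev \<Omega> p" using S by blast
      fix u assume u: "u \<in> S \<inter> T"
      obtain e where e: "e > 0"
        "\<forall>v \<in> sobolev \<Omega> p. sobolev_norm \<Omega> p (\<lambda>x. v x - u x) < e \<longrightarrow> v \<in> S" using S u by blast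
      obtain e' where e': "e' > 0"
        "\<forall>v \<in> sobolev \<Omega> p. sobolev_norm \<Omega> p (\<lambda>x. v x - u x) < e' \<longrightarrow> v \<in> T" using T u by blast
      show "\<exists>e>0. \<forall>v \<in> sobolev \<Omega> p. sobolev_norm \<Omega> p (\<lambda>x. v x - u x) < e \<longrightarrow> v \<in> S \<inter> T"
        using e e' by (intro exI[of _ "min e e'"]) auto
    qed
  next
    fix K assume K: "\<forall>S\<in>K. ?P S"
    show "?P (\<Union>K)"
    proof (intro conjI ballI)
      show "\<Union>K \<subseteq> sobolev \<Omega> p" using K by blast
      fix u assume "u \<in> \<Union>K"
      then obtain S where S: "S \<in> K" "u \<in> S" by blast
      then obtain e where "e > 0"
        "\<forall>v \<in> sobolev \<Omega> p. sobolev_norm \<Omega> p (\<lambda>x. v x - u x) < e \<longrightarrow> v \<in> S" using K by blast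
      then show "\<exists>e>0. \<forall>v \<in> sobolev \<Omega> p. sobolev_norm \<Omega> p (\<lambda>x. v x - u x) < e \<longrightarrow> v \<in> \<Union>K"
        using S by blast
    qed
  qed
  then show ?thesis
    unfolding sobolev_topology_def by (simp add: topology_inverse')
qed

text \<open>
  The trace is the continuous extension to \<open>W\<^sup>1\<^sup>,\<^sup>p(\<Omega>)\<close> of the restriction to the boundary of those
  Sobolev functions that are continuous up to the boundary.  On a bounded Lipschitz domain it
  exists and is unique up to null sets of the surface measure.
\<close>

definition is_trace ::
    "(real^'n) set \<Rightarrow> real \<Rightarrow> (real^'n \<Rightarrow> real) \<Rightarrow> (real^'n \<Rightarrow> real) \<Rightarrow> bool" where
  "is_trace \<Omega> p u g \<longleftrightarrow>
     g \<in> Lp (surface_measure \<Omega>) p \<and>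
     (\<exists>\<phi> :: nat \<Rightarrow> real^'n \<Rightarrow> real.
        (\<forall>j. \<phi> j \<in> sobolev \<Omega> p \<and> continuous_on (closure \<Omega>) (\<phi> j)) \<and>
        (\<lambda>j. sobolev_norm \<Omega> p (\<lambda>x. \<phi> j x - u x)) \<longlonglongrightarrow> 0 \<and>
        (\<lambda>j. Lp_norm (surface_measure \<Omega>) p (\<lambda>x. \<phi> j x - g x)) \<longlonglongrightarrow> 0)"

definition boundary_trace :: "(real^'n) set \<Rightarrow> real \<Rightarrow> (real^'n \<Rightarrow> real) \<Rightarrow> real^'n \<Rightarrow> real" where
  "boundary_trace \<Omega> p u = (SOME g. is_trace \<Omega> p u g)"


section \<open>Variational Steklov eigenvalues\<close>

definition rayleigh_quotient :: "(real^'n) set \<Rightarrow> real \<Rightarrow> (real^'n \<Rightarrow> real) \<Rightarrow> ennreal" where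
  "rayleigh_quotient \<Omega> p u =
     (let N = \<integral>x. norm (weak_gradient \<Omega> p u x) powr p \<partial>lebesgue_on \<Omega>;
          D = \<integral>x. \<bar>boundary_trace \<Omega> p u x\<bar> powr p \<partial>surface_measure \<Omega>
      in if D = 0 then \<infinity> else ennreal (N / D))"

definition genus :: "('a \<Rightarrow> real) topology \<Rightarrow> ('a \<Rightarrow> real) set \<Rightarrow> enat" where
  "genus X F =
     Inf {enat l | l. l \<ge> 1 \<and>
       (\<exists>f. continuous_map (subtopology X F) (subtopology (Euclidean_space l) (- {\<lambda>i. 0})) f \<and>
            (\<forall>u\<in>F. f (\<lambda>x. - u x) = (\<lambda>i. - f u i)))}"

definition steklov_family :: "(real^'n) set \<Rightarrow> real \<Rightarrow> nat \<Rightarrow> (real^'n \<Rightarrow> real) set set" where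
  "steklov_family \<Omega> p k =
     {F. F \<subseteq> {u \<in> sobolev \<Omega> p. \<not> (AE x in lebesgue_on \<Omega>. u x = 0)} \<and>
         (\<lambda>u x. - u x) ` F = F \<and>
         compactin (sobolev_topology \<Omega> p)
           (F \<inter> {u. Lp_norm (surface_measure \<Omega>) p (boundary_trace \<Omega> p u) = 1}) \<and>
         enat k \<le> genus (sobolev_topology \<Omega> p) F}"

definition steklov_eigenvalue :: "(real^'n) set \<Rightarrow> real \<Rightarrow> nat \<Rightarrow> ennreal" where
  "steklov_eigenvalue \<Omega> p k = (INF F \<in> steklov_family \<Omega> p k. SUP u \<in> F. rayleigh_quotient \<Omega> p u)"

end

theory Submission imports Defs "HOL-Library.Z2"
begin

text \<open>
  The eigenvalue \<open>\<sigma>\<^sub>p\<^sub>,\<^sub>k\<close> is bounded by exhibiting one admissible set.  Let \<open>u\<^sub>0, \<dots>, u\<^sub>k\<^sub>-\<^sub>1\<close> be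
  nonnegative \<open>C\<^sup>1\<close> functions on the whole space of which at most one is nonzero at each point.
  Normalize them in \<open>L\<^sup>p(\<partial>\<Omega>)\<close>.  The combinations with coefficients in the \<open>\<ell>\<^sup>p\<close> unit
  sphere of \<open>\<real>\<^sup>k\<close> form a compact symmetric set whose Rayleigh quotients are averages of those of
  the \<open>u\<^sub>i\<close>, and by the Borsuk-Ulam theorem its genus is at least \<open>k\<close>.  So
  \<open>\<sigma>\<^sub>p\<^sub>,\<^sub>k\<close> is at most the largest Rayleigh quotient of the \<open>u\<^sub>i\<close> (\<open>steklov_eigenvalue_le\<close>).  The
  Borsuk-Ulam theorem is derived from Tucker's lemma on a cubical grid (\<open>tucker\<close>).

  The boundary values in the denominator are traces, that is, limits of continuous Sobolev functions.
  For a function that is continuous up to the boundary the trace has to be the restriction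
  (\<open>is_trace_unique\<close>).  If a continuous \<open>w\<close> is large on a piece of the boundary, then, moving
  into the domain along the direction of the chart, either \<open>w\<close> stays large or its gradient has a large integral
  along the segment.  The Hausdorff measure of the piece is comparable to the volume of the tube swept
  out by these segments (\<open>graph_hausdorff_outer_le\<close>), hence it is small whenever \<open>w\<close> is small in \<open>W\<^sup>1\<^sup>,\<^sup>1\<close>
  (\<open>boundary_superlevel_bound\<close>).  The same comparison with volumes shows that the boundary
  measure of a ball of radius \<open>r\<close> is \<open>O(r\<^sup>n\<^sup>-\<^sup>1)\<close> (\<open>lipschitz_boundary_upper_regular\<close>), so that the
  distortion is a supremum of a bounded family.

  The functions \<open>u\<^sub>i\<close> come from a decomposition of the boundary measure alone (\<open>capacitors\<close>).
  Put \<open>m = |\<partial>\<Omega>| / (6 k M)\<close>, where \<open>M\<close> is a covering number of the space.  Choose balls of mass at least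
  \<open>m\<close> greedily, each of the smallest possible dyadic radius after the sixteenfold enlargements of the
  previous ones have been removed (\<open>greedy_balls\<close>).  The function \<open>u\<^sub>i\<close> is a cutoff function of the \<open>i\<close>-th ball,
  multiplied by functions that vanish on the earlier balls nearby.  Among \<open>3 k\<close> balls at least \<open>2 k\<close>
  have a number of relevant neighbours bounded in terms of \<open>n\<close>, and for those the gradient of \<open>u\<^sub>i\<close> is
  bounded by a sum of boundedly many terms \<open>16 / \<rho>\<close> supported in balls of radius \<open>2 \<rho>\<close>, each of which carries boundary mass
  at least \<open>m\<close>.

  Such a term contributes at most \<open>(16 / \<rho>)\<^sup>p\<close> times the volume of \<open>\<Omega> \<inter> {u\<^sub>i \<noteq> 0} \<inter> B(c, 2 \<rho>)\<close> to the
  energy.  If \<open>p \<le> n\<close>, then \<open>k\<close> of the \<open>2 k\<close> disjoint sets \<open>{u\<^sub>i \<noteq> 0}\<close> meet \<open>\<Omega>\<close> in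
  volume at most \<open>|\<Omega>| / k\<close>, and
  interpolation between this bound and the volume of the ball cancels \<open>\<rho>\<close>.  If \<open>p > n\<close>, then the volume of the
  ball leaves \<open>\<rho>\<^sup>n\<^sup>-\<^sup>p\<close>, and \<open>\<rho>\<close> is bounded below because \<open>m \<le> D(\<Omega>) \<omega>\<^sub>n\<^sub>-\<^sub>1 \<rho>\<^sup>n\<^sup>-\<^sup>1\<close>.
\<close>

section \<open>Alternating sets of labels\<close>

text \<open>
  All counting is done modulo two, in the field of type \<open>bit\<close>.  Its default simplification
  rules turn sums into exclusive disjunctions and hide the ring structure, so they are switched off.
\<close>

declare add_bit_eq_xor [simp del] mult_bit_eq_and [simp del] bit_not_zero_iff [simp del] bit_not_one_iff [simp del]

text \<open>
  The elements of \<open>S\<close>, listed by increasing absolute value, have alternating signs, and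
  the sign of the first one is \<open>s\<close>.
\<close>

definition alternating :: "bool \<Rightarrow> int set \<Rightarrow> bool" where
  "alternating s S \<longleftrightarrow> (\<forall>a\<in>S. a > 0 \<longleftrightarrow> (even (card {b \<in> S. \<bar>b\<bar> < \<bar>a\<bar>}) \<longleftrightarrow> s))"

lemma bit_double [simp]: "(a::bit) + a = 0"
  by (cases a) (auto simp: add_bit_eq_xor)

lemma alternating_insert_max:
  assumes "m \<notin> S" "\<And>b. b \<in> S \<Longrightarrow> \<bar>b\<bar> < \<bar>m\<bar>"
  shows "alternating s (insert m S) \<longleftrightarrow> alternating s S \<and> (m > 0 \<longleftrightarrow> (even (card S) \<longleftrightarrow> s))"
proof -
  have 1: "{b \<in> insert m S. \<bar>b\<bar> < \<bar>m\<bar>} = S" using assms by auto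
  have 2: "{b \<in> insert m S. \<bar>b\<bar> < \<bar>a\<bar>} = {b \<in> S. \<bar>b\<bar> < \<bar>a\<bar>}" if "a \<in> S" for a
    using assms that by force
  have "alternating s (insert m S) \<longleftrightarrow> (m > 0 \<longleftrightarrow> (even (card S) \<longleftrightarrow> s)) \<and>
      (\<forall>a\<in>S. a > 0 \<longleftrightarrow> (even (card {b \<in> insert m S. \<bar>b\<bar> < \<bar>a\<bar>}) \<longleftrightarrow> s))"
    unfolding alternating_def by (simp only: ball_simps 1)
  also have "(\<forall>a\<in>S. a > 0 \<longleftrightarrow> (even (card {b \<in> insert m S. \<bar>b\<bar> < \<bar>a\<bar>}) \<longleftrightarrow> s)) \<longleftrightarrow> alternating s S"
    unfolding alternating_def by (intro ball_cong refl) (simp only: 2)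
  finally show ?thesis by blast
qed

text \<open>
  Delete one element from \<open>S\<close> and ask for an alternating set that starts with \<open>s\<close>.  From an alternating \<open>S\<close> this
  is possible in exactly one way: an end of the list has to go, and which one is decided by the starting
  sign.  If \<open>S\<close> is not alternating, deletions that work come in
  pairs, since either member of a unique adjacent pair of equal signs may go.  The induction adds the element of
  largest absolute value, which fits or does not fit the alternation of the rest (\<open>e\<close> below).
\<close>

lemma fan_identity:
  assumes "finite S" "inj_on abs S"
  shows "(\<Sum>b\<in>S. of_bool (alternating s (S - {b})) :: bit) =
    of_bool (alternating True S) + of_bool (alternating False S)"
  using assms
proof (induction S rule: finite_ranking_induct[where f = abs])
  case empty
  then show ?case by (simp add: alternating_def)
next
  case (insert m S)
  show ?case
  proof (cases "m \<in> S")
    case True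
    then show ?thesis using insert by (simp add: insert_absorb)
  next
    case False
    have lt: "\<bar>b\<bar> < \<bar>m\<bar>" if "b \<in> S" for b
    proof -
      have "\<bar>b\<bar> \<noteq> \<bar>m\<bar>" using insert.prems False that by (metis inj_onD insertI1 insertI2)
      then show ?thesis using insert.hyps(2)[OF that] by simp
    qed
    have IH: "(\<Sum>b\<in>S. of_bool (alternating s (S - {b})) :: bit) =
      of_bool (alternating True S) + of_bool (alternating False S)"
      using insert by auto
    define e where "e \<longleftrightarrow> (m > 0 \<longleftrightarrow> (even (card S) \<longleftrightarrow> s))"
    have step: "of_bool (alternating s (insert m S - {b})) = (of_bool (\<not> e) * of_bool (alternating s (S - {b})) :: bit)"
      if b: "b \<in> S" for b
    proof -
      have "insert m S - {b} = insert m (S - {b})" using False b by auto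
      moreover have "card S = Suc (card (S - {b}))" using card_Suc_Diff1[OF insert.hyps(1) b] by simp
      moreover have "alternating s (insert m (S - {b})) \<longleftrightarrow>
          alternating s (S - {b}) \<and> (m > 0 \<longleftrightarrow> (even (card (S - {b})) \<longleftrightarrow> s))"
        by (rule alternating_insert_max) (use False lt in \<open>blast+\<close>)
      ultimately have "alternating s (insert m S - {b}) \<longleftrightarrow> alternating s (S - {b}) \<and> \<not> e"
        unfolding e_def by (simp only: even_Suc) blast
      then show ?thesis by (cases e) simp_all
    qed
    have "(\<Sum>b\<in>insert m S. of_bool (alternating s (insert m S - {b})) :: bit) =
       of_bool (alternating s S) + (\<Sum>b\<in>S. of_bool (alternating s (insert m S - {b})))"
      using False insert.hyps(1) by (subst sum.insert) auto
    also have "(\<Sum>b\<in>S. of_bool (alternating s (insert m S - {b})) :: bit) =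
       of_bool (\<not> e) * (\<Sum>b\<in>S. of_bool (alternating s (S - {b})))"
      unfolding sum_distrib_left by (intro sum.cong refl step)
    also have "\<dots> = of_bool (\<not> e) * (of_bool (alternating True S) + of_bool (alternating False S))"
      by (simp only: IH)
    finally show ?thesis
      using alternating_insert_max[OF False lt, of True] alternating_insert_max[OF False lt, of False]
      by (cases s; cases e; cases "alternating True S"; cases "alternating False S") (auto simp: e_def)
  qed
qed

text \<open>
  A multiset of labels stands for a labelled simplex, and its submultisets with one element less for the facets.
\<close>

definition coboundary :: "('a multiset \<Rightarrow> bit) \<Rightarrow> 'a multiset \<Rightarrow> bit" where
  "coboundary F C = (\<Sum>y\<in>#C. F (C - {#y#}))"

lemma coboundary_add_mset:
  "coboundary F (add_mset y C) = F C + coboundary (\<lambda>D. F (add_mset y D)) C"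
proof -
  have "add_mset y C - {#z#} = add_mset y (C - {#z#})" if "z \<in># C" for z
    using that by (cases "z = y") (simp_all only: insert_DiffM add_mset_remove_trivial multi_self_add_other_not_self, simp add: multiset_eq_iff)
  then have "(\<Sum>z\<in>#C. F (add_mset y C - {#z#})) = (\<Sum>z\<in>#C. F (add_mset y (C - {#z#})))"
    by (intro arg_cong[where f = sum_mset] image_mset_cong) simp
  then show ?thesis by (simp add: coboundary_def)
qed

text \<open>
  The size condition says that the absolute values of the labels are distinct.
\<close>

definition fan_cochain :: "bool \<Rightarrow> int multiset \<Rightarrow> bit" where
  "fan_cochain s C = of_bool (size C = card (abs ` set_mset C) \<and> alternating s (set_mset C))"

lemma fan_cochain_repeated: "fan_cochain s (add_mset a (add_mset a C)) = 0"
proof -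
  have "card (abs ` set_mset (add_mset a (add_mset a C))) = card (abs ` insert a (set_mset C))" by simp
  also have "\<dots> \<le> card (insert a (set_mset C))" by (rule card_image_le) simp
  also have "\<dots> \<le> Suc (card (set_mset C))" by (rule card_insert_le_m1) auto
  also have "card (set_mset C) \<le> size C"
    by (metis size_multiset_overloaded_eq sum_bounded_below[of "set_mset C" 1 "count C"] count_greater_eq_one_iff mult.right_neutral of_nat_id)
  finally show ?thesis by (simp add: fan_cochain_def)
qed

text \<open>
  If a label is repeated, the two facets that drop one copy of it cancel, and all others still contain a repetition.
  Otherwise this is the identity for sets; absolute values are distinct because no two labels are opposite.
\<close>

lemma coboundary_fan_cochain:
  assumes compl: "\<And>a b. a \<in># C \<Longrightarrow> b \<in># C \<Longrightarrow> a \<noteq> - b"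
  shows "coboundary (fan_cochain s) C = fan_cochain True C + fan_cochain False C"
proof (cases "\<exists>a. count C a \<ge> 2")
  case True
  then obtain a where a: "count C a \<ge> 2" by blast
  have "replicate_mset 2 a \<subseteq># C" using a by (simp add: count_le_replicate_mset_subset_eq)
  then obtain D where "C = replicate_mset 2 a + D" by (metis subset_mset.le_iff_add)
  then have D: "C = add_mset a (add_mset a D)" by (simp add: eval_nat_numeral)
  have "coboundary (\<lambda>E. fan_cochain s (add_mset a (add_mset a E))) D = 0"
    by (simp add: coboundary_def fan_cochain_repeated)
  then show ?thesis
    unfolding D by (simp add: coboundary_add_mset fan_cochain_repeated)
next
  case False
  define S where "S = set_mset C"
  have C: "C = mset_set S"
  proof (rule multiset_eqI)
    fix x
    have le: "\<not> count C x \<ge> 2" using False by blast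
    show "count C x = count (mset_set S) x"
    proof (cases "x \<in># C")
      case True
      then have "count C x > 0" by (rule count_greater_zero_iff[THEN iffD2])
      then have "count C x = 1" using le by linarith
      then show ?thesis using True by (simp add: S_def)
    next
      case False
      then show ?thesis by (simp add: S_def not_in_iff[THEN iffD1])
    qed
  qed
  have fin: "finite S" by (simp add: S_def)
  have inj: "inj_on abs S"
    using compl by (auto simp: inj_on_def S_def abs_eq_iff)
  have A: "fan_cochain s (mset_set T) = of_bool (alternating s T)" if "T \<subseteq> S" for s T
    using inj_on_subset[OF inj that] finite_subset[OF that fin] by (simp add: fan_cochain_def card_image)
  have "coboundary (fan_cochain s) C = (\<Sum>b\<in>S. fan_cochain s (mset_set (S - {b})))"
    unfolding coboundary_def C sum_unfold_sum_mset
    by (intro arg_cong[where f = sum_mset] image_mset_cong) (simp add: fin mset_set_Diff)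
  also have "\<dots> = (\<Sum>b\<in>S. of_bool (alternating s (S - {b})))"
    by (intro sum.cong refl A) auto
  finally show ?thesis using fan_identity[OF fin inj, of s] by (simp add: C A)
qed

section \<open>Sums over the simplices of a triangulated cube\<close>

definition shift_by :: "nat set \<Rightarrow> (nat \<Rightarrow> int) \<Rightarrow> nat \<Rightarrow> int" where
  "shift_by T x = (\<lambda>j. x j + of_bool (j \<in> T))"

text \<open>
  The unit cube with lowest vertex \<open>x\<close> and edge directions \<open>I\<close> is triangulated by the monotone edge paths
  from the lowest to the highest vertex, one simplex for each ordering of \<open>I\<close>.  For \<open>k = card I\<close> the value of
  \<open>cube_sum\<close> is the sum of \<open>F\<close>, applied to the multiset of vertex labels, over these simplices.
\<close>

primrec cube_sum :: "((nat \<Rightarrow> int) \<Rightarrow> 'a) \<Rightarrow> nat \<Rightarrow> ('a multiset \<Rightarrow> bit) \<Rightarrow> (nat \<Rightarrow> int) \<Rightarrow> nat set \<Rightarrow> bit" where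
  "cube_sum l 0 F x I = F {#l x#}"
| "cube_sum l (Suc k) F x I =
     (\<Sum>i\<in>I. cube_sum l k (\<lambda>C. F (add_mset (l x) C)) (shift_by {i} x) (I - {i}))"

lemma shift_by_shift_by: "i \<in> T \<Longrightarrow> shift_by (T - {i}) (shift_by {i} x) = shift_by T x"
  by (auto simp: shift_by_def fun_eq_iff)

lemma shift_by_commute: "shift_by S (shift_by T x) = shift_by T (shift_by S x)"
  by (auto simp: shift_by_def)

lemma cube_sum_add: "cube_sum l k (\<lambda>C. F C + G C) x I = cube_sum l k F x I + cube_sum l k G x I"
  by (induction k arbitrary: F G x I) (auto simp: sum.distrib)

lemma cube_sum_cong:
  assumes "\<And>C. set_mset C \<subseteq> (\<lambda>T. l (shift_by T x)) ` Pow I \<Longrightarrow> size C = Suc k \<Longrightarrow> F C = G C"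
  shows "cube_sum l k F x I = cube_sum l k G x I"
  using assms
proof (induction k arbitrary: F G x I)
  case 0
  have "l x = l (shift_by {} x)" by (simp add: shift_by_def)
  then show ?case using 0[of "{#l x#}"] by (auto simp: image_iff)
next
  case (Suc k)
  have x: "l x \<in> (\<lambda>T. l (shift_by T x)) ` Pow I"
    by (rule image_eqI[of _ _ "{}"]) (auto simp: shift_by_def)
  show ?case
  proof (simp, rule sum.cong[OF refl], rule Suc.IH)
    fix i C assume i: "i \<in> I" and C: "set_mset C \<subseteq> (\<lambda>T. l (shift_by T (shift_by {i} x))) ` Pow (I - {i})"
      "size C = Suc k"
    have "(\<lambda>T. l (shift_by T (shift_by {i} x))) ` Pow (I - {i}) \<subseteq> (\<lambda>T. l (shift_by T x)) ` Pow I"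
    proof
      fix z assume "z \<in> (\<lambda>T. l (shift_by T (shift_by {i} x))) ` Pow (I - {i})"
      then obtain T where T: "T \<subseteq> I - {i}" "z = l (shift_by T (shift_by {i} x))" by auto
      then have "T = insert i T - {i}" by auto
      then have "z = l (shift_by (insert i T) x)" using T shift_by_shift_by[of i "insert i T" x] by auto
      then show "z \<in> (\<lambda>T. l (shift_by T x)) ` Pow I" using T i by auto
    qed
    then show "F (add_mset (l x) C) = G (add_mset (l x) C)"
      using C x by (intro Suc.prems) auto
  qed
qed

text \<open>
  The terms for \<open>(i, j)\<close> and \<open>(j, i)\<close> cancel modulo two.
\<close>

lemma sum_off_diagonal_symmetric:
  fixes h :: "'a \<Rightarrow> 'a \<Rightarrow> bit"
  assumes "finite I" and sym: "\<And>i j. h i j = h j i"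
  shows "(\<Sum>i\<in>I. \<Sum>j\<in>I - {i}. h i j) = 0"
  using assms(1)
proof (induction I rule: finite_induct)
  case (insert a I)
  have "(\<Sum>i\<in>I. \<Sum>j\<in>insert a I - {i}. h i j) = (\<Sum>i\<in>I. h i a + (\<Sum>j\<in>I - {i}. h i j))"
  proof (intro sum.cong refl)
    fix i assume "i \<in> I"
    then have "insert a I - {i} = insert a (I - {i})" using insert by auto
    then show "(\<Sum>j\<in>insert a I - {i}. h i j) = h i a + (\<Sum>j\<in>I - {i}. h i j)"
      using insert by simp
  qed
  then show ?case using insert sym[of a] by (simp add: sum.distrib)
qed simp

lemma sum_off_diagonal_swap:
  fixes h :: "'a \<Rightarrow> 'a \<Rightarrow> bit"
  assumes "finite I"
  shows "(\<Sum>i\<in>I. \<Sum>j\<in>I - {i}. h i j) = (\<Sum>j\<in>I. \<Sum>i\<in>I - {j}. h i j)"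
proof -
  have "(\<Sum>i\<in>I. \<Sum>j\<in>I - {i}. h i j) = (\<Sum>i\<in>I. \<Sum>j\<in>I. if i = j then 0 else h i j)"
  proof (rule sum.cong[OF refl])
    fix i assume "i \<in> I"
    show "(\<Sum>j\<in>I - {i}. h i j) = (\<Sum>j\<in>I. if i = j then 0 else h i j)"
      using assms by (intro sum.mono_neutral_cong_left) auto
  qed
  also have "\<dots> = (\<Sum>j\<in>I. \<Sum>i\<in>I. if i = j then 0 else h i j)" by (rule sum.swap)
  also have "\<dots> = (\<Sum>j\<in>I. \<Sum>i\<in>I - {j}. h i j)"
  proof (rule sum.cong[OF refl])
    fix j assume "j \<in> I"
    show "(\<Sum>i\<in>I. if i = j then 0 else h i j) = (\<Sum>i\<in>I - {j}. h i j)"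
      using assms by (intro sum.mono_neutral_cong_right) auto
  qed
  finally show ?thesis .
qed

text \<open>
  Stokes' formula for the triangulated cube: dropping an inner vertex of a monotone path from one corner to
  another gives a facet shared by two simplices, for the two orders in which the two steps
  at that vertex can be taken.  What remains are the simplices of the upper and the lower faces.
\<close>

lemma cube_sum_coboundary:
  assumes "card I = Suc k"
  shows "cube_sum l (Suc k) (coboundary F) x I =
    (\<Sum>i\<in>I. cube_sum l k F (shift_by {i} x) (I - {i}) + cube_sum l k F x (I - {i}))"
  using assms
proof (induction k arbitrary: F x I)
  case 0
  then obtain i where "I = {i}" by (metis One_nat_def card_1_singletonE)
  then show ?case by (simp add: coboundary_def add.commute)
next
  case (Suc k)
  define F' where "F' = (\<lambda>C. F (add_mset (l x) C))"
  have fin: "finite I" using Suc.prems by (metis card.infinite Zero_neq_Suc)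
  have "cube_sum l (Suc (Suc k)) (coboundary F) x I =
     (\<Sum>i\<in>I. cube_sum l (Suc k) (\<lambda>C. F C + coboundary F' C) (shift_by {i} x) (I - {i}))"
    by (simp add: coboundary_add_mset F'_def)
  also have "\<dots> = (\<Sum>i\<in>I. cube_sum l (Suc k) F (shift_by {i} x) (I - {i})) +
     (\<Sum>i\<in>I. cube_sum l (Suc k) (coboundary F') (shift_by {i} x) (I - {i}))"
    by (simp add: cube_sum_add sum.distrib del: cube_sum.simps)
  also have "(\<Sum>i\<in>I. cube_sum l (Suc k) (coboundary F') (shift_by {i} x) (I - {i})) =
     (\<Sum>i\<in>I. \<Sum>j\<in>I - {i}. cube_sum l k F' (shift_by {j} (shift_by {i} x)) (I - {i} - {j}) +
        cube_sum l k F' (shift_by {i} x) (I - {i} - {j}))"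
    using Suc.prems fin by (intro sum.cong refl Suc.IH) simp
  also have "\<dots> = (\<Sum>i\<in>I. \<Sum>j\<in>I - {i}. cube_sum l k F' (shift_by {j} (shift_by {i} x)) (I - {i} - {j})) +
     (\<Sum>i\<in>I. \<Sum>j\<in>I - {i}. cube_sum l k F' (shift_by {i} x) (I - {i} - {j}))"
    by (simp add: sum.distrib)
  also have "(\<Sum>i\<in>I. \<Sum>j\<in>I - {i}. cube_sum l k F' (shift_by {j} (shift_by {i} x)) (I - {i} - {j})) = 0"
    by (rule sum_off_diagonal_symmetric[OF fin]) (simp add: shift_by_commute Diff_insert[symmetric] insert_commute)
  also have "(\<Sum>i\<in>I. \<Sum>j\<in>I - {i}. cube_sum l k F' (shift_by {i} x) (I - {i} - {j})) =
     (\<Sum>j\<in>I. \<Sum>i\<in>I - {j}. cube_sum l k F' (shift_by {i} x) (I - {j} - {i}))"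
    by (subst sum_off_diagonal_swap[OF fin]) (simp add: Diff_insert[symmetric] insert_commute)
  also have "\<dots> = (\<Sum>j\<in>I. cube_sum l (Suc k) F x (I - {j}))"
    by (simp add: F'_def)
  finally show ?case by (simp add: sum.distrib del: cube_sum.simps)
qed

text \<open>
  The recursion of \<open>cube_sum\<close> splits off the lowest vertex; this one splits off the highest one.  The
  reflection in the origin exchanges them.
\<close>

lemma cube_sum_from_top:
  assumes "card I = Suc k"
  shows "cube_sum l (Suc k) F x I =
    (\<Sum>i\<in>I. cube_sum l k (\<lambda>C. F (add_mset (l (shift_by I x)) C)) x (I - {i}))"
  using assms
proof (induction k arbitrary: F x I)
  case 0
  then obtain i where "I = {i}" by (metis One_nat_def card_1_singletonE)
  then show ?case by (simp add: add_mset_commute)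
next
  case (Suc k)
  have fin: "finite I" using Suc.prems by (metis card.infinite Zero_neq_Suc)
  have "cube_sum l (Suc (Suc k)) F x I =
      (\<Sum>i\<in>I. cube_sum l (Suc k) (\<lambda>C. F (add_mset (l x) C)) (shift_by {i} x) (I - {i}))"
    by simp
  also have "\<dots> = (\<Sum>i\<in>I. \<Sum>j\<in>I - {i}. cube_sum l k (\<lambda>C. F (add_mset (l x)
       (add_mset (l (shift_by I x)) C))) (shift_by {i} x) (I - {i} - {j}))"
  proof (rule sum.cong[OF refl])
    fix i assume i: "i \<in> I"
    then have "card (I - {i}) = Suc k" using Suc.prems fin by simp
    from Suc.IH[OF this, of "\<lambda>C. F (add_mset (l x) C)" "shift_by {i} x"]
    show "cube_sum l (Suc k) (\<lambda>C. F (add_mset (l x) C)) (shift_by {i} x) (I - {i}) =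
      (\<Sum>j\<in>I - {i}. cube_sum l k (\<lambda>C. F (add_mset (l x)
       (add_mset (l (shift_by I x)) C))) (shift_by {i} x) (I - {i} - {j}))"
      by (simp only: shift_by_shift_by[OF i])
  qed
  also have "\<dots> = (\<Sum>j\<in>I. \<Sum>i\<in>I - {j}. cube_sum l k (\<lambda>C. F (add_mset (l x)
       (add_mset (l (shift_by I x)) C))) (shift_by {i} x) (I - {j} - {i}))"
    by (subst sum_off_diagonal_swap[OF fin]) (simp add: Diff_insert[symmetric] insert_commute)
  also have "\<dots> = (\<Sum>j\<in>I. cube_sum l (Suc k) (\<lambda>C. F (add_mset (l (shift_by I x)) C)) x (I - {j}))"
    by (simp add: add_mset_commute)
  finally show ?case .
qed

text \<open>
  The reflection maps the triangulation of the cube at \<open>x\<close> to the triangulation of the cube whose lowest vertex is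
  the reflected highest vertex of the first one.
\<close>

lemma cube_sum_antipode:
  fixes l :: "(nat \<Rightarrow> int) \<Rightarrow> int"
  assumes "card I = k" "finite I" and odd: "\<And>T. T \<subseteq> I \<Longrightarrow> l (\<lambda>j. - shift_by T x j) = - l (shift_by T x)"
  shows "cube_sum l k F (\<lambda>j. - shift_by I x j) I = cube_sum l k (\<lambda>C. F (image_mset uminus C)) x I"
  using assms
proof (induction k arbitrary: F I)
  case 0
  then have "I = {}" by simp
  moreover have "shift_by {} x = x" by (simp add: shift_by_def)
  ultimately show ?case using 0(3)[of "{}"] by simp
next
  case (Suc k)
  have "cube_sum l (Suc k) F (\<lambda>j. - shift_by I x j) I =
     (\<Sum>i\<in>I. cube_sum l k (\<lambda>C. F (add_mset (- l (shift_by I x)) C)) (\<lambda>j. - shift_by (I - {i}) x j) (I - {i}))"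
  proof (simp add: Suc.prems(3), rule sum.cong[OF refl])
    fix i assume "i \<in> I"
    then have "shift_by {i} (\<lambda>j. - shift_by I x j) = (\<lambda>j. - shift_by (I - {i}) x j)"
      by (auto simp: shift_by_def)
    then show "cube_sum l k (\<lambda>C. F (add_mset (- l (shift_by I x)) C)) (shift_by {i} (\<lambda>j. - shift_by I x j)) (I - {i})
     = cube_sum l k (\<lambda>C. F (add_mset (- l (shift_by I x)) C)) (\<lambda>j. - shift_by (I - {i}) x j) (I - {i})"
      by simp
  qed
  also have "\<dots> = (\<Sum>i\<in>I. cube_sum l k (\<lambda>C. F (image_mset uminus (add_mset (l (shift_by I x)) C))) x (I - {i}))"
  proof (rule sum.cong[OF refl])
    fix i assume i: "i \<in> I"
    have "card (I - {i}) = k" "finite (I - {i})" using Suc.prems(1,2) i by auto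
    from Suc.IH[OF this, of "\<lambda>C. F (add_mset (- l (shift_by I x)) C)"]
    show "cube_sum l k (\<lambda>C. F (add_mset (- l (shift_by I x)) C)) (\<lambda>j. - shift_by (I - {i}) x j) (I - {i}) =
      cube_sum l k (\<lambda>C. F (image_mset uminus (add_mset (l (shift_by I x)) C))) x (I - {i})"
      using Suc.prems(3) by auto
  qed
  also have "\<dots> = cube_sum l (Suc k) (\<lambda>C. F (image_mset uminus C)) x I"
    using cube_sum_from_top[OF Suc.prems(1), of l "\<lambda>C. F (image_mset uminus C)" x] by simp
  finally show ?case .
qed

section \<open>Chains on the faces of a cubical grid\<close>

text \<open>
  A face of the cube \<open>[-N, N]\<^sup>d\<close> is given by its set \<open>I\<close> of free coordinates and the signs of the others.
  \<open>cells d N I\<close> are the lowest vertices of the unit cubes into which the faces with free coordinates \<open>I\<close> are divided;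
  \<open>corner_signs\<close> records the fixed coordinates as signed indices, shifted by one so
  that the sign of the index \<open>0\<close> is not lost.
\<close>

definition cells :: "nat \<Rightarrow> int \<Rightarrow> nat set \<Rightarrow> (nat \<Rightarrow> int) set" where
  "cells d N I = {x. \<forall>i. (i \<in> I \<longrightarrow> -N \<le> x i \<and> x i < N) \<and>
     (i \<notin> I \<longrightarrow> i < d \<longrightarrow> x i = N \<or> x i = -N) \<and> (i \<notin> I \<longrightarrow> \<not> i < d \<longrightarrow> x i = 0)}"

definition corner_signs :: "nat \<Rightarrow> nat set \<Rightarrow> (nat \<Rightarrow> int) \<Rightarrow> int set" where
  "corner_signs d I x = (\<lambda>i. sgn (x i) * (int i + 1)) ` ({..<d} - I)"

text \<open>
  The \<open>k\<close>-dimensional faces whose fixed coordinates alternate in sign, starting with \<open>s\<close>, are a mod two analogue of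
  a hemisphere of dimension \<open>k\<close>: by the next lemmas the boundary of the one of dimension \<open>k + 1\<close> is the
  one of dimension \<open>k\<close> together with its antipode.
\<close>

definition face_sum :: "nat \<Rightarrow> int \<Rightarrow> ((nat \<Rightarrow> int) \<Rightarrow> 'a) \<Rightarrow> nat \<Rightarrow> ('a multiset \<Rightarrow> bit) \<Rightarrow> bool \<Rightarrow> bit" where
  "face_sum d N l k F s = (\<Sum>I | I \<subseteq> {..<d} \<and> card I = k. \<Sum>x\<in>cells d N I.
     of_bool (alternating s (corner_signs d I x)) * cube_sum l k F x I)"

lemma finite_cells [simp]:
  assumes "I \<subseteq> {..<d}"
  shows "finite (cells d N I)"
proof (rule finite_subset)
  show "finite {x :: nat \<Rightarrow> int. \<forall>i. (i \<in> {..<d} \<longrightarrow> x i \<in> {-\<bar>N\<bar>..\<bar>N\<bar>}) \<and> (i \<notin> {..<d} \<longrightarrow> x i = 0)}"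
    by (rule finite_set_of_finite_funs) auto
  show "cells d N I \<subseteq> {x :: nat \<Rightarrow> int. \<forall>i. (i \<in> {..<d} \<longrightarrow> x i \<in> {-\<bar>N\<bar>..\<bar>N\<bar>}) \<and> (i \<notin> {..<d} \<longrightarrow> x i = 0)}"
  proof (intro subsetI CollectI allI)
    fix x i assume "x \<in> cells d N I"
    then show "(i \<in> {..<d} \<longrightarrow> x i \<in> {-\<bar>N\<bar>..\<bar>N\<bar>}) \<and> (i \<notin> {..<d} \<longrightarrow> x i = 0)"
      using assms unfolding cells_def by (cases "i \<in> I"; cases "i < d") force+
  qed
qed

lemma sum_bit_telescope:
  fixes g :: "int \<Rightarrow> bit"
  shows "(\<Sum>t\<in>{a..<a + int m}. g (t + 1) + g t) = g (a + int m) + g a"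
proof (induction m)
  case (Suc m)
  have "{a..<a + int (Suc m)} = insert (a + int m) {a..<a + int m}" by auto
  then show ?case using Suc by (simp add: ac_simps)
qed simp

text \<open>
  Along the direction \<open>i\<close> the sums over neighbouring unit cubes telescope, and only the two ends
  \<open>x i = -N\<close> and \<open>x i = N\<close> survive.
\<close>

lemma cells_telescope:
  fixes h :: "(nat \<Rightarrow> int) \<Rightarrow> bit"
  assumes I: "I \<subseteq> {..<d}" "i \<in> I" and N: "N > 0"
    and c: "\<And>x t. c (x(i := t)) = c x"
  shows "(\<Sum>x\<in>cells d N I. c x * (h (shift_by {i} x) + h x)) = (\<Sum>y\<in>cells d N (I - {i}). c y * h y)"
proof -
  define Y where "Y = {x \<in> cells d N I. x i = -N}"
  have fin: "finite Y" using finite_cells[OF I(1)] by (auto simp: Y_def)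
  have id: "i < d" using I by auto
  have ins: "x(i := t) \<in> cells d N I" if "x \<in> Y" "t \<in> {-N..<N}" for x t
    using that I(2) by (auto simp: Y_def cells_def)
  have b1: "bij_betw (\<lambda>(x, t). x(i := t)) (Y \<times> {-N..<N}) (cells d N I)"
  proof (rule bij_betwI[where g = "\<lambda>x. (x(i := -N), x i)"])
    show "(\<lambda>(x, t). x(i := t)) \<in> Y \<times> {-N..<N} \<rightarrow> cells d N I"
      using ins by auto
    show "(\<lambda>x. (x(i := -N), x i)) \<in> cells d N I \<rightarrow> Y \<times> {-N..<N}"
    proof
      fix x assume x: "x \<in> cells d N I"
      then have "x i \<in> {-N..<N}" using I(2) by (auto simp: cells_def)
      moreover have "x(i := -N) \<in> Y"
        using x N I(2) by (auto simp: Y_def cells_def)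
      ultimately show "(x(i := -N), x i) \<in> Y \<times> {-N..<N}" by simp
    qed
    show "(\<lambda>x. (x(i := -N), x i)) ((\<lambda>(x, t). x(i := t)) z) = z" if "z \<in> Y \<times> {-N..<N}" for z
      using that by (auto simp: Y_def fun_eq_iff)
    show "(\<lambda>(x, t). x(i := t)) ((\<lambda>x. (x(i := -N), x i)) x) = x" for x by simp
  qed
  have b2: "bij_betw (\<lambda>(x, t). x(i := t)) (Y \<times> {-N, N}) (cells d N (I - {i}))"
  proof (rule bij_betwI[where g = "\<lambda>x. (x(i := -N), x i)"])
    show "(\<lambda>(x, t). x(i := t)) \<in> Y \<times> {-N, N} \<rightarrow> cells d N (I - {i})"
    proof (clarsimp simp del: insert_iff)
      fix x t assume "x \<in> Y" "t \<in> {-N, N}"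
      then show "x(i := t) \<in> cells d N (I - {i})"
        using id unfolding Y_def cells_def by (auto split: if_splits)
    qed
    show "(\<lambda>x. (x(i := -N), x i)) \<in> cells d N (I - {i}) \<rightarrow> Y \<times> {-N, N}"
    proof
      fix x assume x: "x \<in> cells d N (I - {i})"
      then have "x i \<in> {-N, N}" using id by (auto simp: cells_def)
      moreover have "x(i := -N) \<in> Y"
        using x N I(2) unfolding Y_def cells_def by (auto split: if_splits)
      ultimately show "(x(i := -N), x i) \<in> Y \<times> {-N, N}" by simp
    qed
    show "(\<lambda>x. (x(i := -N), x i)) ((\<lambda>(x, t). x(i := t)) z) = z" if "z \<in> Y \<times> {-N, N}" for z
      using that by (auto simp: Y_def fun_eq_iff)
    show "(\<lambda>(x, t). x(i := t)) ((\<lambda>x. (x(i := -N), x i)) x) = x" for x by simp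
  qed
  have sh: "shift_by {i} (x(i := t)) = x(i := t + 1)" for x t
    by (auto simp: shift_by_def fun_eq_iff)
  have "(\<Sum>x\<in>cells d N I. c x * (h (shift_by {i} x) + h x)) =
     (\<Sum>(x, t)\<in>Y \<times> {-N..<N}. c x * (h (x(i := t + 1)) + h (x(i := t))))"
    by (subst sum.reindex_bij_betw[OF b1, symmetric]) (auto simp: case_prod_beta c sh intro!: sum.cong)
  also have "\<dots> = (\<Sum>x\<in>Y. c x * (\<Sum>t\<in>{-N..<N}. h (x(i := t + 1)) + h (x(i := t))))"
    by (simp only: sum.cartesian_product[symmetric] sum_distrib_left)
  also have "\<dots> = (\<Sum>x\<in>Y. c x * (h (x(i := N)) + h (x(i := -N))))"
  proof (rule sum.cong[OF refl])
    fix x assume "x \<in> Y"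
    have "(\<Sum>t\<in>{-N..<N}. h (x(i := t + 1)) + h (x(i := t))) = h (x(i := N)) + h (x(i := -N))"
      using sum_bit_telescope[where g = "\<lambda>t. h (x(i := t))" and a = "-N" and m = "nat (2 * N)"] N by simp
    then show "c x * (\<Sum>t\<in>{-N..<N}. h (x(i := t + 1)) + h (x(i := t))) = c x * (h (x(i := N)) + h (x(i := -N)))"
      by simp
  qed
  also have "\<dots> = (\<Sum>(x, t)\<in>Y \<times> {-N, N}. c x * h (x(i := t)))"
    using N by (simp add: sum.cartesian_product[symmetric] distrib_left add.commute)
  also have "\<dots> = (\<Sum>y\<in>cells d N (I - {i}). c y * h y)"
    by (subst sum.reindex_bij_betw[OF b2, symmetric]) (auto simp: case_prod_beta c intro!: sum.cong)
  finally show ?thesis .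
qed

text \<open>
  Interior walls cancel by telescoping.  A face of dimension \<open>k\<close> appears in the boundary of the
  faces obtained by freeing one of its fixed coordinates, that is, by deleting one of its corner signs;
  the number of alternating results is given by the identity for alternating sets.
\<close>

lemma face_sum_coboundary:
  assumes k: "k < d" and N: "N > 0"
  shows "face_sum d N l (Suc k) (coboundary F) True = face_sum d N l k F True + face_sum d N l k F False"
proof -
  let ?A = "\<lambda>k. {I. I \<subseteq> {..<d} \<and> card I = k}"
  let ?c = "\<lambda>I x. of_bool (alternating True (corner_signs d I x)) :: bit"
  have finA: "finite (?A j)" for j by (rule finite_subset[of _ "Pow {..<d}"]) auto
  have "face_sum d N l (Suc k) (coboundary F) True =
     (\<Sum>I\<in>?A (Suc k). \<Sum>x\<in>cells d N I. ?c I x *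
        (\<Sum>i\<in>I. cube_sum l k F (shift_by {i} x) (I - {i}) + cube_sum l k F x (I - {i})))"
    unfolding face_sum_def
    by (intro sum.cong refl arg_cong2[where f = "(*)"] cube_sum_coboundary) auto
  also have "\<dots> = (\<Sum>I\<in>?A (Suc k). \<Sum>i\<in>I. \<Sum>x\<in>cells d N I. ?c I x *
        (cube_sum l k F (shift_by {i} x) (I - {i}) + cube_sum l k F x (I - {i})))"
    by (simp only: sum_distrib_left) (rule sum.cong[OF refl], rule sum.swap)
  also have "\<dots> = (\<Sum>I\<in>?A (Suc k). \<Sum>i\<in>I. \<Sum>x\<in>cells d N (I - {i}). ?c I x * cube_sum l k F x (I - {i}))"
  proof (rule sum.cong[OF refl], rule sum.cong[OF refl])
    fix I i assume I: "I \<in> ?A (Suc k)" and i: "i \<in> I"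
    show "(\<Sum>x\<in>cells d N I. ?c I x *
        (cube_sum l k F (shift_by {i} x) (I - {i}) + cube_sum l k F x (I - {i}))) =
      (\<Sum>x\<in>cells d N (I - {i}). ?c I x * cube_sum l k F x (I - {i}))"
    proof (rule cells_telescope[OF _ i N])
      show "I \<subseteq> {..<d}" using I by auto
      show "?c I (x(i := t)) = ?c I x" for x t
      proof -
        have "corner_signs d I (x(i := t)) = corner_signs d I x"
          unfolding corner_signs_def using i by (intro image_cong) auto
        then show ?thesis by simp
      qed
    qed
  qed
  also have "\<dots> = (\<Sum>(I, i)\<in>Sigma (?A (Suc k)) (\<lambda>I. I). \<Sum>x\<in>cells d N (I - {i}). ?c I x * cube_sum l k F x (I - {i}))"
    by (rule sum.Sigma) (auto intro: finA finite_subset)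
  also have "\<dots> = (\<Sum>(I, i)\<in>Sigma (?A k) (\<lambda>I. {..<d} - I). \<Sum>x\<in>cells d N I. ?c (insert i I) x * cube_sum l k F x I)"
  proof (rule sum.reindex_bij_witness[where i = "\<lambda>(I, i). (insert i I, i)" and j = "\<lambda>(I, i). (I - {i}, i)"], goal_cases)
    case (1 a) then show ?case by (auto simp: insert_absorb)
  next
    case (2 a)
    then show ?case by (auto dest: finite_subset)
  next
    case (3 b) then show ?case by auto
  next
    case (4 b)
    then obtain I i where "b = (I, i)" "I \<subseteq> {..<d}" "card I = k" "i < d" "i \<notin> I" by auto
    then show ?case using finite_subset[of I "{..<d}"] by simp
  next
    case (5 a) then show ?case by (auto simp: insert_absorb)
  qed
  also have "\<dots> = (\<Sum>I\<in>?A k. \<Sum>i\<in>{..<d} - I. \<Sum>x\<in>cells d N I. ?c (insert i I) x * cube_sum l k F x I)"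
    by (rule sum.Sigma[symmetric]) (auto intro: finA)
  also have "\<dots> = (\<Sum>I\<in>?A k. \<Sum>x\<in>cells d N I.
       (\<Sum>i\<in>{..<d} - I. ?c (insert i I) x) * cube_sum l k F x I)"
    by (simp only: sum_distrib_right) (rule sum.cong[OF refl], rule sum.swap)
  also have "\<dots> = (\<Sum>I\<in>?A k. \<Sum>x\<in>cells d N I.
       (?c I x + of_bool (alternating False (corner_signs d I x))) * cube_sum l k F x I)"
  proof (rule sum.cong[OF refl], rule sum.cong[OF refl])
    fix I x assume I: "I \<in> ?A k" and x: "x \<in> cells d N I"
    let ?f = "\<lambda>i. sgn (x i) * (int i + 1)"
    have nz: "\<bar>?f i\<bar> = int i + 1" if "i \<in> {..<d} - I" for i
    proof -
      have "x i \<noteq> 0" using x that N unfolding cells_def by force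
      then show ?thesis by (simp add: abs_mult abs_sgn_eq)
    qed
    have inj: "inj_on ?f ({..<d} - I)"
      by (rule inj_onI) (metis nz add_right_cancel of_nat_eq_iff)
    have "(\<Sum>i\<in>{..<d} - I. ?c (insert i I) x) =
        (\<Sum>i\<in>{..<d} - I. of_bool (alternating True (corner_signs d I x - {?f i})))"
    proof (rule sum.cong[OF refl])
      fix i assume i: "i \<in> {..<d} - I"
      have "corner_signs d (insert i I) x = ?f ` (({..<d} - I) - {i})"
        unfolding corner_signs_def by (rule arg_cong[where f = "image ?f"]) auto
      also have "\<dots> = corner_signs d I x - {?f i}"
        unfolding corner_signs_def using inj_on_image_set_diff[OF inj, of "{..<d} - I" "{i}"] i by simp
      finally show "?c (insert i I) x = of_bool (alternating True (corner_signs d I x - {?f i}))" by simp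
    qed
    also have "\<dots> = (\<Sum>b\<in>corner_signs d I x. of_bool (alternating True (corner_signs d I x - {b})))"
      by (simp add: corner_signs_def sum.reindex[OF inj])
    also have "\<dots> = ?c I x + of_bool (alternating False (corner_signs d I x))"
    proof (rule fan_identity)
      show "finite (corner_signs d I x)" by (simp add: corner_signs_def)
      show "inj_on abs (corner_signs d I x)"
        unfolding corner_signs_def by (rule inj_onI) (smt (verit) imageE nz of_nat_eq_iff)
    qed
    finally show "(\<Sum>i\<in>{..<d} - I. ?c (insert i I) x) * cube_sum l k F x I =
       (?c I x + of_bool (alternating False (corner_signs d I x))) * cube_sum l k F x I" by simp
  qed
  finally show ?thesis
    unfolding face_sum_def by (simp add: distrib_right sum.distrib)
qed

section \<open>Tucker's lemma and the Borsuk-Ulam theorem\<close>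

lemma alternating_uminus:
  assumes "0 \<notin> S"
  shows "alternating s (uminus ` S) \<longleftrightarrow> alternating (\<not> s) S"
proof -
  have c: "card {b \<in> uminus ` S. \<bar>b\<bar> < \<bar>a\<bar>} = card {b \<in> S. \<bar>b\<bar> < \<bar>a\<bar>}" for a
  proof -
    have "{b \<in> uminus ` S. \<bar>b\<bar> < \<bar>a\<bar>} = uminus ` {b \<in> S. \<bar>b\<bar> < \<bar>a\<bar>}" by auto
    then show ?thesis by (simp add: card_image)
  qed
  have "a > 0 \<longleftrightarrow> \<not> - a > 0" if "a \<in> S" for a
    using assms that by (cases "a = 0") auto
  then show ?thesis
    unfolding alternating_def by (simp add: c ball_simps(9)) blast
qed

lemma cube_sum_zero: "cube_sum l k (\<lambda>C. 0) x I = 0"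
  by (induction k arbitrary: x I) auto

lemma face_sum_cong:
  assumes "\<And>I x C. I \<subseteq> {..<d} \<Longrightarrow> card I = k \<Longrightarrow> x \<in> cells d N I \<Longrightarrow>
     set_mset C \<subseteq> (\<lambda>T. l (shift_by T x)) ` Pow I \<Longrightarrow> size C = Suc k \<Longrightarrow> F C = G C"
  shows "face_sum d N l k F s = face_sum d N l k G s"
  unfolding face_sum_def
  by (intro sum.cong refl arg_cong2[where f = "(*)"] cube_sum_cong assms) auto

lemma fan_cochain_uminus:
  assumes "0 \<notin># C"
  shows "fan_cochain s (image_mset uminus C) = fan_cochain (\<not> s) C"
  using assms by (simp add: fan_cochain_def alternating_uminus image_image)

text \<open>
  Suppose that no two adjacent vertices have opposite labels.  Let \<open>p k\<close> count, modulo two, the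
  simplices with alternating labels on the alternating faces of dimension \<open>k\<close>.  Stokes' formula together with the
  antisymmetry of the labelling on the boundary gives \<open>p (k + 1) = p k\<close>.  But \<open>p 0 = 1\<close>, as there is exactly one
  alternating vertex, and \<open>p d = 0\<close>, since a \<open>d\<close>-simplex with alternating labels needs \<open>d + 1\<close> labels of distinct absolute
  values at most \<open>d\<close>.
\<close>

theorem tucker:
  fixes lab :: "(nat \<Rightarrow> int) \<Rightarrow> int" and d :: nat and N :: int
  defines "G \<equiv> {x. \<forall>i. (i < d \<longrightarrow> \<bar>x i\<bar> \<le> N) \<and> (\<not> i < d \<longrightarrow> x i = 0)}"
  assumes N: "N > 0"
    and lab: "\<And>x. x \<in> G \<Longrightarrow> lab x \<noteq> 0 \<and> \<bar>lab x\<bar> \<le> int d"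
    and anti: "\<And>x i. x \<in> G \<Longrightarrow> i < d \<Longrightarrow> \<bar>x i\<bar> = N \<Longrightarrow> lab (\<lambda>j. - x j) = - lab x"
  shows "\<exists>x\<in>G. \<exists>y\<in>G. (\<forall>i. \<bar>x i - y i\<bar> \<le> 1) \<and> lab x = - lab y"
proof (rule ccontr)
  assume contra: "\<not> ?thesis"
  have vert: "shift_by T x \<in> G" if "x \<in> cells d N I" "T \<subseteq> I" "I \<subseteq> {..<d}" for T x I
    unfolding G_def
  proof (intro CollectI allI)
    fix i
    show "(i < d \<longrightarrow> \<bar>shift_by T x i\<bar> \<le> N) \<and> (\<not> i < d \<longrightarrow> shift_by T x i = 0)"
      using that N unfolding cells_def shift_by_def by (cases "i \<in> I"; cases "i \<in> T"; cases "i < d") force+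
  qed
  have near: "\<bar>shift_by T x i - shift_by T' x i\<bar> \<le> 1" for T T' x i
    by (auto simp: shift_by_def)
  have nocompl: "a \<noteq> - b" if *: "x \<in> cells d N I" "I \<subseteq> {..<d}"
    "a \<in> (\<lambda>T. lab (shift_by T x)) ` Pow I" "b \<in> (\<lambda>T. lab (shift_by T x)) ` Pow I" for a b x I
  proof
    assume ab: "a = - b"
    obtain T where T: "T \<subseteq> I" "a = lab (shift_by T x)" using *(3) by auto
    obtain T' where T': "T' \<subseteq> I" "b = lab (shift_by T' x)" using *(4) by auto
    have "shift_by T x \<in> G" "shift_by T' x \<in> G"
      using vert[OF *(1) _ *(2)] T T' by auto
    moreover have "lab (shift_by T x) = - lab (shift_by T' x)" using ab T T' by simp
    ultimately show False using contra near by blast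
  qed
  define p where "p k = face_sum d N lab k (fan_cochain True) True + face_sum d N lab k (fan_cochain False) True" for k
  \<comment> \<open>the antipodal map exchanges the two kinds of alternating faces and, the labels being
    odd on the boundary, the two kinds of alternating simplices; every cell of dimension less than \<open>d\<close> lies on
    the boundary\<close>
  have flip: "face_sum d N lab k (fan_cochain True) False = face_sum d N lab k (fan_cochain False) True"
    if k: "k < d" for k
    unfolding face_sum_def
  proof (rule sum.cong[OF refl])
    fix I assume "I \<in> {I. I \<subseteq> {..<d} \<and> card I = k}"
    then have I: "I \<subseteq> {..<d}" "card I = k" by auto
    obtain i where i: "i < d" "i \<notin> I"
      using I k by (metis card_lessThan lessThan_iff less_irrefl subsetI subset_antisym)
    let ?T = "\<lambda>x j. - shift_by I x j"
    have T: "?T x \<in> cells d N I" if "x \<in> cells d N I" for x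
      using that unfolding cells_def shift_by_def by force
    have TT: "?T (?T x) = x" for x by (simp add: shift_by_def fun_eq_iff)
    show "(\<Sum>x\<in>cells d N I. of_bool (alternating False (corner_signs d I x)) * cube_sum lab k (fan_cochain True) x I) =
      (\<Sum>x\<in>cells d N I. of_bool (alternating True (corner_signs d I x)) * cube_sum lab k (fan_cochain False) x I)"
    proof (rule sum.reindex_bij_witness[where i = ?T and j = ?T])
      fix x assume x: "x \<in> cells d N I"
      have nz: "x j \<noteq> 0" if "j \<in> {..<d} - I" for j
        using x that N unfolding cells_def by force
      have "corner_signs d I (?T x) = uminus ` corner_signs d I x"
        unfolding corner_signs_def image_image by (intro image_cong refl) (auto simp: shift_by_def sgn_minus)
      moreover have "0 \<notin> corner_signs d I x"
        using nz by (auto simp: corner_signs_def sgn_eq_0_iff)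
      ultimately have a: "alternating True (corner_signs d I (?T x)) = alternating False (corner_signs d I x)"
        by (simp add: alternating_uminus)
      have "cube_sum lab k (fan_cochain False) (?T x) I = cube_sum lab k (\<lambda>C. fan_cochain False (image_mset uminus C)) x I"
      proof (rule cube_sum_antipode)
        show "card I = k" "finite I" using I finite_subset by auto
        fix T assume T: "T \<subseteq> I"
        have "x i = N \<or> x i = - N" using x i by (auto simp: cells_def)
        moreover have "i \<notin> T" using T i by auto
        ultimately have "\<bar>shift_by T x i\<bar> = N" using N by (auto simp: shift_by_def)
        then show "lab (\<lambda>j. - shift_by T x j) = - lab (shift_by T x)"
          using anti[OF vert[OF x T I(1)] i(1)] by simp
      qed
      also have "\<dots> = cube_sum lab k (fan_cochain True) x I"
      proof (rule cube_sum_cong)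
        fix C assume C: "set_mset C \<subseteq> (\<lambda>T. lab (shift_by T x)) ` Pow I"
        have "0 \<notin># C"
        proof
          assume "0 \<in># C"
          then obtain T where T: "T \<subseteq> I" "lab (shift_by T x) = 0" using C by auto
          then show False using lab[OF vert[OF x T(1) I(1)]] by simp
        qed
        then show "fan_cochain False (image_mset uminus C) = fan_cochain True C"
          by (simp add: fan_cochain_uminus)
      qed
      finally show "of_bool (alternating True (corner_signs d I (?T x))) * cube_sum lab k (fan_cochain False) (?T x) I =
        of_bool (alternating False (corner_signs d I x)) * cube_sum lab k (fan_cochain True) x I"
        by (simp only: a)
    qed (use T TT in auto)
  qed
  have step: "p (Suc k) = p k" if k: "k < d" for k
  proof -
    have "p (Suc k) = face_sum d N lab (Suc k) (\<lambda>C. fan_cochain True C + fan_cochain False C) True"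
      unfolding p_def face_sum_def by (simp only: cube_sum_add distrib_left sum.distrib)
    also have "\<dots> = face_sum d N lab (Suc k) (coboundary (fan_cochain True)) True"
    proof (rule face_sum_cong)
      fix I x C assume *: "I \<subseteq> {..<d}" "x \<in> cells d N I"
        "set_mset C \<subseteq> (\<lambda>T. lab (shift_by T x)) ` Pow I"
      show "fan_cochain True C + fan_cochain False C = coboundary (fan_cochain True) C"
      proof (rule coboundary_fan_cochain[symmetric])
        fix a b assume "a \<in># C" "b \<in># C"
        then have "a \<in> (\<lambda>T. lab (shift_by T x)) ` Pow I" "b \<in> (\<lambda>T. lab (shift_by T x)) ` Pow I"
          using *(3) by auto
        then show "a \<noteq> - b" by (rule nocompl[OF *(2,1)])
      qed
    qed
    also have "\<dots> = face_sum d N lab k (fan_cochain True) True + face_sum d N lab k (fan_cochain True) False"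
      by (rule face_sum_coboundary[OF k N])
    finally show ?thesis by (simp add: p_def flip[OF k])
  qed
  have "p k = p 0" if "k \<le> d" for k
    using that by (induction k) (auto simp: step)
  then have "p d = p 0" by blast
  moreover have "p d = 0"
  proof -
    have "face_sum d N lab d (fan_cochain s) True = face_sum d N lab d (\<lambda>C. 0) True" for s
    proof (rule face_sum_cong)
      fix I x C assume *: "I \<subseteq> {..<d}" "x \<in> cells d N I"
        "set_mset C \<subseteq> (\<lambda>T. lab (shift_by T x)) ` Pow I" "size C = Suc d"
      have "abs ` set_mset C \<subseteq> {1..int d}"
      proof
        fix z assume "z \<in> abs ` set_mset C"
        then obtain T where "T \<subseteq> I" "z = \<bar>lab (shift_by T x)\<bar>" using *(3) by blast
        then show "z \<in> {1..int d}" using lab[OF vert[OF *(2) _ *(1)], of T] by auto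
      qed
      from card_mono[OF _ this] have "card (abs ` set_mset C) \<le> d" by simp
      then show "fan_cochain s C = 0" using *(4) by (simp add: fan_cochain_def)
    qed
    then show ?thesis by (simp add: p_def face_sum_def cube_sum_zero)
  qed
  moreover have "p 0 = 1"
  proof -
    have I0: "{I. I \<subseteq> {..<d} \<and> card I = 0} = {{}}"
      using finite_subset[of _ "{..<d}"] by auto
    \<comment> \<open>the only vertex of the cube with alternating coordinates that starts with a positive one\<close>
    define x0 where "x0 = (\<lambda>i. if i < d then (if even i then N else -N) else 0)"
    have x0: "x0 \<in> cells d N {}" by (auto simp: x0_def cells_def)
    have alt: "alternating True (corner_signs d {} x) \<longleftrightarrow> x = x0" if x: "x \<in> cells d N {}" for x
    proof -
      let ?f = "\<lambda>i. sgn (x i) * (int i + 1)"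
      have v: "x i = N \<or> x i = -N" if "i < d" for i using x that by (auto simp: cells_def)
      have v0: "x i = 0" if "\<not> i < d" for i using x that by (auto simp: cells_def)
      have nz: "\<bar>?f i\<bar> = int i + 1" if "i < d" for i
        using v[OF that] N by (auto simp: abs_mult)
      have card: "card {b \<in> ?f ` {..<d}. \<bar>b\<bar> < \<bar>?f i\<bar>} = i" if i: "i < d" for i
      proof -
        have "{b \<in> ?f ` {..<d}. \<bar>b\<bar> < \<bar>?f i\<bar>} = ?f ` {..<i}"
        proof (intro set_eqI iffI)
          fix b assume "b \<in> {b \<in> ?f ` {..<d}. \<bar>b\<bar> < \<bar>?f i\<bar>}"
          then obtain j where j: "j < d" "b = ?f j" "\<bar>?f j\<bar> < \<bar>?f i\<bar>" by auto
          then have "j < i" using nz[OF i] nz[OF j(1)] by linarith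
          then show "b \<in> ?f ` {..<i}" using j by auto
        next
          fix b assume "b \<in> ?f ` {..<i}"
          then obtain j where j: "j < i" "b = ?f j" by auto
          then have "\<bar>?f j\<bar> < \<bar>?f i\<bar>" using nz[OF i] nz[of j] i by linarith
          then show "b \<in> {b \<in> ?f ` {..<d}. \<bar>b\<bar> < \<bar>?f i\<bar>}" using j i by auto
        qed
        moreover have "inj_on ?f {..<i}"
          by (rule inj_onI) (smt (verit) i lessThan_iff less_trans nz of_nat_eq_iff)
        ultimately show ?thesis by (simp add: card_image)
      qed
      have "alternating True (corner_signs d {} x) \<longleftrightarrow> (\<forall>i<d. ?f i > 0 \<longleftrightarrow> even i)"
        unfolding alternating_def corner_signs_def using card by auto
      also have "\<dots> \<longleftrightarrow> (\<forall>i<d. x i = (if even i then N else -N))"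
      proof -
        have "(?f i > 0 \<longleftrightarrow> even i) \<longleftrightarrow> x i = (if even i then N else -N)" if "i < d" for i
          using v[OF that] N by (auto simp: zero_less_mult_iff)
        then show ?thesis by blast
      qed
      also have "\<dots> \<longleftrightarrow> x = x0" using v0 by (auto simp: x0_def fun_eq_iff)
      finally show ?thesis .
    qed
    have one: "fan_cochain True {#lab x#} + fan_cochain False {#lab x#} = 1" if "x \<in> cells d N {}" for x
    proof -
      have "lab x \<noteq> 0" using lab vert[OF that, of "{}"] by (auto simp: shift_by_def)
      then show ?thesis by (auto simp: fan_cochain_def alternating_def)
    qed
    have "p 0 = (\<Sum>x\<in>cells d N {}. of_bool (alternating True (corner_signs d {} x)) *
       (fan_cochain True {#lab x#} + fan_cochain False {#lab x#}))"
      by (simp add: p_def face_sum_def I0 distrib_left sum.distrib)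
    also have "\<dots> = (\<Sum>x\<in>cells d N {}. if x = x0 then 1 else 0)"
      by (intro sum.cong refl) (simp add: alt one)
    also have "\<dots> = 1" using x0 by (simp add: sum.delta finite_cells)
    finally show ?thesis .
  qed
  ultimately show False by simp
qed

lemma tendsto_fun_iff:
  fixes x :: "nat \<Rightarrow> nat \<Rightarrow> real"
  shows "(x \<longlongrightarrow> l) F \<longleftrightarrow> (\<forall>i. ((\<lambda>n. x n i) \<longlongrightarrow> l i) F)"
  using limitin_componentwise[of "\<lambda>_. euclideanreal" "UNIV :: nat set" x l F]
  by (simp add: euclidean_product_topology)

text \<open>
  If there is no zero, then by compactness at each point some component of \<open>f\<close> has absolute value at least \<open>e > 0\<close>.
  Label each point of a fine grid by the first such component and its sign.  Adjacent grid points
  with opposite labels, as provided by Tucker's lemma, have values of \<open>f\<close> at distance at least \<open>2 e\<close>,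
  which contradicts continuity at a limit point.
\<close>

theorem borsuk_ulam_cube:
  fixes f :: "(nat \<Rightarrow> real) \<Rightarrow> nat \<Rightarrow> real" and d :: nat
  defines "K \<equiv> {x. \<forall>i. (i < d \<longrightarrow> \<bar>x i\<bar> \<le> 1) \<and> (\<not> i < d \<longrightarrow> x i = 0)}"
  assumes cont: "\<And>i. i < d \<Longrightarrow> continuous_on K (\<lambda>x. f x i)"
    and odd: "\<And>x i j. x \<in> K \<Longrightarrow> i < d \<Longrightarrow> \<bar>x i\<bar> = 1 \<Longrightarrow> j < d \<Longrightarrow> f (\<lambda>n. - x n) j = - f x j"
  shows "\<exists>x\<in>K. \<forall>i<d. f x i = 0"
proof (rule ccontr)
  assume contra: "\<not> ?thesis"
  have Keq: "K = PiE UNIV (\<lambda>i. if i < d then {-1..1} else {0})"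
    by (auto simp: K_def PiE_def Pi_def abs_le_iff split: if_splits)
  have "compactin (product_topology (\<lambda>i. euclideanreal) UNIV) K"
    unfolding Keq by (simp add: compactin_PiE)
  then have K: "compact K" by (simp add: euclidean_product_topology)
  have Kne: "K \<noteq> {}" by (auto simp: K_def intro!: exI[of _ "\<lambda>_. 0"])
  let ?h = "\<lambda>x. \<Sum>i<d. \<bar>f x i\<bar>"
  have "continuous_on K ?h" by (intro continuous_intros cont) auto
  then obtain x0 where x0: "x0 \<in> K" "\<And>x. x \<in> K \<Longrightarrow> ?h x0 \<le> ?h x"
    using continuous_attains_inf[OF K Kne] by blast
  define e where "e = ?h x0 / d"
  obtain i0 where "i0 < d" "f x0 i0 \<noteq> 0" using contra x0 by blast
  then have d: "d > 0" and "?h x0 > 0"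
    by (auto intro!: sum_pos2[of _ i0])
  then have e: "e > 0" by (simp add: e_def)
  have big: "\<exists>i<d. \<bar>f x i\<bar> \<ge> e" if "x \<in> K" for x
  proof (rule ccontr)
    assume "\<not> ?thesis"
    then have "?h x < (\<Sum>i<d. e)" using d by (intro sum_strict_mono) (auto simp: not_le)
    then show False using x0(2)[OF that] d by (simp add: e_def)
  qed
  define L where "L x = (LEAST i. i < d \<and> \<bar>f x i\<bar> \<ge> e)" for x
  have L: "L x < d" "\<bar>f x (L x)\<bar> \<ge> e" if "x \<in> K" for x
    using LeastI_ex[OF big[OF that]] by (auto simp: L_def)
  have ex: "\<exists>x\<in>K. \<exists>y\<in>K. (\<forall>i. \<bar>x i - y i\<bar> \<le> 1 / real (Suc n)) \<and> 2 * e \<le> (\<Sum>i<d. \<bar>f x i - f y i\<bar>)" for n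
  proof -
    define N where "N = int (Suc n)"
    define r where "r x = (\<lambda>i. real_of_int (x i) / N)" for x :: "nat \<Rightarrow> int"
    have N: "N > 0" by (simp add: N_def)
    define G where "G \<equiv> {x. \<forall>i. (i < d \<longrightarrow> \<bar>x i\<bar> \<le> N) \<and> (\<not> i < d \<longrightarrow> x i = 0)}"
    have rK: "r x \<in> K" if "x \<in> G" for x
    proof -
      have "\<bar>r x i\<bar> \<le> 1" if "i < d" for i
      proof -
        have "\<bar>x i\<bar> \<le> N" using \<open>x \<in> G\<close> that by (simp add: G_def)
        then have "\<bar>real_of_int (x i)\<bar> \<le> real_of_int N" by linarith
        then show ?thesis using N by (simp add: r_def abs_divide)
      qed
      moreover have "r x i = 0" if "\<not> i < d" for i using \<open>x \<in> G\<close> that by (simp add: G_def r_def)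
      ultimately show ?thesis by (simp add: K_def)
    qed
    define lab where "lab x = (if f (r x) (L (r x)) > 0 then 1 else -1) * (int (L (r x)) + 1)" for x
    have "\<exists>x\<in>G. \<exists>y\<in>G. (\<forall>i. \<bar>x i - y i\<bar> \<le> 1) \<and> lab x = - lab y"
      unfolding G_def
    proof (rule tucker[OF N], goal_cases)
      case (1 x)
      then show ?case using L(1)[OF rK[of x]] by (auto simp: G_def lab_def)
    next
      case (2 x i)
      then have x: "x \<in> G" by (simp add: G_def)
      have "\<bar>r x i\<bar> = 1" using 2(3) N by (simp add: r_def abs_divide flip: of_int_abs)
      then have o: "f (\<lambda>n. - r x n) j = - f (r x) j" if "j < d" for j
        using odd[OF rK[OF x] 2(2) _ that] by blast
      have m: "r (\<lambda>j. - x j) = (\<lambda>n. - r x n)" by (simp add: r_def fun_eq_iff)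
      have "L (\<lambda>n. - r x n) = L (r x)"
        unfolding L_def by (rule arg_cong[where f = Least]) (auto simp: o fun_eq_iff)
      then show ?case
        using o[OF L(1)[OF rK[OF x]]] L(2)[OF rK[OF x]] e by (auto simp: lab_def m)
    qed
    then obtain x y where xy: "x \<in> G" "y \<in> G" "\<And>i. \<bar>x i - y i\<bar> \<le> 1" "lab x = - lab y" by blast
    have LL: "L (r x) = L (r y)" and opp: "f (r x) (L (r x)) > 0 \<longleftrightarrow> \<not> f (r y) (L (r y)) > 0"
      using xy(4) by (auto simp: lab_def split: if_splits)
    have "2 * e \<le> \<bar>f (r x) (L (r x)) - f (r y) (L (r x))\<bar>"
      using L(2)[OF rK[OF xy(1)]] L(2)[OF rK[OF xy(2)]] opp LL by (auto simp: abs_if split: if_splits)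
    also have "\<dots> \<le> (\<Sum>i<d. \<bar>f (r x) i - f (r y) i\<bar>)"
      using L(1)[OF rK[OF xy(1)]] by (intro member_le_sum) auto
    finally have "2 * e \<le> (\<Sum>i<d. \<bar>f (r x) i - f (r y) i\<bar>)" .
    moreover have "\<bar>r x i - r y i\<bar> \<le> 1 / real (Suc n)" for i
    proof -
      have "\<bar>real_of_int (x i) - real_of_int (y i)\<bar> \<le> 1" using xy(3)[of i] by linarith
      then have "\<bar>(real_of_int (x i) - real_of_int (y i)) / N\<bar> \<le> 1 / N"
        using N by (simp add: abs_divide divide_right_mono)
      then show ?thesis by (simp add: r_def diff_divide_distrib N_def)
    qed
    ultimately show ?thesis using rK xy(1,2) by blast
  qed
  define Q where "Q n x y \<longleftrightarrow> (\<forall>i. \<bar>x i - y i\<bar> \<le> 1 / real (Suc n)) \<and> 2 * e \<le> (\<Sum>i<d. \<bar>f x i - f y i\<bar>)" for n x y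
  have "\<forall>n. \<exists>x\<in>K. \<exists>y\<in>K. Q n x y" using ex unfolding Q_def by blast
  then obtain x y where xyQ: "\<And>n. x n \<in> K" "\<And>n. y n \<in> K" "\<And>n. Q n (x n) (y n)" by metis
  have xy: "\<And>n. x n \<in> K" "\<And>n. y n \<in> K"
      "\<And>n i. \<bar>x n i - y n i\<bar> \<le> 1 / real (Suc n)" "\<And>n. 2 * e \<le> (\<Sum>i<d. \<bar>f (x n) i - f (y n) i\<bar>)"
    using xyQ unfolding Q_def by blast+
  obtain l r where l: "l \<in> K" "strict_mono r" "(x \<circ> r) \<longlonglongrightarrow> l"
    using K xy(1) unfolding compact_eq_seq_compact_metric seq_compact_def by metis
  have xl: "(\<lambda>n. x (r n)) \<longlonglongrightarrow> l" using l(3) by (simp add: o_def)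
  have yl: "(\<lambda>n. y (r n)) \<longlonglongrightarrow> l"
  unfolding tendsto_fun_iff
  proof
    fix i
    have "(\<lambda>n. x (r n) i - y (r n) i) \<longlonglongrightarrow> 0"
    proof (rule Lim_null_comparison)
      show "\<forall>\<^sub>F n in sequentially. norm (x (r n) i - y (r n) i) \<le> 1 / real (Suc (r n))"
        using xy(3) by simp
      show "(\<lambda>n. 1 / real (Suc (r n))) \<longlonglongrightarrow> 0"
        using LIMSEQ_subseq_LIMSEQ[OF LIMSEQ_Suc[OF lim_inverse_n'] l(2)] by (simp add: o_def)
    qed
    moreover have "(\<lambda>n. x (r n) i) \<longlonglongrightarrow> l i"
      using xl unfolding tendsto_fun_iff by blast
    ultimately have "(\<lambda>n. x (r n) i - (x (r n) i - y (r n) i)) \<longlonglongrightarrow> l i - 0" by (intro tendsto_diff)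
    then show "(\<lambda>n. y (r n) i) \<longlonglongrightarrow> l i" by simp
  qed
  have fx: "(\<lambda>n. f (x (r n)) i) \<longlonglongrightarrow> f l i" and fy: "(\<lambda>n. f (y (r n)) i) \<longlonglongrightarrow> f l i" if "i < d" for i
    using continuous_on_tendsto_compose[OF cont[OF that] xl l(1)]
      continuous_on_tendsto_compose[OF cont[OF that] yl l(1)] xy(1,2) by auto
  have "(\<lambda>n. \<Sum>i<d. \<bar>f (x (r n)) i - f (y (r n)) i\<bar>) \<longlonglongrightarrow> (\<Sum>i<d. \<bar>f l i - f l i\<bar>)"
    by (intro tendsto_intros fx fy) auto
  then have "2 * e \<le> (\<Sum>i<d. \<bar>f l i - f l i\<bar>)"
    by (rule LIMSEQ_le_const) (use xy(4) in auto)
  then show False using e by simp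
qed

text \<open>
  The cube of dimension \<open>l < k\<close> is mapped into the sphere like a hemisphere: one more coordinate is added that
  vanishes exactly when some \<open>\<bar>x i\<bar> = 1\<close> with \<open>i < l\<close> on the cube, and the result is normalized.  Boundary points that are antipodal go
  to antipodal points.
\<close>

corollary borsuk_ulam_sphere:
  fixes g :: "(nat \<Rightarrow> real) \<Rightarrow> nat \<Rightarrow> real" and p :: real and k :: nat
  defines "S \<equiv> {c. (\<forall>i\<ge>k. c i = 0) \<and> (\<Sum>i<k. \<bar>c i\<bar> powr p) = 1}"
  assumes p: "p > 0" and l: "l < k"
    and cont: "\<And>i. i < l \<Longrightarrow> continuous_on S (\<lambda>c. g c i)"
    and odd: "\<And>c i. c \<in> S \<Longrightarrow> i < l \<Longrightarrow> g (\<lambda>j. - c j) i = - g c i"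
  shows "\<exists>c\<in>S. \<forall>i<l. g c i = 0"
proof -
  define K :: "(nat \<Rightarrow> real) set" where "K \<equiv> {x. \<forall>i. (i < l \<longrightarrow> \<bar>x i\<bar> \<le> 1) \<and> (\<not> i < l \<longrightarrow> x i = 0)}"
  define z :: "(nat \<Rightarrow> real) \<Rightarrow> nat \<Rightarrow> real" where
    "z x = (\<lambda>i. if i < l then x i else if i = l then (\<Prod>j<l. 1 - \<bar>x j\<bar>) else 0)" for x
  define m where "m x = (\<Sum>i<k. \<bar>z x i\<bar> powr p) powr (1/p)" for x
  have co: "continuous_on A (\<lambda>x. x i)" for i and A :: "(nat \<Rightarrow> real) set"
    by (rule continuous_on_subset[OF continuous_on_product_coordinates]) simp
  have zc: "continuous_on A (\<lambda>x. z x i)" for A i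
    by (cases "i < l"; cases "i = l") (auto simp: z_def intro!: continuous_intros co)
  have pos: "(\<Sum>i<k. \<bar>z x i\<bar> powr p) > 0" for x
  proof (cases "\<exists>i<l. x i \<noteq> 0")
    case True
    then obtain i where "i < l" "x i \<noteq> 0" by blast
    then show ?thesis using l by (intro sum_pos2[of _ i]) (auto simp: z_def)
  next
    case False
    then have "z x l = 1" by (auto simp: z_def)
    then show ?thesis using l by (intro sum_pos2[of _ l]) auto
  qed
  then have ne: "(\<Sum>i<k. \<bar>z x i\<bar> powr p) \<noteq> 0" for x by (metis less_irrefl)
  have mpos: "m x > 0" for x using pos[of x] by (simp add: m_def)
  have mc: "continuous_on A m" for A
  proof -
    have "continuous_on A (\<lambda>x. \<Sum>i<k. \<bar>z x i\<bar> powr p)"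
      by (intro continuous_on_sum continuous_on_powr' continuous_on_rabs zc continuous_on_const) (use p in auto)
    then show ?thesis
      unfolding m_def by (rule continuous_on_powr[OF _ continuous_on_const]) (use ne in blast)
  qed
  define c where "c x = (\<lambda>i. z x i / m x)" for x
  have cS: "c x \<in> S" for x
  proof -
    have "(\<Sum>i<k. \<bar>c x i\<bar> powr p) = (\<Sum>i<k. \<bar>z x i\<bar> powr p / m x powr p)"
      using mpos[of x] by (intro sum.cong refl) (simp add: c_def abs_divide powr_divide)
    also have "\<dots> = (\<Sum>i<k. \<bar>z x i\<bar> powr p) / m x powr p" by (simp add: sum_divide_distrib)
    also have "m x powr p = (\<Sum>i<k. \<bar>z x i\<bar> powr p)"
      unfolding m_def powr_powr using p pos[of x] by simp
    finally show ?thesis using pos[of x] l by (auto simp: S_def c_def z_def)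
  qed
  have cc: "continuous_on A c" for A
    unfolding c_def by (rule continuous_on_coordinatewise_then_product) (use mpos in \<open>intro continuous_intros zc mc, auto simp: less_imp_neq[symmetric]\<close>)
  have "\<exists>x\<in>K. \<forall>i<l. g (c x) i = 0"
    unfolding K_def
  proof (rule borsuk_ulam_cube)
    fix i assume i: "i < l"
    show "continuous_on {x. \<forall>i. (i < l \<longrightarrow> \<bar>x i\<bar> \<le> 1) \<and> (\<not> i < l \<longrightarrow> x i = 0)} (\<lambda>x. g (c x) i)"
      using continuous_on_compose2[OF cont[OF i] cc] cS by blast
  next
    fix x :: "nat \<Rightarrow> real" and i j assume i: "i < l" "\<bar>x i\<bar> = 1" and j: "j < l"
    have "(\<Prod>j<l. 1 - \<bar>x j\<bar>) = 0" using i by (auto intro: bexI[of _ i])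
    then have z: "z (\<lambda>n. - x n) = (\<lambda>n. - z x n)" by (auto simp: z_def fun_eq_iff)
    then have "c (\<lambda>n. - x n) = (\<lambda>n. - c x n)" by (auto simp: c_def m_def)
    then show "g (c (\<lambda>n. - x n)) j = - g (c x) j" using odd[OF cS j] by simp
  qed
  then show ?thesis using cS by blast
qed

section \<open>Smooth bump functions and the fundamental lemma\<close>

lemma frechet_derivative_eqI: "(f has_derivative f') (at x) \<Longrightarrow> frechet_derivative f (at x) = f'"
  using frechet_derivative_at by metis

text \<open>
  The functions \<open>P (1 / t) exp (- 1 / t)\<close>, extended by zero: the family is closed under differentiation.
\<close>

definition flat_exp :: "real poly \<Rightarrow> real \<Rightarrow> real" where
  "flat_exp P t = (if t > 0 then poly P (1 / t) * exp (- 1 / t) else 0)"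

lemma poly_div_exp_tendsto_0: "((\<lambda>y::real. poly P y * exp (- y)) \<longlongrightarrow> 0) at_top"
proof -
  have "((\<lambda>y. \<Sum>i\<le>degree P. coeff P i * (y ^ i / exp y)) \<longlongrightarrow> (\<Sum>i\<le>degree P. coeff P i * 0)) at_top"
    by (intro tendsto_intros tendsto_power_div_exp_0)
  moreover have "(\<Sum>i\<le>degree P. coeff P i * (y ^ i / exp y)) = poly P y * exp (- y)" for y :: real
    by (simp add: poly_altdef sum_distrib_right exp_minus divide_inverse mult.assoc)
  ultimately show ?thesis by simp
qed

lemma flat_exp_deriv:
  "(flat_exp P has_real_derivative flat_exp (monom 1 2 * (P - pderiv P)) t) (at t)"
proof -
  consider "t > 0" | "t < 0" | "t = 0" by linarith
  then show ?thesis
  proof cases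
    case 1
    have "((\<lambda>t. poly P (1 / t) * exp (- 1 / t)) has_real_derivative
       (poly (pderiv P) (1 / t) * (- 1 / t\<^sup>2)) * exp (- 1 / t) + poly P (1 / t) * (exp (- 1 / t) * (1 / t\<^sup>2))) (at t)"
      using 1 by (auto intro!: derivative_eq_intros DERIV_chain2[OF poly_DERIV] simp: field_simps power2_eq_square)
    also have "(poly (pderiv P) (1 / t) * (- 1 / t\<^sup>2)) * exp (- 1 / t) + poly P (1 / t) * (exp (- 1 / t) * (1 / t\<^sup>2))
      = flat_exp (monom 1 2 * (P - pderiv P)) t"
      using 1 by (simp add: flat_exp_def poly_monom algebra_simps power_one_over)
    finally show ?thesis
    proof (rule has_field_derivative_transform_within_open[where S = "{0<..}"])
      show "\<And>x. x \<in> {0<..} \<Longrightarrow> poly P (1 / x) * exp (- 1 / x) = flat_exp P x" by (simp add: flat_exp_def)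
    qed (use 1 in auto)
  next
    case 2
    have "((\<lambda>t. 0) has_real_derivative 0) (at t)" by simp
    then have "(flat_exp P has_real_derivative 0) (at t)"
      by (rule has_field_derivative_transform_within_open[where S = "{..<0}"]) (use 2 in \<open>auto simp: flat_exp_def\<close>)
    then show ?thesis using 2 by (simp add: flat_exp_def)
  next
    case 3
    have "((\<lambda>h. flat_exp P h / h) \<longlongrightarrow> 0) (at 0)"
    proof (rule filterlim_split_at)
      have "((\<lambda>h. (0::real)) \<longlongrightarrow> 0) (at_left 0)" by simp
      moreover have "\<forall>\<^sub>F h in at_left 0. 0 = flat_exp P h / h"
        by (auto simp: eventually_at_filter flat_exp_def)
      ultimately show "((\<lambda>h. flat_exp P h / h) \<longlongrightarrow> 0) (at_left 0)"
        by (rule Lim_transform_eventually)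
      have "filterlim (\<lambda>h::real. 1 / h) at_top (at_right 0)"
        using filterlim_inverse_at_top_right by (simp add: inverse_eq_divide)
      then have "((\<lambda>h::real. poly (pCons 0 P) (1 / h) * exp (- (1 / h))) \<longlongrightarrow> 0) (at_right 0)"
        by (rule filterlim_compose[OF poly_div_exp_tendsto_0])
      moreover have "\<forall>\<^sub>F h in at_right (0::real). poly (pCons 0 P) (1 / h) * exp (- (1 / h)) = flat_exp P h / h"
        by (auto simp: eventually_at_filter flat_exp_def)
      ultimately show "((\<lambda>h. flat_exp P h / h) \<longlongrightarrow> 0) (at_right 0)"
        by (rule Lim_transform_eventually)
    qed
    then show ?thesis using 3 by (simp add: DERIV_def flat_exp_def)
  qed
qed

text \<open>
  An algebra of functions that contains all directional derivatives of its members.  Smoothness being defined coinductively,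
  this closure property makes all of them smooth.
\<close>

inductive bump_algebra :: "('a::euclidean_space \<Rightarrow> real) \<Rightarrow> bool" where
  const: "bump_algebra (\<lambda>x. c)"
| flat: "bump_algebra (\<lambda>x. flat_exp P (c \<bullet> x + d))"
| add: "bump_algebra f \<Longrightarrow> bump_algebra g \<Longrightarrow> bump_algebra (\<lambda>x. f x + g x)"
| mult: "bump_algebra f \<Longrightarrow> bump_algebra g \<Longrightarrow> bump_algebra (\<lambda>x. f x * g x)"

lemma bump_algebra_derivative:
  "bump_algebra f \<Longrightarrow> \<exists>D. (\<forall>x. (f has_derivative D x) (at x)) \<and> (\<forall>v. bump_algebra (\<lambda>x. D x v))"
proof (induction rule: bump_algebra.induct)
  case (const c)
  then show ?case by (intro exI[of _ "\<lambda>x v. 0"]) (auto intro: bump_algebra.const)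
next
  case (flat P c d)
  let ?P = "monom 1 2 * (P - pderiv P)"
  show ?case
  proof (intro exI[of _ "\<lambda>x v. (c \<bullet> v) * flat_exp ?P (c \<bullet> x + d)"] conjI allI)
    show "((\<lambda>x. flat_exp P (c \<bullet> x + d)) has_derivative (\<lambda>v. (c \<bullet> v) * flat_exp ?P (c \<bullet> x + d))) (at x)" for x
      by (rule has_derivative_eq_rhs, rule DERIV_compose_FDERIV[OF flat_exp_deriv], rule derivative_eq_intros, (rule derivative_eq_intros refl)+) auto
    show "bump_algebra (\<lambda>x. (c \<bullet> v) * flat_exp ?P (c \<bullet> x + d))" for v
      by (intro bump_algebra.intros)
  qed
next
  case (add f g)
  then obtain D E where "\<forall>x. (f has_derivative D x) (at x)" "\<forall>v. bump_algebra (\<lambda>x. D x v)"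
    "\<forall>x. (g has_derivative E x) (at x)" "\<forall>v. bump_algebra (\<lambda>x. E x v)" by blast
  then show ?case
    by (intro exI[of _ "\<lambda>x v. D x v + E x v"]) (auto intro: has_derivative_add bump_algebra.add)
next
  case (mult f g)
  then obtain D E where "\<forall>x. (f has_derivative D x) (at x)" "\<forall>v. bump_algebra (\<lambda>x. D x v)"
    "\<forall>x. (g has_derivative E x) (at x)" "\<forall>v. bump_algebra (\<lambda>x. E x v)" by blast
  then show ?case using mult(1,2)
    by (intro exI[of _ "\<lambda>x v. f x * E x v + D x v * g x"])
      (auto intro!: has_derivative_mult bump_algebra.add bump_algebra.mult)
qed

lemma smooth_bump_algebra:
  assumes "bump_algebra f"
  shows "smooth f"
  using assms
proof (coinduction arbitrary: f rule: smooth.coinduct)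
  case (smooth f)
  then obtain D where D: "\<And>x. (f has_derivative D x) (at x)" "\<And>v. bump_algebra (\<lambda>x. D x v)"
    using bump_algebra_derivative by blast
  then show ?case by (auto simp: frechet_derivative_eqI[OF D(1)] intro: differentiableI)
qed

lemma smooth_differentiable: "smooth f \<Longrightarrow> f differentiable (at x)"
  and smooth_frechet_derivative: "smooth f \<Longrightarrow> smooth (\<lambda>x. frechet_derivative f (at x) v)"
  by (auto elim: smooth.cases)

lemma smooth_continuous: "smooth f \<Longrightarrow> continuous_on A f"
  by (meson continuous_at_imp_continuous_on differentiable_imp_continuous_within smooth_differentiable)

lemma smooth_has_derivative: "smooth f \<Longrightarrow> (f has_derivative frechet_derivative f (at x)) (at x)"
  using smooth_differentiable frechet_derivative_works by blast

lemma frechet_derivative_translate: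
  assumes "smooth f"
  shows "frechet_derivative (\<lambda>x. f (x + c)) (at x) = frechet_derivative f (at (x + c))"
proof (rule frechet_derivative_eqI)
  have "((\<lambda>x. x + c) has_derivative (\<lambda>h. h)) (at x)" by (auto intro!: derivative_eq_intros)
  from diff_chain_at[OF this smooth_has_derivative[OF assms]]
  show "((\<lambda>x. f (x + c)) has_derivative frechet_derivative f (at (x + c))) (at x)"
    by (simp add: o_def)
qed

lemma smooth_translate:
  assumes "smooth f"
  shows "smooth (\<lambda>x. f (x + c))"
  using assms
proof (coinduction arbitrary: f rule: smooth.coinduct)
  case (smooth f)
  have "(\<lambda>x. f (x + c)) differentiable (at x)" for x
  proof -
    have "((\<lambda>x. x + c) has_derivative (\<lambda>h. h)) (at x)" by (auto intro!: derivative_eq_intros)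
    from diff_chain_at[OF this smooth_has_derivative[OF smooth(1)]]
    show ?thesis by (auto simp: o_def intro: differentiableI)
  qed
  then show ?case
    using smooth by (auto simp: frechet_derivative_translate intro: smooth_frechet_derivative)
qed

lemma frechet_derivative_linear_sum:
  fixes f :: "real^'n \<Rightarrow> real"
  assumes "smooth f"
  shows "frechet_derivative f (at x) v = (\<Sum>i\<in>UNIV. v $ i * frechet_derivative f (at x) (axis i 1))"
proof -
  have lin: "linear (frechet_derivative f (at x))"
    using smooth_has_derivative[OF assms] has_derivative_linear by blast
  have "v = (\<Sum>i\<in>UNIV. v $ i *\<^sub>R axis i 1)"
    by (metis (no_types, lifting) basis_expansion scalar_mult_eq_scaleR sum.cong)
  then have "frechet_derivative f (at x) v = frechet_derivative f (at x) (\<Sum>i\<in>UNIV. v $ i *\<^sub>R axis i 1)" by simp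
  also have "\<dots> = (\<Sum>i\<in>UNIV. v $ i * frechet_derivative f (at x) (axis i 1))"
    by (simp add: linear_sum[OF lin] linear_scale[OF lin])
  finally show ?thesis .
qed

text \<open>
  The arguments are \<open>m (x\<^sub>i - a\<^sub>i) - 1\<close> and \<open>m (b\<^sub>i - x\<^sub>i) - 1\<close>, written as affine functions.  The summand
  \<open>- 1\<close> keeps the support at distance \<open>1 / m\<close> from the complement of the box, and as \<open>m\<close> grows both factors tend
  to one at interior points.
\<close>

definition box_bump :: "real^'n \<Rightarrow> real^'n \<Rightarrow> nat \<Rightarrow> real^'n \<Rightarrow> real" where
  "box_bump a b m x = (\<Prod>i\<in>UNIV. flat_exp 1 ((real m *\<^sub>R axis i 1) \<bullet> x + (- real m * a $ i - 1)) *
      flat_exp 1 ((- real m *\<^sub>R axis i 1) \<bullet> x + (real m * b $ i - 1)))"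

lemma bump_algebra_prod: "finite I \<Longrightarrow> (\<And>i. i \<in> I \<Longrightarrow> bump_algebra (f i)) \<Longrightarrow> bump_algebra (\<lambda>x. \<Prod>i\<in>I. f i x)"
  by (induction I rule: finite_induct) (auto intro: bump_algebra.intros)

lemma smooth_box_bump: "smooth (box_bump a b m)"
proof -
  have "bump_algebra (box_bump a b m)"
    unfolding box_bump_def by (intro bump_algebra_prod bump_algebra.mult bump_algebra.flat) auto
  then show ?thesis by (rule smooth_bump_algebra)
qed

lemma flat_exp_1: "flat_exp 1 t = (if t > 0 then exp (- 1 / t) else 0)"
  by (simp add: flat_exp_def)

lemma flat_exp_1_bounds: "0 \<le> flat_exp 1 t" "flat_exp 1 t \<le> 1"
  by (auto simp: flat_exp_1)

lemma box_bump_bounds: "0 \<le> box_bump a b m x" "box_bump a b m x \<le> 1"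
  unfolding box_bump_def by (intro prod_nonneg prod_le_1 ballI conjI mult_nonneg_nonneg mult_le_one flat_exp_1_bounds)+

lemma box_bump_nonzero:
  assumes "box_bump a b m x \<noteq> 0"
  shows "m > 0" "a $ i + 1 / real m \<le> x $ i" "x $ i \<le> b $ i - 1 / real m"
proof -
  have *: "real m * x $ i + (- real m * a $ i - 1) > 0" "- real m * x $ i + (real m * b $ i - 1) > 0"
    using assms unfolding box_bump_def prod_zero_iff[OF finite] 
    by (auto simp: flat_exp_1 inner_axis' split: if_splits dest!: spec[of _ i])
  then show m: "m > 0" by (cases m) auto
  show "a $ i + 1 / real m \<le> x $ i" "x $ i \<le> b $ i - 1 / real m"
    using * m by (auto simp: field_simps)
qed

lemma test_function_box_bump:
  assumes "box a b \<subseteq> U"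
  shows "test_function U (box_bump a b m)"
proof -
  let ?a = "\<chi> i. a $ i + 1 / real m" and ?b = "\<chi> i. b $ i - 1 / real m"
  have sub: "{x. box_bump a b m x \<noteq> 0} \<subseteq> cbox ?a ?b"
    using box_bump_nonzero(2,3)[of a b m] by (auto simp: mem_box_cart)
  then have cl: "closure {x. box_bump a b m x \<noteq> 0} \<subseteq> cbox ?a ?b"
    by (rule closure_minimal) (rule closed_cbox)
  have "closure {x. box_bump a b m x \<noteq> 0} \<subseteq> U"
  proof (cases "m = 0")
    case True
    then have "{x. box_bump a b m x \<noteq> 0} = {}" using box_bump_nonzero(1) by blast
    then show ?thesis by simp
  next
    case False
    then have m: "1 / real m > 0" by simp
    have "cbox ?a ?b \<subseteq> box a b"
    proof
      fix x assume x: "x \<in> cbox ?a ?b"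
      have "a $ i < x $ i \<and> x $ i < b $ i" for i
      proof -
        have "a $ i + 1 / real m \<le> x $ i \<and> x $ i \<le> b $ i - 1 / real m"
          using x[unfolded mem_box_cart, THEN spec, of i] by simp
        then show ?thesis using m by linarith
      qed
      then show "x \<in> box a b" by (simp add: mem_box_cart)
    qed
    then show ?thesis using cl assms by blast
  qed
  moreover have "compact (closure {x. box_bump a b m x \<noteq> 0})"
    using cl by (meson bounded_cbox bounded_subset compact_eq_bounded_closed closed_closure)
  ultimately show ?thesis by (simp add: test_function_def smooth_box_bump)
qed

lemma flat_exp_1_affine_tendsto:
  assumes "s > 0"
  shows "(\<lambda>m. flat_exp 1 (real m * s - 1)) \<longlonglongrightarrow> 1"
proof -
  have top: "filterlim (\<lambda>m. - 1 + s * real m) at_top sequentially"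
    by (intro filterlim_tendsto_add_at_top[OF tendsto_const] filterlim_tendsto_pos_mult_at_top[OF tendsto_const assms] filterlim_real_sequentially)
  have "(\<lambda>m. exp (- inverse (- 1 + s * real m))) \<longlonglongrightarrow> exp (- 0)"
    by (intro tendsto_intros filterlim_compose[OF tendsto_inverse_0_at_top[OF filterlim_ident] top])
  moreover have "\<forall>\<^sub>F m in sequentially. exp (- inverse (- 1 + s * real m)) = flat_exp 1 (real m * s - 1)"
    using filterlim_at_top_dense[THEN iffD1, OF top, rule_format, of 0]
    by eventually_elim (simp add: flat_exp_1 inverse_eq_divide mult.commute add.commute)
  ultimately show ?thesis by (auto intro: Lim_transform_eventually)
qed

lemma box_bump_tendsto: "(\<lambda>m. box_bump a b m x) \<longlonglongrightarrow> indicator (box a b) x"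
proof (cases "x \<in> box a b")
  case True
  have "(\<lambda>m. \<Prod>i\<in>UNIV. flat_exp 1 (real m * (x $ i - a $ i) - 1) * flat_exp 1 (real m * (b $ i - x $ i) - 1))
     \<longlonglongrightarrow> (\<Prod>i\<in>(UNIV :: 'a set). 1 * 1)"
    using True by (intro tendsto_intros flat_exp_1_affine_tendsto) (auto simp: mem_box_cart)
  moreover have "(\<Prod>i\<in>UNIV. flat_exp 1 (real m * (x $ i - a $ i) - 1) * flat_exp 1 (real m * (b $ i - x $ i) - 1)) = box_bump a b m x" for m
    unfolding box_bump_def by (intro prod.cong refl arg_cong2[where f = "(*)"] arg_cong[where f = "flat_exp 1"]) (auto simp: inner_axis' algebra_simps)
  ultimately show ?thesis using True by simp
next
  case False
  then obtain i where i: "\<not> (a $ i < x $ i \<and> x $ i < b $ i)" by (auto simp: mem_box_cart)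
  have "box_bump a b m x = 0" for m
  proof (rule ccontr)
    assume *: "box_bump a b m x \<noteq> 0"
    from box_bump_nonzero(1)[OF *] have "1 / real m > 0" by simp
    then show False using box_bump_nonzero(2,3)[OF *, of i] i by linarith
  qed
  then show ?thesis using False by simp
qed

text \<open>
  Boxes are stable under intersection and generate the Borel sets.
\<close>

lemma box_integrals_zero_imp_AE_zero:
  fixes g :: "'a::euclidean_space \<Rightarrow> real"
  assumes g: "integrable lborel g"
    and zero: "\<And>a b. box a b \<subseteq> box A B \<Longrightarrow> (\<integral>x. indicator (box a b) x * g x \<partial>lborel) = 0"
  shows "AE x in lborel. x \<in> box A B \<longrightarrow> g x = 0"
proof -
  let ?g = "\<lambda>x. indicator (box A B) x * g x"
  have gi: "integrable lborel ?g"
    using integrable_mult_indicator[OF _ g, of "box A B"] by simp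
  have "set_lebesgue_integral lborel X ?g = 0" if "X \<in> sets borel" for X
  proof -
    have "X \<in> sigma_sets UNIV (range (\<lambda>(a, b). box a b :: 'a set))"
      using that unfolding borel_eq_box by simp
    note Xs = this
    have IS: "Int_stable (range (\<lambda>(a, b). box a b :: 'a set))" by (auto simp: Int_stable_def box_Int_box)
    have SUB: "range (\<lambda>(a, b). box a b :: 'a set) \<subseteq> Pow UNIV" by simp
    show ?thesis
      using IS SUB Xs
    proof (induct rule: sigma_sets_induct_disjoint)
      fix X assume "X \<in> range (\<lambda>(a, b). box a b :: 'a set)"
      then obtain a b where X: "X = box a b" by auto
      obtain c d where cd: "box a b \<inter> box A B = box c d" using box_Int_box by blast
      have "set_lebesgue_integral lborel X ?g = (\<integral>x. indicator (box c d) x * g x \<partial>lborel)"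
        unfolding set_lebesgue_integral_def X cd[symmetric] by (intro Bochner_Integration.integral_cong) (auto split: split_indicator)
      also have "\<dots> = 0" using zero[of c d] cd by blast
      finally show "set_lebesgue_integral lborel X ?g = 0" .
    next
      show "set_lebesgue_integral lborel {} ?g = 0" by (simp add: set_lebesgue_integral_def)
    next
      fix X assume X: "X \<in> sigma_sets UNIV (range (\<lambda>(a, b). box a b :: 'a set))"
        and IH: "set_lebesgue_integral lborel X ?g = 0"
      then have Xb: "X \<in> sets lborel" unfolding sets_lborel borel_eq_box by simp
      have "set_lebesgue_integral lborel (UNIV - X) ?g = integral\<^sup>L lborel ?g - set_lebesgue_integral lborel X ?g"
      proof -
        have "set_lebesgue_integral lborel (UNIV - X) ?g = (\<integral>x. ?g x - indicator X x *\<^sub>R ?g x \<partial>lborel)"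
          unfolding set_lebesgue_integral_def by (intro Bochner_Integration.integral_cong) (auto split: split_indicator)
        also have "\<dots> = integral\<^sup>L lborel ?g - set_lebesgue_integral lborel X ?g"
          unfolding set_lebesgue_integral_def using integrable_mult_indicator[OF Xb gi]
          by (intro Bochner_Integration.integral_diff gi)
        finally show ?thesis .
      qed
      also have "integral\<^sup>L lborel ?g = 0" using zero[of A B] by simp
      finally show "set_lebesgue_integral lborel (UNIV - X) ?g = 0" using IH by simp
    next
      fix Y :: "nat \<Rightarrow> 'a set"
      assume disj: "disjoint_family Y" and Y: "range Y \<subseteq> sigma_sets UNIV (range (\<lambda>(a, b). box a b :: 'a set))"
        and IH: "\<And>i. set_lebesgue_integral lborel (Y i) ?g = 0"
      have Yb: "Y i \<in> sets lborel" for i using Y unfolding sets_lborel borel_eq_box by auto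
      then have U: "(\<Union>i. Y i) \<in> sets lborel" by auto
      have "set_lebesgue_integral lborel (\<Union>i. Y i) ?g = (\<Sum>i. set_lebesgue_integral lborel (Y i) ?g)"
      proof (rule lebesgue_integral_countable_add[OF Yb])
        show "Y i \<inter> Y j = {}" if "i \<noteq> j" for i j using disj that by (auto simp: disjoint_family_on_def)
        show "set_integrable lborel (\<Union>i. Y i) ?g"
          unfolding set_integrable_def by (rule integrable_mult_indicator[OF U gi])
      qed
      then show "set_lebesgue_integral lborel (\<Union>i. Y i) ?g = 0" by (simp add: IH)
    qed
  qed
  then have "AE x in lborel. ?g x = 0" 
    by (intro density_unique_real[OF gi, of "\<lambda>_. 0"]) (auto simp: set_lebesgue_integral_def)
  then show ?thesis by eventually_elim (auto split: split_indicator)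
qed

text \<open>
  Indicators of boxes are bounded pointwise limits of test functions, so the integrals of \<open>f\<close> over all boxes inside \<open>U\<close>
  vanish; \<open>U\<close> is a countable union of boxes.
\<close>

theorem fundamental_lemma_calculus_of_variations:
  fixes f :: "real^'n \<Rightarrow> real"
  assumes U: "open U" and f: "integrable lebesgue f"
    and zero: "\<And>\<phi>. test_function U \<phi> \<Longrightarrow> (\<integral>x. f x * \<phi> x \<partial>lebesgue) = 0"
  shows "AE x in lebesgue. x \<in> U \<longrightarrow> f x = 0"
proof -
  obtain g where g: "g \<in> borel_measurable lborel" "AE x in lborel. f x = g x"
    using completion_ex_borel_measurable_real[OF borel_measurable_integrable[OF f]] by blast
  have fg: "AE x in lebesgue. f x = g x" using g(2) by (rule AE_completion)
  have gl: "g \<in> borel_measurable lebesgue" using g(1) by (rule measurable_completion)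
  have "integrable lebesgue g"
    using integrable_cong_AE[THEN iffD1, OF borel_measurable_integrable[OF f] gl fg f] .
  then have gi: "integrable lborel g" by (rule integrable_completion[THEN iffD1, OF g(1)])
  have box0: "(\<integral>x. indicator (box a b) x * g x \<partial>lborel) = 0" if ab: "box a b \<subseteq> U" for a b
  proof -
    have bm: "box_bump a b m \<in> borel_measurable borel" for m
      using smooth_continuous[OF smooth_box_bump] by (rule borel_measurable_continuous_onI)
    have z: "(\<integral>x. box_bump a b m x * g x \<partial>lborel) = 0" for m
    proof -
      have "(\<integral>x. f x * box_bump a b m x \<partial>lebesgue) = 0" by (rule zero[OF test_function_box_bump[OF ab]])
      moreover have "(\<integral>x. f x * box_bump a b m x \<partial>lebesgue) = (\<integral>x. box_bump a b m x * g x \<partial>lebesgue)"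
      proof (rule integral_cong_AE)
        have [measurable]: "box_bump a b m \<in> borel_measurable lebesgue"
          by (rule measurable_completion) (use bm in simp)
        note [measurable] = borel_measurable_integrable[OF f] gl
        show "(\<lambda>x. f x * box_bump a b m x) \<in> borel_measurable lebesgue"
          "(\<lambda>x. box_bump a b m x * g x) \<in> borel_measurable lebesgue" by measurable
        show "AE x in lebesgue. f x * box_bump a b m x = box_bump a b m x * g x"
          using fg by eventually_elim simp
      qed
      moreover have "(\<integral>x. box_bump a b m x * g x \<partial>lebesgue) = (\<integral>x. box_bump a b m x * g x \<partial>lborel)"
        using bm g(1) by (intro integral_completion) auto
      ultimately show ?thesis by simp
    qed
    have "(\<lambda>m. \<integral>x. box_bump a b m x * g x \<partial>lborel) \<longlonglongrightarrow> (\<integral>x. indicator (box a b) x * g x \<partial>lborel)"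
    proof (rule integral_dominated_convergence[where w = "\<lambda>x. \<bar>g x\<bar>"])
      show "AE x in lborel. (\<lambda>m. box_bump a b m x * g x) \<longlonglongrightarrow> indicator (box a b) x * g x"
        by (intro AE_I2 tendsto_mult box_bump_tendsto tendsto_const)
      show "AE x in lborel. norm (box_bump a b m x * g x) \<le> \<bar>g x\<bar>" for m
        by (intro AE_I2) (auto simp: abs_mult box_bump_bounds intro: mult_left_le_one_le)
    qed (use bm g(1) gi in auto)
    then show ?thesis by (simp add: z LIMSEQ_const_iff)
  qed
  obtain \<D> where D: "countable \<D>" "\<And>X. X \<in> \<D> \<Longrightarrow> \<exists>a b. X = box a b" "\<Union>\<D> = U"
    using open_countable_Union_open_box[OF U] by metis
  have "AE x in lborel. x \<in> X \<longrightarrow> g x = 0" if X: "X \<in> \<D>" for X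
  proof -
    obtain A B where "X = box A B" using D(2)[OF X] by blast
    moreover have "X \<subseteq> U" using X D(3) by blast
    ultimately show ?thesis using box_integrals_zero_imp_AE_zero[OF gi, of A B] box0 by auto
  qed
  then have "AE x in lborel. \<forall>X\<in>\<D>. x \<in> X \<longrightarrow> g x = 0" by (subst AE_ball_countable[OF D(1)]) blast
  then have "AE x in lebesgue. \<forall>X\<in>\<D>. x \<in> X \<longrightarrow> g x = 0" by (rule AE_completion)
  with fg show ?thesis
  proof eventually_elim
    case (elim x)
    then show ?case using D(3) by auto
  qed
qed

section \<open>Weak gradients on bounded open sets\<close>

lemma finite_measure_lebesgue_on_open:
  assumes "open \<Omega>" "bounded (\<Omega> :: 'a::euclidean_space set)"
  shows "finite_measure (lebesgue_on \<Omega>)"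
  using assms by (intro finite_measure_lebesgue_on lmeasurable_open)

lemma norm_le_one_plus_powr:
  assumes "p \<ge> 1"
  shows "norm x \<le> 1 + norm x powr p"
proof (cases "norm x \<le> 1")
  case False
  then have "norm x powr 1 \<le> norm x powr p" using assms by (intro powr_mono) auto
  then show ?thesis using False by simp
qed (simp add: add_increasing2)

lemma Lp_integrable:
  fixes f :: "'a \<Rightarrow> 'b::{banach,second_countable_topology}"
  assumes "finite_measure M" "f \<in> Lp M p" "p \<ge> 1"
  shows "integrable M f"
proof (rule Bochner_Integration.integrable_bound)
  interpret finite_measure M by fact
  show "integrable M (\<lambda>x. 1 + norm (f x) powr p)" using assms by (auto simp: Lp_def)
  show "f \<in> borel_measurable M" using assms by (auto simp: Lp_def)
  show "AE x in M. norm (f x) \<le> norm (1 + norm (f x) powr p)"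
    using norm_le_one_plus_powr[OF assms(3)] by (intro AE_I2) (simp add: add_nonneg_nonneg)
qed

lemma norm_diff_powr_le:
  fixes a b :: "'a::real_normed_vector"
  assumes "p \<ge> 0"
  shows "norm (a - b) powr p \<le> 2 powr p * (norm a powr p + norm b powr p)"
proof -
  let ?m = "max (norm a) (norm b)"
  have "norm (a - b) \<le> 2 * ?m" using norm_triangle_ineq4[of a b] by linarith
  then have "norm (a - b) powr p \<le> (2 * ?m) powr p" using assms by (intro powr_mono2) auto
  also have "\<dots> = 2 powr p * ?m powr p" by (simp add: powr_mult)
  also have "?m powr p \<le> norm a powr p + norm b powr p" by (auto simp: max_def)
  finally show ?thesis by simp
qed

lemma Lp_diff:
  fixes f g :: "'a \<Rightarrow> 'b::{real_normed_vector,second_countable_topology}"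
  assumes "f \<in> Lp M p" "g \<in> Lp M p" "p \<ge> 0"
  shows "(\<lambda>x. f x - g x) \<in> Lp M p"
proof -
  have [measurable]: "f \<in> borel_measurable M" "g \<in> borel_measurable M" using assms by (auto simp: Lp_def)
  have "integrable M (\<lambda>x. norm (f x - g x) powr p)"
  proof (rule Bochner_Integration.integrable_bound)
    show "integrable M (\<lambda>x. 2 powr p * (norm (f x) powr p + norm (g x) powr p))"
      using assms by (auto simp: Lp_def)
    show "AE x in M. norm (norm (f x - g x) powr p) \<le> norm (2 powr p * (norm (f x) powr p + norm (g x) powr p))"
      using norm_diff_powr_le[OF assms(3)] by (intro AE_I2) (simp add: abs_mult)
  qed measurable
  then show ?thesis by (simp add: Lp_def)
qed

lemma test_function_zero_outside:
  assumes "test_function \<Omega> \<phi>" "x \<notin> \<Omega>"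
  shows "\<phi> x = 0" "frechet_derivative \<phi> (at x) v = 0"
proof -
  let ?S = "closure {x. \<phi> x \<noteq> 0}"
  have x: "x \<notin> ?S" using assms by (auto simp: test_function_def)
  then show "\<phi> x = 0" using closure_subset[of "{x. \<phi> x \<noteq> 0}"] by blast
  have "((\<lambda>x. 0) has_derivative (\<lambda>v. 0)) (at x)" by simp
  then have "(\<phi> has_derivative (\<lambda>v. 0)) (at x)"
    by (rule has_derivative_transform_within_open[of _ _ _ UNIV "- ?S"])
      (use x closure_subset[of "{x. \<phi> x \<noteq> 0}"] in auto)
  then show "frechet_derivative \<phi> (at x) v = 0" by (simp add: frechet_derivative_eqI)
qed

lemma continuous_bounded_support_bounded:
  fixes f :: "'a::euclidean_space \<Rightarrow> real"
  assumes "continuous_on UNIV f" "compact S" "\<And>x. x \<notin> S \<Longrightarrow> f x = 0"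
  shows "\<exists>M>0. \<forall>x. \<bar>f x\<bar> \<le> M"
proof -
  have "bounded (f ` S)"
    by (intro compact_imp_bounded compact_continuous_image assms(2) continuous_on_subset[OF assms(1)]) simp
  then obtain M where "M > 0" "\<And>x. x \<in> S \<Longrightarrow> \<bar>f x\<bar> \<le> M" by (auto simp: bounded_pos)
  then have "\<bar>f x\<bar> \<le> M" for x using assms(3)[of x] by (cases "x \<in> S") auto
  then show ?thesis using \<open>M > 0\<close> by blast
qed

lemma test_function_bounded:
  assumes "test_function \<Omega> \<phi>"
  shows "\<exists>M>0. \<forall>x. \<bar>\<phi> x\<bar> \<le> M" "\<exists>M>0. \<forall>x. \<bar>frechet_derivative \<phi> (at x) v\<bar> \<le> M"
proof -
  let ?S = "closure {x. \<phi> x \<noteq> 0}"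
  have sm: "smooth \<phi>" and S: "compact ?S" and t: "test_function ?S \<phi>"
    using assms by (auto simp: test_function_def)
  show "\<exists>M>0. \<forall>x. \<bar>\<phi> x\<bar> \<le> M"
    by (rule continuous_bounded_support_bounded[OF smooth_continuous[OF sm] S]) (rule test_function_zero_outside(1)[OF t])
  show "\<exists>M>0. \<forall>x. \<bar>frechet_derivative \<phi> (at x) v\<bar> \<le> M"
    by (rule continuous_bounded_support_bounded[OF smooth_continuous[OF smooth_frechet_derivative[OF sm]] S])
      (rule test_function_zero_outside(2)[OF t])
qed

lemma integrable_mult_bounded:
  fixes f g :: "'a \<Rightarrow> real"
  assumes "integrable M f" "g \<in> borel_measurable M" "\<And>x. \<bar>g x\<bar> \<le> B"
  shows "integrable M (\<lambda>x. f x * g x)"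
proof (rule Bochner_Integration.integrable_bound)
  show "integrable M (\<lambda>x. B * f x)" using assms by simp
  show "(\<lambda>x. f x * g x) \<in> borel_measurable M" using assms by auto
  show "AE x in M. norm (f x * g x) \<le> norm (B * f x)"
  proof (rule AE_I2)
    fix x
    have "\<bar>g x\<bar> \<le> \<bar>B\<bar>" using assms(3)[of x] by linarith
    then have "\<bar>g x\<bar> * \<bar>f x\<bar> \<le> \<bar>B\<bar> * \<bar>f x\<bar>" by (rule mult_right_mono) simp
    then show "norm (f x * g x) \<le> norm (B * f x)" by (simp add: abs_mult mult.commute)
  qed
qed

lemma continuous_lebesgue_on_measurable:
  fixes f :: "'a::euclidean_space \<Rightarrow> 'b::{second_countable_topology,metric_space}"
  assumes "continuous_on UNIV f"
  shows "f \<in> borel_measurable (lebesgue_on \<Omega>)"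
  using borel_measurable_continuous_onI[OF assms]
  by (intro measurable_restrict_space1 measurable_completion) simp

lemma test_function_integrable_mult:
  assumes "integrable (lebesgue_on \<Omega>) f" "test_function \<Omega>' \<phi>"
  shows "integrable (lebesgue_on \<Omega>) (\<lambda>x. f x * \<phi> x)"
    "integrable (lebesgue_on \<Omega>) (\<lambda>x. f x * frechet_derivative \<phi> (at x) v)"
proof -
  have sm: "smooth \<phi>" using assms by (auto simp: test_function_def)
  obtain M where "\<And>x. \<bar>\<phi> x\<bar> \<le> M" using test_function_bounded(1)[OF assms(2)] by blast
  then show "integrable (lebesgue_on \<Omega>) (\<lambda>x. f x * \<phi> x)"
    using assms(1) continuous_lebesgue_on_measurable[OF smooth_continuous[OF sm]]
    by (intro integrable_mult_bounded) auto
  obtain M where "\<And>x. \<bar>frechet_derivative \<phi> (at x) v\<bar> \<le> M" using test_function_bounded(2)[OF assms(2)] by blast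
  then show "integrable (lebesgue_on \<Omega>) (\<lambda>x. f x * frechet_derivative \<phi> (at x) v)"
    using assms(1) continuous_lebesgue_on_measurable[OF smooth_continuous[OF smooth_frechet_derivative[OF sm]]]
    by (intro integrable_mult_bounded) auto
qed

lemma integrable_vec_nth:
  fixes G :: "'a \<Rightarrow> real^'n"
  shows "integrable M G \<Longrightarrow> integrable M (\<lambda>x. G x $ i)"
  by (rule integrable_bounded_linear[OF bounded_linear_vec_nth])

lemma open_sets_lebesgue: "open \<Omega> \<Longrightarrow> \<Omega> \<inter> space lebesgue \<in> sets lebesgue"
  by simp

theorem weak_gradient_unique:
  fixes \<Omega> :: "(real^'n) set"
  assumes \<Omega>: "open \<Omega>" "bounded \<Omega>" and p: "p \<ge> 1"
    and G: "G \<in> Lp (lebesgue_on \<Omega>) p" "is_weak_gradient \<Omega> u G"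
    and H: "H \<in> Lp (lebesgue_on \<Omega>) p" "is_weak_gradient \<Omega> u H"
  shows "AE x in lebesgue_on \<Omega>. G x = H x"
proof -
  have fm: "finite_measure (lebesgue_on \<Omega>)" by (rule finite_measure_lebesgue_on_open[OF \<Omega>])
  have Gi: "integrable (lebesgue_on \<Omega>) (\<lambda>x. G x $ i)" and Hi: "integrable (lebesgue_on \<Omega>) (\<lambda>x. H x $ i)" for i
    using Lp_integrable[OF fm G(1) p] Lp_integrable[OF fm H(1) p] by (auto intro: integrable_vec_nth)
  have "AE x in lebesgue. x \<in> \<Omega> \<longrightarrow> G x $ i = H x $ i" for i
  proof -
    let ?f = "\<lambda>x. indicator \<Omega> x *\<^sub>R (G x $ i - H x $ i)"
    have "AE x in lebesgue. x \<in> \<Omega> \<longrightarrow> ?f x = 0"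
    proof (rule fundamental_lemma_calculus_of_variations[OF \<Omega>(1)])
      have "integrable (lebesgue_on \<Omega>) (\<lambda>x. G x $ i - H x $ i)" using Gi Hi by auto
      then show "integrable lebesgue ?f"
        by (subst (asm) integrable_restrict_space) (use \<Omega> in auto)
      fix \<phi> assume t: "test_function \<Omega> \<phi>"
      have "(\<integral>x. ?f x * \<phi> x \<partial>lebesgue) = (\<integral>x. indicator \<Omega> x *\<^sub>R ((G x $ i - H x $ i) * \<phi> x) \<partial>lebesgue)"
        by (simp add: mult.assoc)
      also have "\<dots> = (\<integral>x. (G x $ i - H x $ i) * \<phi> x \<partial>lebesgue_on \<Omega>)"
        by (rule integral_restrict_space[symmetric]) (use \<Omega> in auto)
      also have "\<dots> = (\<integral>x. G x $ i * \<phi> x - H x $ i * \<phi> x \<partial>lebesgue_on \<Omega>)"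
        by (simp add: left_diff_distrib)
      also have "\<dots> = (\<integral>x. G x $ i * \<phi> x \<partial>lebesgue_on \<Omega>) - (\<integral>x. H x $ i * \<phi> x \<partial>lebesgue_on \<Omega>)"
        by (intro Bochner_Integration.integral_diff test_function_integrable_mult[OF _ t] Gi Hi)
      also have "\<dots> = 0"
        using G(2)[unfolded is_weak_gradient_def, rule_format, OF t, of i]
          H(2)[unfolded is_weak_gradient_def, rule_format, OF t, of i] by simp
      finally show "(\<integral>x. ?f x * \<phi> x \<partial>lebesgue) = 0" .
    qed
    then show ?thesis by eventually_elim auto
  qed
  then have "AE x in lebesgue. \<forall>i\<in>UNIV. x \<in> \<Omega> \<longrightarrow> G x $ i = H x $ i"
    by (intro AE_finite_allI) auto
  then have "AE x in lebesgue. x \<in> \<Omega> \<longrightarrow> G x = H x"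
    by eventually_elim (auto simp: vec_eq_iff)
  then show ?thesis by (subst AE_restrict_space_iff) (use \<Omega> in auto)
qed

text \<open>
  Weak gradients are defined by the coordinate directions; the derivative in direction \<open>v\<close> is a linear combination of these.
\<close>

lemma weak_gradient_directional:
  fixes \<Omega> :: "(real^'n) set"
  assumes u: "integrable (lebesgue_on \<Omega>) u" and G: "integrable (lebesgue_on \<Omega>) G" "is_weak_gradient \<Omega> u G"
    and t: "test_function \<Omega> \<phi>"
  shows "(\<integral>x. u x * frechet_derivative \<phi> (at x) v \<partial>lebesgue_on \<Omega>) = - (\<integral>x. (G x \<bullet> v) * \<phi> x \<partial>lebesgue_on \<Omega>)"
proof -
  have sm: "smooth \<phi>" using t by (simp add: test_function_def)
  have "(\<integral>x. u x * frechet_derivative \<phi> (at x) v \<partial>lebesgue_on \<Omega>) =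
     (\<integral>x. (\<Sum>i\<in>UNIV. v $ i * (u x * frechet_derivative \<phi> (at x) (axis i 1))) \<partial>lebesgue_on \<Omega>)"
    by (subst frechet_derivative_linear_sum[OF sm]) (simp add: sum_distrib_left mult.left_commute)
  also have "\<dots> = (\<Sum>i\<in>UNIV. v $ i * (\<integral>x. u x * frechet_derivative \<phi> (at x) (axis i 1) \<partial>lebesgue_on \<Omega>))"
    by (subst Bochner_Integration.integral_sum) (auto intro!: test_function_integrable_mult[OF u t])
  also have "\<dots> = (\<Sum>i\<in>UNIV. - (v $ i * (\<integral>x. G x $ i * \<phi> x \<partial>lebesgue_on \<Omega>)))"
    using G(2) t by (simp add: is_weak_gradient_def)
  also have "\<dots> = - (\<integral>x. (\<Sum>i\<in>UNIV. v $ i * (G x $ i * \<phi> x)) \<partial>lebesgue_on \<Omega>)"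
    by (subst Bochner_Integration.integral_sum)
      (auto intro!: test_function_integrable_mult[OF _ t] integrable_vec_nth G simp: sum_negf)
  also have "(\<lambda>x. \<Sum>i\<in>UNIV. v $ i * (G x $ i * \<phi> x)) = (\<lambda>x. (G x \<bullet> v) * \<phi> x)"
    by (simp add: inner_vec_def sum_distrib_left mult_ac)
  finally show ?thesis .
qed

lemma is_weak_gradient_diff:
  fixes \<Omega> :: "(real^'n) set"
  assumes "integrable (lebesgue_on \<Omega>) u" "integrable (lebesgue_on \<Omega>) G" "is_weak_gradient \<Omega> u G"
    and "integrable (lebesgue_on \<Omega>) v" "integrable (lebesgue_on \<Omega>) H" "is_weak_gradient \<Omega> v H"
  shows "is_weak_gradient \<Omega> (\<lambda>x. u x - v x) (\<lambda>x. G x - H x)"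
  unfolding is_weak_gradient_def
proof (intro allI impI)
  fix \<phi> i assume t: "test_function \<Omega> \<phi>"
  let ?d = "\<lambda>x. frechet_derivative \<phi> (at x) (axis i 1)"
  have "(\<integral>x. (u x - v x) * ?d x \<partial>lebesgue_on \<Omega>) = (\<integral>x. u x * ?d x \<partial>lebesgue_on \<Omega>) - (\<integral>x. v x * ?d x \<partial>lebesgue_on \<Omega>)"
    unfolding left_diff_distrib by (intro Bochner_Integration.integral_diff test_function_integrable_mult[OF _ t] assms)
  also have "\<dots> = - (\<integral>x. G x $ i * \<phi> x \<partial>lebesgue_on \<Omega>) - - (\<integral>x. H x $ i * \<phi> x \<partial>lebesgue_on \<Omega>)"
    using assms(3,6) t by (simp add: is_weak_gradient_def)
  also have "\<dots> = - ((\<integral>x. G x $ i * \<phi> x \<partial>lebesgue_on \<Omega>) - (\<integral>x. H x $ i * \<phi> x \<partial>lebesgue_on \<Omega>))" by simp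
  also have "\<dots> = - (\<integral>x. (G x - H x) $ i * \<phi> x \<partial>lebesgue_on \<Omega>)"
    unfolding vector_minus_component left_diff_distrib
    by (subst Bochner_Integration.integral_diff)
      (auto intro!: test_function_integrable_mult[OF _ t] integrable_vec_nth assms)
  finally show "(\<integral>x. (u x - v x) * ?d x \<partial>lebesgue_on \<Omega>) = - (\<integral>x. (G x - H x) $ i * \<phi> x \<partial>lebesgue_on \<Omega>)" .
qed

lemma sobolev_weak_gradient:
  assumes "u \<in> sobolev \<Omega> p"
  shows "u \<in> Lp (lebesgue_on \<Omega>) p" "weak_gradient \<Omega> p u \<in> Lp (lebesgue_on \<Omega>) p"
    "is_weak_gradient \<Omega> u (weak_gradient \<Omega> p u)"
proof -
  have "\<exists>G. G \<in> Lp (lebesgue_on \<Omega>) p \<and> is_weak_gradient \<Omega> u G" using assms by (auto simp: sobolev_def)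
  from someI_ex[OF this] show "weak_gradient \<Omega> p u \<in> Lp (lebesgue_on \<Omega>) p"
    "is_weak_gradient \<Omega> u (weak_gradient \<Omega> p u)" by (auto simp: weak_gradient_def)
qed (use assms in \<open>simp add: sobolev_def\<close>)

lemma sobolev_diff:
  fixes \<Omega> :: "(real^'n) set"
  assumes \<Omega>: "open \<Omega>" "bounded \<Omega>" and p: "p \<ge> 1" and u: "u \<in> sobolev \<Omega> p" and v: "v \<in> sobolev \<Omega> p"
  shows "(\<lambda>x. u x - v x) \<in> sobolev \<Omega> p"
proof -
  note fm = finite_measure_lebesgue_on_open[OF \<Omega>]
  note I = Lp_integrable[OF fm _ p]
  note U = sobolev_weak_gradient[OF u] and V = sobolev_weak_gradient[OF v]
  have "is_weak_gradient \<Omega> (\<lambda>x. u x - v x) (\<lambda>x. weak_gradient \<Omega> p u x - weak_gradient \<Omega> p v x)"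
    by (intro is_weak_gradient_diff I U V)
  moreover have "(\<lambda>x. weak_gradient \<Omega> p u x - weak_gradient \<Omega> p v x) \<in> Lp (lebesgue_on \<Omega>) p"
    using p by (intro Lp_diff U V) auto
  moreover have "(\<lambda>x. u x - v x) \<in> Lp (lebesgue_on \<Omega>) p"
    using p by (intro Lp_diff U V) auto
  ultimately show ?thesis unfolding sobolev_def by blast
qed

lemma integral_lborel_translate:
  fixes f :: "'a::euclidean_space \<Rightarrow> real"
  assumes "f \<in> borel_measurable borel"
  shows "(\<integral>x. f (x + c) \<partial>lborel) = (\<integral>x. f x \<partial>lborel)"
proof -
  have "(\<integral>x. f x \<partial>lborel) = (\<integral>x. f x \<partial>distr lborel borel ((+) c))" by (simp add: lborel_distr_plus)
  also have "\<dots> = (\<integral>x. f (c + x) \<partial>lborel)" using assms by (intro integral_distr) auto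
  finally show ?thesis by (simp add: add.commute)
qed

text \<open>
  The difference quotients in direction \<open>e\<close> have integral zero by translation invariance and converge boundedly,
  with supports in a common ball.
\<close>

lemma integral_directional_derivative_eq_0:
  fixes w :: "'a::euclidean_space \<Rightarrow> real"
  assumes w: "\<And>x. (w has_derivative D x) (at x)" and cont: "continuous_on UNIV (\<lambda>x. D x e)"
    and supp: "bounded {x. w x \<noteq> 0}"
  shows "(\<integral>x. D x e \<partial>lborel) = 0"
proof -
  obtain R where R: "R > 0" "\<And>x. w x \<noteq> 0 \<Longrightarrow> norm x \<le> R" using supp by (auto simp: bounded_pos)
  let ?K = "cball (0::'a) (R + norm e)"
  have cl: "closure {x. w x \<noteq> 0} \<subseteq> cball 0 R" by (rule closure_minimal) (use R in auto)
  have D0: "D x e = 0" if "x \<notin> cball 0 R" for x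
  proof -
    have "((\<lambda>x. 0) has_derivative (\<lambda>v. 0)) (at x)" by simp
    then have "(w has_derivative (\<lambda>v. 0)) (at x)"
      by (rule has_derivative_transform_within_open[of _ _ _ UNIV "- cball 0 R"]) (use that R(2) in force)+
    then show ?thesis using has_derivative_unique[OF w] by metis
  qed
  obtain M where M: "M > 0" "\<And>x. \<bar>D x e\<bar> \<le> M"
    using continuous_bounded_support_bounded[OF cont compact_cball D0] by blast
  have wc: "continuous_on UNIV w"
    by (rule has_derivative_continuous_on) (rule has_derivative_at_withinI[OF w])
  then have wm: "w \<in> borel_measurable borel" by (rule borel_measurable_continuous_onI)
  let ?h = "\<lambda>n. 1 / real (Suc n)"
  let ?g = "\<lambda>n x. (w (x + ?h n *\<^sub>R e) - w x) / ?h n"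
  have line: "((\<lambda>s. w (x + s *\<^sub>R e)) has_derivative (\<lambda>s. s * D (x + t *\<^sub>R e) e)) (at t)" for x t
  proof -
    have "((\<lambda>s. x + s *\<^sub>R e) has_derivative (\<lambda>s. s *\<^sub>R e)) (at t)" by (auto intro!: derivative_eq_intros)
    from diff_chain_at[OF this w]
    have "((\<lambda>s. w (x + s *\<^sub>R e)) has_derivative (\<lambda>s. D (x + t *\<^sub>R e) (s *\<^sub>R e))) (at t)" by (simp add: o_def)
    moreover have "linear (D (x + t *\<^sub>R e))" using w has_derivative_linear by blast
    ultimately show ?thesis by (simp add: linear_scale)
  qed
  have lip: "\<bar>w (x + h *\<^sub>R e) - w x\<bar> \<le> M * h" if "h > 0" for x h
  proof -
    have "\<exists>s\<in>{0<..<h}. w (x + h *\<^sub>R e) - w (x + 0 *\<^sub>R e) = (h - 0) * D (x + s *\<^sub>R e) e"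
      by (rule mvt_simple[OF that]) (rule has_derivative_at_withinI[OF line])
    then obtain s where "w (x + h *\<^sub>R e) - w (x + 0 *\<^sub>R e) = (h - 0) * D (x + s *\<^sub>R e) e" by blast
    then show ?thesis using M(2)[of "x + s *\<^sub>R e"] that by (simp add: abs_mult mult.commute)
  qed
  have wi: "integrable lborel w"
  proof -
    have "integrable lborel (\<lambda>x. indicator (cball 0 R) x *\<^sub>R w x)"
      by (rule borel_integrable_compact[OF compact_cball continuous_on_subset[OF wc]]) auto
    moreover have "(\<lambda>x. indicator (cball 0 R) x *\<^sub>R w x) = w" using R(2) by (force split: split_indicator)
    ultimately show ?thesis by simp
  qed
  have "(\<lambda>n. \<integral>x. ?g n x \<partial>lborel) \<longlonglongrightarrow> (\<integral>x. D x e \<partial>lborel)"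
  proof (rule integral_dominated_convergence[where w = "\<lambda>x. M * indicator ?K x"])
    show "(\<lambda>x. D x e) \<in> borel_measurable lborel" using borel_measurable_continuous_onI[OF cont] by simp
    show "?g n \<in> borel_measurable lborel" for n
    proof -
      have "continuous_on UNIV (?g n)"
        by (intro continuous_intros continuous_on_compose2[OF wc] wc) auto
      then show ?thesis using borel_measurable_continuous_onI by fastforce
    qed
    show "integrable lborel (\<lambda>x. M * indicator ?K x)"
      by (rule integrable_mult_right, rule integrable_real_indicator)
        (use emeasure_bounded_finite[OF bounded_cball, of "0::'a" "R + norm e"] in simp_all)
    show "AE x in lborel. (\<lambda>n. ?g n x) \<longlonglongrightarrow> D x e"
    proof (rule AE_I2)
      fix x
      have "((\<lambda>s. w (x + s *\<^sub>R e)) has_real_derivative D x e) (at 0)"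
      proof -
        have "(\<lambda>s. s * D x e) = (*) (D x e)" by (auto simp: fun_eq_iff)
        then show ?thesis using line[of x 0] by (simp add: has_field_derivative_def)
      qed
      then have "((\<lambda>h. (w (x + h *\<^sub>R e) - w x) / h) \<longlongrightarrow> D x e) (at 0)" by (simp add: DERIV_def)
      moreover have "filterlim ?h (at 0) sequentially"
        unfolding filterlim_at using LIMSEQ_Suc[OF lim_inverse_n'] by auto
      ultimately show "(\<lambda>n. ?g n x) \<longlonglongrightarrow> D x e" by (rule filterlim_compose)
    qed
    show "AE x in lborel. norm (?g n x) \<le> M * indicator ?K x" for n
    proof (rule AE_I2)
      fix x
      show "norm (?g n x) \<le> M * indicator ?K x"
      proof (cases "x \<in> ?K")
        case True
        have h: "?h n > 0" by simp
        have "\<bar>w (x + ?h n *\<^sub>R e) - w x\<bar> / ?h n \<le> M"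
          by (rule pos_divide_le_eq[OF h, THEN iffD2, OF lip[OF h]])
        then show ?thesis using True by (simp only: real_norm_def abs_divide abs_of_pos[OF h] indicator_simps mult_1_right)
      next
        case False
        have he: "norm (?h n *\<^sub>R e) \<le> norm e"
          unfolding norm_scaleR by (rule mult_left_le_one_le) auto
        have "norm x > R + norm e" using False by simp
        moreover have "norm x \<le> norm (x + ?h n *\<^sub>R e) + norm (?h n *\<^sub>R e)" by (metis add_diff_cancel_right' norm_triangle_ineq4)
        ultimately have n1: "norm (x + ?h n *\<^sub>R e) > R" using he by linarith
        have n2: "norm x > R" using \<open>norm x > R + norm e\<close> norm_ge_zero[of e] by linarith
        have w0: "w y = 0" if "norm y > R" for y using R(2)[of y] that by (cases "w y = 0") auto
        have "w (x + ?h n *\<^sub>R e) = 0" "w x = 0" by (rule w0[OF n1], rule w0[OF n2])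
        then show ?thesis using M(1) by simp
      qed
    qed
  qed
  moreover have "(\<integral>x. ?g n x \<partial>lborel) = 0" for n
  proof -
    have "integrable lborel (\<lambda>x. w (x + ?h n *\<^sub>R e))"
      using integrable_distr_eq[of "(+) (?h n *\<^sub>R e)" lborel borel w] wi wm
      by (simp add: lborel_distr_plus add.commute)
    then have "(\<integral>x. w (x + ?h n *\<^sub>R e) - w x \<partial>lborel) = 0"
      using wi integral_lborel_translate[OF wm, of "?h n *\<^sub>R e"] by simp
    then show ?thesis by simp
  qed
  ultimately show ?thesis by (simp add: LIMSEQ_const_iff)
qed

definition C1_gradient :: "('a::euclidean_space \<Rightarrow> real) \<Rightarrow> ('a \<Rightarrow> 'a) \<Rightarrow> bool" where
  "C1_gradient u g \<longleftrightarrow> (\<forall>x. (u has_derivative (\<lambda>h. g x \<bullet> h)) (at x)) \<and> continuous_on UNIV g"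

lemma C1_gradient_continuous:
  assumes "C1_gradient u g"
  shows "continuous_on A u"
proof (rule has_derivative_continuous_on)
  show "(u has_derivative (\<lambda>h. g x \<bullet> h)) (at x within A)" for x
    by (rule has_derivative_at_withinI) (use assms in \<open>unfold C1_gradient_def, blast\<close>)
qed

lemma integral_lebesgue_on_supported:
  fixes h :: "'a::euclidean_space \<Rightarrow> real"
  assumes "open \<Omega>" "continuous_on UNIV h" "\<And>x. x \<notin> \<Omega> \<Longrightarrow> h x = 0"
  shows "(\<integral>x. h x \<partial>lebesgue_on \<Omega>) = (\<integral>x. h x \<partial>lborel)"
proof -
  have "(\<integral>x. h x \<partial>lebesgue_on \<Omega>) = (\<integral>x. indicator \<Omega> x *\<^sub>R h x \<partial>lebesgue)"
    by (rule integral_restrict_space[OF open_sets_lebesgue[OF assms(1)]])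
  also have "(\<lambda>x. indicator \<Omega> x *\<^sub>R h x) = h" using assms(3) by (auto simp: fun_eq_iff indicator_def)
  also have "(\<integral>x. h x \<partial>lebesgue) = (\<integral>x. h x \<partial>lborel)"
    by (rule integral_completion) (use borel_measurable_continuous_onI[OF assms(2)] in simp)
  finally show ?thesis .
qed

text \<open>
  The product \<open>u \<phi>\<close> is \<open>C\<^sup>1\<close> with compact support in \<open>\<Omega>\<close>, so the integral of each of its partial derivatives vanishes.
\<close>

theorem C1_gradient_is_weak_gradient:
  fixes \<Omega> :: "(real^'n) set"
  assumes \<Omega>: "open \<Omega>" "bounded \<Omega>" and u: "C1_gradient u g"
  shows "is_weak_gradient \<Omega> u g"
  unfolding is_weak_gradient_def
proof (intro allI impI)
  fix \<phi> i assume t: "test_function \<Omega> \<phi>"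
  let ?e = "axis i 1 :: real^'n" and ?d = "\<lambda>x. frechet_derivative \<phi> (at x)"
  have sm: "smooth \<phi>" using t by (simp add: test_function_def)
  have uc: "continuous_on UNIV u" and gc: "continuous_on UNIV g"
    using C1_gradient_continuous[OF u] u by (auto simp: C1_gradient_def)
  have dc: "continuous_on UNIV (\<lambda>x. ?d x ?e)" and pc: "continuous_on UNIV \<phi>"
    by (rule smooth_continuous[OF smooth_frechet_derivative[OF sm]], rule smooth_continuous[OF sm])
  have c1: "continuous_on UNIV (\<lambda>x. u x * ?d x ?e)" by (intro continuous_intros uc dc)
  have c2: "continuous_on UNIV (\<lambda>x. g x $ i * \<phi> x)" by (intro continuous_intros gc pc)
  have supp: "bounded {x. \<phi> x \<noteq> 0}"
    using t bounded_subset[OF compact_imp_bounded closure_subset] unfolding test_function_def by blast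
  have ci: "integrable lborel h" if h: "continuous_on UNIV h" "\<And>x. x \<notin> \<Omega> \<Longrightarrow> h x = 0" for h :: "real^'n \<Rightarrow> real"
  proof -
    have "integrable lborel (\<lambda>x. indicator (closure \<Omega>) x *\<^sub>R h x)"
      by (rule borel_integrable_compact[OF _ continuous_on_subset[OF h(1)]]) (use \<Omega> in auto)
    moreover have "(\<lambda>x. indicator (closure \<Omega>) x *\<^sub>R h x) = h"
      using h(2) closure_subset[of \<Omega>] by (auto simp: fun_eq_iff indicator_def)
    ultimately show ?thesis by simp
  qed
  have "(\<integral>x. u x * ?d x ?e + (g x \<bullet> ?e) * \<phi> x \<partial>lborel) = 0"
  proof (rule integral_directional_derivative_eq_0[where w = "\<lambda>x. u x * \<phi> x" and D = "\<lambda>x h. u x * ?d x h + (g x \<bullet> h) * \<phi> x"])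
    show "((\<lambda>x. u x * \<phi> x) has_derivative (\<lambda>h. u x * ?d x h + (g x \<bullet> h) * \<phi> x)) (at x)" for x
      using u smooth_has_derivative[OF sm] by (auto simp: C1_gradient_def intro: has_derivative_mult)
    show "continuous_on UNIV (\<lambda>x. u x * ?d x ?e + (g x \<bullet> ?e) * \<phi> x)"
      by (intro continuous_intros uc gc dc pc)
    show "bounded {x. u x * \<phi> x \<noteq> 0}" by (rule bounded_subset[OF supp]) auto
  qed
  moreover have "(\<integral>x. u x * ?d x ?e + (g x \<bullet> ?e) * \<phi> x \<partial>lborel) =
     (\<integral>x. u x * ?d x ?e \<partial>lborel) + (\<integral>x. g x $ i * \<phi> x \<partial>lborel)"
  proof -
    have "integrable lborel (\<lambda>x. u x * ?d x ?e)"
      by (rule ci[OF c1]) (simp add: test_function_zero_outside(2)[OF t])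
    moreover have "integrable lborel (\<lambda>x. g x $ i * \<phi> x)"
      by (rule ci[OF c2]) (simp add: test_function_zero_outside(1)[OF t])
    ultimately show ?thesis unfolding inner_axis by simp
  qed
  ultimately show "(\<integral>x. u x * ?d x ?e \<partial>lebesgue_on \<Omega>) = - (\<integral>x. g x $ i * \<phi> x \<partial>lebesgue_on \<Omega>)"
    by (subst (1 2) integral_lebesgue_on_supported[OF \<Omega>(1)])
      (auto simp: c1 c2 test_function_zero_outside[OF t])
qed

lemma continuous_Lp_lebesgue_on:
  fixes f :: "'a::euclidean_space \<Rightarrow> 'b::euclidean_space"
  assumes \<Omega>: "open \<Omega>" "bounded \<Omega>" and p: "p \<ge> 0" and f: "continuous_on UNIV f"
  shows "f \<in> Lp (lebesgue_on \<Omega>) p"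
proof -
  have m: "f \<in> borel_measurable (lebesgue_on \<Omega>)" by (rule continuous_lebesgue_on_measurable[OF f])
  have "bounded (f ` closure \<Omega>)"
    using \<Omega> f by (meson compact_closure compact_continuous_image compact_imp_bounded continuous_on_subset subset_UNIV)
  then obtain B where B: "\<And>x. x \<in> closure \<Omega> \<Longrightarrow> norm (f x) \<le> B" by (auto simp: bounded_iff)
  interpret finite_measure "lebesgue_on \<Omega>" by (rule finite_measure_lebesgue_on_open[OF \<Omega>])
  have "integrable (lebesgue_on \<Omega>) (\<lambda>x. norm (f x) powr p)"
  proof (rule integrable_const_bound[where B = "B powr p"])
    show "(\<lambda>x. norm (f x) powr p) \<in> borel_measurable (lebesgue_on \<Omega>)" using m by measurable
    show "AE x in lebesgue_on \<Omega>. norm (norm (f x) powr p) \<le> B powr p"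
    proof (rule AE_I2)
      fix x assume "x \<in> space (lebesgue_on \<Omega>)"
      then have "norm (f x) \<le> B" using B closure_subset by (auto simp: space_restrict_space)
      then show "norm (norm (f x) powr p) \<le> B powr p" using p by (simp add: powr_mono2)
    qed
  qed
  then show ?thesis using m by (simp add: Lp_def)
qed

lemma C1_gradient_sobolev:
  fixes \<Omega> :: "(real^'n) set"
  assumes \<Omega>: "open \<Omega>" "bounded \<Omega>" and p: "p \<ge> 1" and u: "C1_gradient u g"
  shows "u \<in> sobolev \<Omega> p" "AE x in lebesgue_on \<Omega>. weak_gradient \<Omega> p u x = g x"
proof -
  have g: "g \<in> Lp (lebesgue_on \<Omega>) p" "is_weak_gradient \<Omega> u g"
    using continuous_Lp_lebesgue_on[OF \<Omega>, of p] C1_gradient_is_weak_gradient[OF \<Omega> u] u p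
    by (auto simp: C1_gradient_def)
  then show us: "u \<in> sobolev \<Omega> p"
    using continuous_Lp_lebesgue_on[OF \<Omega> _ C1_gradient_continuous[OF u], of p] p by (auto simp: sobolev_def)
  show "AE x in lebesgue_on \<Omega>. weak_gradient \<Omega> p u x = g x"
    by (rule weak_gradient_unique[OF \<Omega> p sobolev_weak_gradient(2,3)[OF us] g])
qed

section \<open>The fundamental theorem of calculus for weak gradients\<close>

lemma integrable_lborel_translate:
  fixes f :: "'a::euclidean_space \<Rightarrow> real"
  assumes "integrable lborel f"
  shows "integrable lborel (\<lambda>x. f (x + c))"
proof -
  have "f \<in> borel_measurable borel" using assms by auto
  then show ?thesis
    using integrable_distr_eq[of "(+) c" lborel borel f] assms by (simp add: lborel_distr_plus add.commute)
qed

text \<open>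
  This justifies exchanging the integrals over the space and along the segments \<open>y + [a c, b c] v\<close>.
\<close>

lemma integrable_sweep:
  fixes g :: "'a::euclidean_space \<Rightarrow> real"
  assumes g: "integrable lborel g"
  shows "integrable (lborel \<Otimes>\<^sub>M lborel) (\<lambda>(s, y). indicator {a..b} s * g (y + (c * s) *\<^sub>R v))"
proof (rule lborel_pair.Fubini_integrable)
  have [measurable]: "g \<in> borel_measurable borel" using g by auto
  show "(\<lambda>(s, y). indicator {a..b} s * g (y + (c * s) *\<^sub>R v)) \<in> borel_measurable (lborel \<Otimes>\<^sub>M lborel)"
    by measurable
  have "(\<integral>y. norm (case (s, y) of (s, y) \<Rightarrow> indicator {a..b} s * g (y + (c * s) *\<^sub>R v)) \<partial>lborel) =
     indicator {a..b} s * (\<integral>y. \<bar>g y\<bar> \<partial>lborel)" for s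
  proof -
    have "(\<integral>y. norm (case (s, y) of (s, y) \<Rightarrow> indicator {a..b} s * g (y + (c * s) *\<^sub>R v)) \<partial>lborel) =
      (\<integral>y. indicator {a..b} s * \<bar>g (y + (c * s) *\<^sub>R v)\<bar> \<partial>lborel)"
      by (intro Bochner_Integration.integral_cong) (auto simp: abs_mult indicator_def)
    also have "\<dots> = indicator {a..b} s * (\<integral>y. \<bar>g (y + (c * s) *\<^sub>R v)\<bar> \<partial>lborel)" by simp
    also have "(\<integral>y. \<bar>g (y + (c * s) *\<^sub>R v)\<bar> \<partial>lborel) = (\<integral>y. \<bar>g y\<bar> \<partial>lborel)"
      by (rule integral_lborel_translate[where f = "\<lambda>y. \<bar>g y\<bar>"]) measurable
    finally show ?thesis .
  qed
  moreover have "integrable lborel (\<lambda>s. indicator {a..b} s * (\<integral>y. \<bar>g y\<bar> \<partial>lborel))"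
    by (intro integrable_mult_left integrable_real_indicator) (auto simp: emeasure_lborel_Icc_eq)
  ultimately show "integrable lborel (\<lambda>s. \<integral>y. norm (case (s, y) of (s, y) \<Rightarrow> indicator {a..b} s * g (y + (c * s) *\<^sub>R v)) \<partial>lborel)"
    by presburger
  show "AE s in lborel. integrable lborel (\<lambda>y. case (s, y) of (s, y) \<Rightarrow> indicator {a..b} s * g (y + (c * s) *\<^sub>R v))"
    using integrable_lborel_translate[OF g] by (intro AE_I2) simp
qed

lemma open_segment_preimage:
  fixes \<Omega> :: "'a::euclidean_space set"
  assumes "open \<Omega>"
  shows "open {y. \<forall>s\<in>{0..t}. y - s *\<^sub>R v \<in> \<Omega>}"
proof (rule openI)
  fix y assume y: "y \<in> {y. \<forall>s\<in>{0..t}. y - s *\<^sub>R v \<in> \<Omega>}"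
  let ?K = "(\<lambda>s. y - s *\<^sub>R v) ` {0..t}"
  have "compact ?K" by (intro compact_continuous_image continuous_intros) auto
  moreover have "?K \<subseteq> \<Omega>" using y by auto
  ultimately obtain e where e: "e > 0" "(\<Union>x\<in>?K. ball x e) \<subseteq> \<Omega>"
    using compact_subset_open_imp_ball_epsilon_subset[OF _ assms] by metis
  have "ball y e \<subseteq> {y. \<forall>s\<in>{0..t}. y - s *\<^sub>R v \<in> \<Omega>}"
  proof (intro subsetI CollectI ballI)
    fix y' s assume "y' \<in> ball y e" "s \<in> {0..t}"
    then have "y' - s *\<^sub>R v \<in> ball (y - s *\<^sub>R v) e" by (simp add: dist_norm)
    then show "y' - s *\<^sub>R v \<in> \<Omega>" using e(2) \<open>s \<in> {0..t}\<close> by blast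
  qed
  then show "\<exists>e>0. ball y e \<subseteq> {y. \<forall>s\<in>{0..t}. y - s *\<^sub>R v \<in> \<Omega>}" using e(1) by blast
qed

lemma test_function_translate:
  fixes \<Omega> :: "(real^'n) set"
  assumes t: "test_function {y. \<forall>s\<in>{0..t}. y - s *\<^sub>R v \<in> \<Omega>} \<phi>" and s: "s \<in> {0..t}"
  shows "test_function \<Omega> (\<lambda>y. \<phi> (y + s *\<^sub>R v))"
proof -
  let ?S = "closure {x. \<phi> x \<noteq> 0}"
  have sm: "smooth \<phi>" and S: "compact ?S" "?S \<subseteq> {y. \<forall>s\<in>{0..t}. y - s *\<^sub>R v \<in> \<Omega>}"
    using t by (auto simp: test_function_def)
  have "{x. \<phi> (x + s *\<^sub>R v) \<noteq> 0} = (\<lambda>x. - (s *\<^sub>R v) + x) ` {x. \<phi> x \<noteq> 0}"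
    by (auto simp: image_iff intro!: exI[of _ "_ + s *\<^sub>R v"])
  then have cl: "closure {x. \<phi> (x + s *\<^sub>R v) \<noteq> 0} = (\<lambda>x. - (s *\<^sub>R v) + x) ` ?S"
    by (simp only: closure_translation)
  have "compact ((\<lambda>x. - (s *\<^sub>R v) + x) ` ?S)" using S(1) by (rule compact_translation)
  moreover have "(\<lambda>x. - (s *\<^sub>R v) + x) ` ?S \<subseteq> \<Omega>"
    using S(2) s by auto
  ultimately show ?thesis using smooth_translate[OF sm] cl by (simp add: test_function_def)
qed

text \<open>
  Both sides are tested against a test function \<open>\<phi>\<close> supported in the open set of those \<open>y\<close> whose segment lies in \<open>\<Omega>\<close>.
  After Fubini and a translation the right-hand side becomes the integral over \<open>s\<close> of the weak derivative tested against \<open>\<phi>(\<cdot> + s v)\<close>, so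
  the derivative moves to \<open>\<phi>\<close>, where the classical theorem applies; then the
  fundamental lemma removes \<open>\<phi>\<close>.  The functions \<open>W\<close> and \<open>g\<close> are Borel measurable extensions by
  zero of \<open>w\<close> and of the derivative in direction \<open>v\<close>.
\<close>

theorem weak_gradient_shift:
  fixes \<Omega> :: "(real^'n) set"
  assumes \<Omega>: "open \<Omega>" "bounded \<Omega>"
    and w: "integrable (lebesgue_on \<Omega>) w" "integrable lborel W" "AE x in lebesgue. W x = indicator \<Omega> x * w x"
    and G: "integrable (lebesgue_on \<Omega>) G" "is_weak_gradient \<Omega> w G"
    and g: "integrable lborel g" "AE x in lebesgue. g x = indicator \<Omega> x * (G x \<bullet> v)"
    and t: "t \<ge> 0"
  shows "AE y in lborel. (\<forall>s\<in>{0..t}. y - s *\<^sub>R v \<in> \<Omega>) \<longrightarrow>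
           W y - W (y - t *\<^sub>R v) = (\<integral>s. indicator {0..t} s * g (y - s *\<^sub>R v) \<partial>lborel)"
proof -
  define U where "U = {y. \<forall>s\<in>{0..t}. y - s *\<^sub>R v \<in> \<Omega>}"
  have U: "open U" unfolding U_def by (rule open_segment_preimage[OF \<Omega>(1)])
  define Q where "Q y = (\<integral>s. indicator {0..t} s * g (y - s *\<^sub>R v) \<partial>lborel)" for y
  define f where "f y = W y - W (y + (- t) *\<^sub>R v) - Q y" for y
  have Wt: "integrable lborel (\<lambda>y. W (y + (- t) *\<^sub>R v))" by (rule integrable_lborel_translate[OF w(2)])
  have gsw: "integrable (lborel \<Otimes>\<^sub>M lborel) (\<lambda>(s, y). indicator {0..t} s * g (y - s *\<^sub>R v))"
    using integrable_sweep[OF g(1), of 0 t "-1" v] by simp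
  have Qi: "integrable lborel Q"
    unfolding Q_def using lborel_pair.integrable_snd[OF gsw] by simp
  have fi: "integrable lborel f" unfolding f_def by (intro Bochner_Integration.integrable_diff w Wt Qi)
  have fm: "f \<in> borel_measurable lborel" using fi by auto
  have [measurable]: "W \<in> borel_measurable borel" "g \<in> borel_measurable borel" using w g by auto
  have "AE x in lebesgue. x \<in> U \<longrightarrow> f x = 0"
  proof (rule fundamental_lemma_calculus_of_variations[OF U])
    show "integrable lebesgue f" by (rule integrable_completion[THEN iffD2, OF fm fi])
    fix \<phi> assume tf: "test_function U \<phi>"
    have sm: "smooth \<phi>" using tf by (simp add: test_function_def)
    obtain M where M: "\<And>x. \<bar>\<phi> x\<bar> \<le> M" using test_function_bounded(1)[OF tf] by blast
    let ?D = "\<lambda>x. frechet_derivative \<phi> (at x) v"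
    obtain M' where M': "\<And>x. \<bar>?D x\<bar> \<le> M'" using test_function_bounded(2)[OF tf] by blast
    have pc: "continuous_on UNIV \<phi>" and Dc: "continuous_on UNIV ?D"
      by (rule smooth_continuous[OF sm], rule smooth_continuous[OF smooth_frechet_derivative[OF sm]])
    have [measurable]: "\<phi> \<in> borel_measurable borel" "?D \<in> borel_measurable borel"
      using pc Dc by (auto intro: borel_measurable_continuous_onI)
    have ftc: "(\<integral>s. indicator {0..t} s *\<^sub>R ?D (y + s *\<^sub>R v) \<partial>lborel) = \<phi> (y + t *\<^sub>R v) - \<phi> (y + 0 *\<^sub>R v)" for y
    proof (rule integral_FTC_Icc[OF t])
      show "((\<lambda>s. \<phi> (y + s *\<^sub>R v)) has_vector_derivative ?D (y + s *\<^sub>R v)) (at s within {0..t})" for s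
      proof -
        have "((\<lambda>s. y + s *\<^sub>R v) has_derivative (\<lambda>s. s *\<^sub>R v)) (at s)" by (auto intro!: derivative_eq_intros)
        from diff_chain_at[OF this smooth_has_derivative[OF sm]]
        have "((\<lambda>s. \<phi> (y + s *\<^sub>R v)) has_derivative (\<lambda>h. frechet_derivative \<phi> (at (y + s *\<^sub>R v)) (h *\<^sub>R v))) (at s)"
          by (simp add: o_def)
        moreover have "linear (frechet_derivative \<phi> (at (y + s *\<^sub>R v)))"
          using smooth_has_derivative[OF sm] has_derivative_linear by blast
        ultimately show ?thesis
          by (auto simp: has_vector_derivative_def linear_scale intro: has_derivative_at_withinI)
      qed
      show "continuous_on {0..t} (\<lambda>s. ?D (y + s *\<^sub>R v))"
        by (intro continuous_on_compose2[OF Dc] continuous_intros) auto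
    qed
    \<comment> \<open>the translates of \<open>\<phi>\<close> are supported in \<open>\<Omega>\<close> as the segments are\<close>
    have wk: "(\<integral>y. W y * ?D (y + s *\<^sub>R v) \<partial>lborel) = - (\<integral>y. g (y - s *\<^sub>R v) * \<phi> y \<partial>lborel)" if s: "s \<in> {0..t}" for s
    proof -
      let ?\<psi> = "\<lambda>y. \<phi> (y + s *\<^sub>R v)"
      have ts: "test_function \<Omega> ?\<psi>" using tf s unfolding U_def by (rule test_function_translate)
      have conv: "(\<integral>x. k x * q x \<partial>lebesgue_on \<Omega>) = (\<integral>x. K x * q x \<partial>lborel)"
        if k: "integrable (lebesgue_on \<Omega>) k" and q[measurable]: "q \<in> borel_measurable borel"
          and K: "integrable lborel K" "AE x in lebesgue. K x = indicator \<Omega> x * k x"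
        for k K q :: "real^'n \<Rightarrow> real"
      proof -
        have km: "(\<lambda>x. indicator \<Omega> x *\<^sub>R k x) \<in> borel_measurable lebesgue"
          using k integrable_restrict_space[OF open_sets_lebesgue[OF \<Omega>(1)], of k] by auto
        have ql: "q \<in> borel_measurable lebesgue" by (rule measurable_completion) simp
        have Km: "K \<in> borel_measurable lborel" using K by auto
        have Kl: "K \<in> borel_measurable lebesgue" by (rule measurable_completion[OF Km])
        have "(\<integral>x. k x * q x \<partial>lebesgue_on \<Omega>) = (\<integral>x. indicator \<Omega> x *\<^sub>R (k x * q x) \<partial>lebesgue)"
          by (rule integral_restrict_space[OF open_sets_lebesgue[OF \<Omega>(1)]])
        also have "\<dots> = (\<integral>x. (indicator \<Omega> x *\<^sub>R k x) * q x \<partial>lebesgue)" by (simp add: mult.assoc)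
        also have "\<dots> = (\<integral>x. K x * q x \<partial>lebesgue)"
        proof (rule integral_cong_AE)
          show "(\<lambda>x. (indicator \<Omega> x *\<^sub>R k x) * q x) \<in> borel_measurable lebesgue" by (rule borel_measurable_times[OF km ql])
          show "(\<lambda>x. K x * q x) \<in> borel_measurable lebesgue" by (rule borel_measurable_times[OF Kl ql])
          show "AE x in lebesgue. (indicator \<Omega> x *\<^sub>R k x) * q x = K x * q x"
            using K(2) by eventually_elim simp
        qed
        also have "\<dots> = (\<integral>x. K x * q x \<partial>lborel)" by (rule integral_completion) (use Km in measurable)
        finally show ?thesis .
      qed
      have "(\<integral>y. W y * ?D (y + s *\<^sub>R v) \<partial>lborel) = (\<integral>x. w x * ?D (x + s *\<^sub>R v) \<partial>lebesgue_on \<Omega>)"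
        by (rule conv[symmetric]) (use w in measurable)
      also have "\<dots> = (\<integral>x. w x * frechet_derivative ?\<psi> (at x) v \<partial>lebesgue_on \<Omega>)"
        by (simp add: frechet_derivative_translate[OF sm])
      also have "\<dots> = - (\<integral>x. (G x \<bullet> v) * ?\<psi> x \<partial>lebesgue_on \<Omega>)"
        by (rule weak_gradient_directional[OF w(1) G ts])
      also have "(\<integral>x. (G x \<bullet> v) * ?\<psi> x \<partial>lebesgue_on \<Omega>) = (\<integral>x. g x * ?\<psi> x \<partial>lborel)"
        by (rule conv) (use G g in \<open>auto intro: integrable_inner_left\<close>)
      also have "\<dots> = (\<integral>x. g (x + (- s) *\<^sub>R v) * ?\<psi> (x + (- s) *\<^sub>R v) \<partial>lborel)"
        by (rule integral_lborel_translate[symmetric]) measurable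
      finally show ?thesis by simp
    qed
    have WD: "integrable (lborel \<Otimes>\<^sub>M lborel) (\<lambda>(s, y). indicator {0..t} s * W y * ?D (y + s *\<^sub>R v))"
    proof -
      have "integrable (lborel \<Otimes>\<^sub>M lborel) (\<lambda>z. (case z of (s, y) \<Rightarrow> indicator {0..t} s * W (y + (0 * s) *\<^sub>R v)) *
          (case z of (s, y) \<Rightarrow> ?D (y + s *\<^sub>R v)))"
        by (rule integrable_mult_bounded[OF integrable_sweep[OF w(2)]]) (use M' in \<open>measurable, auto\<close>)
      then show ?thesis by (simp add: case_prod_unfold)
    qed
    have gp: "integrable (lborel \<Otimes>\<^sub>M lborel) (\<lambda>(s, y). indicator {0..t} s * g (y - s *\<^sub>R v) * \<phi> y)"
    proof -
      have "integrable (lborel \<Otimes>\<^sub>M lborel) (\<lambda>z. (case z of (s, y) \<Rightarrow> indicator {0..t} s * g (y - s *\<^sub>R v)) *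
          (case z of (s, y) \<Rightarrow> \<phi> y))"
        by (rule integrable_mult_bounded[OF gsw]) (use M in \<open>measurable, auto\<close>)
      then show ?thesis by (simp add: case_prod_unfold)
    qed
    have "(\<integral>y. Q y * \<phi> y \<partial>lborel) = (\<integral>y. \<integral>s. indicator {0..t} s * g (y - s *\<^sub>R v) * \<phi> y \<partial>lborel \<partial>lborel)"
      by (simp add: Q_def)
    also have "\<dots> = (\<integral>s. \<integral>y. indicator {0..t} s * g (y - s *\<^sub>R v) * \<phi> y \<partial>lborel \<partial>lborel)"
      by (rule lborel_pair.Fubini_integral[OF gp])
    also have "\<dots> = (\<integral>s. - (\<integral>y. indicator {0..t} s * W y * ?D (y + s *\<^sub>R v) \<partial>lborel) \<partial>lborel)"
    proof (rule Bochner_Integration.integral_cong[OF refl])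
      fix s :: real
      show "(\<integral>y. indicator {0..t} s * g (y - s *\<^sub>R v) * \<phi> y \<partial>lborel) =
         - (\<integral>y. indicator {0..t} s * W y * ?D (y + s *\<^sub>R v) \<partial>lborel)"
        using wk[of s] by (cases "s \<in> {0..t}") (simp_all add: mult.assoc)
    qed
    also have "\<dots> = - (\<integral>s. (\<integral>y. indicator {0..t} s * W y * ?D (y + s *\<^sub>R v) \<partial>lborel) \<partial>lborel)" by simp
    also have "(\<integral>s. (\<integral>y. indicator {0..t} s * W y * ?D (y + s *\<^sub>R v) \<partial>lborel) \<partial>lborel) =
       (\<integral>y. (\<integral>s. indicator {0..t} s * W y * ?D (y + s *\<^sub>R v) \<partial>lborel) \<partial>lborel)"
      by (rule lborel_pair.Fubini_integral[OF WD, symmetric])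
    also have "\<dots> = (\<integral>y. W y * (\<phi> (y + t *\<^sub>R v) - \<phi> y) \<partial>lborel)"
    proof (rule Bochner_Integration.integral_cong[OF refl])
      fix y
      have "(\<integral>s. indicator {0..t} s * W y * ?D (y + s *\<^sub>R v) \<partial>lborel) = (\<integral>s. W y * (indicator {0..t} s *\<^sub>R ?D (y + s *\<^sub>R v)) \<partial>lborel)"
        by (simp add: ac_simps)
      also have "\<dots> = W y * (\<integral>s. indicator {0..t} s *\<^sub>R ?D (y + s *\<^sub>R v) \<partial>lborel)"
        by (rule integral_mult_right_zero)
      finally show "(\<integral>s. indicator {0..t} s * W y * ?D (y + s *\<^sub>R v) \<partial>lborel) = W y * (\<phi> (y + t *\<^sub>R v) - \<phi> y)"
        using ftc[of y] by simp
    qed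
    finally have Qphi: "(\<integral>y. Q y * \<phi> y \<partial>lborel) = - (\<integral>y. W y * (\<phi> (y + t *\<^sub>R v) - \<phi> y) \<partial>lborel)" .
    have pm: "\<phi> \<in> borel_measurable lborel" "(\<lambda>y. \<phi> (y + t *\<^sub>R v)) \<in> borel_measurable lborel" by measurable
    have i1: "integrable lborel (\<lambda>y. W y * \<phi> y)"
      by (rule integrable_mult_bounded[OF w(2) pm(1) M])
    have i2: "integrable lborel (\<lambda>y. W y * \<phi> (y + t *\<^sub>R v))"
      by (rule integrable_mult_bounded[OF w(2) pm(2) M])
    have i3: "integrable lborel (\<lambda>y. W (y + (- t) *\<^sub>R v) * \<phi> y)"
      by (rule integrable_mult_bounded[OF Wt pm(1) M])
    have i4: "integrable lborel (\<lambda>y. Q y * \<phi> y)"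
      by (rule integrable_mult_bounded[OF Qi pm(1) M])
    have "(\<integral>y. W (y + (- t) *\<^sub>R v) * \<phi> y \<partial>lborel) = (\<integral>y. W y * \<phi> (y + t *\<^sub>R v) \<partial>lborel)"
      using integral_lborel_translate[of "\<lambda>y. W y * \<phi> (y + t *\<^sub>R v)" "(- t) *\<^sub>R v"] by simp
    then have "(\<integral>y. f y * \<phi> y \<partial>lborel) = 0"
      unfolding f_def left_diff_distrib
      using Qphi i1 i2 i3 i4 by (simp add: right_diff_distrib)
    moreover have "(\<integral>y. f y * \<phi> y \<partial>lebesgue) = (\<integral>y. f y * \<phi> y \<partial>lborel)"
      by (rule integral_completion) (use fm in measurable)
    ultimately show "(\<integral>y. f y * \<phi> y \<partial>lebesgue) = 0" by simp
  qed
  then have "AE x in lborel. x \<in> U \<longrightarrow> f x = 0"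
    by (subst (asm) AE_completion_iff) (use U fm in measurable)
  then show ?thesis
    by eventually_elim (auto simp: U_def f_def Q_def)
qed

section \<open>Hausdorff measure of Lipschitz graphs\<close>

definition orth_part :: "'a::real_inner \<Rightarrow> 'a \<Rightarrow> 'a" where
  "orth_part \<nu> x = x - (x \<bullet> \<nu>) *\<^sub>R \<nu>"

lemma norm_orth_part_le:
  assumes "norm \<nu> = 1"
  shows "norm (orth_part \<nu> x) \<le> norm x"
proof -
  have nn: "\<nu> \<bullet> \<nu> = 1" using assms by (simp add: norm_eq_1)
  have "(norm (orth_part \<nu> x))\<^sup>2 = (norm x)\<^sup>2 - (x \<bullet> \<nu>)\<^sup>2"
    unfolding orth_part_def power2_norm_eq_inner
    by (simp add: inner_diff_left inner_diff_right inner_commute[of \<nu> x] power2_eq_square nn algebra_simps)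
  then have "(norm (orth_part \<nu> x))\<^sup>2 \<le> (norm x)\<^sup>2" by simp
  then show ?thesis by (rule power2_le_imp_le) simp
qed

lemma orth_part_add_scaleR:
  assumes "norm \<nu> = 1"
  shows "orth_part \<nu> (x + s *\<^sub>R \<nu>) = orth_part \<nu> x"
  using assms by (simp add: orth_part_def inner_add_left algebra_simps norm_eq_1)

text \<open>
  A separated set with as many points as possible cannot be enlarged, so the balls of radius \<open>\<eta>\<close> around its points
  cover \<open>A\<close>.
\<close>

lemma maximal_separated_set:
  fixes A :: "'a::metric_space set"
  assumes "\<And>X. finite X \<Longrightarrow> X \<subseteq> A \<Longrightarrow> (\<And>x y. x \<in> X \<Longrightarrow> y \<in> X \<Longrightarrow> x \<noteq> y \<Longrightarrow> dist x y \<ge> \<eta>) \<Longrightarrow> card X \<le> N"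
  shows "\<exists>X. finite X \<and> X \<subseteq> A \<and> (\<forall>x\<in>X. \<forall>y\<in>X. x \<noteq> y \<longrightarrow> dist x y \<ge> \<eta>) \<and> A \<subseteq> (\<Union>x\<in>X. ball x \<eta>) \<union> X"
proof -
  define P where "P X \<longleftrightarrow> finite X \<and> X \<subseteq> A \<and> (\<forall>x\<in>X. \<forall>y\<in>X. x \<noteq> y \<longrightarrow> dist x y \<ge> \<eta>)" for X
  have b: "card X \<le> N" if "P X" for X using assms that by (auto simp: P_def)
  have "P {}" by (simp add: P_def)
  then obtain X where X: "P X" "\<And>Y. P Y \<Longrightarrow> card Y \<le> card X"
    using ex_has_greatest_nat[of P "{}" card "Suc N"] b by (metis le_imp_less_Suc)
  have "A \<subseteq> (\<Union>x\<in>X. ball x \<eta>) \<union> X"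
  proof (rule ccontr)
    assume "\<not> ?thesis"
    then obtain a where a: "a \<in> A" "a \<notin> X" "\<And>x. x \<in> X \<Longrightarrow> dist x a \<ge> \<eta>" by force
    have "P (insert a X)" using X(1) a by (auto simp: P_def dist_commute)
    from X(2)[OF this] show False using X(1) a(2) by (simp add: P_def)
  qed
  then show ?thesis by (intro exI[of _ X]) (use X(1) in \<open>simp add: P_def\<close>)
qed

text \<open>
  The set \<open>A\<close> is a Lipschitz graph in direction \<open>\<nu>\<close>.  Cover it by balls of radius \<open>\<eta> = 2 K \<rho>\<close> around a maximal
  \<open>\<eta>\<close>-separated set \<open>X\<close>.  Above each point of \<open>X\<close> stack about \<open>h / (2 \<rho>)\<close> balls of radius \<open>\<rho>\<close> in direction \<open>\<nu>\<close>.
  Different stacks are disjoint, since the projections of the points of \<open>X\<close> along \<open>\<nu>\<close> have distance at least \<open>\<eta> / K\<close>.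
  So the volume of \<open>T\<close> bounds \<open>card X\<close> times \<open>h \<rho>\<^sup>n\<^sup>-\<^sup>1\<close>, and that is the contribution of the
  covering to the Hausdorff content up to constants.
\<close>

theorem graph_content_le:
  fixes A T :: "(real^'n) set"
  assumes \<nu>: "norm \<nu> = 1" and K: "K \<ge> 1" and n: "CARD('n) \<ge> 2"
    and graph: "\<And>x y. x \<in> A \<Longrightarrow> y \<in> A \<Longrightarrow> dist x y \<le> K * norm (orth_part \<nu> (x - y))"
    and h: "h > 0" and \<rho>: "\<rho> > 0"
    and T: "T \<in> sets borel" "\<And>x s. x \<in> A \<Longrightarrow> s \<in> {a..a + h} \<Longrightarrow> ball (x + s *\<^sub>R \<nu>) \<rho> \<subseteq> T"
  defines "n \<equiv> real CARD('n)"
  shows "hausdorff_content (n - 1) (4 * K * \<rho>) A \<le>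
    ennreal (unit_ball_vol (n - 1) * (2 * K) powr (n - 1) * 2 / (unit_ball_vol n * h)) * emeasure lborel T"
proof (cases "emeasure lborel T = \<infinity>")
  case True
  define C where "C = unit_ball_vol (n - 1) * (2 * K) powr (n - 1) * 2 / (unit_ball_vol n * h)"
  have "C > 0" unfolding C_def
    using K h n by (intro divide_pos_pos mult_pos_pos unit_ball_vol_pos) (auto simp: n_def)
  then show ?thesis using True unfolding C_def[symmetric] by (simp add: ennreal_mult_top)
next
  case False
  define \<eta> where "\<eta> = 2 * K * \<rho>"
  define V where "V = unit_ball_vol n * \<rho> powr n"
  define t where "t = measure lborel T"
  have t: "emeasure lborel T = ennreal t" using False by (simp add: t_def emeasure_eq_ennreal_measure)
  have t0: "t \<ge> 0" by (simp add: t_def)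
  have V: "V > 0" using \<rho> by (simp add: V_def n_def)
  have \<eta>: "\<eta> > 0" using K \<rho> by (simp add: \<eta>_def)
  \<comment> \<open>the number of balls in a stack\<close>
  define N where "N = Suc (nat \<lfloor>h / (2 * \<rho>)\<rfloor>)"
  have N: "real N \<ge> h / (2 * \<rho>)" unfolding N_def by linarith
  have kN: "2 * \<rho> * real k \<le> h" if "k < N" for k
  proof -
    have "real k \<le> h / (2 * \<rho>)"
      using that h \<rho> unfolding N_def by (simp add: less_Suc_eq_le le_nat_iff le_floor_iff)
    then show ?thesis using \<rho> by (simp add: field_simps)
  qed
  have vol: "real (card X) * (h / (2 * \<rho>)) * V \<le> t"
    if X: "finite X" "X \<subseteq> A" and sep: "\<And>x y. x \<in> X \<Longrightarrow> y \<in> X \<Longrightarrow> x \<noteq> y \<Longrightarrow> dist x y \<ge> \<eta>" for X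
  proof -
    let ?c = "\<lambda>(x, k). x + (a + 2 * \<rho> * real k) *\<^sub>R \<nu>"
    let ?B = "\<lambda>z. ball (?c z) \<rho>"
    have far: "dist (?c z) (?c z') \<ge> 2 * \<rho>" if zz: "z \<in> X \<times> {..<N}" "z' \<in> X \<times> {..<N}" "z \<noteq> z'" for z z'
    proof -
      obtain x k x' k' where z: "z = (x, k)" "z' = (x', k')" by (cases z; cases z')
      show ?thesis
      proof (cases "x = x'")
        case False
        then have "\<eta> \<le> K * norm (orth_part \<nu> (x - x'))"
          using sep[of x x'] graph[of x x'] zz z X(2) by (meson SigmaD1 order_trans subsetD)
        then have "2 * \<rho> \<le> norm (orth_part \<nu> (x - x'))" using K by (simp add: \<eta>_def)
        also have "orth_part \<nu> (x - x') = orth_part \<nu> (x - x' + (2 * \<rho> * real k - 2 * \<rho> * real k') *\<^sub>R \<nu>)"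
          by (rule orth_part_add_scaleR[OF \<nu>, symmetric])
        also have "x - x' + (2 * \<rho> * real k - 2 * \<rho> * real k') *\<^sub>R \<nu> = ?c z - ?c z'"
          by (simp add: z algebra_simps)
        also have "norm (orth_part \<nu> (?c z - ?c z')) \<le> dist (?c z) (?c z')"
          unfolding dist_norm by (rule norm_orth_part_le[OF \<nu>])
        finally show ?thesis .
      next
        case True
        then have kk: "k \<noteq> k'" using zz z by auto
        have "?c z - ?c z' = (2 * \<rho> * (real k - real k')) *\<^sub>R \<nu>" using True by (simp add: z algebra_simps)
        then have "dist (?c z) (?c z') = 2 * \<rho> * \<bar>real k - real k'\<bar>"
          using \<nu> \<rho> by (simp add: dist_norm abs_mult)
        moreover have "\<bar>real k - real k'\<bar> \<ge> 1" using kk by linarith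
        ultimately show ?thesis using \<rho> by simp
      qed
    qed
    have disj: "disjoint_family_on ?B (X \<times> {..<N})"
      unfolding disjoint_family_on_def
    proof (intro ballI impI)
      fix z z' assume "z \<in> X \<times> {..<N}" "z' \<in> X \<times> {..<N}" "z \<noteq> z'"
      from far[OF this] show "?B z \<inter> ?B z' = {}"
        by (intro disjoint_ballI) simp
    qed
    have sub: "(\<Union>z\<in>X \<times> {..<N}. ?B z) \<subseteq> T"
    proof
      fix y assume "y \<in> (\<Union>z\<in>X \<times> {..<N}. ?B z)"
      then obtain x k where xk: "x \<in> X" "k < N" "y \<in> ball (x + (a + 2 * \<rho> * real k) *\<^sub>R \<nu>) \<rho>" by auto
      have "a + 2 * \<rho> * real k \<in> {a..a + h}" using kN[OF xk(2)] \<rho> by simp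
      then show "y \<in> T" using T(2)[of x "a + 2 * \<rho> * real k"] xk X by blast
    qed
    have "ennreal (real (card X * N) * V) = (\<Sum>z\<in>X \<times> {..<N}. emeasure lborel (?B z))"
    proof -
      have "emeasure lborel (?B z) = ennreal V" for z
        using \<rho> by (simp add: emeasure_ball V_def n_def powr_realpow)
      then show ?thesis using V X(1) by (simp add: card_cartesian_product ennreal_mult ennreal_of_nat_eq_real_of_nat)
    qed
    also have "\<dots> = emeasure lborel (\<Union>z\<in>X \<times> {..<N}. ?B z)"
      by (rule sum_emeasure) (use X disj in auto)
    also have "\<dots> \<le> ennreal t" unfolding t[symmetric] by (rule emeasure_mono[OF sub]) (use T in simp)
    finally have "real (card X * N) * V \<le> t" using t0 by (simp add: ennreal_le_iff)
    moreover have "real (card X) * (h / (2 * \<rho>)) * V \<le> real (card X) * real N * V"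
      using N V by (intro mult_right_mono mult_left_mono) auto
    ultimately show ?thesis by simp
  qed
  have cardb: "card X \<le> nat \<lceil>t / (h / (2 * \<rho>) * V)\<rceil>"
    if X: "finite X" "X \<subseteq> A" "\<And>x y. x \<in> X \<Longrightarrow> y \<in> X \<Longrightarrow> x \<noteq> y \<Longrightarrow> dist x y \<ge> \<eta>" for X
  proof -
    have "real (card X) \<le> t / (h / (2 * \<rho>) * V)"
    proof -
      have pos: "h / (2 * \<rho>) * V > 0" using h \<rho> V by simp
      have "real (card X) * (h / (2 * \<rho>)) * V \<le> t" by (rule vol) (use X in auto)
      then show ?thesis by (simp only: pos_le_divide_eq[OF pos] mult.assoc)
    qed
    then show ?thesis by linarith
  qed
  have "\<exists>X. finite X \<and> X \<subseteq> A \<and> (\<forall>x\<in>X. \<forall>y\<in>X. x \<noteq> y \<longrightarrow> dist x y \<ge> \<eta>) \<and> A \<subseteq> (\<Union>x\<in>X. ball x \<eta>) \<union> X"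
    by (rule maximal_separated_set[OF cardb])
  then obtain X where X: "finite X" "X \<subseteq> A" "\<And>x y. x \<in> X \<Longrightarrow> y \<in> X \<Longrightarrow> x \<noteq> y \<Longrightarrow> dist x y \<ge> \<eta>"
    "A \<subseteq> (\<Union>x\<in>X. ball x \<eta>) \<union> X"
    by blast
  have cov: "A \<subseteq> (\<Union>x\<in>X. ball x \<eta>)" using X(4) \<eta> by force
  obtain e where e: "bij_betw e {..<card X} X" using X(1) bij_betw_from_nat_into_finite by blast
  define U where "U i = (if i < card X then ball (e i) \<eta> else {})" for i
  have diam: "diameter (ball x \<eta>) \<le> 2 * \<eta>" for x :: "real^'n"
    using \<eta> by (intro diameter_le) (auto simp: dist_norm intro!: order_trans[OF norm_triangle_ineq4, of "x - _" "x - _", simplified])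
  have "hausdorff_content (n - 1) (4 * K * \<rho>) A \<le> (\<Sum>i. ennreal (unit_ball_vol (n - 1) * (diameter (U i) / 2) powr (n - 1)))"
    unfolding hausdorff_content_def
  proof (rule INF_lower, intro CollectI conjI allI)
    show "A \<subseteq> (\<Union>i. U i)"
    proof
      fix y assume "y \<in> A"
      then obtain x where "x \<in> X" "y \<in> ball x \<eta>" using cov by blast
      then obtain i where "i < card X" "x = e i" using e by (auto simp: bij_betw_def)
      then show "y \<in> (\<Union>i. U i)" using \<open>y \<in> ball x \<eta>\<close> by (auto simp: U_def)
    qed
    show "bounded (U i)" for i by (simp add: U_def)
    show "diameter (U i) \<le> 4 * K * \<rho>" for i
      using diam[of "e i"] K \<rho> by (auto simp: U_def \<eta>_def)
  qed
  also have "\<dots> = (\<Sum>i<card X. ennreal (unit_ball_vol (n - 1) * (diameter (U i) / 2) powr (n - 1)))"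
    by (rule suminf_finite) (auto simp: U_def)
  also have "\<dots> \<le> (\<Sum>i<card X. ennreal (unit_ball_vol (n - 1) * \<eta> powr (n - 1)))"
  proof (rule sum_mono)
    fix i assume "i \<in> {..<card X}"
    then have "diameter (U i) / 2 \<le> \<eta>" "diameter (U i) \<ge> 0" using diam[of "e i"] by (auto simp: U_def diameter_ge_0)
    then show "ennreal (unit_ball_vol (n - 1) * (diameter (U i) / 2) powr (n - 1)) \<le> ennreal (unit_ball_vol (n - 1) * \<eta> powr (n - 1))"
      using n by (intro ennreal_leI mult_left_mono powr_mono2) (auto simp: n_def)
  qed
  also have "\<dots> = ennreal (real (card X) * (unit_ball_vol (n - 1) * \<eta> powr (n - 1)))"
    using n by (simp add: ennreal_mult ennreal_of_nat_eq_real_of_nat n_def)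
  also have "\<dots> \<le> ennreal (unit_ball_vol (n - 1) * (2 * K) powr (n - 1) * 2 / (unit_ball_vol n * h) * t)"
  proof (rule ennreal_leI)
    have v1: "unit_ball_vol n > 0" and v2: "unit_ball_vol (n - 1) > 0" using n by (auto simp: n_def)
    have "\<eta> powr (n - 1) = (2 * K) powr (n - 1) * (\<rho> powr n / \<rho>)"
      using \<rho> K by (simp add: \<eta>_def powr_mult powr_diff)
    then have "real (card X) * (unit_ball_vol (n - 1) * \<eta> powr (n - 1)) =
       (unit_ball_vol (n - 1) * (2 * K) powr (n - 1) * 2 / (unit_ball_vol n * h)) * (real (card X) * (h / (2 * \<rho>)) * V)"
      using v1 h \<rho> by (simp add: V_def)
    also have "\<dots> \<le> (unit_ball_vol (n - 1) * (2 * K) powr (n - 1) * 2 / (unit_ball_vol n * h)) * t"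
      using vol[OF X(1-3)] v1 v2 h K by (intro mult_left_mono) auto
    finally show "real (card X) * (unit_ball_vol (n - 1) * \<eta> powr (n - 1)) \<le>
      unit_ball_vol (n - 1) * (2 * K) powr (n - 1) * 2 / (unit_ball_vol n * h) * t" .
  qed
  also have "\<dots> = ennreal (unit_ball_vol (n - 1) * (2 * K) powr (n - 1) * 2 / (unit_ball_vol n * h)) * emeasure lborel T"
    unfolding t by (rule ennreal_mult) (use K h n t0 in \<open>auto simp: n_def\<close>)
  finally show ?thesis .
qed

definition tube :: "'a::real_vector \<Rightarrow> real \<Rightarrow> real \<Rightarrow> 'a set \<Rightarrow> 'a set" where
  "tube \<nu> a b A = (\<lambda>(x, s). x + s *\<^sub>R \<nu>) ` (A \<times> {a..b})"

lemma compact_tube: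
  fixes A :: "'a::real_normed_vector set"
  shows "compact A \<Longrightarrow> compact (tube \<nu> a b A)"
  unfolding tube_def by (intro compact_continuous_image compact_Times) (auto simp: case_prod_beta intro!: continuous_intros)

text \<open>
  The volume of small open neighbourhoods of the compact tube tends to the volume of the tube.
\<close>

corollary graph_hausdorff_outer_le:
  fixes A :: "(real^'n) set"
  assumes \<nu>: "norm \<nu> = 1" and K: "K \<ge> 1" and n: "CARD('n) \<ge> 2" and A: "compact A"
    and graph: "\<And>x y. x \<in> A \<Longrightarrow> y \<in> A \<Longrightarrow> dist x y \<le> K * norm (orth_part \<nu> (x - y))"
    and h: "h > 0"
  defines "n \<equiv> real CARD('n)"
  shows "hausdorff_outer (n - 1) A \<le>
    ennreal (unit_ball_vol (n - 1) * (2 * K) powr (n - 1) * 2 / (unit_ball_vol n * h)) * emeasure lborel (tube \<nu> a (a + h) A)"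
proof -
  define C where "C = unit_ball_vol (n - 1) * (2 * K) powr (n - 1) * 2 / (unit_ball_vol n * h)"
  let ?S = "tube \<nu> a (a + h) A"
  have S: "compact ?S" by (rule compact_tube[OF A])
  have C: "C > 0"
    unfolding C_def using K h n by (intro divide_pos_pos mult_pos_pos unit_ball_vol_pos) (auto simp: n_def)
  have main: "hausdorff_content (n - 1) \<delta> A \<le> ennreal C * emeasure lborel ?S + ennreal e" if \<delta>: "\<delta> > 0" and e: "e > 0" for \<delta> e
  proof -
    have "?S \<in> sets borel" using S by (simp add: compact_imp_closed)
    then obtain T where T: "open T" "?S \<subseteq> T" "emeasure lborel (T - ?S) < ennreal (e / C)"
      using outer_regular_lborel[of ?S "e / C"] e C by auto
    obtain \<rho>0 where r0: "\<rho>0 > 0" "(\<Union>x\<in>?S. ball x \<rho>0) \<subseteq> T"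
      using compact_subset_open_imp_ball_epsilon_subset[OF S T(1,2)] by metis
    define \<rho> where "\<rho> = min \<rho>0 (\<delta> / (4 * K))"
    have \<rho>: "\<rho> > 0" "4 * K * \<rho> \<le> \<delta>" "\<rho> \<le> \<rho>0" using r0 \<delta> K by (auto simp: \<rho>_def min_def field_simps)
    have "hausdorff_content (n - 1) \<delta> A \<le> hausdorff_content (n - 1) (4 * K * \<rho>) A"
      by (rule hausdorff_content_antimono[OF \<rho>(2)])
    also have "\<dots> \<le> ennreal C * emeasure lborel T"
      unfolding C_def n_def
    proof (rule graph_content_le[OF \<nu> K n graph h \<rho>(1), where a = a])
      show "T \<in> sets borel" using T by simp
      fix x s assume "x \<in> A" "s \<in> {a..a + h}"
      then have "x + s *\<^sub>R \<nu> \<in> ?S" unfolding tube_def by (intro image_eqI[of _ _ "(x, s)"]) auto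
      then show "ball (x + s *\<^sub>R \<nu>) \<rho> \<subseteq> T" using r0(2) \<rho>(3) by force
    qed
    also have "emeasure lborel T \<le> emeasure lborel ?S + ennreal (e / C)"
    proof -
      have "emeasure lborel T = emeasure lborel (?S \<union> (T - ?S))" using T(2) by (simp add: Un_absorb1)
      also have "\<dots> \<le> emeasure lborel ?S + emeasure lborel (T - ?S)"
        using T(1) S by (intro emeasure_subadditive) (auto simp: compact_imp_closed)
      finally show ?thesis using T(3) by (meson add_left_mono less_imp_le order_trans)
    qed
    also have "ennreal C * (emeasure lborel ?S + ennreal (e / C)) = ennreal C * emeasure lborel ?S + ennreal e"
      using C e by (simp add: distrib_left ennreal_mult[symmetric])
    finally show ?thesis by (simp add: mult_left_mono)
  qed
  have "hausdorff_content (n - 1) \<delta> A \<le> ennreal C * emeasure lborel ?S" if "\<delta> > 0" for \<delta>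
    by (rule ennreal_le_epsilon) (rule main[OF that])
  then show ?thesis unfolding hausdorff_outer_def C_def[symmetric] by (intro SUP_least) auto
qed

section \<open>Charts and measure of a Lipschitz boundary\<close>

lemma orth_part_diff: "orth_part \<nu> (x - y) = orth_part \<nu> x - orth_part \<nu> y"
  by (simp add: orth_part_def inner_diff_left algebra_simps)

text \<open>
  Boundary points near \<open>z\<close> lie on the graph: strictly above it is \<open>\<Omega>\<close>, which is open, and a neighbourhood of a point strictly
  below misses \<open>\<Omega>\<close>.
\<close>

lemma lipschitz_boundary_chart:
  fixes \<Omega> :: "(real^'n) set"
  assumes lip: "lipschitz_boundary \<Omega>" and op: "open \<Omega>" and z: "z \<in> frontier \<Omega>"
  obtains \<nu> K r where "norm \<nu> = 1" "K \<ge> 1" "r > 0"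
    "\<And>x y. x \<in> frontier \<Omega> \<inter> ball z r \<Longrightarrow> y \<in> frontier \<Omega> \<inter> ball z r \<Longrightarrow> dist x y \<le> K * norm (orth_part \<nu> (x - y))"
    "\<And>x s. x \<in> frontier \<Omega> \<inter> ball z r \<Longrightarrow> s > 0 \<Longrightarrow> x + s *\<^sub>R \<nu> \<in> ball z r \<Longrightarrow> x + s *\<^sub>R \<nu> \<in> \<Omega>"
proof -
  obtain \<nu> g L r where \<nu>: "norm \<nu> = 1" and r: "r > 0" and L: "L-lipschitz_on {y. y \<bullet> \<nu> = 0} g"
    and eq: "\<Omega> \<inter> ball z r = {y \<in> ball z r. y \<bullet> \<nu> > (g (orth_part \<nu> y) :: real)}"
    using lip z unfolding lipschitz_boundary_def orth_part_def by blast
  have nn: "\<nu> \<bullet> \<nu> = 1" using \<nu> by (simp add: norm_eq_1)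
  have hyp: "orth_part \<nu> y \<in> {y. y \<bullet> \<nu> = 0}" for y
    by (simp add: orth_part_def inner_diff_left nn)
  define q where "q y = y \<bullet> \<nu> - g (orth_part \<nu> y)" for y
  have "continuous_on UNIV (\<lambda>y. g (orth_part \<nu> y))"
    by (rule continuous_on_compose2[OF lipschitz_on_continuous_on[OF L]])
      (use hyp in \<open>auto simp: orth_part_def[abs_def] intro!: continuous_intros\<close>)
  then have qc: "continuous_on UNIV q" unfolding q_def by (intro continuous_intros)
  have q0: "q y = 0" if y: "y \<in> frontier \<Omega> \<inter> ball z r" for y
  proof (rule ccontr)
    assume "q y \<noteq> 0"
    then consider "q y > 0" | "q y < 0" by linarith
    then show False
    proof cases
      case 1
      then have "y \<in> \<Omega> \<inter> ball z r" using y unfolding eq q_def by auto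
      then show False using y op by (simp add: frontier_def interior_open)
    next
      case 2
      have "open (q -` {..<0})" using continuous_on_open_vimage[OF open_UNIV, of q] qc by auto
      then have "open (q -` {..<0} \<inter> ball z r)" by (intro open_Int) auto
      moreover have "y \<in> q -` {..<0} \<inter> ball z r" using 2 y by auto
      moreover have "y \<in> closure \<Omega>" using y by (simp add: frontier_def)
      ultimately obtain u where "u \<in> \<Omega>" "u \<in> q -` {..<0} \<inter> ball z r"
        unfolding closure_iff_nhds_not_empty by blast
      then have "u \<in> \<Omega> \<inter> ball z r" "q u < 0" by auto
      then show False unfolding eq q_def by auto
    qed
  qed
  have L0: "L \<ge> 0" using lipschitz_on_nonneg[OF L] .
  show ?thesis
  proof (rule that[OF \<nu> _ r, of "1 + L"])
    show "1 + L \<ge> 1" using L0 by simp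
  next
    fix x y assume xy: "x \<in> frontier \<Omega> \<inter> ball z r" "y \<in> frontier \<Omega> \<inter> ball z r"
    have "(x - y) \<bullet> \<nu> = g (orth_part \<nu> x) - g (orth_part \<nu> y)"
      using q0[OF xy(1)] q0[OF xy(2)] by (simp add: q_def inner_diff_left)
    also have "\<bar>\<dots>\<bar> \<le> L * norm (orth_part \<nu> (x - y))"
      using lipschitz_onD[OF L hyp hyp, of x y] by (simp add: dist_norm orth_part_diff)
    finally have "norm (((x - y) \<bullet> \<nu>) *\<^sub>R \<nu>) \<le> L * norm (orth_part \<nu> (x - y))" using \<nu> by simp
    moreover have "x - y = orth_part \<nu> (x - y) + ((x - y) \<bullet> \<nu>) *\<^sub>R \<nu>" by (simp add: orth_part_def)
    then have "norm (x - y) \<le> norm (orth_part \<nu> (x - y)) + norm (((x - y) \<bullet> \<nu>) *\<^sub>R \<nu>)"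
      using norm_triangle_ineq by metis
    ultimately show "dist x y \<le> (1 + L) * norm (orth_part \<nu> (x - y))"
      by (simp add: dist_norm distrib_right)
  next
    fix x s assume x: "x \<in> frontier \<Omega> \<inter> ball z r" and s: "s > 0" "x + s *\<^sub>R \<nu> \<in> ball z r"
    have "q (x + s *\<^sub>R \<nu>) = s"
      using q0[OF x] by (simp add: q_def orth_part_add_scaleR[OF \<nu>] inner_add_left nn)
    then have "x + s *\<^sub>R \<nu> \<in> \<Omega> \<inter> ball z r" using s unfolding eq q_def by auto
    then show "x + s *\<^sub>R \<nu> \<in> \<Omega>" by simp
  qed
qed

lemma emeasure_surface_measure:
  fixes \<Omega> :: "(real^'n) set"
  assumes n: "CARD('n) \<ge> 2" and A: "A \<in> sets borel" "A \<subseteq> frontier \<Omega>"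
  shows "emeasure (surface_measure \<Omega>) A = hausdorff_outer (real CARD('n) - 1) A"
proof -
  have "emeasure (surface_measure \<Omega>) A = emeasure (hausdorff_measure (real CARD('n) - 1)) A"
    unfolding surface_measure_def by (rule emeasure_restrict_space) (use A in auto)
  also have "\<dots> = hausdorff_outer (real CARD('n) - 1) A"
    by (rule emeasure_hausdorff_measure) (use n A in auto)
  finally show ?thesis .
qed

lemma hausdorff_outer_UN_finite:
  "finite I \<Longrightarrow> hausdorff_outer s (\<Union>i\<in>I. A i) \<le> (\<Sum>i\<in>I. hausdorff_outer s (A i))"
proof (induction I rule: finite_induct)
  case (insert i I)
  have "hausdorff_outer s (\<Union>i\<in>insert i I. A i) \<le> hausdorff_outer s (A i) + hausdorff_outer s (\<Union>i\<in>I. A i)"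
    using hausdorff_outer_Un[of s "A i" "\<Union>i\<in>I. A i"] by simp
  also have "\<dots> \<le> hausdorff_outer s (A i) + (\<Sum>i\<in>I. hausdorff_outer s (A i))"
    by (intro add_left_mono insert.IH)
  finally show ?case using insert by simp
qed (simp add: hausdorff_outer_empty)

text \<open>
  By compactness finitely many charts cover the boundary.  In each of them, a piece inside a ball of radius \<open>r\<close>
  generates a tube of height \<open>r\<close> that stays, also after enlargement by \<open>\<rho> \<le> r\<close>, in the ball of radius \<open>3 r\<close>.
\<close>

theorem lipschitz_boundary_upper_regular:
  fixes \<Omega> :: "(real^'n) set"
  assumes \<Omega>: "bounded_lipschitz_domain \<Omega>" and n: "CARD('n) \<ge> 2"
  shows "\<exists>B\<ge>0. \<forall>x r. r > 0 \<longrightarrow>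
     emeasure (surface_measure \<Omega>) (frontier \<Omega> \<inter> ball x r) \<le> ennreal (B * r powr (real CARD('n) - 1))"
proof -
  have op: "open \<Omega>" and lip: "lipschitz_boundary \<Omega>" and bd: "bounded \<Omega>"
    using \<Omega> by (auto simp: bounded_lipschitz_domain_def)
  define N where "N = real CARD('n)"
  have "\<forall>z\<in>frontier \<Omega>. \<exists>\<nu> K r. norm \<nu> = 1 \<and> K \<ge> 1 \<and> r > 0 \<and>
    (\<forall>x\<in>frontier \<Omega> \<inter> ball z r. \<forall>y\<in>frontier \<Omega> \<inter> ball z r. dist x y \<le> K * norm (orth_part \<nu> (x - y)))"
    using lipschitz_boundary_chart[OF lip op] by metis
  then obtain \<nu> K R where ch: "\<And>z. z \<in> frontier \<Omega> \<Longrightarrow> norm (\<nu> z) = 1" "\<And>z. z \<in> frontier \<Omega> \<Longrightarrow> K z \<ge> 1"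
    "\<And>z. z \<in> frontier \<Omega> \<Longrightarrow> R z > 0"
    "\<And>z x y. z \<in> frontier \<Omega> \<Longrightarrow> x \<in> frontier \<Omega> \<inter> ball z (R z) \<Longrightarrow> y \<in> frontier \<Omega> \<inter> ball z (R z) \<Longrightarrow>
       dist x y \<le> K z * norm (orth_part (\<nu> z) (x - y))"
    by metis
  have "compact (frontier \<Omega>)" using bd by (rule compact_frontier_bounded)
  then obtain Z where Z: "Z \<subseteq> frontier \<Omega>" "finite Z" "frontier \<Omega> \<subseteq> (\<Union>z\<in>Z. ball z (R z))"
    using compactE_image[of "frontier \<Omega>" "frontier \<Omega>" "\<lambda>z. ball z (R z)"] ch(3)
    by (metis (no_types, lifting) UN_I centre_in_ball open_ball subsetI)
  define c where "c z = unit_ball_vol (N - 1) * (2 * K z) powr (N - 1) * 2 * 3 ^ CARD('n)" for z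
  have c0: "c z \<ge> 0" for z using n by (simp add: c_def N_def)
  have piece: "hausdorff_outer (N - 1) (frontier \<Omega> \<inter> ball z (R z) \<inter> ball x r) \<le> ennreal (c z * r powr (N - 1))"
    if z: "z \<in> frontier \<Omega>" and r: "r > 0" for z x r
    unfolding hausdorff_outer_def
  proof (rule SUP_least)
    fix \<delta> :: real assume "\<delta> \<in> {0<..}"
    then have \<delta>: "\<delta> > 0" by simp
    let ?A = "frontier \<Omega> \<inter> ball z (R z) \<inter> ball x r"
    define \<rho> where "\<rho> = min r (\<delta> / (4 * K z))"
    have Kz: "K z \<ge> 1" by (rule ch(2)[OF z])
    have \<rho>: "\<rho> > 0" "4 * K z * \<rho> \<le> \<delta>" "\<rho> \<le> r" using r \<delta> Kz by (auto simp: \<rho>_def min_def field_simps)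
    have "hausdorff_content (N - 1) \<delta> ?A \<le> hausdorff_content (N - 1) (4 * K z * \<rho>) ?A"
      by (rule hausdorff_content_antimono[OF \<rho>(2)])
    also have "\<dots> \<le> ennreal (unit_ball_vol (N - 1) * (2 * K z) powr (N - 1) * 2 / (unit_ball_vol N * r)) * emeasure lborel (ball x (3 * r))"
      unfolding N_def
    proof (rule graph_content_le[where a = 0, OF ch(1)[OF z] Kz n _ r \<rho>(1)])
      show "dist u v \<le> K z * norm (orth_part (\<nu> z) (u - v))" if "u \<in> ?A" "v \<in> ?A" for u v
        using ch(4)[OF z] that by blast
      fix u s assume u: "u \<in> ?A" and s: "s \<in> {0..0 + r}"
      show "ball (u + s *\<^sub>R \<nu> z) \<rho> \<subseteq> ball x (3 * r)"
      proof
        fix y assume "y \<in> ball (u + s *\<^sub>R \<nu> z) \<rho>"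
        then have "dist (u + s *\<^sub>R \<nu> z) y < r" using \<rho>(3) by simp
        moreover have "dist u (u + s *\<^sub>R \<nu> z) \<le> r" using s ch(1)[OF z] by (simp add: dist_norm)
        moreover have "dist x u < r" using u by simp
        ultimately show "y \<in> ball x (3 * r)"
          using dist_triangle[of x y u] dist_triangle[of u y "u + s *\<^sub>R \<nu> z"] by simp
      qed
    qed simp
    also have "\<dots> = ennreal (c z * r powr (N - 1))"
    proof -
      have v1: "unit_ball_vol N > 0" using n by (simp add: N_def)
      have e1: "emeasure lborel (ball x (3 * r)) = ennreal (unit_ball_vol N * (3 * r) ^ CARD('n))"
        using r by (simp add: emeasure_ball N_def)
      have e2: "unit_ball_vol (N - 1) * (2 * K z) powr (N - 1) * 2 / (unit_ball_vol N * r) * (unit_ball_vol N * (3 * r) ^ CARD('n)) =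
        c z * (r ^ CARD('n) / r)"
        using v1 r by (simp add: c_def power_mult_distrib)
      have e3: "r ^ CARD('n) / r = r powr (N - 1)" using r by (simp add: N_def powr_diff powr_realpow)
      have "0 \<le> unit_ball_vol (N - 1) * (2 * K z) powr (N - 1) * 2 / (unit_ball_vol N * r)"
        "0 \<le> unit_ball_vol N * (3 * r) ^ CARD('n)"
        using v1 r Kz n by (auto simp: N_def)
      then show ?thesis by (simp only: e1 ennreal_mult[symmetric] e2 e3)
    qed
    finally show "hausdorff_content (N - 1) \<delta> ?A \<le> ennreal (c z * r powr (N - 1))" .
  qed
  show ?thesis
  proof (intro exI[of _ "\<Sum>z\<in>Z. c z"] conjI allI impI)
    show "(\<Sum>z\<in>Z. c z) \<ge> 0" by (intro sum_nonneg c0)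
    fix x and r :: real assume r: "r > 0"
    have "emeasure (surface_measure \<Omega>) (frontier \<Omega> \<inter> ball x r) = hausdorff_outer (N - 1) (frontier \<Omega> \<inter> ball x r)"
      unfolding N_def by (rule emeasure_surface_measure[OF n]) (auto simp: frontier_closed)
    also have "\<dots> \<le> hausdorff_outer (N - 1) (\<Union>z\<in>Z. frontier \<Omega> \<inter> ball z (R z) \<inter> ball x r)"
      by (rule hausdorff_outer_mono) (use Z(3) in auto)
    also have "\<dots> \<le> (\<Sum>z\<in>Z. hausdorff_outer (N - 1) (frontier \<Omega> \<inter> ball z (R z) \<inter> ball x r))"
      by (rule hausdorff_outer_UN_finite[OF Z(2)])
    also have "\<dots> \<le> (\<Sum>z\<in>Z. ennreal (c z * r powr (N - 1)))"
      by (intro sum_mono piece r) (use Z(1) in auto)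
    also have "\<dots> = ennreal ((\<Sum>z\<in>Z. c z) * r powr (N - 1))"
      using c0 by (simp add: sum_distrib_right)
    finally show "emeasure (surface_measure \<Omega>) (frontier \<Omega> \<inter> ball x r) \<le> ennreal ((\<Sum>z\<in>Z. c z) * r powr (real CARD('n) - 1))"
      by (simp add: N_def)
  qed
qed

section \<open>Uniqueness of traces\<close>

lemma integrable_extension_lborel:
  fixes k :: "'a::euclidean_space \<Rightarrow> real"
  assumes \<Omega>: "open \<Omega>" and k: "integrable (lebesgue_on \<Omega>) k"
    and K: "K \<in> borel_measurable lborel" "AE x in lebesgue. K x = indicator \<Omega> x * k x"
  shows "integrable lborel K" "(\<integral>\<^sup>+x. ennreal \<bar>K x\<bar> \<partial>lborel) = ennreal (\<integral>x. \<bar>k x\<bar> \<partial>lebesgue_on \<Omega>)"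
proof -
  have k': "integrable lebesgue (\<lambda>x. indicator \<Omega> x *\<^sub>R k x)"
    using k integrable_restrict_space[OF open_sets_lebesgue[OF \<Omega>], of k] by simp
  have Kl: "K \<in> borel_measurable lebesgue" by (rule measurable_completion[OF K(1)])
  have "integrable lebesgue K"
    by (rule integrable_cong_AE[THEN iffD1, OF borel_measurable_integrable[OF k'] Kl _ k'])
      (use K(2) in \<open>eventually_elim, simp\<close>)
  then show Ki: "integrable lborel K" by (rule integrable_completion[THEN iffD1, OF K(1)])
  have "(\<integral>\<^sup>+x. ennreal \<bar>K x\<bar> \<partial>lborel) = ennreal (\<integral>x. \<bar>K x\<bar> \<partial>lborel)"
    by (rule nn_integral_eq_integral) (use Ki in auto)
  also have "(\<integral>x. \<bar>K x\<bar> \<partial>lborel) = (\<integral>x. \<bar>K x\<bar> \<partial>lebesgue)"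
    by (rule integral_completion[symmetric]) (use K(1) in measurable)
  also have "\<dots> = (\<integral>x. \<bar>indicator \<Omega> x *\<^sub>R k x\<bar> \<partial>lebesgue)"
  proof (rule integral_cong_AE)
    show "(\<lambda>x. \<bar>K x\<bar>) \<in> borel_measurable lebesgue" using Kl by (rule borel_measurable_abs)
    show "(\<lambda>x. \<bar>indicator \<Omega> x *\<^sub>R k x\<bar>) \<in> borel_measurable lebesgue"
      using borel_measurable_integrable[OF k'] by (rule borel_measurable_abs)
    show "AE x in lebesgue. \<bar>K x\<bar> = \<bar>indicator \<Omega> x *\<^sub>R k x\<bar>" using K(2) by eventually_elim simp
  qed
  also have "\<dots> = (\<integral>x. indicator \<Omega> x *\<^sub>R \<bar>k x\<bar> \<partial>lebesgue)"
    by (intro Bochner_Integration.integral_cong) (auto simp: abs_mult)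
  also have "\<dots> = (\<integral>x. \<bar>k x\<bar> \<partial>lebesgue_on \<Omega>)"
    by (rule integral_restrict_space[symmetric, OF open_sets_lebesgue[OF \<Omega>]])
  finally show "(\<integral>\<^sup>+x. ennreal \<bar>K x\<bar> \<partial>lborel) = ennreal (\<integral>x. \<bar>k x\<bar> \<partial>lebesgue_on \<Omega>)" .
qed

text \<open>
  Consider the tube \<open>S\<close> of the points \<open>x + s \<nu>\<close> with \<open>x\<close> in the superlevel set and \<open>h \<le> s \<le> 2 h\<close>.  By
  continuity of \<open>w\<close> and the fundamental theorem along the segment from \<open>y = x + s \<nu>\<close> to \<open>x\<close>, almost every \<open>y\<close> in \<open>S\<close> satisfies
  \<open>\<epsilon> \<le> \<bar>w y\<bar> + I y\<close>, where \<open>I y\<close> is the integral of the derivative along the segment.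
  One of the two terms is at least \<open>\<epsilon> / 2\<close>, and Markov's inequality bounds the volume of \<open>S\<close>.
\<close>

theorem boundary_superlevel_bound:
  fixes \<Omega> :: "(real^'n) set"
  assumes \<Omega>: "open \<Omega>" "bounded \<Omega>" and n: "CARD('n) \<ge> 2"
    and \<nu>: "norm \<nu> = 1" and K: "K \<ge> 1" and h: "h > 0"
    and graph: "\<And>x y. x \<in> frontier \<Omega> \<inter> ball z (4 * h) \<Longrightarrow> y \<in> frontier \<Omega> \<inter> ball z (4 * h) \<Longrightarrow> dist x y \<le> K * norm (orth_part \<nu> (x - y))"
    and inside: "\<And>x s. x \<in> frontier \<Omega> \<inter> ball z (4 * h) \<Longrightarrow> s > 0 \<Longrightarrow> x + s *\<^sub>R \<nu> \<in> ball z (4 * h) \<Longrightarrow> x + s *\<^sub>R \<nu> \<in> \<Omega>"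
    and wc: "continuous_on (closure \<Omega>) w" and wi: "integrable (lebesgue_on \<Omega>) w"
    and G: "integrable (lebesgue_on \<Omega>) G" "is_weak_gradient \<Omega> w G" and \<epsilon>: "\<epsilon> > 0"
  defines "N \<equiv> real CARD('n)"
  shows "hausdorff_outer (N - 1) {x \<in> frontier \<Omega> \<inter> cball z h. \<bar>w x\<bar> \<ge> \<epsilon>} \<le>
    ennreal (unit_ball_vol (N - 1) * (2 * K) powr (N - 1) * 2 / (unit_ball_vol N * h)) *
    ennreal (2 / \<epsilon> * ((\<integral>x. \<bar>w x\<bar> \<partial>lebesgue_on \<Omega>) + 2 * h * (\<integral>x. norm (G x) \<partial>lebesgue_on \<Omega>)))"
proof -
  define A where "A = {x \<in> frontier \<Omega> \<inter> cball z h. \<bar>w x\<bar> \<ge> \<epsilon>}"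
  have frc: "frontier \<Omega> \<subseteq> closure \<Omega>" by (simp add: frontier_def)
  have Ac: "compact A"
  proof -
    have "A = (frontier \<Omega> \<inter> cball z h) \<inter> (\<lambda>x. \<bar>w x\<bar>) -` {\<epsilon>..}" by (auto simp: A_def)
    also have "closed \<dots>"
    proof (rule continuous_closed_preimage)
      show "continuous_on (frontier \<Omega> \<inter> cball z h) (\<lambda>x. \<bar>w x\<bar>)"
        using frc by (intro continuous_on_rabs continuous_on_subset[OF wc]) auto
    qed (auto intro: frontier_closed)
    finally show ?thesis
      by (auto simp: compact_eq_bounded_closed A_def intro: bounded_subset[OF bounded_cball])
  qed
  have Asub: "A \<subseteq> frontier \<Omega> \<inter> ball z (4 * h)" using h by (auto simp: A_def)
  define S where "S = tube \<nu> h (h + h) A"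
  have Sc: "compact S" unfolding S_def by (rule compact_tube[OF Ac])
  have step1: "hausdorff_outer (N - 1) A \<le>
      ennreal (unit_ball_vol (N - 1) * (2 * K) powr (N - 1) * 2 / (unit_ball_vol N * h)) * emeasure lborel S"
    unfolding S_def N_def
    by (rule graph_hausdorff_outer_le[OF \<nu> K n Ac _ h]) (use graph Asub in blast)
  define W where "W x = indicator \<Omega> x * w x" for x
  have Wm: "W \<in> borel_measurable lborel"
    using borel_measurable_continuous_on_indicator[of \<Omega> w] \<Omega>(1) continuous_on_subset[OF wc closure_subset]
    by (simp add: W_def[abs_def])
  have W: "integrable lborel W" "(\<integral>\<^sup>+x. ennreal \<bar>W x\<bar> \<partial>lborel) = ennreal (\<integral>x. \<bar>w x\<bar> \<partial>lebesgue_on \<Omega>)"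
    using integrable_extension_lborel[OF \<Omega>(1) wi Wm] by (auto simp: W_def)
  have Gi: "integrable (lebesgue_on \<Omega>) (\<lambda>x. G x \<bullet> \<nu>)" using G(1) by (rule integrable_inner_left)
  have "(\<lambda>x. indicator \<Omega> x *\<^sub>R (G x \<bullet> \<nu>)) \<in> borel_measurable lebesgue"
    using Gi integrable_restrict_space[OF open_sets_lebesgue[OF \<Omega>(1)], of "\<lambda>x. G x \<bullet> \<nu>"] by auto
  then obtain g where g: "g \<in> borel_measurable lborel" "AE x in lborel. indicator \<Omega> x *\<^sub>R (G x \<bullet> \<nu>) = g x"
    using completion_ex_borel_measurable_real by blast
  have gae: "AE x in lebesgue. g x = indicator \<Omega> x * (G x \<bullet> \<nu>)"
    using AE_completion[OF g(2)] by eventually_elim simp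
  have gi: "integrable lborel g" "(\<integral>\<^sup>+x. ennreal \<bar>g x\<bar> \<partial>lborel) = ennreal (\<integral>x. \<bar>G x \<bullet> \<nu>\<bar> \<partial>lebesgue_on \<Omega>)"
    using integrable_extension_lborel[OF \<Omega>(1) Gi g(1) gae] by auto
  have [measurable]: "W \<in> borel_measurable borel" "g \<in> borel_measurable borel" using Wm g by auto
  define I where "I y = (\<integral>\<^sup>+s. indicator {0..2 * h} s * ennreal \<bar>g (y - s *\<^sub>R \<nu>)\<bar> \<partial>lborel)" for y
  have Im[measurable]: "I \<in> borel_measurable borel"
    unfolding I_def by measurable
  have Iint: "(\<integral>\<^sup>+y. I y \<partial>lborel) \<le> ennreal (2 * h * (\<integral>x. norm (G x) \<partial>lebesgue_on \<Omega>))"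
  proof -
    have "(\<integral>\<^sup>+y. I y \<partial>lborel) = (\<integral>\<^sup>+s. \<integral>\<^sup>+y. indicator {0..2 * h} s * ennreal \<bar>g (y - s *\<^sub>R \<nu>)\<bar> \<partial>lborel \<partial>lborel)"
      unfolding I_def by (rule lborel_pair.Fubini') measurable
    also have "\<dots> = (\<integral>\<^sup>+s. indicator {0..2 * h} s * (\<integral>\<^sup>+y. ennreal \<bar>g y\<bar> \<partial>lborel) \<partial>lborel)"
    proof (rule nn_integral_cong)
      fix s :: real
      have "(\<integral>\<^sup>+y. ennreal \<bar>g y\<bar> \<partial>lborel) = (\<integral>\<^sup>+y. ennreal \<bar>g y\<bar> \<partial>distr lborel borel ((+) (- (s *\<^sub>R \<nu>))))"
        by (simp only: lborel_distr_plus)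
      also have "\<dots> = (\<integral>\<^sup>+y. ennreal \<bar>g (- (s *\<^sub>R \<nu>) + y)\<bar> \<partial>lborel)"
        by (rule nn_integral_distr) measurable
      also have "\<dots> = (\<integral>\<^sup>+y. ennreal \<bar>g (y - s *\<^sub>R \<nu>)\<bar> \<partial>lborel)" by simp
      finally show "(\<integral>\<^sup>+y. indicator {0..2 * h} s * ennreal \<bar>g (y - s *\<^sub>R \<nu>)\<bar> \<partial>lborel) =
          indicator {0..2 * h} s * (\<integral>\<^sup>+y. ennreal \<bar>g y\<bar> \<partial>lborel)"
        by (subst nn_integral_cmult) auto
    qed
    also have "\<dots> = emeasure lborel {0..2 * h} * (\<integral>\<^sup>+y. ennreal \<bar>g y\<bar> \<partial>lborel)"
      by (subst nn_integral_multc) auto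
    also have "\<dots> = ennreal (2 * h * (\<integral>x. \<bar>G x \<bullet> \<nu>\<bar> \<partial>lebesgue_on \<Omega>))"
      using h by (simp add: gi(2) ennreal_mult)
    also have "\<dots> \<le> ennreal (2 * h * (\<integral>x. norm (G x) \<partial>lebesgue_on \<Omega>))"
    proof (intro ennreal_leI mult_left_mono integral_mono)
      show "\<bar>G x \<bullet> \<nu>\<bar> \<le> norm (G x)" for x using Cauchy_Schwarz_ineq2[of "G x" \<nu>] \<nu> by simp
    qed (use h Gi G in auto)
    finally show ?thesis .
  qed
  \<comment> \<open>\<open>s\<close> depends on \<open>y\<close>, and the exceptional null set on the length \<open>t\<close>; rational lengths below \<open>s\<close> suffice, since
    \<open>w\<close> is continuous up to the boundary\<close>
  have "AE y in lborel. \<forall>t\<in>\<rat> \<inter> {0..}. (\<forall>s\<in>{0..t}. y - s *\<^sub>R \<nu> \<in> \<Omega>) \<longrightarrow>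
           W y - W (y - t *\<^sub>R \<nu>) = (\<integral>s. indicator {0..t} s * g (y - s *\<^sub>R \<nu>) \<partial>lborel)"
  proof (subst AE_ball_countable)
    show "countable (\<rat> \<inter> {0::real..})" using countable_rat by (rule countable_subset[rotated]) auto
    show "\<forall>t\<in>\<rat> \<inter> {0..}. AE y in lborel. (\<forall>s\<in>{0..t}. y - s *\<^sub>R \<nu> \<in> \<Omega>) \<longrightarrow>
           W y - W (y - t *\<^sub>R \<nu>) = (\<integral>s. indicator {0..t} s * g (y - s *\<^sub>R \<nu>) \<partial>lborel)"
    proof
      fix t :: real assume "t \<in> \<rat> \<inter> {0..}"
      then show "AE y in lborel. (\<forall>s\<in>{0..t}. y - s *\<^sub>R \<nu> \<in> \<Omega>) \<longrightarrow>
           W y - W (y - t *\<^sub>R \<nu>) = (\<integral>s. indicator {0..t} s * g (y - s *\<^sub>R \<nu>) \<partial>lborel)"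
        by (intro weak_gradient_shift[OF \<Omega> wi W(1) _ G gi(1) gae]) (auto simp: W_def)
    qed
  qed
  then have key: "AE y in lborel. y \<in> S \<longrightarrow> ennreal (\<epsilon> / 2) \<le> ennreal \<bar>W y\<bar> \<or> ennreal (\<epsilon> / 2) \<le> I y"
  proof eventually_elim
    case (elim y)
    show ?case
    proof (rule impI, rule ccontr)
      assume yS: "y \<in> S" and "\<not> (ennreal (\<epsilon> / 2) \<le> ennreal \<bar>W y\<bar> \<or> ennreal (\<epsilon> / 2) \<le> I y)"
      then have Wy: "\<bar>W y\<bar> < \<epsilon> / 2" and Iy: "I y < ennreal (\<epsilon> / 2)"
        using \<epsilon> by (auto simp: not_le ennreal_less_iff)
      then obtain i where i: "I y = ennreal i" "0 \<le> i" "i < \<epsilon> / 2"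
        by (metis ennreal_less_iff enn2real_nonneg ennreal_enn2real_if infinity_ennreal_def less_top_ennreal top.extremum_strict ennreal_enn2real less_top)
      obtain x s where x: "x \<in> A" and s: "h \<le> s" "s \<le> 2 * h" and y: "y = x + s *\<^sub>R \<nu>"
        using yS by (auto simp: S_def tube_def)
      have xf: "x \<in> frontier \<Omega> \<inter> ball z (4 * h)" using Asub x by auto
      have dx: "dist z x \<le> h" using x by (simp add: A_def)
      have seg: "y - t *\<^sub>R \<nu> \<in> \<Omega>" if "0 \<le> t" "t < s" for t
      proof -
        have eq: "y - t *\<^sub>R \<nu> = x + (s - t) *\<^sub>R \<nu>" by (simp add: y algebra_simps)
        have "dist x (x + (s - t) *\<^sub>R \<nu>) < 3 * h" using that s \<nu> h by (simp add: dist_norm)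
        then have "x + (s - t) *\<^sub>R \<nu> \<in> ball z (4 * h)"
          using dx dist_triangle[of z "x + (s - t) *\<^sub>R \<nu>" x] by simp
        then show ?thesis unfolding eq using inside[OF xf] that by simp
      qed
      have close: "\<bar>W y - W (y - t *\<^sub>R \<nu>)\<bar> \<le> i" if t: "t \<in> \<rat>" "0 \<le> t" "t < s" for t
      proof -
        let ?f = "\<lambda>s. indicator {0..t} s * g (y - s *\<^sub>R \<nu>)"
        have "W y - W (y - t *\<^sub>R \<nu>) = (\<integral>s. ?f s \<partial>lborel)"
          using elim t seg by auto
        moreover have "ennreal \<bar>\<integral>s. ?f s \<partial>lborel\<bar> \<le> ennreal i"
        proof (cases "integrable lborel ?f")
          case True
          have "ennreal \<bar>\<integral>s. ?f s \<partial>lborel\<bar> \<le> (\<integral>\<^sup>+s. ennreal (norm (?f s)) \<partial>lborel)"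
            using integral_norm_bound_ennreal[OF True] by simp
          also have "\<dots> \<le> I y" unfolding I_def
            by (rule nn_integral_mono) (use t s in \<open>auto simp: indicator_def\<close>)
          finally show ?thesis by (simp add: i)
        qed (simp add: not_integrable_integral_eq)
        ultimately show ?thesis using i(2) by (simp add: ennreal_le_iff)
      qed
      have y0: "y \<in> \<Omega>" using seg[of 0] s h by simp
      have "\<exists>t\<in>\<rat>. max 0 (s - 1 / real (Suc k)) < t \<and> t < s" for k
        by (rule Rats_dense_in_real) (use s h in auto)
      then obtain t where t: "\<And>k. t k \<in> \<rat>" "\<And>k. max 0 (s - 1 / real (Suc k)) < t k" "\<And>k. t k < s" by metis
      have tlim: "t \<longlonglongrightarrow> s"
      proof (rule tendsto_sandwich[of "\<lambda>k. s - 1 / real (Suc k)" _ _ "\<lambda>_. s"])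
        show "(\<lambda>k. s - 1 / real (Suc k)) \<longlonglongrightarrow> s"
          using tendsto_diff[OF tendsto_const LIMSEQ_Suc[OF lim_inverse_n'], of s] by simp
      qed (use t in \<open>auto intro!: always_eventually less_imp_le\<close>)
      have "(\<lambda>k. y - t k *\<^sub>R \<nu>) \<longlonglongrightarrow> y - s *\<^sub>R \<nu>" by (intro tendsto_intros tlim)
      then have pl: "(\<lambda>k. y - t k *\<^sub>R \<nu>) \<longlonglongrightarrow> x" by (simp add: y)
      have sk: "y - t k *\<^sub>R \<nu> \<in> \<Omega>" for k using seg[of "t k"] t(2,3)[of k] by simp
      have "(\<lambda>k. w (y - t k *\<^sub>R \<nu>)) \<longlonglongrightarrow> w x"
        by (rule continuous_on_tendsto_compose[OF wc pl])
          (use xf frc sk closure_subset in \<open>auto intro!: always_eventually\<close>)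
      then have "(\<lambda>k. \<bar>w (y - t k *\<^sub>R \<nu>)\<bar>) \<longlonglongrightarrow> \<bar>w x\<bar>" by (rule tendsto_rabs)
      moreover have "\<bar>w (y - t k *\<^sub>R \<nu>)\<bar> \<le> \<bar>W y\<bar> + i" for k
      proof -
        have "W (y - t k *\<^sub>R \<nu>) = w (y - t k *\<^sub>R \<nu>)" using sk by (simp add: W_def)
        moreover have "\<bar>W y - W (y - t k *\<^sub>R \<nu>)\<bar> \<le> i" using close[OF t(1) _ t(3)] t(2)[of k] by simp
        ultimately show ?thesis by linarith
      qed
      ultimately have "\<bar>w x\<bar> \<le> \<bar>W y\<bar> + i" by (intro LIMSEQ_le_const2) auto
      then show False using x Wy i(3) by (simp add: A_def)
    qed
  qed
  let ?E = "ennreal (2 / \<epsilon>)"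
  have mk: "emeasure lborel {y. ennreal (\<epsilon> / 2) \<le> f y} \<le> ?E * (\<integral>\<^sup>+y. f y \<partial>lborel)"
    if [measurable]: "f \<in> borel_measurable borel" for f :: "real^'n \<Rightarrow> ennreal"
  proof -
    have "{y. ennreal (\<epsilon> / 2) \<le> f y} = {y \<in> space lborel. 1 \<le> ?E * f y}"
    proof -
      have "ennreal (\<epsilon> / 2) \<le> f y \<longleftrightarrow> 1 \<le> ?E * f y" for y
      proof -
        have one: "?E * ennreal (\<epsilon> / 2) = 1" using \<epsilon> by (simp add: ennreal_mult[symmetric])
        have two: "ennreal (\<epsilon> / 2) * ?E = 1" using \<epsilon> by (simp add: ennreal_mult[symmetric])
        show ?thesis
        proof
          assume "ennreal (\<epsilon> / 2) \<le> f y"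
          from mult_left_mono[OF this, of ?E] show "1 \<le> ?E * f y" using one by simp
        next
          assume "1 \<le> ?E * f y"
          from mult_left_mono[OF this, of "ennreal (\<epsilon> / 2)"] show "ennreal (\<epsilon> / 2) \<le> f y"
            using two by (simp add: mult.assoc[symmetric])
        qed
      qed
      then show ?thesis by simp
    qed
    then show ?thesis
      using nn_integral_Markov_inequality[of "\<lambda>y. f y" UNIV lborel "2 / \<epsilon>"] \<epsilon> by simp
  qed
  have "emeasure lborel S \<le> emeasure lborel ({y. ennreal (\<epsilon> / 2) \<le> ennreal \<bar>W y\<bar>} \<union> {y. ennreal (\<epsilon> / 2) \<le> I y})"
  proof (rule emeasure_mono_AE)
    show "AE y in lborel. y \<in> S \<longrightarrow> y \<in> {y. ennreal (\<epsilon> / 2) \<le> ennreal \<bar>W y\<bar>} \<union> {y. ennreal (\<epsilon> / 2) \<le> I y}"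
      using key by eventually_elim auto
    show "{y. ennreal (\<epsilon> / 2) \<le> ennreal \<bar>W y\<bar>} \<union> {y. ennreal (\<epsilon> / 2) \<le> I y} \<in> sets lborel" by measurable
  qed
  also have "\<dots> \<le> emeasure lborel {y. ennreal (\<epsilon> / 2) \<le> ennreal \<bar>W y\<bar>} + emeasure lborel {y. ennreal (\<epsilon> / 2) \<le> I y}"
    by (rule emeasure_subadditive) measurable
  also have "\<dots> \<le> ?E * (\<integral>\<^sup>+y. ennreal \<bar>W y\<bar> \<partial>lborel) + ?E * (\<integral>\<^sup>+y. I y \<partial>lborel)"
    by (intro add_mono mk) measurable
  also have "\<dots> \<le> ?E * ennreal (\<integral>x. \<bar>w x\<bar> \<partial>lebesgue_on \<Omega>) + ?E * ennreal (2 * h * (\<integral>x. norm (G x) \<partial>lebesgue_on \<Omega>))"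
    by (intro add_mono mult_left_mono Iint) (auto simp: W)
  also have "\<dots> = ennreal (2 / \<epsilon> * ((\<integral>x. \<bar>w x\<bar> \<partial>lebesgue_on \<Omega>) + 2 * h * (\<integral>x. norm (G x) \<partial>lebesgue_on \<Omega>)))"
  proof -
    have "?E * ennreal a + ?E * ennreal b = ennreal (2 / \<epsilon> * (a + b))" if "a \<ge> 0" "b \<ge> 0" for a b
    proof -
      have "?E * ennreal a = ennreal (2 / \<epsilon> * a)" "?E * ennreal b = ennreal (2 / \<epsilon> * b)"
        using that \<epsilon> by (auto intro!: ennreal_mult[symmetric] simp del: times_divide_eq_left times_divide_eq_right)
      moreover have "ennreal (2 / \<epsilon> * a) + ennreal (2 / \<epsilon> * b) = ennreal (2 / \<epsilon> * a + 2 / \<epsilon> * b)"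
        using that \<epsilon> by (intro ennreal_plus[symmetric]) auto
      ultimately show ?thesis by (simp only: distrib_left)
    qed
    then show ?thesis using h by simp
  qed
  finally show ?thesis
    using step1 unfolding A_def by (meson mult_left_mono order_trans zero_le)
qed

lemma Lp_tendsto_imp_L1_tendsto:
  fixes f :: "nat \<Rightarrow> 'a \<Rightarrow> 'b::{banach,second_countable_topology}"
  assumes M: "finite_measure M" and p: "p \<ge> 1" and f: "\<And>j. f j \<in> Lp M p"
    and lim: "(\<lambda>j. \<integral>x. norm (f j x) powr p \<partial>M) \<longlonglongrightarrow> 0"
  shows "(\<lambda>j. \<integral>x. norm (f j x) \<partial>M) \<longlonglongrightarrow> 0"
proof (rule LIMSEQ_I)
  fix e :: real assume e: "e > 0"
  interpret finite_measure M by fact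
  let ?m = "measure M (space M)"
  define \<delta> where "\<delta> = e / (2 * (?m + 1))"
  have m0: "?m \<ge> 0" by simp
  have "?m + 1 > 0" using m0 by linarith
  then have \<delta>: "\<delta> > 0" using e unfolding \<delta>_def by (intro divide_pos_pos mult_pos_pos) simp_all
  have fi: "integrable M (f j)" and fp: "integrable M (\<lambda>x. norm (f j x) powr p)" for j
    using Lp_integrable[OF M f p] f[of j] by (auto simp: Lp_def)
  have pt: "norm y \<le> \<delta> + \<delta> powr (1 - p) * norm y powr p" for y :: 'b
  proof (cases "norm y \<le> \<delta>")
    case False
    then have ny: "norm y > 0" "norm y \<ge> \<delta>" using \<delta> by auto
    have "\<delta> powr (p - 1) \<le> norm y powr (p - 1)" using ny \<delta> p by (intro powr_mono2) auto
    then have "\<delta> powr (1 - p) * \<delta> powr (p - 1) \<le> \<delta> powr (1 - p) * norm y powr (p - 1)"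
      by (rule mult_left_mono) simp
    moreover have "\<delta> powr (1 - p) * \<delta> powr (p - 1) = 1" using \<delta> by (simp add: powr_add[symmetric])
    ultimately have "1 \<le> \<delta> powr (1 - p) * norm y powr (p - 1)" by simp
    then have "1 * norm y \<le> \<delta> powr (1 - p) * norm y powr (p - 1) * norm y" by (rule mult_right_mono) simp
    then have "norm y \<le> \<delta> powr (1 - p) * (norm y powr (p - 1) * norm y)" by (simp only: mult_1_left mult.assoc)
    also have "norm y powr (p - 1) * norm y = norm y powr p"
      using ny(1) by (simp add: powr_diff)
    finally show ?thesis using \<delta> by simp
  qed (simp add: add_increasing2)
  have int: "(\<integral>x. norm (f j x) \<partial>M) \<le> \<delta> * ?m + \<delta> powr (1 - p) * (\<integral>x. norm (f j x) powr p \<partial>M)" for j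
  proof -
    have "(\<integral>x. norm (f j x) \<partial>M) \<le> (\<integral>x. \<delta> + \<delta> powr (1 - p) * norm (f j x) powr p \<partial>M)"
      using fi fp pt by (intro integral_mono) auto
    also have "\<dots> = \<delta> * ?m + \<delta> powr (1 - p) * (\<integral>x. norm (f j x) powr p \<partial>M)"
      using fp by simp
    finally show ?thesis .
  qed
  have "\<delta> * ?m \<le> \<delta> * (?m + 1)" using \<delta> by simp
  also have "\<dots> = e / 2" unfolding \<delta>_def using \<open>?m + 1 > 0\<close> by (simp add: divide_simps)
  finally have d: "\<delta> * ?m \<le> e / 2" .
  have "e / 2 / \<delta> powr (1 - p) > 0" using e \<delta> by simp
  then obtain N where N: "\<And>j. j \<ge> N \<Longrightarrow> norm ((\<integral>x. norm (f j x) powr p \<partial>M) - 0) < e / 2 / \<delta> powr (1 - p)"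
    using LIMSEQ_D[OF lim] by blast
  show "\<exists>no. \<forall>j\<ge>no. norm ((\<integral>x. norm (f j x) \<partial>M) - 0) < e"
  proof (intro exI[of _ N] allI impI)
    fix j assume j: "j \<ge> N"
    have "(\<integral>x. norm (f j x) powr p \<partial>M) < e / 2 / \<delta> powr (1 - p)" using N[OF j] by simp
    from mult_strict_left_mono[OF this, of "\<delta> powr (1 - p)"]
    have "\<delta> powr (1 - p) * (\<integral>x. norm (f j x) powr p \<partial>M) < e / 2"
      using \<delta> by simp
    then show "norm ((\<integral>x. norm (f j x) \<partial>M) - 0) < e" using int[of j] d by simp
  qed
qed

lemma tendsto_zero_of_powr:
  fixes X :: "nat \<Rightarrow> real"
  assumes "(\<lambda>j. X j powr (1 / p)) \<longlonglongrightarrow> 0" "\<And>j. X j \<ge> 0" "p > 0"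
  shows "X \<longlonglongrightarrow> 0"
proof -
  have "(\<lambda>j. (X j powr (1 / p)) powr p) \<longlonglongrightarrow> 0"
    by (rule tendsto_zero_powrI[OF assms(1) tendsto_const]) (use assms in auto)
  moreover have "(X j powr (1 / p)) powr p = X j" for j
    using assms(2)[of j] assms(3) by (simp add: powr_powr)
  ultimately show ?thesis by simp
qed

lemma space_surface_measure [simp]: "space (surface_measure \<Omega>) = frontier \<Omega>"
  by (simp add: surface_measure_def space_restrict_space)

lemma continuous_surface_measurable:
  fixes f :: "real^'n \<Rightarrow> real"
  assumes "continuous_on (frontier \<Omega>) f"
  shows "f \<in> borel_measurable (surface_measure \<Omega>)"
proof -
  have "f \<in> borel_measurable (restrict_space borel (frontier \<Omega>))"
    by (rule borel_measurable_continuous_on_restrict[OF assms])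
  moreover have "sets (surface_measure \<Omega>) = sets (restrict_space borel (frontier \<Omega>))"
    unfolding surface_measure_def by (rule sets_restrict_space_cong) simp
  ultimately show ?thesis by (subst measurable_cong_sets[OF _ refl])
qed

lemma continuous_surface_Lp:
  fixes f :: "real^'n \<Rightarrow> real"
  assumes fin: "finite_measure (surface_measure \<Omega>)" and bd: "bounded \<Omega>" and f: "continuous_on (frontier \<Omega>) f" and p: "p \<ge> 0"
  shows "f \<in> Lp (surface_measure \<Omega>) p"
proof -
  interpret finite_measure "surface_measure \<Omega>" by fact
  have m: "f \<in> borel_measurable (surface_measure \<Omega>)" by (rule continuous_surface_measurable[OF f])
  have "bounded (f ` frontier \<Omega>)"
    using f compact_frontier_bounded[OF bd] by (intro compact_imp_bounded compact_continuous_image)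
  then obtain B where B: "\<And>x. x \<in> frontier \<Omega> \<Longrightarrow> \<bar>f x\<bar> \<le> B" by (auto simp: bounded_iff)
  have "integrable (surface_measure \<Omega>) (\<lambda>x. norm (f x) powr p)"
  proof (rule integrable_const_bound[where B = "B powr p"])
    show "(\<lambda>x. norm (f x) powr p) \<in> borel_measurable (surface_measure \<Omega>)" using m by measurable
    show "AE x in surface_measure \<Omega>. norm (norm (f x) powr p) \<le> B powr p"
      using B p by (intro AE_I2) (simp add: powr_mono2)
  qed
  then show ?thesis using m by (simp add: Lp_def)
qed

text \<open>
  Let \<open>\<phi> j\<close> be continuous functions that converge to \<open>u\<close> in the Sobolev norm and to \<open>g\<close> on the boundary.  Where \<open>\<bar>g - u\<bar> \<ge> 2 \<epsilon>\<close>, one of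
  \<open>\<bar>\<phi> j - u\<bar>\<close> and \<open>\<bar>\<phi> j - g\<bar>\<close> is at least \<open>\<epsilon>\<close>.  The measure of the first set tends to zero by the
  bound for superlevel sets, that of the second by Markov's inequality.
\<close>

theorem is_trace_unique:
  fixes \<Omega> :: "(real^'n) set"
  assumes \<Omega>: "bounded_lipschitz_domain \<Omega>" and n: "CARD('n) \<ge> 2" and p: "p > 1"
    and fin: "finite_measure (surface_measure \<Omega>)"
    and u: "continuous_on (closure \<Omega>) u" "u \<in> sobolev \<Omega> p" and tr: "is_trace \<Omega> p u g"
  shows "AE x in surface_measure \<Omega>. g x = u x"
proof -
  have op: "open \<Omega>" and lip: "lipschitz_boundary \<Omega>" and bd: "bounded \<Omega>"
    using \<Omega> by (auto simp: bounded_lipschitz_domain_def)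
  have p1: "p \<ge> 1" and p0: "p > 0" using p by auto
  let ?M = "surface_measure \<Omega>"
  interpret fM: finite_measure ?M by fact
  have frc: "frontier \<Omega> \<subseteq> closure \<Omega>" by (simp add: frontier_def)
  note fL = finite_measure_lebesgue_on_open[OF op bd]
  obtain \<phi> where g: "g \<in> Lp ?M p" and \<phi>: "\<And>j. \<phi> j \<in> sobolev \<Omega> p" "\<And>j. continuous_on (closure \<Omega>) (\<phi> j)"
    and lim1: "(\<lambda>j. sobolev_norm \<Omega> p (\<lambda>x. \<phi> j x - u x)) \<longlonglongrightarrow> 0"
    and lim2: "(\<lambda>j. Lp_norm ?M p (\<lambda>x. \<phi> j x - g x)) \<longlonglongrightarrow> 0"
    using tr unfolding is_trace_def by blast
  define w where "w j = (\<lambda>x. \<phi> j x - u x)" for j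
  define G where "G j = weak_gradient \<Omega> p (w j)" for j
  have ws: "w j \<in> sobolev \<Omega> p" for j unfolding w_def by (rule sobolev_diff[OF op bd p1 \<phi>(1) u(2)])
  note wG = sobolev_weak_gradient[OF ws, folded G_def]
  have wc: "continuous_on (closure \<Omega>) (w j)" for j unfolding w_def by (intro continuous_intros \<phi> u)
  define X where "X j = (\<integral>x. norm (w j x) powr p \<partial>lebesgue_on \<Omega>)" for j
  define Y where "Y j = (\<integral>x. norm (G j x) powr p \<partial>lebesgue_on \<Omega>)" for j
  have X0: "X j \<ge> 0" and Y0: "Y j \<ge> 0" for j by (auto simp: X_def Y_def)
  have "(\<lambda>j. X j + Y j) \<longlonglongrightarrow> 0"
  proof (rule tendsto_zero_of_powr[OF _ _ p0])
    show "(\<lambda>j. (X j + Y j) powr (1 / p)) \<longlonglongrightarrow> 0"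
      using lim1 by (simp add: sobolev_norm_def X_def Y_def G_def w_def)
  qed (use X0 Y0 in \<open>simp add: add_nonneg_nonneg\<close>)
  then have Xl: "X \<longlonglongrightarrow> 0" and Yl: "Y \<longlonglongrightarrow> 0"
    using X0 Y0 by (auto intro: tendsto_sandwich[OF _ _ tendsto_const, where h = "\<lambda>j. X j + Y j"])
  define a where "a j = (\<integral>x. \<bar>w j x\<bar> \<partial>lebesgue_on \<Omega>)" for j
  define b where "b j = (\<integral>x. norm (G j x) \<partial>lebesgue_on \<Omega>)" for j
  have al: "a \<longlonglongrightarrow> 0"
    using Lp_tendsto_imp_L1_tendsto[OF fL p1 wG(1)] Xl by (simp add: X_def[abs_def] a_def[abs_def])
  have bl: "b \<longlonglongrightarrow> 0"
    using Lp_tendsto_imp_L1_tendsto[OF fL p1 wG(2)] Yl by (simp add: Y_def[abs_def] b_def[abs_def])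
  define Z where "Z j = (\<integral>x. norm (\<phi> j x - g x) powr p \<partial>?M)" for j
  have Zl: "Z \<longlonglongrightarrow> 0"
    by (rule tendsto_zero_of_powr[OF _ _ p0]) (use lim2 in \<open>simp_all add: Lp_norm_def Z_def\<close>)
  have fcont: "continuous_on (frontier \<Omega>) (\<phi> j)" and ucont: "continuous_on (frontier \<Omega>) u" for j
    by (rule continuous_on_subset[OF \<phi>(2) frc], rule continuous_on_subset[OF u(1) frc])
  have \<phi>L: "\<phi> j \<in> Lp ?M p" for j
    by (rule continuous_surface_Lp[OF fin bd fcont]) (use p in simp)
  have dL: "(\<lambda>x. \<phi> j x - g x) \<in> Lp ?M p" for j
    by (rule Lp_diff[OF \<phi>L g]) (use p in simp)
  have um[measurable]: "u \<in> borel_measurable ?M" by (rule continuous_surface_measurable[OF ucont])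
  have gm[measurable]: "g \<in> borel_measurable ?M" using g by (simp add: Lp_def)
  have fm[measurable]: "\<phi> j \<in> borel_measurable ?M" for j by (rule continuous_surface_measurable[OF fcont])
  have cbM[measurable]: "Measurable.pred ?M (\<lambda>x. x \<in> cball z h)" for z h
  proof -
    have "frontier \<Omega> \<inter> cball z h \<in> sets ?M"
      unfolding surface_measure_def by (subst sets_restrict_space_iff) auto
    moreover have "{x \<in> space ?M. x \<in> cball z h} = frontier \<Omega> \<inter> cball z h" by auto
    ultimately show ?thesis by (simp add: pred_def)
  qed
  have loc: "\<exists>h>0. AE x in ?M. x \<in> cball z h \<longrightarrow> g x = u x" if z: "z \<in> frontier \<Omega>" for z
  proof -
    obtain \<nu> K r where \<nu>: "norm \<nu> = 1" and K: "K \<ge> 1" and r: "r > 0"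
      and gr: "\<And>x y. x \<in> frontier \<Omega> \<inter> ball z r \<Longrightarrow> y \<in> frontier \<Omega> \<inter> ball z r \<Longrightarrow> dist x y \<le> K * norm (orth_part \<nu> (x - y))"
      and ins: "\<And>x s. x \<in> frontier \<Omega> \<inter> ball z r \<Longrightarrow> s > 0 \<Longrightarrow> x + s *\<^sub>R \<nu> \<in> ball z r \<Longrightarrow> x + s *\<^sub>R \<nu> \<in> \<Omega>"
      using lipschitz_boundary_chart[OF lip op z] by metis
    define h where "h = r / 4"
    have h: "h > 0" and h4: "4 * h = r" using r by (auto simp: h_def)
    let ?N = "real CARD('n)"
    let ?C = "unit_ball_vol (?N - 1) * (2 * K) powr (?N - 1) * 2 / (unit_ball_vol ?N * h)"
    have C0: "?C \<ge> 0" using h K n by (intro divide_nonneg_nonneg mult_nonneg_nonneg unit_ball_vol_nonneg) auto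
    have null: "emeasure ?M {x \<in> space ?M. x \<in> cball z h \<and> 2 * \<epsilon> \<le> \<bar>g x - u x\<bar>} = 0" if \<epsilon>: "\<epsilon> > 0" for \<epsilon>
    proof -
      let ?S = "{x \<in> space ?M. x \<in> cball z h \<and> 2 * \<epsilon> \<le> \<bar>g x - u x\<bar>}"
      define c where "c j = ?C * (2 / \<epsilon> * (a j + 2 * h * b j)) + (1 / \<epsilon> powr p) * Z j" for j
      have "emeasure ?M ?S \<le> ennreal (c j)" for j
      proof -
        let ?A = "{x \<in> frontier \<Omega> \<inter> cball z h. \<bar>w j x\<bar> \<ge> \<epsilon>}"
        let ?B = "{x \<in> space ?M. \<epsilon> \<le> \<bar>\<phi> j x - g x\<bar>}"
        have Am: "?A \<in> sets borel"
        proof -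
          have "?A = (frontier \<Omega> \<inter> cball z h) \<inter> (\<lambda>x. \<bar>w j x\<bar>) -` {\<epsilon>..}" by auto
          also have "closed \<dots>"
          proof (rule continuous_closed_preimage)
            show "continuous_on (frontier \<Omega> \<inter> cball z h) (\<lambda>x. \<bar>w j x\<bar>)"
              using frc by (intro continuous_on_rabs continuous_on_subset[OF wc]) auto
          qed auto
          finally show ?thesis by simp
        qed
        then have AM: "?A \<in> sets ?M"
          unfolding surface_measure_def by (subst sets_restrict_space_iff) auto
        have "emeasure ?M ?S \<le> emeasure ?M (?A \<union> ?B)"
        proof (rule emeasure_mono)
          show "?S \<subseteq> ?A \<union> ?B" unfolding w_def by auto
          show "?A \<union> ?B \<in> sets ?M" using AM by measurable
        qed
        also have "\<dots> \<le> emeasure ?M ?A + emeasure ?M ?B"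
          by (rule emeasure_subadditive[OF AM]) measurable
        also have "emeasure ?M ?A = hausdorff_outer (?N - 1) ?A"
          by (rule emeasure_surface_measure[OF n Am]) auto
        also have "\<dots> \<le> ennreal ?C * ennreal (2 / \<epsilon> * (a j + 2 * h * b j))"
          unfolding a_def b_def
          by (rule boundary_superlevel_bound[OF op bd n \<nu> K h _ _ wc Lp_integrable[OF fL wG(1) p1] Lp_integrable[OF fL wG(2) p1] wG(3) \<epsilon>])
            (use gr ins h4 in auto)
        also have "\<dots> = ennreal (?C * (2 / \<epsilon> * (a j + 2 * h * b j)))"
          using C0 \<epsilon> h by (intro ennreal_mult[symmetric]) (auto simp: a_def b_def)
        also have "emeasure ?M ?B \<le> ennreal ((1 / \<epsilon> powr p) * Z j)"
        proof -
          have fi: "integrable ?M (\<lambda>x. norm (\<phi> j x - g x) powr p)" using dL[of j] by (simp add: Lp_def)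
          have "?B \<subseteq> {x \<in> space ?M. norm (\<phi> j x - g x) powr p \<ge> \<epsilon> powr p}"
            using \<epsilon> p by (auto intro!: powr_mono2)
          then have "emeasure ?M ?B \<le> emeasure ?M {x \<in> space ?M. norm (\<phi> j x - g x) powr p \<ge> \<epsilon> powr p}"
            by (rule emeasure_mono) measurable
          also have "\<dots> \<le> ennreal ((1 / \<epsilon> powr p) * Z j)"
            unfolding Z_def by (rule integral_Markov_inequality[OF fi]) (use \<epsilon> in auto)
          finally show ?thesis .
        qed
        finally have "emeasure ?M ?S \<le> ennreal (?C * (2 / \<epsilon> * (a j + 2 * h * b j))) + ennreal ((1 / \<epsilon> powr p) * Z j)"
          by (simp add: add_right_mono)
        also have "\<dots> = ennreal (c j)"
          unfolding c_def using C0 \<epsilon> h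
          by (intro ennreal_plus[symmetric] mult_nonneg_nonneg add_nonneg_nonneg) (auto simp: a_def b_def Z_def)
        finally show ?thesis .
      qed
      moreover have "(\<lambda>j. ennreal (c j)) \<longlonglongrightarrow> ennreal 0"
      proof (rule tendsto_ennrealI)
        have "c \<longlonglongrightarrow> ?C * (2 / \<epsilon> * (0 + 2 * h * 0)) + (1 / \<epsilon> powr p) * 0"
          unfolding c_def by (intro tendsto_intros al bl Zl)
        then show "c \<longlonglongrightarrow> 0" by simp
      qed
      ultimately have "emeasure ?M ?S \<le> ennreal 0"
        by (intro LIMSEQ_le_const) auto
      then show ?thesis by simp
    qed
    have "AE x in ?M. \<forall>m::nat. \<not> (x \<in> cball z h \<and> 2 * (1 / real (Suc m)) \<le> \<bar>g x - u x\<bar>)"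
    proof (subst AE_all_countable, rule allI)
      fix m :: nat
      have "{x \<in> space ?M. x \<in> cball z h \<and> 2 * (1 / real (Suc m)) \<le> \<bar>g x - u x\<bar>} \<in> null_sets ?M"
        by (rule null_setsI[OF null]) measurable
      from AE_not_in[OF this] AE_space
      show "AE x in ?M. \<not> (x \<in> cball z h \<and> 2 * (1 / real (Suc m)) \<le> \<bar>g x - u x\<bar>)"
        by eventually_elim simp
    qed
    then have "AE x in ?M. x \<in> cball z h \<longrightarrow> g x = u x"
    proof eventually_elim
      case (elim x)
      show ?case
      proof (rule impI, rule ccontr)
        assume "x \<in> cball z h" "g x \<noteq> u x"
        then have "\<bar>g x - u x\<bar> / 2 > 0" by simp
        then obtain m where "1 / real (Suc m) < \<bar>g x - u x\<bar> / 2" using nat_approx_posE by blast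
        moreover have "\<not> 2 * (1 / real (Suc m)) \<le> \<bar>g x - u x\<bar>" using elim \<open>x \<in> cball z h\<close> by blast
        moreover have "q < t / 2 \<Longrightarrow> \<not> 2 * q \<le> t \<Longrightarrow> False" for q t :: real by linarith
        ultimately show False by blast
      qed
    qed
    then show ?thesis using h by blast
  qed
  then obtain h where h: "\<And>z. z \<in> frontier \<Omega> \<Longrightarrow> h z > 0"
    "\<And>z. z \<in> frontier \<Omega> \<Longrightarrow> AE x in ?M. x \<in> cball z (h z) \<longrightarrow> g x = u x" by metis
  have "compact (frontier \<Omega>)" using bd by (rule compact_frontier_bounded)
  then obtain D where D: "D \<subseteq> frontier \<Omega>" "finite D" "frontier \<Omega> \<subseteq> (\<Union>z\<in>D. ball z (h z))"
    using compactE_image[of "frontier \<Omega>" "frontier \<Omega>" "\<lambda>z. ball z (h z)"] h(1)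
    by (metis (no_types, lifting) UN_I centre_in_ball open_ball subsetI)
  have "AE x in ?M. \<forall>z\<in>D. x \<in> cball z (h z) \<longrightarrow> g x = u x"
    by (rule AE_finite_allI[OF D(2)]) (use h(2) D(1) in auto)
  then show ?thesis
  proof (rule AE_mp, intro AE_I2 impI)
    fix x assume x: "x \<in> space ?M" "\<forall>z\<in>D. x \<in> cball z (h z) \<longrightarrow> g x = u x"
    then obtain z where "z \<in> D" "x \<in> ball z (h z)" using D(3) by auto
    then have "x \<in> cball z (h z)" by simp
    then show "g x = u x" using x(2) \<open>z \<in> D\<close> by blast
  qed
qed

section \<open>Cutoff functions\<close>

definition sq_pos :: "real \<Rightarrow> real" where "sq_pos t = (max 0 t)\<^sup>2"

lemma sq_pos_deriv: "(sq_pos has_real_derivative 2 * max 0 t) (at t)"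
proof -
  consider "t > 0" | "t < 0" | "t = 0" by linarith
  then show ?thesis
  proof cases
    case 1
    have "((\<lambda>t. t\<^sup>2) has_real_derivative 2 * max 0 t) (at t)"
      using 1 by (auto intro!: derivative_eq_intros)
    then show ?thesis
      by (rule has_field_derivative_transform_within_open[where S = "{0<..}"]) (use 1 in \<open>auto simp: sq_pos_def\<close>)
  next
    case 2
    have "((\<lambda>t. 0) has_real_derivative 2 * max 0 t) (at t)" using 2 by simp
    then show ?thesis
      by (rule has_field_derivative_transform_within_open[where S = "{..<0}"]) (use 2 in \<open>auto simp: sq_pos_def\<close>)
  next
    case 3
    have "((\<lambda>h. sq_pos h / h) \<longlongrightarrow> 0) (at 0)"
    proof (rule Lim_null_comparison)
      show "\<forall>\<^sub>F h in at 0. norm (sq_pos h / h) \<le> \<bar>h\<bar>"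
        by (intro always_eventually allI) (auto simp: sq_pos_def max_def power2_eq_square)
      show "((\<lambda>h::real. \<bar>h\<bar>) \<longlongrightarrow> 0) (at 0)" by (intro tendsto_rabs_zero tendsto_ident_at)
    qed
    then show ?thesis using 3 by (simp add: DERIV_def sq_pos_def)
  qed
qed

text \<open>
  Being a composition of \<open>C\<^sup>1\<close> functions, this one is \<open>C\<^sup>1\<close> and not just Lipschitz.  The inner argument is at most \<open>0\<close> on the ball of
  radius \<open>r\<close> and at least \<open>1\<close> (in fact \<open>3\<close>) outside the ball of radius \<open>2 r\<close>.
\<close>

definition cutoff :: "'a::euclidean_space \<Rightarrow> real \<Rightarrow> 'a \<Rightarrow> real" where
  "cutoff c r x = sq_pos (1 - sq_pos ((x - c) \<bullet> (x - c) / r\<^sup>2 - 1))"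

definition cutoff_grad :: "'a::euclidean_space \<Rightarrow> real \<Rightarrow> 'a \<Rightarrow> 'a" where
  "cutoff_grad c r x = (let s = (x - c) \<bullet> (x - c) / r\<^sup>2 - 1 in
     (2 * max 0 (1 - sq_pos s) * (- (2 * max 0 s)) * (2 / r\<^sup>2)) *\<^sub>R (x - c))"

lemma C1_gradient_cutoff: "C1_gradient (cutoff c r) (cutoff_grad c r)"
proof -
  have "(cutoff c r has_derivative (\<lambda>h. cutoff_grad c r x \<bullet> h)) (at x)" for x
  proof -
    let ?s = "\<lambda>x. (x - c) \<bullet> (x - c) / r\<^sup>2 - 1"
    have s: "(?s has_derivative (\<lambda>h. 2 / r\<^sup>2 * ((x - c) \<bullet> h))) (at x)"
    proof -
      have 0: "((\<lambda>x. (x - c) \<bullet> (x - c)) has_derivative (\<lambda>h. 2 * ((x - c) \<bullet> h))) (at x)"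
        by (auto intro!: derivative_eq_intros simp: inner_commute)
      have "((\<lambda>x. 1 / r\<^sup>2 * ((x - c) \<bullet> (x - c)) - 1) has_derivative (\<lambda>h. 1 / r\<^sup>2 * (2 * ((x - c) \<bullet> h)) - 0)) (at x)"
        by (intro has_derivative_diff has_derivative_mult_right 0 has_derivative_const)
      then show ?thesis by simp
    qed
    have 1: "((\<lambda>x. 1 - sq_pos (?s x)) has_derivative (\<lambda>h. 0 - (2 / r\<^sup>2 * ((x - c) \<bullet> h)) * (2 * max 0 (?s x)))) (at x)"
      by (intro has_derivative_diff has_derivative_const DERIV_compose_FDERIV[OF sq_pos_deriv s])
    have "((\<lambda>x. sq_pos (1 - sq_pos (?s x))) has_derivative
       (\<lambda>h. (0 - (2 / r\<^sup>2 * ((x - c) \<bullet> h)) * (2 * max 0 (?s x))) * (2 * max 0 (1 - sq_pos (?s x))))) (at x)"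
      by (rule DERIV_compose_FDERIV[OF sq_pos_deriv 1])
    moreover have "(\<lambda>h. (0 - (2 / r\<^sup>2 * ((x - c) \<bullet> h)) * (2 * max 0 (?s x))) * (2 * max 0 (1 - sq_pos (?s x)))) =
       (\<lambda>h. cutoff_grad c r x \<bullet> h)"
      by (simp add: cutoff_grad_def Let_def fun_eq_iff mult_ac)
    ultimately show ?thesis by (simp add: cutoff_def[abs_def])
  qed
  moreover have "continuous_on UNIV (cutoff_grad c r)"
    unfolding cutoff_grad_def[abs_def] Let_def sq_pos_def
    by (cases "r = 0") (auto intro!: continuous_intros)
  ultimately show ?thesis by (simp add: C1_gradient_def)
qed

lemma cutoff_bounds: "0 \<le> cutoff c r x" "cutoff c r x \<le> 1"
proof -
  have "0 \<le> max 0 (1 - sq_pos t) \<and> max 0 (1 - sq_pos t) \<le> 1" for t by (auto simp: sq_pos_def)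
  then show "0 \<le> cutoff c r x" "cutoff c r x \<le> 1"
    unfolding cutoff_def sq_pos_def[of "1 - _"] by (auto intro: power_le_one)
qed

lemma cutoff_eq_1:
  assumes "r > 0" "dist x c \<le> r"
  shows "cutoff c r x = 1"
proof -
  have "(x - c) \<bullet> (x - c) \<le> r\<^sup>2"
    using assms by (simp add: dist_norm power_mono flip: power2_norm_eq_inner)
  then have "(x - c) \<bullet> (x - c) / r\<^sup>2 - 1 \<le> 0" using assms by simp
  then show ?thesis by (simp add: cutoff_def sq_pos_def)
qed

lemma cutoff_grad_outside_aux:
  assumes "r > 0" "dist x c \<ge> 2 * r"
  shows "sq_pos ((x - c) \<bullet> (x - c) / r\<^sup>2 - 1) \<ge> 1"
proof -
  have "(2 * r)\<^sup>2 \<le> (norm (x - c))\<^sup>2" using assms by (intro power_mono) (auto simp: dist_norm)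
  then have "4 * r\<^sup>2 \<le> (x - c) \<bullet> (x - c)" by (simp add: power2_norm_eq_inner power_mult_distrib)
  then have "4 \<le> (x - c) \<bullet> (x - c) / r\<^sup>2" using assms by (simp add: pos_le_divide_eq)
  then have "(x - c) \<bullet> (x - c) / r\<^sup>2 - 1 \<ge> 1" by linarith
  then show ?thesis unfolding sq_pos_def by (intro one_le_power) simp
qed

lemma cutoff_eq_0:
  assumes "r > 0" "dist x c \<ge> 2 * r"
  shows "cutoff c r x = 0"
  using cutoff_grad_outside_aux[OF assms] by (simp add: cutoff_def sq_pos_def[of "1 - _"])

lemma norm_cutoff_grad:
  assumes r: "r > 0"
  shows "norm (cutoff_grad c r x) \<le> 16 / r * indicator (ball c (2 * r)) x"
proof -
  define s where "s = (x - c) \<bullet> (x - c) / r\<^sup>2 - 1"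
  define a where "a = max 0 (1 - sq_pos s)"
  have g: "cutoff_grad c r x = (2 * a * (- (2 * max 0 s)) * (2 / r\<^sup>2)) *\<^sub>R (x - c)"
    by (simp add: cutoff_grad_def Let_def s_def a_def)
  show ?thesis
  proof (cases "x \<in> ball c (2 * r)")
    case False
    then have "dist x c \<ge> 2 * r" by (simp add: dist_commute)
    then have "sq_pos s \<ge> 1" unfolding s_def by (rule cutoff_grad_outside_aux[OF r])
    then have "a = 0" by (simp add: a_def)
    then show ?thesis using False by (simp add: g)
  next
    case True
    have a: "0 \<le> a" "a \<le> 1" by (auto simp: a_def sq_pos_def)
    have am: "a * max 0 s \<le> 1"
    proof (cases "s \<le> 1")
      case True
      then show ?thesis using a by (intro mult_le_one) auto
    next
      case False
      then have "sq_pos s \<ge> 1" unfolding sq_pos_def by (intro one_le_power) simp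
      then show ?thesis by (simp add: a_def)
    qed
    have am0: "0 \<le> a * max 0 s" using a by simp
    have "norm (cutoff_grad c r x) = (a * max 0 s) * (8 / r\<^sup>2) * norm (x - c)"
      using a by (simp add: g abs_mult mult_ac)
    also have "\<dots> \<le> 1 * (8 / r\<^sup>2) * (2 * r)"
      using am am0 True r by (intro mult_mono) (auto simp: dist_norm norm_minus_commute)
    also have "\<dots> = 16 / r" using r by (simp add: power2_eq_square)
    finally show ?thesis using True by simp
  qed
qed

lemma C1_gradient_one_minus: "C1_gradient u g \<Longrightarrow> C1_gradient (\<lambda>x. 1 - u x) (\<lambda>x. - g x)"
  unfolding C1_gradient_def by (auto intro!: derivative_eq_intros continuous_intros)

lemma C1_gradient_mult:
  "C1_gradient u g \<Longrightarrow> C1_gradient v h \<Longrightarrow> C1_gradient (\<lambda>x. u x * v x) (\<lambda>x. u x *\<^sub>R h x + v x *\<^sub>R g x)"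
proof -
  assume u: "C1_gradient u g" and v: "C1_gradient v h"
  have "((\<lambda>x. u x * v x) has_derivative (\<lambda>y. u x * (h x \<bullet> y) + (g x \<bullet> y) * v x)) (at x)" for x
    using u v unfolding C1_gradient_def by (intro has_derivative_mult) auto
  moreover have "continuous_on UNIV (\<lambda>x. u x *\<^sub>R h x + v x *\<^sub>R g x)"
    using u v C1_gradient_continuous[OF u] C1_gradient_continuous[OF v] unfolding C1_gradient_def
    by (intro continuous_intros) auto
  ultimately show ?thesis by (simp add: C1_gradient_def inner_add_left mult.commute)
qed

lemma C1_gradient_scaleR: "C1_gradient u g \<Longrightarrow> C1_gradient (\<lambda>x. c * u x) (\<lambda>x. c *\<^sub>R g x)"
  unfolding C1_gradient_def by (auto intro!: derivative_eq_intros continuous_intros)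

lemma C1_gradient_sum:
  assumes "\<And>j. j \<in> J \<Longrightarrow> C1_gradient (u j) (g j)"
  shows "C1_gradient (\<lambda>x. \<Sum>j\<in>J. u j x) (\<lambda>x. \<Sum>j\<in>J. g j x)"
proof -
  have "((\<lambda>x. \<Sum>j\<in>J. u j x) has_derivative (\<lambda>h. \<Sum>j\<in>J. g j x \<bullet> h)) (at x)" for x
    using assms unfolding C1_gradient_def by (intro has_derivative_sum) auto
  moreover have "continuous_on UNIV (\<lambda>x. \<Sum>j\<in>J. g j x)"
    using assms unfolding C1_gradient_def by (intro continuous_on_sum) auto
  ultimately show ?thesis by (simp add: C1_gradient_def inner_sum_left)
qed

lemma C1_gradient_prod:
  assumes "finite J" "\<And>j. j \<in> J \<Longrightarrow> C1_gradient (u j) (g j)" "\<And>j x. j \<in> J \<Longrightarrow> 0 \<le> u j x \<and> u j x \<le> 1"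
  shows "\<exists>G. C1_gradient (\<lambda>x. \<Prod>j\<in>J. u j x) G \<and> (\<forall>x. norm (G x) \<le> (\<Sum>j\<in>J. norm (g j x)))"
  using assms
proof (induction J rule: finite_induct)
  case empty
  have "C1_gradient (\<lambda>x::'b. 1) (\<lambda>x. 0)" by (auto simp: C1_gradient_def)
  then show ?case by (intro exI[of _ "\<lambda>x. 0"]) simp
next
  case (insert i J)
  then obtain G where G: "C1_gradient (\<lambda>x. \<Prod>j\<in>J. u j x) G" "\<And>x. norm (G x) \<le> (\<Sum>j\<in>J. norm (g j x))" by auto
  let ?G = "\<lambda>x. u i x *\<^sub>R G x + (\<Prod>j\<in>J. u j x) *\<^sub>R g i x"
  have "C1_gradient (\<lambda>x. u i x * (\<Prod>j\<in>J. u j x)) ?G"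
    using insert.prems G(1) by (intro C1_gradient_mult) auto
  moreover have "norm (?G x) \<le> (\<Sum>j\<in>insert i J. norm (g j x))" for x
  proof -
    have p: "0 \<le> (\<Prod>j\<in>J. u j x)" "(\<Prod>j\<in>J. u j x) \<le> 1"
      using insert.prems by (auto intro!: prod_nonneg prod_le_1)
    have q: "0 \<le> u i x" "u i x \<le> 1" using insert.prems by auto
    have "norm (?G x) \<le> u i x * norm (G x) + (\<Prod>j\<in>J. u j x) * norm (g i x)"
      using norm_triangle_ineq[of "u i x *\<^sub>R G x" "(\<Prod>j\<in>J. u j x) *\<^sub>R g i x"] p q by simp
    also have "\<dots> \<le> norm (G x) + norm (g i x)"
      using p q by (intro add_mono mult_left_le_one_le) auto
    also have "\<dots> \<le> (\<Sum>j\<in>insert i J. norm (g j x))" using G(2)[of x] insert by simp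
    finally show ?thesis .
  qed
  ultimately show ?case using insert by (intro exI[of _ ?G]) simp
qed

text \<open>
  The radii \<open>18 r\<close> and \<open>r / 2\<close> are those that occur in the greedy choice of balls below.
\<close>

lemma uniform_covering_number:
  "\<exists>M\<ge>1. \<forall>(x::'a::euclidean_space) r. r > 0 \<longrightarrow> (\<exists>Z. finite Z \<and> card Z \<le> M \<and> cball x (18 * r) \<subseteq> (\<Union>z\<in>Z. ball z (r / 2)))"
proof -
  have "cball (0::'a) 18 \<subseteq> (\<Union>z\<in>UNIV. ball z (1/2))"
    by (intro subsetI UN_I[OF UNIV_I]) (rule centre_in_ball[THEN iffD2], simp)
  then obtain Z where Z: "finite Z" "cball (0::'a) 18 \<subseteq> (\<Union>z\<in>Z. ball z (1/2))"
    using compactE_image[OF compact_cball, of "UNIV::'a set" "\<lambda>z. ball z (1/2)"] by (metis open_ball)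
  show ?thesis
  proof (intro exI[of _ "Suc (card Z)"] conjI allI impI)
    fix x :: 'a and r :: real assume r: "r > 0"
    show "\<exists>Z'. finite Z' \<and> card Z' \<le> Suc (card Z) \<and> cball x (18 * r) \<subseteq> (\<Union>z\<in>Z'. ball z (r / 2))"
    proof (intro exI[of _ "(\<lambda>z. x + r *\<^sub>R z) ` Z"] conjI)
      show "card ((\<lambda>z. x + r *\<^sub>R z) ` Z) \<le> Suc (card Z)" using card_image_le[OF Z(1)] by (meson le_Suc_eq)
      show "cball x (18 * r) \<subseteq> (\<Union>z\<in>(\<lambda>z. x + r *\<^sub>R z) ` Z. ball z (r / 2))"
      proof
        fix y assume y: "y \<in> cball x (18 * r)"
        let ?y = "(1 / r) *\<^sub>R (y - x)"
        have "norm ?y \<le> 18" using y r by (simp add: dist_norm norm_minus_commute divide_le_eq)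
        then obtain z where z: "z \<in> Z" "dist z ?y < 1/2" using Z(2) by force
        have "x + r *\<^sub>R z - y = r *\<^sub>R (z - ?y)" using r by (simp add: algebra_simps)
        then have "dist (x + r *\<^sub>R z) y = r * dist z ?y" using r by (simp add: dist_norm)
        also have "\<dots> < r / 2" using z(2) r by simp
        finally show "y \<in> (\<Union>z\<in>(\<lambda>z. x + r *\<^sub>R z) ` Z. ball z (r / 2))" using z(1) by auto
      qed
    qed (use Z(1) in simp)
  qed simp
qed

section \<open>Disjoint capacitors\<close>

text \<open>
  Otherwise a limit point of the centres of balls of mass \<open>m\<close> and radius tending to zero would be an atom.
\<close>

lemma small_balls_small_measure:
  fixes \<mu> :: "'a::euclidean_space measure"
  assumes fin: "finite_measure \<mu>" and sets[measurable_cong]: "sets \<mu> = sets borel"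
    and supp: "measure \<mu> (- ball 0 R) = 0" and atom: "\<And>x. measure \<mu> {x} = 0" and m: "m > 0"
  shows "\<exists>\<rho>>0. \<forall>z. measure \<mu> (ball z \<rho>) < m"
proof (rule ccontr)
  interpret finite_measure \<mu> by fact
  assume contra: "\<not> ?thesis"
  have "\<exists>z. m \<le> measure \<mu> (ball z (1 / real (Suc n)))" for n
    using contra by (metis not_le of_nat_0_less_iff zero_less_Suc zero_less_divide_1_iff)
  then obtain z where z: "\<And>n. m \<le> measure \<mu> (ball (z n) (1 / real (Suc n)))" by metis
  have zR: "z n \<in> cball 0 (R + 1)" for n
  proof (rule ccontr)
    assume n: "z n \<notin> cball 0 (R + 1)"
    have "ball (z n) (1 / real (Suc n)) \<subseteq> - ball 0 R"
    proof (intro subsetI ComplI)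
      fix y assume y: "y \<in> ball (z n) (1 / real (Suc n))" "y \<in> ball 0 R"
      have "1 / real (Suc n) \<le> 1" by simp
      with y(1) have "dist (z n) y < 1" unfolding mem_ball by (rule less_le_trans)
      moreover have "norm (z n) \<le> dist (z n) y + norm y" by (metis dist_norm norm_triangle_sub add.commute)
      ultimately show False using n y(2) by simp
    qed
    then have "measure \<mu> (ball (z n) (1 / real (Suc n))) \<le> measure \<mu> (- ball 0 R)"
      by (rule finite_measure_mono) (simp add: sets)
    then show False using z[of n] supp m by simp
  qed
  obtain l r where l: "strict_mono r" "(z \<circ> r) \<longlonglongrightarrow> l"
    using compact_cball[of "0::'a" "R + 1"] zR unfolding compact_def by metis
  have big: "m \<le> measure \<mu> (ball l (1 / real (Suc k)))" for k
  proof -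
    define \<delta> where "\<delta> = 1 / real (Suc k) / 2"
    have \<delta>: "\<delta> > 0" by (simp add: \<delta>_def)
    have "\<forall>\<^sub>F n in sequentially. dist (z (r n)) l < \<delta>" using l(2) \<delta> by (auto simp: tendsto_iff o_def)
    moreover have "\<forall>\<^sub>F n in sequentially. 1 / real (Suc (r n)) < \<delta>"
    proof -
      have "(\<lambda>n. 1 / real (Suc (r n))) \<longlonglongrightarrow> 0"
        using LIMSEQ_subseq_LIMSEQ[OF LIMSEQ_Suc[OF lim_inverse_n'] l(1)] by (simp add: o_def)
      then show ?thesis using \<delta> by (rule order_tendstoD)
    qed
    ultimately have "\<forall>\<^sub>F n in sequentially. dist (z (r n)) l < \<delta> \<and> 1 / real (Suc (r n)) < \<delta>" by eventually_elim simp
    then obtain n where n: "dist (z (r n)) l < \<delta>" "1 / real (Suc (r n)) < \<delta>"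
      using eventually_happens'[OF sequentially_bot] by blast
    have "ball (z (r n)) (1 / real (Suc (r n))) \<subseteq> ball l (1 / real (Suc k))"
    proof
      fix y assume "y \<in> ball (z (r n)) (1 / real (Suc (r n)))"
      then have "dist (z (r n)) y < \<delta>" using n(2) by simp
      then have "dist l y < \<delta> + \<delta>" using n(1) dist_triangle[of l y "z (r n)"] by (simp add: dist_commute)
      also have "\<delta> + \<delta> = 1 / real (Suc k)" by (simp only: \<delta>_def field_sum_of_halves)
      finally show "y \<in> ball l (1 / real (Suc k))" by simp
    qed
    then show ?thesis using z[of "r n"] finite_measure_mono[of "ball (z (r n)) (1 / real (Suc (r n)))" "ball l (1 / real (Suc k))"]
      by (simp add: sets del: of_nat_Suc)
  qed
  have "(\<lambda>k. measure \<mu> (ball l (1 / real (Suc k)))) \<longlonglongrightarrow> measure \<mu> (\<Inter>k. ball l (1 / real (Suc k)))"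
  proof (rule finite_Lim_measure_decseq)
    show "range (\<lambda>k. ball l (1 / real (Suc k))) \<subseteq> sets \<mu>" by (auto simp: sets)
    show "decseq (\<lambda>k. ball l (1 / real (Suc k)))"
      by (intro decseq_SucI subset_ball) (simp add: field_simps)
  qed
  moreover have "(\<Inter>k. ball l (1 / real (Suc k))) = {l}"
  proof (intro set_eqI iffI)
    fix y assume y: "y \<in> (\<Inter>k. ball l (1 / real (Suc k)))"
    show "y \<in> {l}"
    proof (rule ccontr)
      assume "y \<notin> {l}"
      then have "dist l y > 0" by simp
      then obtain k where "1 / real (Suc k) < dist l y" using nat_approx_posE by blast
      moreover have "dist l y < 1 / real (Suc k)" using y by auto
      ultimately show False by simp
    qed
  qed auto
  ultimately have "(\<lambda>k. measure \<mu> (ball l (1 / real (Suc k)))) \<longlonglongrightarrow> 0" by (simp add: atom)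
  then have "m \<le> 0" by (rule LIMSEQ_le_const) (use big in auto)
  then show False using m by simp
qed

text \<open>
  The radius \<open>r i\<close> is the smallest power of two such that some ball of this radius has mass at least \<open>m\<close> outside the removed set.
  It exists, because small balls have small mass, and because the removed set never exhausts
  the measure: the ball of radius \<open>16 r\<close> is covered by \<open>M\<close> balls of radius \<open>r / 2\<close>, each of which adds mass less than \<open>m\<close>.
\<close>

theorem greedy_balls:
  fixes \<mu> :: "'a::euclidean_space measure"
  assumes fin: "finite_measure \<mu>" and sets[measurable_cong]: "sets \<mu> = sets borel"
    and supp: "measure \<mu> (- ball 0 R) = 0" and atom: "\<And>x. measure \<mu> {x} = 0" and m: "m > 0"
    and M: "\<And>(x::'a) r. r > 0 \<Longrightarrow> \<exists>Z. finite Z \<and> card Z \<le> M \<and> cball x (18 * r) \<subseteq> (\<Union>z\<in>Z. ball z (r / 2))"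
    and tot: "real k * real M * m + m \<le> measure \<mu> UNIV"
  shows "\<exists>x r. \<forall>i<k. (\<exists>e::int. r i = 2 powr e) \<and>
     m \<le> measure \<mu> (ball (x i) (r i) - (\<Union>j<i. ball (x j) (16 * r j))) \<and>
     (\<forall>z. measure \<mu> (ball z (r i / 2) - (\<Union>j<i. ball (x j) (16 * r j))) < m)"
  using tot
proof (induction k)
  case (Suc k)
  interpret finite_measure \<mu> by fact
  have "real k * real M * m + m \<le> measure \<mu> UNIV"
  proof -
    have "real k * real M * m \<le> real (Suc k) * real M * m" using m by (intro mult_right_mono) auto
    then show ?thesis using Suc.prems by linarith
  qed
  from Suc.IH[OF this] obtain x r where xr: "\<And>i. i < k \<Longrightarrow> \<exists>e::int. r i = 2 powr e"
    "\<And>i. i < k \<Longrightarrow> m \<le> measure \<mu> (ball (x i) (r i) - (\<Union>j<i. ball (x j) (16 * r j)))"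
    "\<And>i z. i < k \<Longrightarrow> measure \<mu> (ball z (r i / 2) - (\<Union>j<i. ball (x j) (16 * r j))) < m" by blast
  define D where "D i = (\<Union>j<i. ball (x j) (16 * r j))" for i
  have Dm: "D i \<in> sets \<mu>" for i by (auto simp: D_def sets)
  have bm: "ball z s \<in> sets \<mu>" for z s by (simp add: sets)
  have step: "measure \<mu> (ball (x i) (16 * r i) - D i) \<le> real M * m" if i: "i < k" for i
  proof -
    have ri: "r i > 0" using xr(1)[OF i] by auto
    obtain Z where Z: "finite Z" "card Z \<le> M" "cball (x i) (18 * r i) \<subseteq> (\<Union>z\<in>Z. ball z (r i / 2))" using M[OF ri] by blast
    have "ball (x i) (16 * r i) \<subseteq> cball (x i) (18 * r i)" using ri by auto
    then have "ball (x i) (16 * r i) - D i \<subseteq> (\<Union>z\<in>Z. ball z (r i / 2) - D i)" using Z(3) by auto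
    then have "measure \<mu> (ball (x i) (16 * r i) - D i) \<le> measure \<mu> (\<Union>z\<in>Z. ball z (r i / 2) - D i)"
      by (rule finite_measure_mono) (intro sets.finite_UN sets.Diff Dm bm Z(1))
    also have "\<dots> \<le> (\<Sum>z\<in>Z. measure \<mu> (ball z (r i / 2) - D i))"
      using Z(1) Dm bm by (intro finite_measure_subadditive_finite) auto
    also have "\<dots> \<le> (\<Sum>z\<in>Z. m)" using xr(3)[OF i] by (intro sum_mono) (auto simp: D_def less_imp_le)
    also have "\<dots> \<le> real M * m" using Z(2) m by simp
    finally show ?thesis .
  qed
  have "measure \<mu> (D i) \<le> real i * (real M * m)" if "i \<le> k" for i
    using that
  proof (induction i)
    case (Suc i)
    have "D (Suc i) = D i \<union> (ball (x i) (16 * r i) - D i)" by (auto simp: D_def lessThan_Suc)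
    then have "measure \<mu> (D (Suc i)) \<le> measure \<mu> (D i) + measure \<mu> (ball (x i) (16 * r i) - D i)"
      by (simp only:) (rule measure_Un_le[OF Dm sets.Diff[OF bm Dm]])
    also have "\<dots> \<le> real i * (real M * m) + real M * m" using Suc step[of i] by (intro add_mono) auto
    finally show ?case by (simp add: distrib_right)
  qed (simp add: D_def)
  then have Dk: "measure \<mu> (D k) \<le> real k * real M * m" by (simp add: mult.assoc)
  have spc: "space \<mu> = UNIV" using sets_eq_imp_space_eq[OF sets] by simp
  \<comment> \<open>exponents of radii of heavy balls; large ones belong to \<open>E\<close>, and \<open>E\<close> is bounded below\<close>
  define E where "E = {e::int. \<exists>z. m \<le> measure \<mu> (ball z (2 powr e) - D k)}"
  obtain e1 :: int where "R < 2 powr e1"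
  proof -
    obtain n :: nat where "R < 2 ^ n" using real_arch_pow[of 2 R] by auto
    then show ?thesis using that[of "int n"] by (simp add: powr_realpow)
  qed
  then have sub: "UNIV = (ball 0 (2 powr e1) - D k) \<union> (D k \<union> - ball 0 R)" by auto
  have "e1 \<in> E"
  proof -
    have "measure \<mu> UNIV \<le> measure \<mu> (ball 0 (2 powr e1) - D k) + measure \<mu> (D k \<union> - ball 0 R)"
      by (subst sub) (intro measure_Un_le, use Dm bm in \<open>auto simp: sets\<close>)
    also have "measure \<mu> (D k \<union> - ball 0 R) \<le> measure \<mu> (D k) + measure \<mu> (- ball 0 R)"
      by (intro measure_Un_le) (use Dm in \<open>auto simp: sets\<close>)
    finally have "measure \<mu> UNIV - real k * real M * m \<le> measure \<mu> (ball 0 (2 powr e1) - D k)"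
      using Dk supp by simp
    moreover have "real k * real M * m + m \<le> measure \<mu> UNIV" by fact
    ultimately show ?thesis by (auto simp: E_def intro!: exI[of _ 0])
  qed
  obtain \<rho> where \<rho>: "\<rho> > 0" "\<And>z. measure \<mu> (ball z \<rho>) < m"
    using small_balls_small_measure[OF fin sets supp atom m] by blast
  have lower: "\<rho> < 2 powr e" if eE: "e \<in> E" for e
  proof (rule ccontr)
    assume "\<not> \<rho> < 2 powr e"
    obtain z where z: "m \<le> measure \<mu> (ball z (2 powr e) - D k)" using eE by (auto simp: E_def)
    also have "\<dots> \<le> measure \<mu> (ball z \<rho>)"
      using \<open>\<not> \<rho> < 2 powr e\<close> bm by (intro finite_measure_mono) auto
    finally show False using \<rho>(2)[of z] by simp
  qed
  define e0 where "e0 = \<lfloor>log 2 \<rho>\<rfloor>"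
  have e0: "e0 \<le> e" if "e \<in> E" for e
  proof -
    have "log 2 \<rho> < e" using lower[OF that] \<rho>(1) by (simp add: log_less_iff)
    then show ?thesis unfolding e0_def by linarith
  qed
  define n where "n = (LEAST n. e0 + int n \<in> E)"
  have "e0 + int (nat (e1 - e0)) \<in> E" using e0[OF \<open>e1 \<in> E\<close>] \<open>e1 \<in> E\<close> by simp
  then have nE: "e0 + int n \<in> E" unfolding n_def by (rule LeastI)
  have least: "e0 + int n \<le> e" if "e \<in> E" for e
  proof -
    have "e0 + int (nat (e - e0)) \<in> E" using e0[OF that] that by simp
    then have "n \<le> nat (e - e0)" unfolding n_def by (rule Least_le)
    then show ?thesis using e0[OF that] by linarith
  qed
  define e where "e = e0 + int n"
  have "e \<in> E" unfolding e_def by (rule nE)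
  then obtain z where z: "m \<le> measure \<mu> (ball z (2 powr e) - D k)" unfolding E_def by blast
  have half: "measure \<mu> (ball y (2 powr e / 2) - D k) < m" for y
  proof (rule ccontr)
    assume "\<not> ?thesis"
    moreover have "2 powr e / 2 = 2 powr real_of_int (e - 1)" by (simp add: powr_diff)
    ultimately have "e - 1 \<in> E" unfolding E_def by (metis (mono_tags) mem_Collect_eq not_le)
    from least[OF this] show False by (simp add: e_def)
  qed
  let ?x = "x(k := z)" and ?r = "r(k := 2 powr e)"
  have D': "(\<Union>j<i. ball (?x j) (16 * ?r j)) = D i" if "i \<le> k" for i
    unfolding D_def using that by (intro SUP_cong) auto
  show ?case
  proof (intro exI[of _ ?x] exI[of _ ?r] allI impI)
    fix i assume "i < Suc k"
    then consider "i < k" | "i = k" by linarith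
    then show "(\<exists>e::int. ?r i = 2 powr e) \<and>
     m \<le> measure \<mu> (ball (?x i) (?r i) - (\<Union>j<i. ball (?x j) (16 * ?r j))) \<and>
     (\<forall>z. measure \<mu> (ball z (?r i / 2) - (\<Union>j<i. ball (?x j) (16 * ?r j))) < m)"
    proof cases
      case 1
      then show ?thesis using D'[of i] xr[of i] by (auto simp: D_def)
    next
      case 2
      then show ?thesis using D'[of k] z half by auto
    qed
  qed
qed simp

text \<open>
  The form of the gradient bound from which the energy is estimated later; for \<open>16 / \<rho>\<close> and \<open>2 \<rho>\<close> compare
  the gradient of \<open>cutoff\<close>.
\<close>

definition heavy_ball_gradient :: "'a::euclidean_space measure \<Rightarrow> nat \<Rightarrow> real \<Rightarrow> ('a \<Rightarrow> 'a) \<Rightarrow> bool" where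
  "heavy_ball_gradient \<mu> P m g \<longleftrightarrow> (\<exists>(J :: nat set) c \<rho>. finite J \<and> card J \<le> P \<and>
     (\<forall>j\<in>J. \<rho> j > 0 \<and> m \<le> measure \<mu> (ball (c j) (\<rho> j))) \<and>
     (\<forall>x. norm (g x) \<le> (\<Sum>j\<in>J. 16 / \<rho> j * indicator (ball (c j) (2 * \<rho> j)) x)))"

text \<open>
  Greedily chosen balls have nondecreasing radii.  The function \<open>u i\<close> is one on the part of the ball \<open>B(x i, r i)\<close> outside the removed balls, and it
  has to vanish on \<open>B(x j, 2 r j)\<close> for all earlier \<open>j\<close>.  A factor that vanishes on \<open>B(x j, 8 r j)\<close> achieves
  this, but there may be many much smaller earlier balls.  A ball \<open>i\<close> that comes close to a much smaller earlier one
  \<open>j\<close> has \<open>B(x j, 8 r j) \<subseteq> B(x i, 8 r i)\<close> (it swallows \<open>j\<close>), and after that the factor for \<open>j\<close> is superseded by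
  the one for \<open>i\<close>.  So only balls that have not been swallowed yet need a factor.  Those of size comparable to \<open>r i\<close> are well separated,
  so there are at most \<open>M\<close> of them nearby; those of much smaller size are swallowed by \<open>i\<close>.  As each
  ball is counted at most once in this last group, at most one third of the balls swallow more than two others; they are discarded.
\<close>

theorem capacitors:
  fixes \<mu> :: "'a::euclidean_space measure"
  assumes fin: "finite_measure \<mu>" and sets[measurable_cong]: "sets \<mu> = sets borel"
    and supp: "measure \<mu> (- ball 0 R) = 0" and atom: "\<And>x. measure \<mu> {x} = 0" and m: "m > 0"
    and M: "\<forall>(x::'a) r. r > 0 \<longrightarrow> (\<exists>Z. finite Z \<and> card Z \<le> M \<and> cball x (18 * r) \<subseteq> (\<Union>z\<in>Z. ball z (r / 2)))"
    and tot: "real (3 * k) * real M * m + m \<le> measure \<mu> UNIV"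
  shows "\<exists>(I :: nat set) u g. finite I \<and> card I \<ge> 2 * k \<and>
    (\<forall>i\<in>I. C1_gradient (u i) (g i) \<and> (\<forall>x. 0 \<le> u i x \<and> u i x \<le> 1) \<and> m \<le> measure \<mu> {x. u i x = 1} \<and>
      heavy_ball_gradient \<mu> (M + 3) m (g i)) \<and>
    (\<forall>i\<in>I. \<forall>j\<in>I. i \<noteq> j \<longrightarrow> (\<forall>x. u i x = 0 \<or> u j x = 0))"
proof -
  interpret finite_measure \<mu> by fact
  define K where "K = 3 * k"
  obtain x r where xr: "\<And>i. i < K \<Longrightarrow> \<exists>e::int. r i = 2 powr e"
    "\<And>i. i < K \<Longrightarrow> m \<le> measure \<mu> (ball (x i) (r i) - (\<Union>j<i. ball (x j) (16 * r j)))"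
    "\<And>i z. i < K \<Longrightarrow> measure \<mu> (ball z (r i / 2) - (\<Union>j<i. ball (x j) (16 * r j))) < m"
    using greedy_balls[OF fin sets supp atom m M[rule_format] tot] unfolding K_def by blast
  have bm: "ball z s \<in> sets \<mu>" for z s by (simp add: sets)
  have r0: "r i > 0" if "i < K" for i using xr(1)[OF that] by auto
  \<comment> \<open>radii are powers of two, so a smaller radius would be at most half of the earlier one, and a smaller ball would
    have been chosen before\<close>
  have mono: "r j \<le> r i" if ij: "j < i" "i < K" for i j
  proof (rule ccontr)
    assume "\<not> r j \<le> r i"
    obtain e f :: int where ef: "r i = 2 powr e" "r j = 2 powr f" using xr(1)[of i] xr(1)[of j] ij by auto
    then have "e < f" using \<open>\<not> r j \<le> r i\<close> by simp
    then have "r i \<le> 2 powr (f - 1)" unfolding ef by simp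
    also have "\<dots> = r j / 2" unfolding ef by (simp add: powr_diff)
    finally have "ball (x i) (r i) - (\<Union>j<i. ball (x j) (16 * r j)) \<subseteq> ball (x i) (r j / 2) - (\<Union>l<j. ball (x l) (16 * r l))"
      using ij(1) by fastforce
    then have "measure \<mu> (ball (x i) (r i) - (\<Union>j<i. ball (x j) (16 * r j))) \<le>
        measure \<mu> (ball (x i) (r j / 2) - (\<Union>l<j. ball (x l) (16 * r l)))"
      by (rule finite_measure_mono) (auto simp: sets)
    then show False using xr(2)[OF ij(2)] xr(3)[of j "x i"] ij by simp
  qed
  have apart: "16 * r j - r i \<le> dist (x j) (x i)" if ij: "j < i" "i < K" for i j
  proof -
    have "ball (x i) (r i) - (\<Union>j<i. ball (x j) (16 * r j)) \<noteq> {}"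
      using xr(2)[OF ij(2)] m by (metis measure_empty not_le)
    then obtain y where "y \<in> ball (x i) (r i)" "y \<notin> ball (x j) (16 * r j)" using ij(1) by blast
    then show ?thesis using dist_triangle[of "x j" y "x i"] by simp
  qed
  \<comment> \<open>\<open>meets i j\<close>: the supports of the cutoff function of \<open>i\<close> and of the factor for \<open>j\<close> may intersect; \<open>sw i j\<close>: ball
    \<open>i\<close> swallows ball \<open>j\<close>; \<open>act i j\<close>: ball \<open>j\<close> has not been swallowed before step \<open>i\<close>\<close>
  define meets where "meets i j \<longleftrightarrow> dist (x i) (x j) < 2 * r i + 16 * r j" for i j
  define sw where "sw i j \<longleftrightarrow> j < i \<and> meets i j \<and> 8 * r j < r i" for i j
  define act where "act i j \<longleftrightarrow> j < i \<and> \<not> (\<exists>l<i. sw l j)" for i j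
  define N where "N i = {j. act i j \<and> meets i j}" for i
  define C where "C i = {j. act i j \<and> sw i j}" for i
  have Nfin: "finite (N i)" "N i \<subseteq> {..<i}" and CN: "C i \<subseteq> N i" for i
    by (auto simp: N_def act_def C_def sw_def intro: finite_subset[of _ "{..<i}"])
  have swal: "ball (x j) (8 * r j) \<subseteq> ball (x i) (8 * r i)" if "sw i j" "i < K" for i j
  proof
    fix y assume "y \<in> ball (x j) (8 * r j)"
    then have "dist (x i) y < 2 * r i + 16 * r j + 8 * r j"
      using that dist_triangle[of "x i" y "x j"] by (simp add: sw_def meets_def)
    also have "\<dots> \<le> 8 * r i" using that(1) r0[OF that(2)] unfolding sw_def by linarith
    finally show "y \<in> ball (x i) (8 * r i)" by simp
  qed
  \<comment> \<open>if the last ball containing it were swallowed, the swallowing ball would contain it, too\<close>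
  have anc: "\<exists>a. act i a \<and> ball (x j) (8 * r j) \<subseteq> ball (x a) (8 * r a)" if ij: "j < i" "i \<le> K" for i j
  proof -
    define S where "S = {a. a < i \<and> ball (x j) (8 * r j) \<subseteq> ball (x a) (8 * r a)}"
    have S: "finite S" "j \<in> S" using ij by (auto simp: S_def)
    let ?a = "Max S"
    have aS: "?a \<in> S" using S by (intro Max_in) auto
    have "act i ?a"
      unfolding act_def
    proof (intro conjI notI)
      show "?a < i" using aS by (simp add: S_def)
      assume "\<exists>l<i. sw l ?a"
      then obtain l where l: "l < i" "sw l ?a" by blast
      have "l \<in> S" using aS swal[OF l(2)] l(1) ij by (auto simp: S_def)
      then have "l \<le> ?a" using S(1) by simp
      moreover have "?a < l" using l(2) by (simp add: sw_def)
      ultimately show False by simp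
    qed
    then show ?thesis using aS by (auto simp: S_def)
  qed
  have comparable: "card (N i - C i) \<le> M" if i: "i < K" for i
  proof -
    obtain Z where Z: "finite Z" "card Z \<le> M" "cball (x i) (18 * r i) \<subseteq> (\<Union>z\<in>Z. ball z (r i / 2))"
      using M[rule_format, OF r0[OF i], of "x i"] by (elim exE conjE) (rule that)
    have B: "j < i" "r i \<le> 8 * r j" "x j \<in> cball (x i) (18 * r i)" if "j \<in> N i - C i" for j
    proof -
      show ji: "j < i" using that by (auto simp: N_def act_def)
      show "r i \<le> 8 * r j" using that ji by (auto simp: N_def C_def sw_def)
      show "x j \<in> cball (x i) (18 * r i)" using that mono[OF ji i] by (auto simp: N_def meets_def)
    qed
    then have "\<forall>j\<in>N i - C i. \<exists>z\<in>Z. x j \<in> ball z (r i / 2)" using Z(3) by blast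
    then obtain f where f: "\<And>j. j \<in> N i - C i \<Longrightarrow> f j \<in> Z" "\<And>j. j \<in> N i - C i \<Longrightarrow> x j \<in> ball (f j) (r i / 2)" by metis
    have far: "f j \<noteq> f j'" if jj: "j \<in> N i - C i" "j' \<in> N i - C i" "j < j'" for j j'
    proof
      assume eq: "f j = f j'"
      have "dist (x j) (x j') < r i"
        using f(2)[OF jj(1)] f(2)[OF jj(2)] eq dist_triangle2[of "x j" "x j'" "f j"] by (simp add: dist_commute)
      moreover have "16 * r j - r j' \<le> dist (x j) (x j')" using apart[OF jj(3)] B(1)[OF jj(2)] i by simp
      moreover have "r j' \<le> r i" using mono[OF B(1)[OF jj(2)] i] .
      ultimately show False using B(2)[OF jj(1)] by linarith
    qed
    have "inj_on f (N i - C i)" by (rule inj_onI) (metis far linorder_neqE_nat)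
    then have "card (N i - C i) \<le> card Z" using f(1) Z(1) by (intro card_inj_on_le) auto
    then show ?thesis using Z(2) by simp
  qed
  have Cdisj: "C i \<inter> C i' = {}" if "i \<noteq> i'" for i i'
    using that by (auto simp: C_def act_def) (metis linorder_neqE_nat)
  define I where "I = {i. i < K \<and> card (C i) \<le> 2}"
  have Ifin: "finite I" by (simp add: I_def)
  have cardI: "card I \<ge> 2 * k"
  proof -
    let ?B = "{i. i < K \<and> \<not> card (C i) \<le> 2}"
    have "3 * card ?B = (\<Sum>i\<in>?B. 3)" by simp
    also have "\<dots> \<le> (\<Sum>i\<in>?B. card (C i))" by (intro sum_mono) auto
    also have "\<dots> = card (\<Union>i\<in>?B. C i)"
      by (rule card_UN_disjoint[symmetric]) (use Cdisj finite_subset[OF CN Nfin(1)] in auto)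
    also have "\<dots> \<le> card {..<K}"
      by (intro card_mono) (auto simp: C_def act_def)
    finally have "card ?B \<le> k" by (simp add: K_def)
    moreover have "card I + card ?B = card (I \<union> ?B)" by (rule card_Un_disjoint[symmetric]) (auto simp: I_def)
    moreover have "I \<union> ?B = {..<K}" by (auto simp: I_def)
    ultimately show ?thesis by (simp add: K_def)
  qed
  have Ik: "i < K" if "i \<in> I" for i using that by (simp add: I_def)
  define v where "v i j = (if j = i then cutoff (x i) (r i) else (\<lambda>y. 1 - cutoff (x j) (8 * r j) y))" for i j
  define vg where "vg i j = (if j = i then cutoff_grad (x i) (r i) else (\<lambda>y. - cutoff_grad (x j) (8 * r j) y))" for i j
  define u where "u i y = (\<Prod>j\<in>insert i (N i). v i j y)" for i y
  have iN: "i \<notin> N i" for i using Nfin(2)[of i] by auto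
  have vC: "C1_gradient (v i j) (vg i j)" for i j
    by (auto simp: v_def vg_def intro: C1_gradient_cutoff C1_gradient_one_minus)
  have vb: "0 \<le> v i j y \<and> v i j y \<le> 1" for i j y
    using cutoff_bounds[of "x i" "r i" y] cutoff_bounds[of "x j" "8 * r j" y] by (auto simp: v_def)
  have "\<exists>G. C1_gradient (u i) G \<and> (\<forall>y. norm (G y) \<le> (\<Sum>j\<in>insert i (N i). norm (vg i j y)))" for i
    using C1_gradient_prod[of "insert i (N i)" "v i" "vg i"] Nfin vC vb unfolding u_def[abs_def] by auto
  then obtain g where g: "\<And>i. C1_gradient (u i) (g i)" "\<And>i y. norm (g i y) \<le> (\<Sum>j\<in>insert i (N i). norm (vg i j y))"
    by metis
  have ub: "0 \<le> u i y \<and> u i y \<le> 1" for i y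
    unfolding u_def using vb by (auto intro!: prod_nonneg prod_le_1)
  have u1: "u i y = 1" if i: "i < K" and y: "y \<in> ball (x i) (r i) - (\<Union>j<i. ball (x j) (16 * r j))" for i y
  proof -
    have "v i j y = 1" if j: "j \<in> insert i (N i)" for j
    proof (cases "j = i")
      case True
      then show ?thesis using y r0[OF i] by (simp add: v_def cutoff_eq_1 dist_commute)
    next
      case False
      then have ji: "j < i" using j Nfin(2) by auto
      then have "y \<notin> ball (x j) (16 * r j)" using y by blast
      then have "dist (x j) y \<ge> 16 * r j" by simp
      then have "cutoff (x j) (8 * r j) y = 0"
        using r0[of j] ji i by (intro cutoff_eq_0) (auto simp: dist_commute)
      then show ?thesis using False by (simp add: v_def)
    qed
    then show ?thesis by (simp add: u_def)
  qed
  have ui: "dist (x i) y < 2 * r i" if "u i y \<noteq> 0" "i < K" for i y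
  proof (rule ccontr)
    assume "\<not> dist (x i) y < 2 * r i"
    then have "v i i y = 0" using r0[OF that(2)] by (simp add: v_def cutoff_eq_0 dist_commute)
    then show False using that(1) Nfin by (simp add: u_def)
  qed
  have disj: "u i y = 0 \<or> u j y = 0" if ij: "j < i" "i < K" for i j y
  proof (rule ccontr)
    assume nz: "\<not> ?thesis"
    then have di: "dist (x i) y < 2 * r i" and dj: "dist (x j) y < 2 * r j" using ui ij by auto
    obtain a where a: "act i a" "ball (x j) (8 * r j) \<subseteq> ball (x a) (8 * r a)" using anc[of j i] ij by auto
    have ai: "a < i" using a(1) by (simp add: act_def)
    have "y \<in> ball (x j) (8 * r j)" using dj r0[of j] ij by simp
    then have ya: "dist (x a) y < 8 * r a" using a(2) by auto
    have ra: "r a > 0" using r0[of a] ai ij by simp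
    have "meets i a"
      unfolding meets_def using dist_triangle[of "x i" "x a" y] di ya ra by (simp add: dist_commute)
    then have aN: "a \<in> N i" using a(1) by (simp add: N_def)
    moreover have "v i a y = 0" using ai ya ra by (simp add: v_def cutoff_eq_1 dist_commute)
    ultimately have "u i y = 0" using Nfin by (auto simp: u_def)
    then show False using nz by simp
  qed
  show ?thesis
  proof (intro exI[of _ I] exI[of _ u] exI[of _ g] conjI ballI impI allI)
    fix i assume i: "i \<in> I"
    show "m \<le> measure \<mu> {y. u i y = 1}"
    proof -
      have "continuous_on UNIV (u i)" by (rule C1_gradient_continuous[OF g(1)])
      then have "u i \<in> borel_measurable borel" by (rule borel_measurable_continuous_onI)
      then have "{y. u i y = 1} \<in> sets \<mu>" unfolding sets by measurable
      then have "measure \<mu> (ball (x i) (r i) - (\<Union>j<i. ball (x j) (16 * r j))) \<le> measure \<mu> {y. u i y = 1}"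
        using u1[OF Ik[OF i]] by (intro finite_measure_mono) auto
      then show ?thesis using xr(2)[OF Ik[OF i]] by simp
    qed
    define \<rho> where "\<rho> j = (if j = i then r i else 8 * r j)" for j
    have big: "m \<le> measure \<mu> (ball (x j) (r j))" if "j < K" for j
    proof -
      have "measure \<mu> (ball (x j) (r j) - (\<Union>l<j. ball (x l) (16 * r l))) \<le> measure \<mu> (ball (x j) (r j))"
        using bm by (intro finite_measure_mono) auto
      then show ?thesis using xr(2)[OF that] by simp
    qed
    show "heavy_ball_gradient \<mu> (M + 3) m (g i)"
      unfolding heavy_ball_gradient_def
    proof (intro exI[of _ "insert i (N i)"] exI[of _ x] exI[of _ \<rho>] conjI ballI allI)
      show "finite (insert i (N i))" using Nfin by simp
      have "card (N i) = card (C i) + card (N i - C i)"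
        using CN Nfin by (metis card_Diff_subset card_mono finite_subset le_add_diff_inverse)
      then have "card (N i) \<le> 2 + M" using comparable[OF Ik[OF i]] i by (simp add: I_def)
      then show "card (insert i (N i)) \<le> M + 3" using Nfin iN by simp
      fix j assume j: "j \<in> insert i (N i)"
      then have jK: "j < K" using Ik[OF i] Nfin(2)[of i] by auto
      then show "\<rho> j > 0" using r0 Ik[OF i] by (simp add: \<rho>_def)
      have "r j \<le> \<rho> j" using r0[OF jK] by (auto simp: \<rho>_def)
      then have "measure \<mu> (ball (x j) (r j)) \<le> measure \<mu> (ball (x j) (\<rho> j))"
        using bm by (intro finite_measure_mono subset_ball)
      then show "m \<le> measure \<mu> (ball (x j) (\<rho> j))" using big[OF jK] by simp
    next
      fix y
      have "norm (vg i j y) \<le> 16 / \<rho> j * indicator (ball (x j) (2 * \<rho> j)) y" if j: "j \<in> insert i (N i)" for j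
      proof -
        have jK: "j < K" using Ik[OF i] Nfin(2)[of i] j by auto
        then show ?thesis
          using norm_cutoff_grad[of "r i" "x i" y] norm_cutoff_grad[of "8 * r j" "x j" y] r0[OF jK] r0[OF Ik[OF i]]
          by (auto simp: vg_def \<rho>_def)
      qed
      then have "(\<Sum>j\<in>insert i (N i). norm (vg i j y)) \<le> (\<Sum>j\<in>insert i (N i). 16 / \<rho> j * indicator (ball (x j) (2 * \<rho> j)) y)"
        by (rule sum_mono)
      then show "norm (g i y) \<le> (\<Sum>j\<in>insert i (N i). 16 / \<rho> j * indicator (ball (x j) (2 * \<rho> j)) y)"
        using g(2)[of i y] by linarith
    qed
  next
    fix i j y assume "i \<in> I" "j \<in> I" "i \<noteq> j"
    then show "u i y = 0 \<or> u j y = 0" using disj[of j i y] disj[of i j y] Ik by (metis linorder_neqE_nat)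
  qed (use Ifin cardI g(1) ub in auto)
qed

section \<open>An upper bound for eigenvalues by disjoint test functions\<close>

lemma norm_sum_disjoint_powr:
  fixes a :: "'i \<Rightarrow> 'b::real_normed_vector"
  assumes J: "finite J" and disj: "\<And>i j. i \<in> J \<Longrightarrow> j \<in> J \<Longrightarrow> i \<noteq> j \<Longrightarrow> a i = 0 \<or> a j = 0"
  shows "norm (\<Sum>i\<in>J. a i) powr p = (\<Sum>i\<in>J. norm (a i) powr p)"
proof (cases "\<exists>i\<in>J. a i \<noteq> 0")
  case True
  then obtain i where i: "i \<in> J" "a i \<noteq> 0" by blast
  have z: "a j = 0" if "j \<in> J - {i}" for j using disj[of i j] i that by auto
  have "(\<Sum>j\<in>J. a j) = a i" using sum.remove[OF J i(1), of a] z by simp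
  moreover have "(\<Sum>j\<in>J. norm (a j) powr p) = norm (a i) powr p"
    using sum.remove[OF J i(1), of "\<lambda>j. norm (a j) powr p"] z by simp
  ultimately show ?thesis by simp
qed simp

text \<open>
  A zero of a nonnegative function is a minimum.
\<close>

lemma C1_gradient_at_zero:
  assumes u: "C1_gradient u g" and nn: "\<And>x. 0 \<le> u x" and z: "u x = 0"
  shows "g x = 0"
proof -
  have "(u has_derivative (\<lambda>h. g x \<bullet> h)) (at x)" using u by (simp add: C1_gradient_def)
  then have "(\<lambda>h. g x \<bullet> h) = (\<lambda>h. 0)"
    by (rule differential_zero_maxmin[OF UNIV_I open_UNIV]) (use nn z in auto)
  then have "g x \<bullet> g x = 0" by metis
  then show ?thesis by simp
qed

lemma finite_surface_measure:
  assumes "boundary_area \<Omega> > 0"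
  shows "finite_measure (surface_measure \<Omega>)"
proof (rule finite_measureI)
  show "emeasure (surface_measure \<Omega>) (space (surface_measure \<Omega>)) \<noteq> \<infinity>"
    using assms by (auto simp: boundary_area_def measure_def)
qed

lemma topspace_sobolev_topology: "topspace (sobolev_topology \<Omega> p) = sobolev \<Omega> p"
proof
  show "topspace (sobolev_topology \<Omega> p) \<subseteq> sobolev \<Omega> p"
    unfolding topspace_def openin_sobolev_topology by auto
  have "openin (sobolev_topology \<Omega> p) (sobolev \<Omega> p)"
    unfolding openin_sobolev_topology by (auto intro: exI[of _ 1])
  then show "sobolev \<Omega> p \<subseteq> topspace (sobolev_topology \<Omega> p)" by (rule openin_subset)
qed

text \<open>
  The constant sequence \<open>u\<close> shows that \<open>u\<close> is a trace of itself; every other one agrees with it almost everywhere.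
\<close>

lemma C1_gradient_boundary_trace:
  fixes \<Omega> :: "(real^'n) set"
  assumes \<Omega>: "bounded_lipschitz_domain \<Omega>" and n: "CARD('n) \<ge> 2" and p: "p > 1"
    and fin: "finite_measure (surface_measure \<Omega>)" and u: "C1_gradient u g"
  shows "AE x in surface_measure \<Omega>. boundary_trace \<Omega> p u x = u x"
    and "boundary_trace \<Omega> p u \<in> borel_measurable (surface_measure \<Omega>)"
proof -
  have op: "open \<Omega>" and bd: "bounded \<Omega>" using \<Omega> by (auto simp: bounded_lipschitz_domain_def)
  have p1: "p \<ge> 1" using p by simp
  have us: "u \<in> sobolev \<Omega> p" by (rule C1_gradient_sobolev(1)[OF op bd p1 u])
  have "C1_gradient (\<lambda>x::real^'n. 0) (\<lambda>x. 0)" by (simp add: C1_gradient_def)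
  note C1_gradient_sobolev(2)[OF op bd p1 this]
  then have "AE x in lebesgue_on \<Omega>. norm (weak_gradient \<Omega> p (\<lambda>x. 0) x) powr p = 0"
    by eventually_elim simp
  then have "(\<integral>x. norm (weak_gradient \<Omega> p (\<lambda>x. 0) x) powr p \<partial>lebesgue_on \<Omega>) = 0"
    by (rule integral_eq_zero_AE)
  then have "sobolev_norm \<Omega> p (\<lambda>x. u x - u x) = 0" using p by (simp add: sobolev_norm_def)
  moreover have "Lp_norm (surface_measure \<Omega>) p (\<lambda>x. u x - u x) = 0" using p by (simp add: Lp_norm_def)
  moreover have "u \<in> Lp (surface_measure \<Omega>) p"
    by (rule continuous_surface_Lp[OF fin bd C1_gradient_continuous[OF u]]) (use p in simp)
  ultimately have "is_trace \<Omega> p u u"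
    unfolding is_trace_def using us C1_gradient_continuous[OF u] by (auto intro!: exI[of _ "\<lambda>_. u"])
  then have tr: "is_trace \<Omega> p u (boundary_trace \<Omega> p u)" unfolding boundary_trace_def by (rule someI[where P = "is_trace \<Omega> p u"])
  then show "AE x in surface_measure \<Omega>. boundary_trace \<Omega> p u x = u x"
    by (rule is_trace_unique[OF \<Omega> n p fin C1_gradient_continuous[OF u] us])
  show "boundary_trace \<Omega> p u \<in> borel_measurable (surface_measure \<Omega>)"
    using tr by (simp add: is_trace_def Lp_def)
qed

lemma integral_boundary_trace:
  fixes \<Omega> :: "(real^'n) set"
  assumes \<Omega>: "bounded_lipschitz_domain \<Omega>" and n: "CARD('n) \<ge> 2" and p: "p > 1"
    and fin: "finite_measure (surface_measure \<Omega>)" and u: "C1_gradient u g"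
  shows "(\<integral>x. \<bar>boundary_trace \<Omega> p u x\<bar> powr p \<partial>surface_measure \<Omega>) = (\<integral>x. \<bar>u x\<bar> powr p \<partial>surface_measure \<Omega>)"
proof -
  let ?M = "surface_measure \<Omega>"
  have um: "u \<in> borel_measurable ?M" by (rule continuous_surface_measurable[OF C1_gradient_continuous[OF u]])
  show ?thesis
  proof (rule integral_cong_AE)
    show "(\<lambda>x. \<bar>boundary_trace \<Omega> p u x\<bar> powr p) \<in> borel_measurable ?M"
      using C1_gradient_boundary_trace(2)[OF assms] by measurable
    show "(\<lambda>x. \<bar>u x\<bar> powr p) \<in> borel_measurable ?M" using um by measurable
    show "AE x in ?M. \<bar>boundary_trace \<Omega> p u x\<bar> powr p = \<bar>u x\<bar> powr p"
      using C1_gradient_boundary_trace(1)[OF assms] by eventually_elim simp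
  qed
qed

lemma integral_weak_gradient:
  fixes \<Omega> :: "(real^'n) set"
  assumes \<Omega>: "open \<Omega>" "bounded \<Omega>" and p: "p \<ge> 1" and u: "C1_gradient u g"
  shows "(\<integral>x. norm (weak_gradient \<Omega> p u x) powr p \<partial>lebesgue_on \<Omega>) = (\<integral>x. norm (g x) powr p \<partial>lebesgue_on \<Omega>)"
proof (rule integral_cong_AE)
  have "weak_gradient \<Omega> p u \<in> borel_measurable (lebesgue_on \<Omega>)"
    using sobolev_weak_gradient(2)[OF C1_gradient_sobolev(1)[OF assms]] by (simp add: Lp_def)
  then show "(\<lambda>x. norm (weak_gradient \<Omega> p u x) powr p) \<in> borel_measurable (lebesgue_on \<Omega>)" by measurable
  have "g \<in> borel_measurable (lebesgue_on \<Omega>)"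
    by (rule continuous_lebesgue_on_measurable) (use u in \<open>simp add: C1_gradient_def\<close>)
  then show "(\<lambda>x. norm (g x) powr p) \<in> borel_measurable (lebesgue_on \<Omega>)" by measurable
  show "AE x in lebesgue_on \<Omega>. norm (weak_gradient \<Omega> p u x) powr p = norm (g x) powr p"
    using C1_gradient_sobolev(2)[OF assms] by eventually_elim simp
qed

lemma compact_lp_sphere:
  fixes p :: real
  assumes p: "p > 0"
  shows "compact {c :: nat \<Rightarrow> real. (\<forall>i\<ge>k. c i = 0) \<and> (\<Sum>i<k. \<bar>c i\<bar> powr p) = 1}" (is "compact ?S")
proof -
  define K where "K = PiE UNIV (\<lambda>i. if i < k then {-1..1::real} else {0})"
  have "compactin (product_topology (\<lambda>i. euclideanreal) UNIV) K"
    unfolding K_def by (simp add: compactin_PiE)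
  then have K: "compact K" by (simp add: euclidean_product_topology)
  have "continuous_on UNIV (\<lambda>c :: nat \<Rightarrow> real. \<Sum>i<k. \<bar>c i\<bar> powr p)"
    by (intro continuous_on_sum continuous_on_powr' continuous_on_rabs continuous_on_product_coordinates continuous_on_const)
      (use p in auto)
  then have "closed ((\<lambda>c :: nat \<Rightarrow> real. \<Sum>i<k. \<bar>c i\<bar> powr p) -` {1})"
    by (intro continuous_closed_vimage) (auto simp: continuous_on_eq_continuous_at)
  moreover have "?S = K \<inter> ((\<lambda>c :: nat \<Rightarrow> real. \<Sum>i<k. \<bar>c i\<bar> powr p) -` {1})"
  proof (intro set_eqI iffI)
    fix c :: "nat \<Rightarrow> real" assume c: "c \<in> ?S"
    have "\<bar>c i\<bar> \<le> 1" if "i < k" for i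
    proof (rule ccontr)
      assume "\<not> \<bar>c i\<bar> \<le> 1"
      then have "1 < \<bar>c i\<bar> powr p" using p by (simp add: gr_one_powr)
      also have "\<dots> \<le> (\<Sum>i<k. \<bar>c i\<bar> powr p)" using that by (intro member_le_sum) auto
      finally show False using c by simp
    qed
    then show "c \<in> K \<inter> ((\<lambda>c :: nat \<Rightarrow> real. \<Sum>i<k. \<bar>c i\<bar> powr p) -` {1})"
      using c by (auto simp: K_def PiE_def Pi_def abs_le_iff)
  next
    fix c assume c: "c \<in> K \<inter> ((\<lambda>c :: nat \<Rightarrow> real. \<Sum>i<k. \<bar>c i\<bar> powr p) -` {1})"
    have "c i = 0" if "i \<ge> k" for i
    proof -
      have "c i \<in> (if i < k then {-1..1::real} else {0})" using c unfolding K_def by blast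
      then show ?thesis using that by simp
    qed
    then show "c \<in> ?S" using c by simp
  qed
  ultimately show ?thesis using K by (simp add: compact_Int_closed)
qed

text \<open>
  The image of the \<open>\<ell>\<^sup>p\<close> sphere \<open>S\<close> of \<open>\<real>\<^sup>k\<close> under \<open>c \<mapsto> \<Sum>i. c i * v i\<close>, where \<open>v i\<close> is \<open>u i\<close> normalized in \<open>L\<^sup>p\<close> of the boundary, is an admissible
  set.  The exponent \<open>p\<close> of the sphere matches the norms: as the supports are disjoint, the \<open>p\<close>-th powers
  of the norms of a combination are the averages of those of the \<open>v i\<close> with weights \<open>\<bar>c i\<bar>\<^sup>p\<close>.  An odd map
  from this set to \<open>\<real>\<^sup>l\<close> with \<open>l < k\<close> has a zero by the Borsuk-Ulam theorem.
\<close>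

theorem steklov_eigenvalue_le:
  fixes \<Omega> :: "(real^'n) set"
  assumes \<Omega>: "bounded_lipschitz_domain \<Omega>" and n: "CARD('n) \<ge> 2" and p: "p > 1"
    and fin: "finite_measure (surface_measure \<Omega>)" and L: "L \<ge> 0"
    and u: "\<And>i. i < k \<Longrightarrow> C1_gradient (u i) (g i)" "\<And>i x. i < k \<Longrightarrow> 0 \<le> u i x"
    and disj: "\<And>i j x. i < k \<Longrightarrow> j < k \<Longrightarrow> i \<noteq> j \<Longrightarrow> u i x = 0 \<or> u j x = 0"
    and pos: "\<And>i. i < k \<Longrightarrow> (\<integral>x. \<bar>u i x\<bar> powr p \<partial>surface_measure \<Omega>) > 0"
    and ray: "\<And>i. i < k \<Longrightarrow> (\<integral>x. norm (g i x) powr p \<partial>lebesgue_on \<Omega>) \<le> L * (\<integral>x. \<bar>u i x\<bar> powr p \<partial>surface_measure \<Omega>)"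
  shows "steklov_eigenvalue \<Omega> p k \<le> ennreal L"
proof -
  let ?M = "surface_measure \<Omega>" and ?X = "sobolev_topology \<Omega> p"
  have op: "open \<Omega>" and bd: "bounded \<Omega>" using \<Omega> by (auto simp: bounded_lipschitz_domain_def)
  have p1: "p \<ge> 1" and p0: "p > 0" using p by auto
  define b where "b i = (\<integral>x. \<bar>u i x\<bar> powr p \<partial>?M)" for i
  define v where "v i x = b i powr (- (1 / p)) * u i x" for i x
  define h where "h i x = b i powr (- (1 / p)) *\<^sub>R g i x" for i x
  define \<Psi> where "\<Psi> c x = (\<Sum>i<k. c i * v i x)" for c :: "nat \<Rightarrow> real" and x
  define H where "H c x = (\<Sum>i<k. c i *\<^sub>R h i x)" for c :: "nat \<Rightarrow> real" and x
  have b0: "b i > 0" if "i < k" for i using pos[OF that] by (simp add: b_def)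
  have bp: "(b i powr (- (1 / p))) powr p = 1 / b i" if "i < k" for i
  proof -
    have "(b i powr (- (1 / p))) powr p = b i powr (- 1)" unfolding powr_powr using p0 by simp
    then show ?thesis using b0[OF that] by (simp add: powr_minus_divide)
  qed
  have vC: "C1_gradient (v i) (h i)" if "i < k" for i
    unfolding v_def[abs_def] h_def[abs_def] by (rule C1_gradient_scaleR[OF u(1)[OF that]])
  have PC: "C1_gradient (\<Psi> c) (H c)" for c
    unfolding \<Psi>_def[abs_def] H_def[abs_def] by (intro C1_gradient_sum C1_gradient_scaleR vC) auto
  have vd: "v i x = 0 \<or> v j x = 0" if "i < k" "j < k" "i \<noteq> j" for i j x
    using disj[OF that] by (auto simp: v_def)
  \<comment> \<open>on the zero set of a nonnegative function the gradient vanishes, so gradients are disjoint as well\<close>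
  have hd: "h i x = 0 \<or> h j x = 0" if "i < k" "j < k" "i \<noteq> j" for i j x
    using disj[OF that, of x] C1_gradient_at_zero[OF u(1,2), of i x] C1_gradient_at_zero[OF u(1,2), of j x] that
    by (auto simp: h_def)
  have P_powr: "\<bar>\<Psi> c x\<bar> powr p = (\<Sum>i<k. \<bar>c i\<bar> powr p * \<bar>v i x\<bar> powr p)" for c x
    using norm_sum_disjoint_powr[of "{..<k}" "\<lambda>i. c i * v i x" p] vd
    by (force simp: \<Psi>_def abs_mult powr_mult)
  have H_powr: "norm (H c x) powr p = (\<Sum>i<k. \<bar>c i\<bar> powr p * norm (h i x) powr p)" for c x
    using norm_sum_disjoint_powr[of "{..<k}" "\<lambda>i. c i *\<^sub>R h i x" p] hd
    by (force simp: H_def powr_mult)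
  have vM: "integrable ?M (\<lambda>x. \<bar>v i x\<bar> powr p)" if "i < k" for i
    using continuous_surface_Lp[OF fin bd C1_gradient_continuous[OF vC[OF that]], of p] p by (simp add: Lp_def)
  have vL: "integrable (lebesgue_on \<Omega>) (\<lambda>x. \<bar>v i x\<bar> powr p)" if "i < k" for i
    using continuous_Lp_lebesgue_on[OF op bd _ C1_gradient_continuous[OF vC[OF that]], of p] p by (simp add: Lp_def)
  have hL: "integrable (lebesgue_on \<Omega>) (\<lambda>x. norm (h i x) powr p)" if "i < k" for i
    using continuous_Lp_lebesgue_on[OF op bd, of p "h i"] vC[OF that] p by (simp add: Lp_def C1_gradient_def)
  have vM1: "(\<integral>x. \<bar>v i x\<bar> powr p \<partial>?M) = 1" if "i < k" for i
  proof -
    have "(\<integral>x. \<bar>v i x\<bar> powr p \<partial>?M) = (\<integral>x. 1 / b i * \<bar>u i x\<bar> powr p \<partial>?M)"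
      by (simp add: v_def abs_mult powr_mult bp[OF that])
    also have "\<dots> = 1 / b i * b i" unfolding b_def by (rule integral_mult_right_zero)
    finally show ?thesis using b0[OF that] by simp
  qed
  have hLL: "(\<integral>x. norm (h i x) powr p \<partial>lebesgue_on \<Omega>) \<le> L" if "i < k" for i
  proof -
    have "(\<integral>x. norm (h i x) powr p \<partial>lebesgue_on \<Omega>) = (\<integral>x. 1 / b i * norm (g i x) powr p \<partial>lebesgue_on \<Omega>)"
      by (simp add: h_def powr_mult bp[OF that])
    also have "\<dots> = 1 / b i * (\<integral>x. norm (g i x) powr p \<partial>lebesgue_on \<Omega>)" by (rule integral_mult_right_zero)
    also have "\<dots> \<le> 1 / b i * (L * b i)"
      using ray[OF that] b0[OF that] unfolding b_def[symmetric] by (intro mult_left_mono) auto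
    finally show ?thesis using b0[OF that] by simp
  qed
  define S where "S = {c :: nat \<Rightarrow> real. (\<forall>i\<ge>k. c i = 0) \<and> (\<Sum>i<k. \<bar>c i\<bar> powr p) = 1}"
  have PM: "(\<integral>x. \<bar>\<Psi> c x\<bar> powr p \<partial>?M) = (\<Sum>i<k. \<bar>c i\<bar> powr p)" for c
    unfolding P_powr by (subst Bochner_Integration.integral_sum) (auto simp: vM vM1)
  have HL: "(\<integral>x. norm (H c x) powr p \<partial>lebesgue_on \<Omega>) = (\<Sum>i<k. \<bar>c i\<bar> powr p * (\<integral>x. norm (h i x) powr p \<partial>lebesgue_on \<Omega>))" for c
    unfolding H_powr by (subst Bochner_Integration.integral_sum) (auto simp: hL)
  have PL: "(\<integral>x. \<bar>\<Psi> c x\<bar> powr p \<partial>lebesgue_on \<Omega>) = (\<Sum>i<k. \<bar>c i\<bar> powr p * (\<integral>x. \<bar>v i x\<bar> powr p \<partial>lebesgue_on \<Omega>))" for c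
    unfolding P_powr by (subst Bochner_Integration.integral_sum) (auto simp: vL)
  have trP: "(\<integral>x. \<bar>boundary_trace \<Omega> p (\<Psi> c) x\<bar> powr p \<partial>?M) = (\<Sum>i<k. \<bar>c i\<bar> powr p)" for c
    unfolding integral_boundary_trace[OF \<Omega> n p fin PC] by (rule PM)
  have Ps: "\<Psi> c \<in> sobolev \<Omega> p" for c by (rule C1_gradient_sobolev(1)[OF op bd p1 PC])
  have rq: "rayleigh_quotient \<Omega> p (\<Psi> c) \<le> ennreal L" if c: "c \<in> S" for c
  proof -
    have "(\<integral>x. norm (H c x) powr p \<partial>lebesgue_on \<Omega>) \<le> (\<Sum>i<k. \<bar>c i\<bar> powr p * L)"
      unfolding HL by (intro sum_mono mult_left_mono hLL) auto
    also have "\<dots> = L" using c by (simp add: S_def sum_distrib_right[symmetric])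
    finally show ?thesis
      using c by (simp add: rayleigh_quotient_def trP integral_weak_gradient[OF op bd p1 PC] S_def ennreal_leI)
  qed
  define A where "A i = (\<integral>x. \<bar>v i x\<bar> powr p \<partial>lebesgue_on \<Omega>) + (\<integral>x. norm (h i x) powr p \<partial>lebesgue_on \<Omega>)" for i
  have sn: "sobolev_norm \<Omega> p (\<Psi> c) = (\<Sum>i<k. \<bar>c i\<bar> powr p * A i) powr (1 / p)" for c
    unfolding sobolev_norm_def integral_weak_gradient[OF op bd p1 PC] PL HL A_def
    by (simp add: sum.distrib distrib_left)
  have Pdiff: "(\<lambda>x. \<Psi> c' x - \<Psi> c x) = \<Psi> (\<lambda>i. c' i - c i)" for c c'
    by (simp add: \<Psi>_def fun_eq_iff sum_subtractf left_diff_distrib)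
  have Pneg: "\<Psi> (\<lambda>i. - c i) = (\<lambda>x. - \<Psi> c x)" for c
    by (simp add: \<Psi>_def fun_eq_iff sum_negf)
  have cm: "continuous_map (top_of_set S) ?X \<Psi>"
    unfolding continuous_map_def
  proof (intro conjI allI impI)
    show "\<Psi> \<in> topspace (top_of_set S) \<rightarrow> topspace ?X" using Ps by (simp add: topspace_sobolev_topology)
    fix U assume U: "openin ?X U"
    show "openin (top_of_set S) {c \<in> topspace (top_of_set S). \<Psi> c \<in> U}"
    proof (subst openin_subopen, intro ballI)
      fix c assume c: "c \<in> {c \<in> topspace (top_of_set S). \<Psi> c \<in> U}"
      then obtain e where e: "e > 0" "\<And>w. w \<in> sobolev \<Omega> p \<Longrightarrow> sobolev_norm \<Omega> p (\<lambda>x. w x - \<Psi> c x) < e \<Longrightarrow> w \<in> U"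
        using U unfolding openin_sobolev_topology by blast
      define B where "B c' = (\<Sum>i<k. \<bar>c' i - c i\<bar> powr p * A i)" for c' :: "nat \<Rightarrow> real"
      have Bc: "continuous_on UNIV B"
        unfolding B_def
        by (intro continuous_on_sum continuous_on_mult continuous_on_powr' continuous_on_rabs continuous_on_diff
            continuous_on_product_coordinates continuous_on_const) (use p0 in auto)
      define T where "T = B -` {..<e powr p}"
      have "open T" unfolding T_def using Bc by (auto intro!: open_vimage)
      moreover have "c \<in> T" using e(1) p0 by (simp add: T_def B_def)
      moreover have "\<Psi> c' \<in> U" if c': "c' \<in> T" for c'
      proof (rule e(2)[OF Ps])
        have A0: "A i \<ge> 0" for i by (simp add: A_def)
        have B0: "B c' \<ge> 0" unfolding B_def using A0 by (intro sum_nonneg) auto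
        have "sobolev_norm \<Omega> p (\<lambda>x. \<Psi> c' x - \<Psi> c x) = B c' powr (1 / p)"
          unfolding Pdiff sn B_def ..
        also have "\<dots> < (e powr p) powr (1 / p)"
          using c' B0 p0 by (intro powr_less_mono2) (auto simp: T_def)
        also have "\<dots> = e" using e(1) p0 by (simp add: powr_powr)
        finally show "sobolev_norm \<Omega> p (\<lambda>x. \<Psi> c' x - \<Psi> c x) < e" .
      qed
      ultimately show "\<exists>T. openin (top_of_set S) T \<and> c \<in> T \<and> T \<subseteq> {c \<in> topspace (top_of_set S). \<Psi> c \<in> U}"
        using c by (intro exI[of _ "S \<inter> T"]) (auto intro: openin_open_Int)
    qed
  qed
  define F where "F = \<Psi> ` S"
  have Sneg: "(\<lambda>i. - c i) \<in> S" if "c \<in> S" for c using that by (simp add: S_def)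
  have nz: "\<not> (AE x in lebesgue_on \<Omega>. \<Psi> c x = 0)" if c: "c \<in> S" for c
  proof
    assume "AE x in lebesgue_on \<Omega>. \<Psi> c x = 0"
    then have ae: "AE x in lebesgue. x \<in> \<Omega> \<longrightarrow> \<Psi> c x = 0"
      by (subst (asm) AE_restrict_space_iff) (use op in auto)
    have cl: "closed {x. \<Psi> c x = 0}"
      using continuous_closed_vimage[of "{0}" "\<Psi> c"] C1_gradient_continuous[OF PC, of UNIV c]
      by (auto simp: vimage_def continuous_on_eq_continuous_at)
    have "x \<in> {x. \<Psi> c x = 0}" if "x \<in> \<Omega>" for x
      by (rule mem_closed_if_AE_lebesgue_open[OF op cl _ that]) (use ae in simp)
    then have "closure \<Omega> \<subseteq> {x. \<Psi> c x = 0}" by (intro closure_minimal cl) auto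
    then have "\<Psi> c x = 0" if "x \<in> frontier \<Omega>" for x using that by (auto simp: frontier_def)
    then have "(\<integral>x. \<bar>\<Psi> c x\<bar> powr p \<partial>?M) = (\<integral>x. 0 \<partial>?M)"
      using p0 by (intro Bochner_Integration.integral_cong) auto
    then show False using c by (simp add: PM S_def)
  qed
  have "F \<in> steklov_family \<Omega> p k"
    unfolding steklov_family_def
  proof (intro CollectI conjI)
    show "F \<subseteq> {u \<in> sobolev \<Omega> p. \<not> (AE x in lebesgue_on \<Omega>. u x = 0)}" using Ps nz by (auto simp: F_def)
    show "(\<lambda>u x. - u x) ` F = F"
    proof -
      have sub: "(\<lambda>u x. - u x) ` F \<subseteq> F"
      proof
        fix w assume "w \<in> (\<lambda>u x. - u x) ` F"
        then obtain c where c: "c \<in> S" "w = (\<lambda>x. - \<Psi> c x)" by (auto simp: F_def)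
        then have "w = \<Psi> (\<lambda>i. - c i)" by (simp add: Pneg)
        then show "w \<in> F" using Sneg[OF c(1)] by (simp add: F_def)
      qed
      have "F = (\<lambda>u x. - u x) ` ((\<lambda>u x. - u x) ` F)" by (simp add: image_image)
      also have "\<dots> \<subseteq> (\<lambda>u x. - u x) ` F" using sub by (rule image_mono)
      finally show ?thesis using sub by blast
    qed
    have "F \<inter> {u. Lp_norm ?M p (boundary_trace \<Omega> p u) = 1} = F"
      using trP by (auto simp: F_def Lp_norm_def S_def)
    moreover have "compactin ?X F"
      unfolding F_def
    proof (rule image_compactin[OF _ cm])
      show "compactin (top_of_set S) S"
        using compact_lp_sphere[OF p0, of k] by (simp add: S_def compactin_subtopology)
    qed
    ultimately show "compactin ?X (F \<inter> {u. Lp_norm ?M p (boundary_trace \<Omega> p u) = 1})" by simp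
    show "enat k \<le> genus ?X F"
      unfolding genus_def
    proof (rule Inf_greatest, clarify)
      fix l f assume l: "l \<ge> 1" and f: "continuous_map (subtopology ?X F) (subtopology (Euclidean_space l) (- {\<lambda>i. 0})) f"
        and odd: "\<forall>u\<in>F. f (\<lambda>x. - u x) = (\<lambda>i. - f u i)"
      show "enat k \<le> enat l"
      proof (rule ccontr)
        assume "\<not> enat k \<le> enat l"
        then have lk: "l < k" by simp
        have cm': "continuous_map (top_of_set S) (subtopology ?X F) \<Psi>"
          using cm by (auto simp: continuous_map_in_subtopology F_def)
        have cf: "continuous_map (top_of_set S) (subtopology (Euclidean_space l) (- {\<lambda>i. 0})) (f \<circ> \<Psi>)"
          by (rule continuous_map_compose[OF cm' f])
        then have cE: "continuous_map (top_of_set S) (Euclidean_space l) (f \<circ> \<Psi>)"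
          and im: "\<And>c. c \<in> S \<Longrightarrow> f (\<Psi> c) \<noteq> (\<lambda>i. 0)"
          by (auto simp: continuous_map_in_subtopology)
        then have cp: "continuous_map (top_of_set S) (powertop_real UNIV) (f \<circ> \<Psi>)"
          and "f \<circ> \<Psi> \<in> S \<rightarrow> {x. \<forall>i\<ge>l. x i = 0}"
          unfolding Euclidean_space_def by (auto simp: continuous_map_in_subtopology)
        then have iE: "f (\<Psi> c) i = 0" if "c \<in> S" "i \<ge> l" for c i
          using that by (auto simp: Pi_def)
        have "\<exists>c\<in>S. \<forall>i<l. (f \<circ> \<Psi>) c i = 0"
          unfolding S_def
        proof (rule borsuk_ulam_sphere[OF p0 lk], fold S_def)
          show "continuous_on S (\<lambda>c. (f \<circ> \<Psi>) c i)" for i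
            using cp by (simp add: continuous_map_componentwise_UNIV)
          show "(f \<circ> \<Psi>) (\<lambda>j. - c j) i = - (f \<circ> \<Psi>) c i" if "c \<in> S" for c i
            using odd that by (auto simp: Pneg F_def)
        qed
        then obtain c where c: "c \<in> S" "\<forall>i<l. f (\<Psi> c) i = 0" by auto
        then have "f (\<Psi> c) = (\<lambda>i. 0)" using iE[OF c(1)] by (metis not_le)
        then show False using im[OF c(1)] by simp
      qed
    qed
  qed
  then have "steklov_eigenvalue \<Omega> p k \<le> (SUP u\<in>F. rayleigh_quotient \<Omega> p u)"
    unfolding steklov_eigenvalue_def by (rule INF_lower)
  also have "\<dots> \<le> ennreal L" using rq by (intro SUP_least) (auto simp: F_def)
  finally show ?thesis .
qed

section \<open>Test functions from the boundary measure\<close>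

text \<open>
  The surface measure as a measure on the whole space, where the greedy choice of balls takes place.
\<close>

definition boundary_mass :: "(real^'n) set \<Rightarrow> (real^'n) measure" where
  "boundary_mass \<Omega> = distr (surface_measure \<Omega>) borel (\<lambda>x. x)"

lemma measurable_id_surface: "(\<lambda>x. x) \<in> surface_measure \<Omega> \<rightarrow>\<^sub>M borel"
  unfolding surface_measure_def
  by (intro measurable_restrict_space1 measurable_ident_sets) simp

lemma sets_boundary_mass [simp]: "sets (boundary_mass \<Omega>) = sets borel"
  by (simp add: boundary_mass_def)

lemma measure_boundary_mass:
  "A \<in> sets borel \<Longrightarrow> measure (boundary_mass \<Omega>) A = measure (surface_measure \<Omega>) (A \<inter> frontier \<Omega>)"
  unfolding boundary_mass_def by (subst measure_distr[OF measurable_id_surface]) auto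

lemma finite_boundary_mass: "finite_measure (surface_measure \<Omega>) \<Longrightarrow> finite_measure (boundary_mass \<Omega>)"
  unfolding boundary_mass_def by (rule finite_measure.finite_measure_distr[OF _ measurable_id_surface])

lemma hausdorff_outer_singleton: "hausdorff_outer s {x} = 0"
proof -
  have "hausdorff_content s \<delta> {x} \<le> 0" if "\<delta> > 0" for \<delta>
    unfolding hausdorff_content_def
    by (rule INF_lower2[of "\<lambda>_. {x}"]) (use that in auto)
  then show ?thesis unfolding hausdorff_outer_def by (auto simp: SUP_eq_iff)
qed

lemma boundary_mass_singleton:
  fixes x :: "real^'n"
  assumes "CARD('n) \<ge> 2"
  shows "measure (boundary_mass \<Omega>) {x} = 0"
proof (cases "x \<in> frontier \<Omega>")
  case True
  then have "emeasure (surface_measure \<Omega>) {x} = 0"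
    using emeasure_surface_measure[OF assms, of "{x}" \<Omega>] by (simp add: hausdorff_outer_singleton)
  then have "measure (surface_measure \<Omega>) {x} = 0" by (simp add: measure_def)
  then show ?thesis using True by (simp add: measure_boundary_mass)
qed (simp add: measure_boundary_mass)

lemma sum_powr_le:
  fixes a :: "'i \<Rightarrow> real"
  assumes J: "finite J" "card J \<le> P" and a: "\<And>j. j \<in> J \<Longrightarrow> a j \<ge> 0" and p: "p > 0"
  shows "(\<Sum>j\<in>J. a j) powr p \<le> real P powr p * (\<Sum>j\<in>J. a j powr p)"
proof (cases "J = {}")
  case False
  have "Max (a ` J) \<in> a ` J" using J False by (intro Max_in) auto
  then obtain i where i: "i \<in> J" "a i = Max (a ` J)" by auto
  have "(\<Sum>j\<in>J. a j) \<le> (\<Sum>j\<in>J. a i)" using J i by (intro sum_mono) (auto intro: Max_ge)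
  also have "\<dots> \<le> real P * a i" using J a[OF i(1)] by (simp add: mult_right_mono)
  finally have "(\<Sum>j\<in>J. a j) powr p \<le> (real P * a i) powr p"
    using a p by (intro powr_mono2 sum_nonneg) auto
  also have "\<dots> = real P powr p * a i powr p" using a[OF i(1)] by (simp add: powr_mult)
  also have "\<dots> \<le> real P powr p * (\<Sum>j\<in>J. a j powr p)"
    using J i by (intro mult_left_mono member_le_sum) auto
  finally show ?thesis .
qed simp

lemma gradient_energy_le:
  fixes g :: "real^'n \<Rightarrow> real^'n" and J :: "nat set"
  assumes \<Omega>: "open \<Omega>" "bounded \<Omega>" and p: "p > 0" and g: "continuous_on UNIV g"
    and A: "open A" "\<And>x. x \<notin> A \<Longrightarrow> g x = 0"
    and J: "finite J" "card J \<le> P" "\<And>j. j \<in> J \<Longrightarrow> \<rho> j > 0"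
    and bound: "\<And>x. norm (g x) \<le> (\<Sum>j\<in>J. 16 / \<rho> j * indicator (ball (c j) (2 * \<rho> j)) x)"
  shows "(\<integral>x. norm (g x) powr p \<partial>lebesgue_on \<Omega>) \<le>
    real P powr p * (\<Sum>j\<in>J. (16 / \<rho> j) powr p * measure lebesgue (\<Omega> \<inter> A \<inter> ball (c j) (2 * \<rho> j)))"
proof -
  interpret finite_measure "lebesgue_on \<Omega>" by (rule finite_measure_lebesgue_on_open[OF \<Omega>])
  let ?B = "\<lambda>j. \<Omega> \<inter> A \<inter> ball (c j) (2 * \<rho> j)"
  have Bs: "?B j \<in> sets (lebesgue_on \<Omega>)" for j
    using \<Omega>(1) A(1) by (subst sets_restrict_space_iff) auto
  have Bi: "integrable (lebesgue_on \<Omega>) (indicator (?B j) :: _ \<Rightarrow> real)" for j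
    using Bs by (intro integrable_real_indicator) (auto simp: emeasure_eq_measure)
  have Bm: "(\<integral>x. indicator (?B j) x \<partial>lebesgue_on \<Omega>) = measure lebesgue (?B j)" for j
  proof -
    have "?B j \<inter> space (lebesgue_on \<Omega>) = ?B j" by (auto simp: space_restrict_space)
    then have "(\<integral>x. indicator (?B j) x \<partial>lebesgue_on \<Omega>) = measure (lebesgue_on \<Omega>) (?B j)"
      by simp
    also have "\<dots> = measure lebesgue (?B j)" by (rule measure_restrict_space) (use \<Omega> in auto)
    finally show ?thesis .
  qed
  have pw: "norm (g x) powr p \<le> real P powr p * (\<Sum>j\<in>J. (16 / \<rho> j) powr p * indicator (?B j) x)" if x: "x \<in> \<Omega>" for x
  proof (cases "x \<in> A")
    case False
    then show ?thesis using A(2) by simp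
  next
    case True
    have "norm (g x) powr p \<le> (\<Sum>j\<in>J. 16 / \<rho> j * indicator (ball (c j) (2 * \<rho> j)) x) powr p"
      using bound p by (intro powr_mono2) auto
    also have "\<dots> \<le> real P powr p * (\<Sum>j\<in>J. (16 / \<rho> j * indicator (ball (c j) (2 * \<rho> j)) x) powr p)"
      using J(3) by (intro sum_powr_le J(1,2) p) (auto simp: indicator_def intro: less_imp_le)
    also have "(\<Sum>j\<in>J. (16 / \<rho> j * indicator (ball (c j) (2 * \<rho> j)) x) powr p) = (\<Sum>j\<in>J. (16 / \<rho> j) powr p * indicator (?B j) x)"
      using True x by (intro sum.cong refl) (auto simp: indicator_def)
    finally show ?thesis .
  qed
  have "(\<integral>x. norm (g x) powr p \<partial>lebesgue_on \<Omega>) \<le>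
     (\<integral>x. real P powr p * (\<Sum>j\<in>J. (16 / \<rho> j) powr p * indicator (?B j) x) \<partial>lebesgue_on \<Omega>)"
  proof (rule integral_mono)
    show "integrable (lebesgue_on \<Omega>) (\<lambda>x. norm (g x) powr p)"
      using continuous_Lp_lebesgue_on[OF \<Omega> _ g, of p] p by (simp add: Lp_def)
    show "integrable (lebesgue_on \<Omega>) (\<lambda>x. real P powr p * (\<Sum>j\<in>J. (16 / \<rho> j) powr p * indicator (?B j) x))"
      using Bi by (intro integrable_mult_right Bochner_Integration.integrable_sum) auto
  qed (use pw in auto)
  also have "\<dots> = real P powr p * (\<Sum>j\<in>J. (16 / \<rho> j) powr p * measure lebesgue (?B j))"
  proof -
    have "(\<integral>x. (\<Sum>j\<in>J. (16 / \<rho> j) powr p * indicator (?B j) x) \<partial>lebesgue_on \<Omega>) =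
        (\<Sum>j\<in>J. (\<integral>x. (16 / \<rho> j) powr p * indicator (?B j) x \<partial>lebesgue_on \<Omega>))"
      using Bi by (intro Bochner_Integration.integral_sum integrable_mult_right) auto
    also have "\<dots> = (\<Sum>j\<in>J. (16 / \<rho> j) powr p * measure lebesgue (?B j))"
      by (simp only: integral_mult_right_zero Bm)
    finally show ?thesis by (simp only: integral_mult_right_zero)
  qed
  finally show ?thesis .
qed

lemma steklov_eigenvalue_le_family:
  fixes \<Omega> :: "(real^'n) set" and I :: "nat set"
  assumes \<Omega>: "bounded_lipschitz_domain \<Omega>" and n: "CARD('n) \<ge> 2" and p: "p > 1"
    and fin: "finite_measure (surface_measure \<Omega>)" and k: "k \<ge> 1" and I: "finite I" "card I \<ge> k" and m: "m > 0"
    and u: "\<And>i. i \<in> I \<Longrightarrow> C1_gradient (u i) (g i)" "\<And>i x. i \<in> I \<Longrightarrow> 0 \<le> u i x"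
    and disj: "\<And>i j x. i \<in> I \<Longrightarrow> j \<in> I \<Longrightarrow> i \<noteq> j \<Longrightarrow> u i x = 0 \<or> u j x = 0"
    and mass: "\<And>i. i \<in> I \<Longrightarrow> m \<le> (\<integral>x. \<bar>u i x\<bar> powr p \<partial>surface_measure \<Omega>)"
    and energy: "\<And>i. i \<in> I \<Longrightarrow> (\<integral>x. norm (g i x) powr p \<partial>lebesgue_on \<Omega>) \<le> E"
  shows "steklov_eigenvalue \<Omega> p k \<le> ennreal (E / m)"
proof -
  obtain I' where I': "I' \<subseteq> I" "card I' = k" using obtain_subset_with_card_n[OF I(2)] by metis
  have "finite I'" using I' I finite_subset by blast
  then obtain e where e: "bij_betw e {..<k} I'" using bij_betw_from_nat_into_finite I'(2) by blast
  have eI: "e i \<in> I" if "i < k" for i using e I'(1) that by (auto simp: bij_betw_def)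
  have einj: "e i \<noteq> e j" if "i < k" "j < k" "i \<noteq> j" for i j
    using e that by (auto simp: bij_betw_def inj_on_def)
  have "0 \<le> (\<integral>x. norm (g (e 0) x) powr p \<partial>lebesgue_on \<Omega>)" by simp
  also have "\<dots> \<le> E" using k by (intro energy eI) simp
  finally have E: "E \<ge> 0" .
  show ?thesis
  proof (rule steklov_eigenvalue_le[OF \<Omega> n p fin, where u = "\<lambda>i. u (e i)" and g = "\<lambda>i. g (e i)"])
    show "E / m \<ge> 0" using E m by simp
    fix i assume i: "i < k"
    show "C1_gradient (u (e i)) (g (e i))" by (rule u(1)[OF eI[OF i]])
    show "0 < (\<integral>x. \<bar>u (e i) x\<bar> powr p \<partial>surface_measure \<Omega>)" using mass[OF eI[OF i]] m by linarith
    have "E = E / m * m" using m by simp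
    also have "\<dots> \<le> E / m * (\<integral>x. \<bar>u (e i) x\<bar> powr p \<partial>surface_measure \<Omega>)"
      using mass[OF eI[OF i]] E m by (intro mult_left_mono) auto
    finally show "(\<integral>x. norm (g (e i) x) powr p \<partial>lebesgue_on \<Omega>) \<le> E / m * (\<integral>x. \<bar>u (e i) x\<bar> powr p \<partial>surface_measure \<Omega>)"
      using energy[OF eI[OF i]] by linarith
  qed (use u(2) eI disj einj in auto)
qed

text \<open>
  The factor \<open>6\<close> in \<open>m\<close> leaves room for \<open>3 k\<close> balls: these use up at most half of the measure, and one more
  mass \<open>m\<close> has to be available at each step.
\<close>

theorem boundary_capacitors:
  fixes \<Omega> :: "(real^'n) set"
  assumes \<Omega>: "bounded_lipschitz_domain \<Omega>" and n: "CARD('n) \<ge> 2" and p: "p > 1" and S: "boundary_area \<Omega> > 0" and k: "k \<ge> 1"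
    and M: "\<forall>(x::real^'n) r. r > 0 \<longrightarrow> (\<exists>Z. finite Z \<and> card Z \<le> M \<and> cball x (18 * r) \<subseteq> (\<Union>z\<in>Z. ball z (r / 2)))" "M \<ge> 1"
  defines "m \<equiv> boundary_area \<Omega> / (6 * real k * real M)"
  shows "\<exists>(I :: nat set) u g. finite I \<and> card I \<ge> 2 * k \<and>
    (\<forall>i\<in>I. C1_gradient (u i) (g i) \<and> (\<forall>x. 0 \<le> u i x) \<and> m \<le> (\<integral>x. \<bar>u i x\<bar> powr p \<partial>surface_measure \<Omega>) \<and>
      heavy_ball_gradient (boundary_mass \<Omega>) (M + 3) m (g i)) \<and>
    (\<forall>i\<in>I. \<forall>j\<in>I. i \<noteq> j \<longrightarrow> (\<forall>x. u i x = 0 \<or> u j x = 0))"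
proof -
  let ?S = "surface_measure \<Omega>"
  have bd: "bounded \<Omega>" using \<Omega> by (auto simp: bounded_lipschitz_domain_def)
  have fin: "finite_measure ?S" by (rule finite_surface_measure[OF S])
  interpret finite_measure ?S by fact
  have "bounded (frontier \<Omega>)" using compact_frontier_bounded[OF bd] compact_imp_bounded by blast
  then obtain R where R: "frontier \<Omega> \<subseteq> ball 0 R" using bounded_subset_ballD by blast
  have kM: "real k * real M \<ge> 1" using k M(2) by (metis mult_le_mono of_nat_1 of_nat_le_iff of_nat_mult mult_1)
  have m: "m > 0" unfolding m_def using S k M(2) by simp
  have supp: "measure (boundary_mass \<Omega>) (- ball 0 R) = 0"
  proof -
    have "- ball 0 R \<inter> frontier \<Omega> = {}" using R by auto
    then show ?thesis by (simp add: measure_boundary_mass)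
  qed
  have tot: "real (3 * k) * real M * m + m \<le> measure (boundary_mass \<Omega>) UNIV"
  proof -
    have "measure (boundary_mass \<Omega>) UNIV = boundary_area \<Omega>" by (simp add: measure_boundary_mass boundary_area_def)
    moreover have "real (3 * k) * real M * m = boundary_area \<Omega> / 2"
      using k M(2) by (simp add: m_def field_simps)
    moreover have "m \<le> boundary_area \<Omega> / 6"
      unfolding m_def using kM S by (intro divide_left_mono) auto
    ultimately show ?thesis using S by linarith
  qed
  obtain I :: "nat set" and u g where I: "finite I" "card I \<ge> 2 * k"
    and P: "\<forall>i\<in>I. C1_gradient (u i) (g i) \<and> (\<forall>x. 0 \<le> u i x \<and> u i x \<le> 1) \<and>
      m \<le> measure (boundary_mass \<Omega>) {x. u i x = 1} \<and> heavy_ball_gradient (boundary_mass \<Omega>) (M + 3) m (g i)"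
    and D: "\<forall>i\<in>I. \<forall>j\<in>I. i \<noteq> j \<longrightarrow> (\<forall>x. u i x = 0 \<or> u j x = 0)"
    using capacitors[OF finite_boundary_mass[OF fin] sets_boundary_mass supp boundary_mass_singleton[OF n] m M(1) tot]
    by (elim exE conjE) (rule that)
  have mass: "m \<le> (\<integral>x. \<bar>u i x\<bar> powr p \<partial>?S)" if i: "i \<in> I" for i
  proof -
    have C: "C1_gradient (u i) (g i)" using P i by blast
    have uc: "continuous_on UNIV (u i)" by (rule C1_gradient_continuous[OF C])
    let ?A = "{x \<in> frontier \<Omega>. u i x = 1}"
    have um: "u i \<in> borel_measurable ?S" by (rule continuous_surface_measurable[OF C1_gradient_continuous[OF C]])
    have As: "?A \<in> sets ?S"
    proof -
      have "{x \<in> space ?S. u i x = 1} \<in> sets ?S" using um by measurable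
      then show ?thesis by simp
    qed
    have ub: "{x. u i x = 1} \<in> sets borel" using borel_measurable_continuous_onI[OF uc] by measurable
    have "{x. u i x = 1} \<inter> frontier \<Omega> = ?A" by auto
    then have "m \<le> measure ?S ?A" using P i measure_boundary_mass[OF ub] by auto
    also have "\<dots> = (\<integral>x. indicator ?A x \<partial>?S)" using As sets.sets_into_space[OF As] by (simp add: Int_absorb2)
    also have "\<dots> \<le> (\<integral>x. \<bar>u i x\<bar> powr p \<partial>?S)"
    proof (rule integral_mono)
      show "integrable ?S (indicator ?A :: _ \<Rightarrow> real)" using As by (intro integrable_real_indicator) (auto simp: emeasure_eq_measure)
      show "integrable ?S (\<lambda>x. \<bar>u i x\<bar> powr p)"
        using continuous_surface_Lp[OF fin bd C1_gradient_continuous[OF C], of p] p by (simp add: Lp_def)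
    qed (auto simp: indicator_def)
    finally show ?thesis .
  qed
  show ?thesis
  proof (intro exI conjI)
    show "\<forall>i\<in>I. C1_gradient (u i) (g i) \<and> (\<forall>x. 0 \<le> u i x) \<and> m \<le> (\<integral>x. \<bar>u i x\<bar> powr p \<partial>?S) \<and>
      heavy_ball_gradient (boundary_mass \<Omega>) (M + 3) m (g i)"
      using P mass by blast
    show "\<forall>i\<in>I. \<forall>j\<in>I. i \<noteq> j \<longrightarrow> (\<forall>x. u i x = 0 \<or> u j x = 0)" by (rule D)
  qed (rule I)+
qed

section \<open>The two estimates\<close>

lemma le_geometric_mean:
  fixes t X Y \<theta> :: real
  assumes "0 \<le> t" "t \<le> X" "t \<le> Y" "0 \<le> \<theta>" "\<theta> \<le> 1"
  shows "t \<le> X powr (1 - \<theta>) * Y powr \<theta>"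
proof (cases "t = 0")
  case False
  then have "t = t powr (1 - \<theta>) * t powr \<theta>" using assms(1) by (simp add: powr_add[symmetric])
  also have "\<dots> \<le> X powr (1 - \<theta>) * Y powr \<theta>"
    using assms by (intro mult_mono powr_mono2) auto
  finally show ?thesis .
qed (use assms in auto)

lemma measure_lebesgue_ball:
  fixes c :: "real^'n"
  shows "r \<ge> 0 \<Longrightarrow> measure lebesgue (ball c r) = unit_ball_vol (real CARD('n)) * r ^ CARD('n)"
  using content_ball[of r c] by simp

lemma measure_lebesgue_open_pos:
  fixes \<Omega> :: "'a::euclidean_space set"
  assumes "open \<Omega>" "bounded \<Omega>" "\<Omega> \<noteq> {}"
  shows "measure lebesgue \<Omega> > 0"
proof -
  have "\<not> negligible \<Omega>" using assms open_not_negligible by blast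
  moreover have "\<Omega> \<in> lmeasurable" using assms by (intro lmeasurable_open)
  ultimately show ?thesis by (simp add: negligible_iff_measure zero_less_measure_iff)
qed

text \<open>
  More than \<open>k\<close> disjoint sets of volume larger than \<open>|\<Omega>| / k\<close> do not fit into \<open>\<Omega>\<close>.
\<close>

lemma card_small_pieces:
  fixes \<Omega> :: "(real^'n) set" and A :: "nat \<Rightarrow> (real^'n) set"
  assumes \<Omega>: "open \<Omega>" "bounded \<Omega>" "\<Omega> \<noteq> {}" and A: "\<And>i. i \<in> I \<Longrightarrow> open (A i)" "finite I" "card I \<ge> 2 * k" and k: "k \<ge> 1"
    and disj: "\<And>i j. i \<in> I \<Longrightarrow> j \<in> I \<Longrightarrow> i \<noteq> j \<Longrightarrow> A i \<inter> A j = {}"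
  shows "card {i \<in> I. measure lebesgue (\<Omega> \<inter> A i) \<le> measure lebesgue \<Omega> / real k} \<ge> k"
proof -
  let ?V = "measure lebesgue \<Omega>" and ?\<mu> = "\<lambda>i. measure lebesgue (\<Omega> \<inter> A i)"
  let ?G = "{i \<in> I. ?\<mu> i \<le> ?V / real k}" and ?B = "{i \<in> I. \<not> ?\<mu> i \<le> ?V / real k}"
  have fm: "\<Omega> \<in> fmeasurable lebesgue" and fmA: "\<And>i. i \<in> I \<Longrightarrow> \<Omega> \<inter> A i \<in> fmeasurable lebesgue"
    using \<Omega> A by (auto intro!: lmeasurable_open bounded_Int)
  have V: "?V > 0" by (rule measure_lebesgue_open_pos[OF \<Omega>])
  have "real (card ?B) * (?V / real k) = (\<Sum>i\<in>?B. ?V / real k)" by simp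
  also have "\<dots> \<le> (\<Sum>i\<in>?B. ?\<mu> i)" by (intro sum_mono) auto
  also have "\<dots> = measure lebesgue (\<Union>i\<in>?B. \<Omega> \<inter> A i)"
    by (rule measure_UNION'[symmetric]) (use A fmA disj in \<open>fastforce simp: pairwise_def disjnt_def\<close>)+
  also have "\<dots> \<le> ?V"
    by (rule measure_mono_fmeasurable) (use fm fmA A in \<open>auto intro!: sets.finite_UN\<close>)
  finally have "real (card ?B) \<le> real k" using V k by (simp add: field_simps)
  moreover have "card I = card ?G + card ?B"
    using A(2) by (subst card_Un_disjoint[symmetric]) (auto intro!: arg_cong[where f = card])
  ultimately show ?thesis using A(3) by simp
qed

text \<open>
  The exponent \<open>p / n\<close> of the interpolation is the one for which the power of \<open>\<rho>\<close> cancels.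
\<close>

lemma energy_bound_small:
  fixes A B t \<rho> :: real
  assumes "n \<ge> 2" "p > 1" "p \<le> real n" "\<rho> > 0" "0 \<le> t" "t \<le> X" "t \<le> w * (2 * \<rho>) ^ n" "w > 0"
  shows "(16 / \<rho>) powr p * t \<le> 32 powr p * w powr (p / real n) * X powr (1 - p / real n)"
proof -
  have "t \<le> X powr (1 - p / real n) * (w * (2 * \<rho>) ^ n) powr (p / real n)"
    using assms by (intro le_geometric_mean) auto
  also have "(w * (2 * \<rho>) ^ n) powr (p / real n) = w powr (p / real n) * (2 * \<rho>) powr p"
    using assms by (simp add: powr_mult powr_powr powr_realpow[symmetric])
  finally have "(16 / \<rho>) powr p * t \<le> (16 / \<rho>) powr p * (X powr (1 - p / real n) * (w powr (p / real n) * (2 * \<rho>) powr p))"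
    by (intro mult_left_mono) auto
  also have "\<dots> = ((16 / \<rho>) powr p * (2 * \<rho>) powr p) * w powr (p / real n) * X powr (1 - p / real n)" by simp
  also have "(16 / \<rho>) powr p * (2 * \<rho>) powr p = 32 powr p"
    using assms by (subst powr_mult[symmetric]) auto
  finally show ?thesis .
qed

lemma energy_bound_large:
  fixes t \<rho> s :: real
  assumes "p > real n" "0 < s" "s \<le> \<rho>" "t \<le> w * (2 * \<rho>) ^ n" "w > 0"
  shows "(16 / \<rho>) powr p * t \<le> 16 powr p * 2 ^ n * w * s powr (real n - p)"
proof -
  have \<rho>: "\<rho> > 0" using assms by simp
  have "(16 / \<rho>) powr p * t \<le> (16 / \<rho>) powr p * (w * (2 * \<rho>) ^ n)" using assms by (intro mult_left_mono) auto
  also have "\<dots> = 16 powr p * 2 ^ n * w * (\<rho> powr real n / \<rho> powr p)"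
    using \<rho> by (simp add: powr_divide powr_realpow power_mult_distrib)
  also have "\<rho> powr real n / \<rho> powr p = \<rho> powr (real n - p)" by (simp add: powr_diff)
  also have "16 powr p * 2 ^ n * w * \<rho> powr (real n - p) \<le> 16 powr p * 2 ^ n * w * s powr (real n - p)"
    using assms by (intro mult_left_mono powr_mono2') auto
  finally show ?thesis .
qed

lemma scaling_small:
  fixes S V k M K :: real
  assumes "n \<ge> 2" "p > 1" "p \<le> real n" "S > 0" "V > 0" "k > 0" "M > 0"
  shows "S powr ((p - 1) / (real n - 1)) * (K * (V / k) powr (1 - p / real n) / (S / (6 * k * M))) =
    6 * M * K / (S / V powr ((real n - 1) / real n)) powr ((real n - p) / (real n - 1)) * k powr (p / real n)"
proof -
  define q where "q = (real n - p) / (real n - 1)"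
  define r where "r = 1 - p / real n"
  have n: "real n - 1 > 0" "real n > 0" using assms by auto
  have q: "(p - 1) / (real n - 1) = 1 - q" "(real n - 1) / real n * q = r"
    using n by (auto simp: q_def r_def field_simps)
  have S: "S powr (1 - q) = S / S powr q" using assms by (simp add: powr_diff)
  have k: "k powr (p / real n) = k / k powr r" using assms by (simp add: r_def powr_diff)
  have V: "(V powr ((real n - 1) / real n)) powr q = V powr r" unfolding powr_powr q(2) ..
  show ?thesis
    unfolding q_def[symmetric] r_def[symmetric] q(1) S k
    using assms by (simp add: powr_divide V)
qed

lemma scaling_large:
  fixes S D k M K w :: real
  assumes "n \<ge> 2" "p > real n" "S > 0" "D > 0" "k > 0" "M > 0" "w > 0"
  shows "S powr ((p - 1) / (real n - 1)) *
      (K * (((S / (6 * k * M)) / (D * w)) powr (1 / (real n - 1))) powr (real n - p) / (S / (6 * k * M))) =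
    K * w powr ((p - real n) / (real n - 1)) * (6 * M) powr ((p - 1) / (real n - 1)) *
      D powr ((p - real n) / (real n - 1)) * k powr ((p - 1) / (real n - 1))"
proof -
  define q where "q = (p - real n) / (real n - 1)"
  have n: "real n - 1 > 0" using assms by auto
  have q: "(p - 1) / (real n - 1) = 1 + q" "1 / (real n - 1) * (real n - p) = - q"
    using n by (auto simp: q_def field_simps)
  have "(((S / (6 * k * M)) / (D * w)) powr (1 / (real n - 1))) powr (real n - p) = ((S / (6 * k * M)) / (D * w)) powr (- q)"
    unfolding powr_powr using q(2) by simp
  also have "\<dots> = (6 * M) powr q * k powr q * D powr q * w powr q / S powr q"
    using assms by (simp add: powr_minus_divide powr_divide powr_mult)
  finally have e: "(((S / (6 * k * M)) / (D * w)) powr (1 / (real n - 1))) powr (real n - p) = (6 * M) powr q * k powr q * D powr q * w powr q / S powr q" .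
  show ?thesis
    unfolding q_def[symmetric] q(1) e
    using assms by (simp add: powr_add)
qed

text \<open>
  The supremum is over a bounded set because the boundary is upper regular.
\<close>

lemma distortion_bound:
  fixes \<Omega> :: "(real^'n) set"
  assumes \<Omega>: "bounded_lipschitz_domain \<Omega>" and n: "CARD('n) \<ge> 2" and r: "r > 0"
  shows "measure (surface_measure \<Omega>) (frontier \<Omega> \<inter> ball x r) \<le>
    distortion \<Omega> * (unit_ball_vol (real CARD('n) - 1) * r powr (real CARD('n) - 1))"
proof -
  let ?w = "unit_ball_vol (real CARD('n) - 1)"
  let ?f = "\<lambda>(x :: real^'n, r). measure (surface_measure \<Omega>) (frontier \<Omega> \<inter> ball x r) / (?w * r powr (real CARD('n) - 1))"
  have w: "?w > 0" using n by (intro unit_ball_vol_pos) auto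
  obtain B where B: "B \<ge> 0" "\<And>x r. r > 0 \<Longrightarrow> emeasure (surface_measure \<Omega>) (frontier \<Omega> \<inter> ball x r) \<le> ennreal (B * r powr (real CARD('n) - 1))"
    using lipschitz_boundary_upper_regular[OF \<Omega> n] by blast
  have "?f (x, r) \<le> B / ?w" if "r > 0" for x r
  proof -
    have "measure (surface_measure \<Omega>) (frontier \<Omega> \<inter> ball x r) \<le> B * r powr (real CARD('n) - 1)"
      using enn2real_mono[OF B(2)[OF that, of x]] B(1) by (simp add: measure_def)
    then have "?f (x, r) \<le> B * r powr (real CARD('n) - 1) / (?w * r powr (real CARD('n) - 1))"
      unfolding case_prod_conv by (rule divide_right_mono) (use w in simp)
    also have "\<dots> = B / ?w" using that by simp
    finally show ?thesis .
  qed
  then have "bdd_above (?f ` (UNIV \<times> {0<..}))" by (intro bdd_aboveI2[of _ _ "B / ?w"]) auto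
  then have "?f (x, r) \<le> distortion \<Omega>" unfolding distortion_def by (rule cSUP_upper2[rotated 2, OF order_refl]) (use r in auto)
  then show ?thesis using w r by (simp add: field_simps)
qed

text \<open>
  Both estimates use the same test functions and differ only in how the energy \<open>Q\<close> of a single ball is bounded: one by
  the volume of \<open>\<Omega> \<inter> A\<close>, the other by the mass of the ball.
\<close>

theorem steklov_test_family:
  fixes \<Omega> :: "(real^'n) set"
  assumes \<Omega>: "bounded_lipschitz_domain \<Omega>" and n: "CARD('n) \<ge> 2" and p: "p > 1" and S: "boundary_area \<Omega> > 0" and k: "k \<ge> 1"
    and M: "\<forall>(x::real^'n) r. r > 0 \<longrightarrow> (\<exists>Z. finite Z \<and> card Z \<le> M \<and> cball x (18 * r) \<subseteq> (\<Union>z\<in>Z. ball z (r / 2)))" "M \<ge> 1"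
    and Q0: "Q \<ge> 0" and Q: "\<And>A c \<rho>. open A \<Longrightarrow> measure lebesgue (\<Omega> \<inter> A) \<le> measure lebesgue \<Omega> / real k \<Longrightarrow> \<rho> > 0 \<Longrightarrow>
       boundary_area \<Omega> / (6 * real k * real M) \<le> measure (boundary_mass \<Omega>) (ball c \<rho>) \<Longrightarrow>
       (16 / \<rho>) powr p * measure lebesgue (\<Omega> \<inter> A \<inter> ball c (2 * \<rho>)) \<le> Q"
  shows "steklov_eigenvalue \<Omega> p k \<le>
    ennreal (real (M + 3) powr p * (real (M + 3) * Q) / (boundary_area \<Omega> / (6 * real k * real M)))"
proof -
  let ?m = "boundary_area \<Omega> / (6 * real k * real M)"
  have op: "open \<Omega>" and bd: "bounded \<Omega>" and ne: "\<Omega> \<noteq> {}" using \<Omega> by (auto simp: bounded_lipschitz_domain_def)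
  obtain I :: "nat set" and u g where I: "finite I" "card I \<ge> 2 * k"
    and P: "\<forall>i\<in>I. C1_gradient (u i) (g i) \<and> (\<forall>x. 0 \<le> u i x) \<and> ?m \<le> (\<integral>x. \<bar>u i x\<bar> powr p \<partial>surface_measure \<Omega>) \<and>
      heavy_ball_gradient (boundary_mass \<Omega>) (M + 3) ?m (g i)"
    and D: "\<forall>i\<in>I. \<forall>j\<in>I. i \<noteq> j \<longrightarrow> (\<forall>x. u i x = 0 \<or> u j x = 0)"
    using boundary_capacitors[OF \<Omega> n p S k M] by (elim exE conjE) (rule that)
  have C: "C1_gradient (u i) (g i)" if "i \<in> I" for i using P that by blast
  define A where "A i = {x. u i x \<noteq> 0}" for i
  have Ao: "open (A i)" if "i \<in> I" for i
    unfolding A_def using C1_gradient_continuous[OF C[OF that], of UNIV]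
    by (intro open_Collect_neq) auto
  \<comment> \<open>test functions whose support takes up too much of \<open>\<Omega>\<close> are dropped; there are at most \<open>k\<close> of them\<close>
  define G where "G = {i \<in> I. measure lebesgue (\<Omega> \<inter> A i) \<le> measure lebesgue \<Omega> / real k}"
  have G: "finite G" "card G \<ge> k"
  proof -
    show "finite G" unfolding G_def using I by simp
    show "card G \<ge> k"
      unfolding G_def
    proof (rule card_small_pieces[OF op bd ne _ I k])
      show "open (A i)" if "i \<in> I" for i by (rule Ao[OF that])
      show "A i \<inter> A j = {}" if "i \<in> I" "j \<in> I" "i \<noteq> j" for i j using D that unfolding A_def by blast
    qed
  qed
  have energy: "(\<integral>x. norm (g i x) powr p \<partial>lebesgue_on \<Omega>) \<le> real (M + 3) powr p * (real (M + 3) * Q)" if i: "i \<in> G" for i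
  proof -
    have iI: "i \<in> I" and small: "measure lebesgue (\<Omega> \<inter> A i) \<le> measure lebesgue \<Omega> / real k" using i by (auto simp: G_def)
    have "heavy_ball_gradient (boundary_mass \<Omega>) (M + 3) ?m (g i)" using P iI by blast
    then obtain J :: "nat set" and c \<rho> where "finite J \<and> card J \<le> M + 3 \<and>
        (\<forall>j\<in>J. \<rho> j > 0 \<and> ?m \<le> measure (boundary_mass \<Omega>) (ball (c j) (\<rho> j))) \<and>
        (\<forall>x. norm (g i x) \<le> (\<Sum>j\<in>J. 16 / \<rho> j * indicator (ball (c j) (2 * \<rho> j)) x))"
      unfolding heavy_ball_gradient_def by (elim exE) (rule that)
    then have J: "finite J" "card J \<le> M + 3" "\<And>j. j \<in> J \<Longrightarrow> \<rho> j > 0"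
      "\<And>j. j \<in> J \<Longrightarrow> ?m \<le> measure (boundary_mass \<Omega>) (ball (c j) (\<rho> j))"
      "\<And>x. norm (g i x) \<le> (\<Sum>j\<in>J. 16 / \<rho> j * indicator (ball (c j) (2 * \<rho> j)) x)"
      by auto
    have gc: "continuous_on UNIV (g i)" using C[OF iI] by (simp add: C1_gradient_def)
    have "\<And>x. 0 \<le> u i x" using P iI by blast
    then have gz: "g i x = 0" if "x \<notin> A i" for x using C1_gradient_at_zero[OF C[OF iI], of x] that by (simp add: A_def)
    have "(\<Sum>j\<in>J. (16 / \<rho> j) powr p * measure lebesgue (\<Omega> \<inter> A i \<inter> ball (c j) (2 * \<rho> j))) \<le> (\<Sum>j\<in>J. Q)"
      by (intro sum_mono Q[OF Ao[OF iI] small] J(3,4))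
    also have "\<dots> \<le> real (M + 3) * Q" using J(2) Q0 by (simp add: mult_right_mono)
    finally have Qs: "real (M + 3) powr p * (\<Sum>j\<in>J. (16 / \<rho> j) powr p * measure lebesgue (\<Omega> \<inter> A i \<inter> ball (c j) (2 * \<rho> j))) \<le> real (M + 3) powr p * (real (M + 3) * Q)"
      by (intro mult_left_mono) auto
    have "(\<integral>x. norm (g i x) powr p \<partial>lebesgue_on \<Omega>) \<le>
        real (M + 3) powr p * (\<Sum>j\<in>J. (16 / \<rho> j) powr p * measure lebesgue (\<Omega> \<inter> A i \<inter> ball (c j) (2 * \<rho> j)))"
      by (rule gradient_energy_le[OF op bd _ gc Ao[OF iI] gz J(1,2,3,5)]) (use p in auto)
    with Qs show ?thesis by (rule order_trans[rotated])
  qed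
  show ?thesis
  proof (rule steklov_eigenvalue_le_family[OF \<Omega> n p finite_surface_measure[OF S] k G])
    show "?m > 0" using S k M(2) by simp
    show "C1_gradient (u i) (g i)" if "i \<in> G" for i using C that by (simp add: G_def)
    show "0 \<le> u i x" if "i \<in> G" for i x using P that by (simp add: G_def)
    show "u i x = 0 \<or> u j x = 0" if "i \<in> G" "j \<in> G" "i \<noteq> j" for i j x using D that by (simp add: G_def)
    show "?m \<le> (\<integral>x. \<bar>u i x\<bar> powr p \<partial>surface_measure \<Omega>)" if "i \<in> G" for i
      using P that unfolding G_def by blast
  qed (rule energy)
qed

lemma steklov_estimate_small:
  fixes \<Omega> :: "(real^'n) set"
  assumes \<Omega>: "bounded_lipschitz_domain \<Omega>" and n: "CARD('n) \<ge> 2" and p: "p > 1" "p \<le> real CARD('n)" and k: "k \<ge> 1"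
    and M: "\<forall>(x::real^'n) r. r > 0 \<longrightarrow> (\<exists>Z. finite Z \<and> card Z \<le> M \<and> cball x (18 * r) \<subseteq> (\<Union>z\<in>Z. ball z (r / 2)))" "M \<ge> 1"
  defines "N \<equiv> real CARD('n)"
  defines "C \<equiv> 6 * real M * (real (M + 3) powr p * (real (M + 3) * (32 powr p * unit_ball_vol N powr (p / N))))"
  shows "ennreal (boundary_area \<Omega> powr ((p - 1) / (N - 1))) * steklov_eigenvalue \<Omega> p k
    \<le> ennreal (C / isoperimetric_ratio \<Omega> powr ((N - p) / (N - 1)) * real k powr (p / N))"
proof (cases "boundary_area \<Omega> > 0")
  case False
  then have "boundary_area \<Omega> = 0" by (simp add: boundary_area_def order_less_le)
  then show ?thesis by simp
next
  case S: True
  let ?S = "boundary_area \<Omega>" and ?V = "measure lebesgue \<Omega>"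
  let ?K = "real (M + 3) powr p * (real (M + 3) * (32 powr p * unit_ball_vol N powr (p / N)))"
  let ?Q = "32 powr p * unit_ball_vol N powr (p / N) * (?V / real k) powr (1 - p / N)"
  have op: "open \<Omega>" and bd: "bounded \<Omega>" and ne: "\<Omega> \<noteq> {}" using \<Omega> by (auto simp: bounded_lipschitz_domain_def)
  have w: "unit_ball_vol N > 0" by (simp add: N_def)
  have V: "?V > 0" by (rule measure_lebesgue_open_pos[OF op bd ne])
  have "steklov_eigenvalue \<Omega> p k \<le> ennreal (real (M + 3) powr p * (real (M + 3) * ?Q) / (?S / (6 * real k * real M)))"
  proof (rule steklov_test_family[OF \<Omega> n p(1) S k M])
    show "?Q \<ge> 0" by simp
    fix A :: "(real^'n) set" and c :: "real^'n" and \<rho> :: real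
    assume A: "open A" "measure lebesgue (\<Omega> \<inter> A) \<le> ?V / real k" and \<rho>: "\<rho> > 0"
    have \<rho>2: "2 * \<rho> > 0" using \<rho> by simp
    have fm: "\<Omega> \<inter> A \<inter> ball c (2 * \<rho>) \<in> fmeasurable lebesgue" "\<Omega> \<inter> A \<in> fmeasurable lebesgue"
      using op bd A by (auto intro!: lmeasurable_open bounded_Int)
    have "measure lebesgue (\<Omega> \<inter> A \<inter> ball c (2 * \<rho>)) \<le> measure lebesgue (\<Omega> \<inter> A)"
      by (rule measure_mono_fmeasurable) (use fm in auto)
    moreover have "measure lebesgue (\<Omega> \<inter> A \<inter> ball c (2 * \<rho>)) \<le> unit_ball_vol N * (2 * \<rho>) ^ CARD('n)"
      unfolding N_def measure_lebesgue_ball[OF less_imp_le[OF \<rho>2], of c, symmetric]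
      by (rule measure_mono_fmeasurable) (use fm in auto)
    ultimately show "(16 / \<rho>) powr p * measure lebesgue (\<Omega> \<inter> A \<inter> ball c (2 * \<rho>)) \<le> ?Q"
      unfolding N_def using A w by (intro energy_bound_small[OF n p \<rho>]) (auto simp: N_def)
  qed
  then have "ennreal (?S powr ((p - 1) / (N - 1))) * steklov_eigenvalue \<Omega> p k
      \<le> ennreal (?S powr ((p - 1) / (N - 1))) * ennreal (real (M + 3) powr p * (real (M + 3) * ?Q) / (?S / (6 * real k * real M)))"
    by (rule mult_left_mono) simp
  also have "\<dots> = ennreal (?S powr ((p - 1) / (N - 1)) * (?K * (?V / real k) powr (1 - p / N) / (?S / (6 * real k * real M))))"
    using S by (subst ennreal_mult'[symmetric]) (auto simp: mult.assoc)
  also have "?S powr ((p - 1) / (N - 1)) * (?K * (?V / real k) powr (1 - p / N) / (?S / (6 * real k * real M)))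
      = C / isoperimetric_ratio \<Omega> powr ((N - p) / (N - 1)) * real k powr (p / N)"
    unfolding C_def isoperimetric_ratio_def N_def
    by (rule scaling_small) (use n p S V k M in auto)
  finally show ?thesis .
qed

lemma steklov_estimate_large:
  fixes \<Omega> :: "(real^'n) set"
  assumes \<Omega>: "bounded_lipschitz_domain \<Omega>" and n: "CARD('n) \<ge> 2" and p: "p > real CARD('n)" and k: "k \<ge> 1"
    and M: "\<forall>(x::real^'n) r. r > 0 \<longrightarrow> (\<exists>Z. finite Z \<and> card Z \<le> M \<and> cball x (18 * r) \<subseteq> (\<Union>z\<in>Z. ball z (r / 2)))" "M \<ge> 1"
  defines "N \<equiv> real CARD('n)"
  defines "C \<equiv> real (M + 3) powr p * (real (M + 3) * (16 powr p * 2 ^ CARD('n) * unit_ball_vol N)) *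
    unit_ball_vol (N - 1) powr ((p - N) / (N - 1)) * (6 * real M) powr ((p - 1) / (N - 1))"
  shows "ennreal (boundary_area \<Omega> powr ((p - 1) / (N - 1))) * steklov_eigenvalue \<Omega> p k
    \<le> ennreal (C * distortion \<Omega> powr ((p - N) / (N - 1)) * real k powr ((p - 1) / (N - 1)))"
proof (cases "boundary_area \<Omega> > 0")
  case False
  then have "boundary_area \<Omega> = 0" by (simp add: boundary_area_def order_less_le)
  then show ?thesis by simp
next
  case S: True
  let ?S = "boundary_area \<Omega>" and ?D = "distortion \<Omega>" and ?w = "unit_ball_vol (N - 1)"
  let ?m = "?S / (6 * real k * real M)"
  let ?s = "(?m / (?D * ?w)) powr (1 / (N - 1))"
  let ?K = "real (M + 3) powr p * (real (M + 3) * (16 powr p * 2 ^ CARD('n) * unit_ball_vol N))"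
  let ?Q = "16 powr p * 2 ^ CARD('n) * unit_ball_vol N * ?s powr (N - p)"
  have op: "open \<Omega>" and bd: "bounded \<Omega>" using \<Omega> by (auto simp: bounded_lipschitz_domain_def)
  have N: "N > 1" and p1: "p > 1" using n p by (auto simp: N_def)
  have w: "unit_ball_vol N > 0" "?w > 0" using N by auto
  have m: "?m > 0" using S k M(2) by simp
  have D: "?D > 0"
  proof -
    have "bounded (frontier \<Omega>)" using compact_frontier_bounded[OF bd] compact_imp_bounded by blast
    then obtain R where R: "R > 0" "frontier \<Omega> \<subseteq> ball 0 R" using bounded_subset_ballD by blast
    have "?S = measure (surface_measure \<Omega>) (frontier \<Omega> \<inter> ball 0 R)" using R(2) by (simp add: boundary_area_def Int_absorb2)
    also have "\<dots> \<le> ?D * (?w * R powr (N - 1))" unfolding N_def by (rule distortion_bound[OF \<Omega> n R(1)])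
    finally have "0 < ?D * (?w * R powr (N - 1))" using S by linarith
    moreover have "0 < ?w * R powr (N - 1)" using w R(1) by simp
    ultimately show ?thesis by (simp only: zero_less_mult_pos2)
  qed
  have "steklov_eigenvalue \<Omega> p k \<le> ennreal (real (M + 3) powr p * (real (M + 3) * ?Q) / ?m)"
  proof (rule steklov_test_family[OF \<Omega> n p1 S k M])
    show "?Q \<ge> 0" using w by simp
    fix A :: "(real^'n) set" and c :: "real^'n" and \<rho> :: real
    assume A: "open A" and \<rho>: "\<rho> > 0" and heavy: "?m \<le> measure (boundary_mass \<Omega>) (ball c \<rho>)"
    have "?m \<le> measure (surface_measure \<Omega>) (frontier \<Omega> \<inter> ball c \<rho>)"
      using heavy by (simp add: measure_boundary_mass Int_commute)
    also have "\<dots> \<le> ?D * (?w * \<rho> powr (N - 1))" unfolding N_def by (rule distortion_bound[OF \<Omega> n \<rho>])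
    finally have "?m \<le> \<rho> powr (N - 1) * (?D * ?w)" by (simp only: mult_ac)
    then have le: "?m / (?D * ?w) \<le> \<rho> powr (N - 1)" using D w by (subst pos_divide_le_eq) auto
    have q: "?m / (?D * ?w) > 0" by (intro divide_pos_pos mult_pos_pos m D w)
    then have "?s \<le> (\<rho> powr (N - 1)) powr (1 / (N - 1))"
      using le N by (intro powr_mono2 less_imp_le[OF q]) auto
    also have "\<dots> = \<rho>" using N \<rho> by (simp add: powr_powr)
    finally have s\<rho>: "?s \<le> \<rho>" .
    have s0: "?s > 0" by (subst powr_gt_zero) (rule less_imp_neq[OF q, symmetric])
    have \<rho>2: "2 * \<rho> \<ge> 0" using \<rho> by simp
    have "measure lebesgue (\<Omega> \<inter> A \<inter> ball c (2 * \<rho>)) \<le> unit_ball_vol N * (2 * \<rho>) ^ CARD('n)"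
      unfolding N_def measure_lebesgue_ball[OF \<rho>2, of c, symmetric]
      by (rule measure_mono_fmeasurable) (use op A in auto)
    then show "(16 / \<rho>) powr p * measure lebesgue (\<Omega> \<inter> A \<inter> ball c (2 * \<rho>)) \<le> ?Q"
      using \<rho> w s0 s\<rho> p unfolding N_def by (intro energy_bound_large) (auto simp: N_def)
  qed
  then have "ennreal (?S powr ((p - 1) / (N - 1))) * steklov_eigenvalue \<Omega> p k
      \<le> ennreal (?S powr ((p - 1) / (N - 1))) * ennreal (real (M + 3) powr p * (real (M + 3) * ?Q) / ?m)"
    by (rule mult_left_mono) simp
  also have "\<dots> = ennreal (?S powr ((p - 1) / (N - 1)) * (?K * ?s powr (N - p) / ?m))"
    using S by (subst ennreal_mult'[symmetric]) (auto simp: mult.assoc)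
  also have "?S powr ((p - 1) / (N - 1)) * (?K * ?s powr (N - p) / ?m)
      = C * ?D powr ((p - N) / (N - 1)) * real k powr ((p - 1) / (N - 1))"
    unfolding C_def N_def
    by (rule scaling_large) (use n p S D w k M in \<open>auto simp: N_def\<close>)
  finally show ?thesis .
qed

theorem theorem1p1:
  fixes n :: nat and p :: real
  assumes "n = CARD('n::finite)" and "n \<ge> 2" and "p > 1"
  shows "(p \<le> real n \<longrightarrow>
           (\<exists>C>0. \<forall>\<Omega> :: (real^'n) set. bounded_lipschitz_domain \<Omega> \<longrightarrow> (\<forall>k\<ge>1.
              ennreal (boundary_area \<Omega> powr ((p - 1) / (real n - 1))) * steklov_eigenvalue \<Omega> p k
              \<le> ennreal (C / isoperimetric_ratio \<Omega> powr ((real n - p) / (real n - 1))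
                          * real k powr (p / real n))))) \<and>
         (p > real n \<longrightarrow>
           (\<exists>C'>0. \<forall>\<Omega> :: (real^'n) set. bounded_lipschitz_domain \<Omega> \<longrightarrow> (\<forall>k\<ge>1.
              ennreal (boundary_area \<Omega> powr ((p - 1) / (real n - 1))) * steklov_eigenvalue \<Omega> p k
              \<le> ennreal (C' * distortion \<Omega> powr ((p - real n) / (real n - 1))
                          * real k powr ((p - 1) / (real n - 1))))))"
proof -
  obtain M where M: "M \<ge> 1" "\<forall>(x::real^'n) r. r > 0 \<longrightarrow> (\<exists>Z. finite Z \<and> card Z \<le> M \<and> cball x (18 * r) \<subseteq> (\<Union>z\<in>Z. ball z (r / 2)))"
    using uniform_covering_number[where 'a = "real^'n"] by blast
  have n: "CARD('n) \<ge> 2" using assms(1,2) by simp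
  have "unit_ball_vol (real CARD('n)) > 0" "unit_ball_vol (real CARD('n) - 1) > 0" using n by auto
  note w = this[THEN less_imp_neq, symmetric]
  show ?thesis
    unfolding assms(1)
  proof (intro conjI impI)
    assume p: "p \<le> real CARD('n)"
    show "\<exists>C>0. \<forall>\<Omega> :: (real^'n) set. bounded_lipschitz_domain \<Omega> \<longrightarrow> (\<forall>k\<ge>1.
      ennreal (boundary_area \<Omega> powr ((p - 1) / (real CARD('n) - 1))) * steklov_eigenvalue \<Omega> p k
      \<le> ennreal (C / isoperimetric_ratio \<Omega> powr ((real CARD('n) - p) / (real CARD('n) - 1)) * real k powr (p / real CARD('n))))"
      by (rule exI, intro conjI allI impI, rule_tac [2] steklov_estimate_small[OF _ n assms(3) p _ M(2,1)])
        (use M(1) w in \<open>auto intro!: mult_pos_pos\<close>)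
  next
    assume p: "p > real CARD('n)"
    show "\<exists>C>0. \<forall>\<Omega> :: (real^'n) set. bounded_lipschitz_domain \<Omega> \<longrightarrow> (\<forall>k\<ge>1.
      ennreal (boundary_area \<Omega> powr ((p - 1) / (real CARD('n) - 1))) * steklov_eigenvalue \<Omega> p k
      \<le> ennreal (C * distortion \<Omega> powr ((p - real CARD('n)) / (real CARD('n) - 1)) * real k powr ((p - 1) / (real CARD('n) - 1))))"
      by (rule exI, intro conjI allI impI, rule_tac [2] steklov_estimate_large[OF _ n p _ M(2,1)])
        (use M(1) w in \<open>auto intro!: mult_pos_pos\<close>)
  qed
qed

end
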